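(* Let $d\in\mathbb{Z}_{>0}$ and $m\in\mathbb{Z}_{>0}\cup\{\infty\}$, and let $z$ and $x_{a,b}$, with $a\in E_m$ and $b\in\{0,\ldots,d-1\}$, be parameters in $\mathcal{R}_m$. There exists a unique chain of relative traces $\{\mathrm{tr}_k\}_{k\in\mathbb{Z}_{>0}}$ with parameters $z$ and $x_{a,b}$, and it is given, for any $k\geq1$, by $$\mathrm{tr}_k\bigl(W^{(k)}_{J,a,b}\,w\bigr)=z\,W^{(k-1)}_{J,a,b}\,w\quad\text{if } 0\leq J<k-1,$$ $$\mathrm{tr}_k\bigl(W^{(k)}_{J,a,b}\,w\bigr)=x_{a,b}\,w\quad\text{if } J=k-1,$$ where $a\in E_m$, $b\in\{0,\ldots,d-1\}$ and $w\in\mathrm{Y}(d,m,k-1)$.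
   Context: Algebra. Let $q,v_1,v_2,\ldots$ be indeterminates; $\mathcal{R}_m:=\mathbb{C}[q^{\pm1},v_1^{\pm1},\ldots,v_m^{\pm1}]$ for $m<\infty$ and $\mathcal{R}_\infty:=\mathbb{C}[q^{\pm1}]$. Set $E_m:=\{0,\ldots,m-1\}$ for $m<\infty$ and $E_\infty:=\mathbb{Z}$. For $n\ge1$, $\mathrm{Y}(d,m,n)$ is the associative $\mathcal{R}_m$-algebra generated by $t_1,\ldots,t_n,g_1,\ldots,g_{n-1},X_1^{\pm1}$ with relations: $g_ig_j=g_jg_i$ if $|i-j|>1$; $g_ig_{i+1}g_i=g_{i+1}g_ig_{i+1}$; $t_it_j=t_jt_i$; $t_jg_i=g_it_{s_i(j)}$ with $s_i=(i,i+1)$; $t_j^d=1$; $g_i^2=1+(q-q^{-1})e_ig_i$ with $e_i:=\frac1d\sum_{s=0}^{d-1}t_i^st_{i+1}^{-s}$; $X_1g_1X_1g_1=g_1X_1g_1X_1$; $X_1g_i=g_iX_1$ for $i\ge2$; $X_1t_j=t_jX_1$ for all $j$; and, if $m<\infty$, $(X_1-v_1)\cdots(X_1-v_m)=0$. Each $g_i$ is invertible with $g_i^{-1}=g_i-(q-q^{-1})e_i$. Put $\mathrm{Y}(d,m,0):=\mathcal{R}_m$. $\mathrm{Y}(d,m,n-1)$ is identified with the subalgebra of $\mathrm{Y}(d,m,n)$ generated by $t_1,\ldots,t_{n-1},g_1,\ldots,g_{n-2},X_1^{\pm1}$ (generators mapping to generators of the same name). For $k\ge1$, $J\in\{0,\ldots,k-1\}$,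 $a,b\in\mathbb{Z}$: $W^{(k)}_{J,a,b}:=g_J^{-1}\cdots g_2^{-1}g_1^{-1}X_1^at_1^bg_1g_2\cdots g_{k-1}\in\mathrm{Y}(d,m,k)$ (empty products equal $1$). Definition. A chain of relative traces with parameters $z$ and $x_{a,b}$ is a set of $\mathcal{R}_m$-linear maps $\{\mathrm{tr}_k\}_{k\in\mathbb{Z}_{>0}}$, $\mathrm{tr}_k:\mathrm{Y}(d,m,k)\to\mathrm{Y}(d,m,k-1)$, satisfying $\mathrm{tr}_1(X_1^at_1^b)=x_{a,b}$ for $a\in E_m$, $b\in\{0,\ldots,d-1\}$, and, for all $k\ge2$, $u,v\in\mathrm{Y}(d,m,k-1)$ and $Z\in\mathrm{Y}(d,m,k)$: (i) $\mathrm{tr}_k(uZv)=u\,\mathrm{tr}_k(Z)\,v$; (ii) $\mathrm{tr}_k(g_{k-1}^{\varepsilon}ug_{k-1}^{-\varepsilon})=\mathrm{tr}_{k-1}(u)$ for $\varepsilon=\pm1$; (iii) $\mathrm{tr}_{k-1}(\mathrm{tr}_k(g_{k-1}Z))=\mathrm{tr}_{k-1}(\mathrm{tr}_k(Zg_{k-1}))$; (iv) $\mathrm{tr}_k(g_{k-1})=z$. *)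

theory Defs
  imports
    "HOL-Algebra.QuotRing"
    "HOL-Library.Poly_Mapping"
    "HOL-Library.Extended_Nat"
    "HOL-Library.FuncSet"
    "HOL-Combinatorics.Transposition"
    Complex_Main
begin

subsection \<open>Laurent polynomials\<close>

datatype indet = IndQ | IndV nat

text \<open>
  Exponent vectors are finitely supported maps to the integers, so the convolution product of
  \<^theory>\<open>HOL-Library.Poly_Mapping\<close> makes the following type the ring of complex Laurent
  polynomials in all the indeterminates \<open>IndQ\<close> (that is, \<open>q\<close>) and \<open>IndV i\<close> (that is, \<open>v_i\<close>).
\<close>

type_synonym laurent = "(indet \<Rightarrow>\<^sub>0 int) \<Rightarrow>\<^sub>0 complex"

definition lvar :: "indet \<Rightarrow> int \<Rightarrow> laurent"
  where "lvar i e = Poly_Mapping.single (Poly_Mapping.single i e) 1"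

definition lconst :: "complex \<Rightarrow> laurent"
  where "lconst c = Poly_Mapping.single 0 c"

definition indets :: "enat \<Rightarrow> indet set"
  where "indets m = insert IndQ {IndV i | i. 1 \<le> i \<and> enat i \<le> m \<and> m \<noteq> \<infinity>}"

definition laurent_ring :: "enat \<Rightarrow> laurent ring" (\<open>\<R>\<close>)
  where "\<R> m = \<lparr>carrier = {p. \<forall>e \<in> Poly_Mapping.keys p. Poly_Mapping.keys e \<subseteq> indets m},
                 mult = (*), one = 1, zero = 0, add = (+)\<rparr>"

definition E_set :: "enat \<Rightarrow> int set"
  where "E_set m = (case m of enat k \<Rightarrow> {0..<int k} | \<infinity> \<Rightarrow> UNIV)"

subsection \<open>Free associative algebras\<close>

text \<open>
  \<open>'g free_word\<close> is the free monoid on \<open>'g\<close>, written additively (concatenation is \<open>+\<close>) because the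
  product on \<open>_ \<Rightarrow>\<^sub>0 _\<close> is convolution with respect to \<open>+\<close> on the exponents.
\<close>

datatype 'g free_word = Word (letters: "'g list")

instantiation free_word :: (type) monoid_add
begin

definition "0 = Word []"
definition "v + w = Word (letters v @ letters w)"

instance
  by standard (auto simp: zero_free_word_def plus_free_word_def)

end

type_synonym 'g free_alg = "'g free_word \<Rightarrow>\<^sub>0 laurent"

definition letter :: "'g \<Rightarrow> 'g free_alg"
  where "letter x = Poly_Mapping.single (Word [x]) 1"

definition scal :: "laurent \<Rightarrow> 'g free_alg"
  where "scal c = Poly_Mapping.single 0 c"

subsection \<open>The algebras \<open>Y(d,m,n)\<close>\<close>

datatype yh_gen = GenT nat | GenG nat | GenX | GenXinv

text \<open>There are no generators at all for \<open>n = 0\<close>; see the isomorphism \<open>YH_0_iso\<close> below.\<close>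

definition yh_gens :: "nat \<Rightarrow> yh_gen set"
  where "yh_gens n = GenT ` {1..n} \<union> GenG ` {1..<n} \<union> (if n = 0 then {} else {GenX, GenXinv})"

definition yh_free :: "enat \<Rightarrow> nat \<Rightarrow> yh_gen free_alg ring"
  where "yh_free m n =
    \<lparr>carrier = {f. \<forall>w \<in> Poly_Mapping.keys f.
                     set (letters w) \<subseteq> yh_gens n \<and> Poly_Mapping.lookup f w \<in> carrier (\<R> m)},
     mult = (*), one = 1, zero = 0, add = (+)\<rparr>"

text \<open>The relation \<open>t_j^d = 1\<close> gives \<open>t_j^{-s} = t_j^{d - s}\<close> for \<open>0 \<le> s < d\<close>.\<close>

definition yh_e :: "nat \<Rightarrow> nat \<Rightarrow> yh_gen free_alg"
  where "yh_e d i =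
    scal (lconst (1 / of_nat d)) * (\<Sum>s<d. letter (GenT i) ^ s * letter (GenT (Suc i)) ^ (d - s))"

inductive yh_rel :: "nat \<Rightarrow> enat \<Rightarrow> nat \<Rightarrow> yh_gen free_alg \<Rightarrow> yh_gen free_alg \<Rightarrow> bool"
  for d :: nat and m :: enat and n :: nat where
  far_comm: "\<lbrakk>i \<in> {1..<n}; j \<in> {1..<n}; 1 < \<bar>int i - int j\<bar>\<rbrakk>
    \<Longrightarrow> yh_rel d m n (letter (GenG i) * letter (GenG j)) (letter (GenG j) * letter (GenG i))"
| braid: "\<lbrakk>i \<in> {1..<n}; Suc i \<in> {1..<n}\<rbrakk>
    \<Longrightarrow> yh_rel d m n (letter (GenG i) * letter (GenG (Suc i)) * letter (GenG i))
                      (letter (GenG (Suc i)) * letter (GenG i) * letter (GenG (Suc i)))"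
| t_comm: "\<lbrakk>i \<in> {1..n}; j \<in> {1..n}\<rbrakk>
    \<Longrightarrow> yh_rel d m n (letter (GenT i) * letter (GenT j)) (letter (GenT j) * letter (GenT i))"
| t_g: "\<lbrakk>i \<in> {1..<n}; j \<in> {1..n}\<rbrakk>
    \<Longrightarrow> yh_rel d m n (letter (GenT j) * letter (GenG i))
                      (letter (GenG i) * letter (GenT (transpose i (Suc i) j)))"
| t_order: "j \<in> {1..n} \<Longrightarrow> yh_rel d m n (letter (GenT j) ^ d) 1"
| quadratic: "i \<in> {1..<n}
    \<Longrightarrow> yh_rel d m n (letter (GenG i) ^ 2)
                      (1 + scal (lvar IndQ 1 - lvar IndQ (-1)) * yh_e d i * letter (GenG i))"
| X_inv_r: "1 \<le> n \<Longrightarrow> yh_rel d m n (letter GenX * letter GenXinv) 1"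
| X_inv_l: "1 \<le> n \<Longrightarrow> yh_rel d m n (letter GenXinv * letter GenX) 1"
| X_braid: "2 \<le> n
    \<Longrightarrow> yh_rel d m n (letter GenX * letter (GenG 1) * letter GenX * letter (GenG 1))
                      (letter (GenG 1) * letter GenX * letter (GenG 1) * letter GenX)"
| X_g: "i \<in> {2..<n}
    \<Longrightarrow> yh_rel d m n (letter GenX * letter (GenG i)) (letter (GenG i) * letter GenX)"
| X_t: "j \<in> {1..n}
    \<Longrightarrow> yh_rel d m n (letter GenX * letter (GenT j)) (letter (GenT j) * letter GenX)"
| cyclotomic: "\<lbrakk>1 \<le> n; m = enat k\<rbrakk>
    \<Longrightarrow> yh_rel d m n (prod_list (map (\<lambda>i. letter GenX - scal (lvar (IndV i) 1)) [1..<Suc k])) 0"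

definition yh_ideal :: "nat \<Rightarrow> enat \<Rightarrow> nat \<Rightarrow> yh_gen free_alg set"
  where "yh_ideal d m n = Idl\<^bsub>yh_free m n\<^esub> {l - r | l r. yh_rel d m n l r}"

type_synonym yh_elem = "yh_gen free_alg set"

definition YH :: "nat \<Rightarrow> enat \<Rightarrow> nat \<Rightarrow> yh_elem ring"
  where "YH d m n = yh_free m n Quot yh_ideal d m n"

definition yh_class :: "nat \<Rightarrow> enat \<Rightarrow> nat \<Rightarrow> yh_gen free_alg \<Rightarrow> yh_elem"
  where "yh_class d m n f = yh_ideal d m n +>\<^bsub>yh_free m n\<^esub> f"

definition yh_t :: "nat \<Rightarrow> enat \<Rightarrow> nat \<Rightarrow> nat \<Rightarrow> yh_elem"
  where "yh_t d m n j = yh_class d m n (letter (GenT j))"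

definition yh_g :: "nat \<Rightarrow> enat \<Rightarrow> nat \<Rightarrow> nat \<Rightarrow> yh_elem"
  where "yh_g d m n i = yh_class d m n (letter (GenG i))"

definition yh_X :: "nat \<Rightarrow> enat \<Rightarrow> nat \<Rightarrow> yh_elem"
  where "yh_X d m n = yh_class d m n (letter GenX)"

text \<open>The structure map of the \<open>\<R> m\<close>-algebra; scalar multiplication by \<open>c\<close> is left
  multiplication by \<open>yh_scal d m n c\<close>.\<close>

definition yh_scal :: "nat \<Rightarrow> enat \<Rightarrow> nat \<Rightarrow> laurent \<Rightarrow> yh_elem"
  where "yh_scal d m n c = yh_class d m n (scal c)"

text \<open>
  The map into \<open>Y(d,m,n)\<close> by which \<open>Y(d,m,n')\<close>, \<open>n' \<le> n\<close>, is identified with a subalgebra. A coset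
  \<open>A\<close> of the smaller ideal is enlarged to the coset of the larger ideal containing it, so that
  generators are sent to the generators of the same name; see \<open>yh_incl_class\<close>.
\<close>

definition yh_incl :: "nat \<Rightarrow> enat \<Rightarrow> nat \<Rightarrow> yh_elem \<Rightarrow> yh_elem"
  where "yh_incl d m n A = yh_ideal d m n <+>\<^bsub>yh_free m n\<^esub> A"

subsection \<open>Well-definedness\<close>

lemma laurent_ring_simps [simp]:
  "mult (\<R> m) = (*)" "one (\<R> m) = 1" "zero (\<R> m) = 0" "add (\<R> m) = (+)"
  by (simp_all add: laurent_ring_def)

lemma yh_free_simps [simp]:
  "mult (yh_free m n) = (*)" "one (yh_free m n) = 1"
  "zero (yh_free m n) = 0" "add (yh_free m n) = (+)"
  by (simp_all add: yh_free_def)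

lemma carrier_laurent_ring_iff:
  "p \<in> carrier (\<R> m) \<longleftrightarrow> (\<forall>e \<in> Poly_Mapping.keys p. Poly_Mapping.keys e \<subseteq> indets m)"
  by (simp add: laurent_ring_def)

lemma laurent_ring_0 [simp]: "0 \<in> carrier (\<R> m)"
  and laurent_ring_1 [simp]: "1 \<in> carrier (\<R> m)"
  by (auto simp: carrier_laurent_ring_iff)

lemma laurent_ring_add:
  "p \<in> carrier (\<R> m) \<Longrightarrow> p' \<in> carrier (\<R> m) \<Longrightarrow> p + p' \<in> carrier (\<R> m)"
  using Poly_Mapping.keys_add[of p p'] by (force simp: carrier_laurent_ring_iff)

lemma laurent_ring_uminus: "p \<in> carrier (\<R> m) \<Longrightarrow> - p \<in> carrier (\<R> m)"
  by (auto simp: carrier_laurent_ring_iff in_keys_iff)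

lemma laurent_ring_diff:
  "p \<in> carrier (\<R> m) \<Longrightarrow> p' \<in> carrier (\<R> m) \<Longrightarrow> p - p' \<in> carrier (\<R> m)"
  using laurent_ring_add[of p m "- p'"] laurent_ring_uminus by simp

lemma laurent_ring_mult:
  assumes "p \<in> carrier (\<R> m)" "p' \<in> carrier (\<R> m)"
  shows "p * p' \<in> carrier (\<R> m)"
  unfolding carrier_laurent_ring_iff
proof
  fix e assume "e \<in> Poly_Mapping.keys (p * p')"
  then obtain a b where "e = a + b" "a \<in> Poly_Mapping.keys p" "b \<in> Poly_Mapping.keys p'"
    using Poly_Mapping.keys_mult[of p p'] by blast
  then show "Poly_Mapping.keys e \<subseteq> indets m"
    using assms Poly_Mapping.keys_add[of a b] unfolding carrier_laurent_ring_iff by blast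
qed

lemma laurent_ring_sum:
  "(\<And>i. i \<in> I \<Longrightarrow> f i \<in> carrier (\<R> m)) \<Longrightarrow> sum f I \<in> carrier (\<R> m)"
  by (induction I rule: infinite_finite_induct) (auto intro: laurent_ring_add)

lemma laurent_ring_lvar: "i \<in> indets m \<Longrightarrow> lvar i e \<in> carrier (\<R> m)"
  by (auto simp: carrier_laurent_ring_iff lvar_def)

lemma laurent_ring_lconst: "lconst c \<in> carrier (\<R> m)"
  by (auto simp: carrier_laurent_ring_iff lconst_def)

lemma cring_laurent_ring: "cring (\<R> m)"
proof (rule cringI)
  show "abelian_group (\<R> m)"
  proof (rule abelian_groupI)
    fix p assume "p \<in> carrier (\<R> m)"
    then show "\<exists>y\<in>carrier (\<R> m). y \<oplus>\<^bsub>\<R> m\<^esub> p = \<zero>\<^bsub>\<R> m\<^esub>"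
      using laurent_ring_uminus by (intro bexI[of _ "- p"]) simp_all
  qed (simp_all add: laurent_ring_add algebra_simps)
  show "comm_monoid (\<R> m)"
    by (rule comm_monoidI) (simp_all add: laurent_ring_mult algebra_simps)
qed (simp add: algebra_simps)

lemma carrier_yh_free_iff:
  "f \<in> carrier (yh_free m n) \<longleftrightarrow>
    (\<forall>w. Poly_Mapping.lookup f w \<in> carrier (\<R> m) \<and>
         (Poly_Mapping.lookup f w \<noteq> 0 \<longrightarrow> set (letters w) \<subseteq> yh_gens n))"
  unfolding yh_free_def by (auto simp: in_keys_iff)

lemma yh_free_0 [simp]: "0 \<in> carrier (yh_free m n)"
  by (simp add: carrier_yh_free_iff)

lemma yh_free_scal: "c \<in> carrier (\<R> m) \<Longrightarrow> scal c \<in> carrier (yh_free m n)"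
  by (auto simp: carrier_yh_free_iff scal_def lookup_single when_def zero_free_word_def)

lemma yh_free_1 [simp]: "1 \<in> carrier (yh_free m n)"
  using yh_free_scal[of 1 m n] by (simp add: scal_def)

lemma yh_free_letter: "x \<in> yh_gens n \<Longrightarrow> letter x \<in> carrier (yh_free m n)"
  by (auto simp: carrier_yh_free_iff letter_def lookup_single when_def)

lemma yh_free_add:
  assumes "f \<in> carrier (yh_free m n)" "h \<in> carrier (yh_free m n)"
  shows "f + h \<in> carrier (yh_free m n)"
  using assms unfolding carrier_yh_free_iff lookup_add
  by (metis add_0 laurent_ring_add)

lemma yh_free_uminus: "f \<in> carrier (yh_free m n) \<Longrightarrow> - f \<in> carrier (yh_free m n)"
  unfolding carrier_yh_free_iff by (auto intro: laurent_ring_uminus)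

lemma yh_free_diff:
  "f \<in> carrier (yh_free m n) \<Longrightarrow> h \<in> carrier (yh_free m n) \<Longrightarrow> f - h \<in> carrier (yh_free m n)"
  using yh_free_add[of f m n "- h"] yh_free_uminus by simp

lemma yh_free_mult:
  assumes f: "f \<in> carrier (yh_free m n)" and h: "h \<in> carrier (yh_free m n)"
  shows "f * h \<in> carrier (yh_free m n)"
  unfolding carrier_yh_free_iff
proof (intro allI conjI impI)
  fix w
  have "Poly_Mapping.lookup (f * h) w \<in> carrier (\<R> m) \<and>
    (Poly_Mapping.lookup (f * h) w \<noteq> 0 \<longrightarrow> w \<in> Poly_Mapping.keys (f * h))"
  proof
    have "f * h = (\<Sum>a\<in>Poly_Mapping.keys f. \<Sum>b\<in>Poly_Mapping.keys h.
        Poly_Mapping.single (a + b) (Poly_Mapping.lookup f a * Poly_Mapping.lookup h b))"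
      (is "_ = ?S")
    proof -
      have "f = (\<Sum>a\<in>Poly_Mapping.keys f. Poly_Mapping.single a (Poly_Mapping.lookup f a))"
        for f :: "yh_gen free_alg"
        by (rule poly_mapping_eqI) (auto simp: lookup_sum lookup_single when_def in_keys_iff)
      then have "f * h = (\<Sum>a\<in>Poly_Mapping.keys f. Poly_Mapping.single a (Poly_Mapping.lookup f a)) *
          (\<Sum>a\<in>Poly_Mapping.keys h. Poly_Mapping.single a (Poly_Mapping.lookup h a))"
        by metis
      then show ?thesis by (simp add: sum_product mult_single)
    qed
    then have "Poly_Mapping.lookup (f * h) w = Poly_Mapping.lookup ?S w" by simp
    moreover have "Poly_Mapping.lookup ?S w \<in> carrier (\<R> m)"
      unfolding lookup_sum
      by (intro laurent_ring_sum)
        (use f h in \<open>auto simp: lookup_single when_def carrier_yh_free_iff intro: laurent_ring_mult\<close>)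
    ultimately show "Poly_Mapping.lookup (f * h) w \<in> carrier (\<R> m)" by simp
  qed (simp add: in_keys_iff)
  then show "Poly_Mapping.lookup (f * h) w \<in> carrier (\<R> m)" by simp
  assume "Poly_Mapping.lookup (f * h) w \<noteq> 0"
  then have "w \<in> Poly_Mapping.keys (f * h)" by (simp add: in_keys_iff)
  then obtain a b where "w = a + b" "a \<in> Poly_Mapping.keys f" "b \<in> Poly_Mapping.keys h"
    using Poly_Mapping.keys_mult[of f h] by blast
  then show "set (letters w) \<subseteq> yh_gens n"
    using f h by (auto simp: carrier_yh_free_iff plus_free_word_def in_keys_iff)
qed

lemma yh_free_power: "f \<in> carrier (yh_free m n) \<Longrightarrow> f ^ k \<in> carrier (yh_free m n)"
  by (induction k) (auto intro: yh_free_mult)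

lemma yh_free_sum:
  "(\<And>i. i \<in> I \<Longrightarrow> f i \<in> carrier (yh_free m n)) \<Longrightarrow> sum f I \<in> carrier (yh_free m n)"
  by (induction I rule: infinite_finite_induct) (auto intro: yh_free_add)

lemma yh_free_prod_list:
  "(\<And>f. f \<in> set fs \<Longrightarrow> f \<in> carrier (yh_free m n)) \<Longrightarrow> prod_list fs \<in> carrier (yh_free m n)"
  by (induction fs) (auto intro: yh_free_mult)

lemma ring_yh_free: "ring (yh_free m n)"
proof (rule ringI)
  show "abelian_group (yh_free m n)"
  proof (rule abelian_groupI)
    fix f assume "f \<in> carrier (yh_free m n)"
    then show "\<exists>y\<in>carrier (yh_free m n). y \<oplus>\<^bsub>yh_free m n\<^esub> f = \<zero>\<^bsub>yh_free m n\<^esub>"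
      using yh_free_uminus by (intro bexI[of _ "- f"]) simp_all
  qed (simp_all add: yh_free_add algebra_simps)
  show "monoid (yh_free m n)"
    by (rule monoidI) (simp_all add: yh_free_mult algebra_simps)
qed (simp_all add: algebra_simps)

lemma yh_rel_closed:
  assumes "yh_rel d m n l r"
  shows "l \<in> carrier (yh_free m n) \<and> r \<in> carrier (yh_free m n)"
proof -
  have tr: "transpose i (Suc i) j \<in> {1..n}" if "i \<in> {1..<n}" "j \<in> {1..n}" for i j
    using that by (auto simp: transpose_def)
  show ?thesis
    using assms
  proof cases
    case (t_g i j)
    then show ?thesis
      using tr[of i j] by (auto intro!: yh_free_mult yh_free_letter simp: yh_gens_def)
  next
    case (quadratic i)
    then have "yh_e d i \<in> carrier (yh_free m n)"
      unfolding yh_e_def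
      by (intro yh_free_mult yh_free_scal laurent_ring_lconst yh_free_sum yh_free_power
          yh_free_letter) (auto simp: yh_gens_def)
    moreover have "scal (lvar IndQ 1 - lvar IndQ (- 1)) \<in> carrier (yh_free m n)"
      by (intro yh_free_scal laurent_ring_diff laurent_ring_lvar) (auto simp: indets_def)
    ultimately show ?thesis
      using quadratic
      by (auto intro!: yh_free_add yh_free_mult yh_free_power yh_free_letter simp: yh_gens_def)
  next
    case (cyclotomic k)
    have "letter GenX - scal (lvar (IndV i) 1) \<in> carrier (yh_free m n)" if "i \<in> set [1..<Suc k]" for i
      using that cyclotomic
      by (intro yh_free_diff yh_free_letter yh_free_scal laurent_ring_lvar)
        (auto simp: yh_gens_def indets_def)
    then show ?thesis
      unfolding cyclotomic by (intro conjI yh_free_prod_list) auto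
  qed (auto intro!: yh_free_mult yh_free_power yh_free_letter simp: yh_gens_def)
qed

lemma ideal_yh_ideal: "ideal (yh_ideal d m n) (yh_free m n)"
  unfolding yh_ideal_def
  by (rule ring.genideal_ideal[OF ring_yh_free]) (auto dest: yh_rel_closed intro: yh_free_diff)

lemma ring_YH: "ring (YH d m n)"
  unfolding YH_def by (rule ideal.quotient_is_ring[OF ideal_yh_ideal])

lemma yh_class_hom: "yh_class d m n \<in> ring_hom (yh_free m n) (YH d m n)"
  using ideal.rcos_ring_hom[OF ideal_yh_ideal] unfolding YH_def
  by (simp add: yh_class_def[abs_def])

lemma yh_class_cases:
  assumes "A \<in> carrier (YH d m n)"
  obtains f where "f \<in> carrier (yh_free m n)" "A = yh_class d m n f"
  using assms unfolding YH_def FactRing_simps yh_class_def by auto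

lemma yh_class_eqI:
  assumes "yh_rel d m n l r"
  shows "yh_class d m n l = yh_class d m n r"
proof -
  interpret ideal "yh_ideal d m n" "yh_free m n" by (rule ideal_yh_ideal)
  have lr: "l \<in> carrier (yh_free m n)" "r \<in> carrier (yh_free m n)"
    using yh_rel_closed[OF assms] by auto
  have "l - r \<in> yh_ideal d m n"
    unfolding yh_ideal_def using assms
    by (intro subsetD[OF ring.genideal_self[OF ring_yh_free]])
      (auto dest: yh_rel_closed intro: yh_free_diff)
  then have "l \<in> yh_class d m n r"
    by (auto simp: yh_class_def a_r_coset_def' intro!: bexI[of _ "l - r"])
  then show ?thesis
    using a_repr_independence'[of l r] lr unfolding yh_class_def by simp
qed

lemma yh_rel_mono:
  assumes "yh_rel d m n l r" "n \<le> n'"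
  shows "yh_rel d m n' l r"
  using assms by (induction rule: yh_rel.induct) (rule yh_rel.intros; force)+

lemma yh_free_mono: "n \<le> n' \<Longrightarrow> carrier (yh_free m n) \<subseteq> carrier (yh_free m n')"
  by (auto simp: yh_free_def yh_gens_def) (fastforce split: if_splits)+

lemma yh_ideal_mono:
  assumes "n \<le> n'"
  shows "yh_ideal d m n \<subseteq> yh_ideal d m n'"
proof -
  interpret I': ideal "yh_ideal d m n'" "yh_free m n'" by (rule ideal_yh_ideal)
  interpret F: ring "yh_free m n" by (rule ring_yh_free)
  let ?J = "yh_ideal d m n' \<inter> carrier (yh_free m n)"
  have sub: "carrier (yh_free m n) \<subseteq> carrier (yh_free m n')"
    by (rule yh_free_mono[OF assms])
  have un: "f \<in> yh_ideal d m n' \<Longrightarrow> - f \<in> yh_ideal d m n'" for f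
  proof -
    assume f: "f \<in> yh_ideal d m n'"
    then have "f \<in> carrier (yh_free m n')" using I'.a_subset by blast
    then have "\<ominus>\<^bsub>yh_free m n'\<^esub> f = - f"
      by (intro I'.minus_equality) (simp_all add: yh_free_uminus)
    then show ?thesis using additive_subgroup.a_inv_closed[OF I'.additive_subgroup_axioms f] by simp
  qed
  have "ideal ?J (yh_free m n)"
  proof (rule idealI[OF ring_yh_free])
    show "subgroup ?J (add_monoid (yh_free m n))"
    proof (rule group.subgroupI)
      show "group (add_monoid (yh_free m n))" by (rule F.a_group)
      have "0 \<in> ?J"
        using additive_subgroup.zero_closed[OF I'.additive_subgroup_axioms] by simp
      then show "?J \<noteq> {}" by blast
      fix a assume a: "a \<in> ?J"
      then have "\<ominus>\<^bsub>yh_free m n\<^esub> a = - a"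
        by (intro F.minus_equality) (simp_all add: yh_free_uminus)
      then show "inv\<^bsub>add_monoid (yh_free m n)\<^esub> a \<in> ?J"
        using a un[of a] yh_free_uminus[of a m n] by (simp add: a_inv_def)
      fix b assume b: "b \<in> ?J"
      then show "a \<otimes>\<^bsub>add_monoid (yh_free m n)\<^esub> b \<in> ?J"
        using a additive_subgroup.a_closed[OF I'.additive_subgroup_axioms, of a b] yh_free_add[of a m n b] by simp
    qed auto
  next
    fix a x assume "a \<in> ?J" "x \<in> carrier (yh_free m n)"
    then show "x \<otimes>\<^bsub>yh_free m n\<^esub> a \<in> ?J" "a \<otimes>\<^bsub>yh_free m n\<^esub> x \<in> ?J"
      using I'.I_l_closed[of a x] I'.I_r_closed[of a x] sub
        yh_free_mult[of a m n x] yh_free_mult[of x m n a]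
      by auto
  qed
  moreover have "{l - r | l r. yh_rel d m n l r} \<subseteq> ?J"
  proof -
    have "{l - r | l r. yh_rel d m n' l r} \<subseteq> yh_ideal d m n'"
      unfolding yh_ideal_def
      by (rule ring.genideal_self[OF ring_yh_free]) (auto dest: yh_rel_closed intro: yh_free_diff)
    moreover have "{l - r | l r. yh_rel d m n l r} \<subseteq> {l - r | l r. yh_rel d m n' l r}"
      using yh_rel_mono[OF _ assms] by blast
    moreover have "{l - r | l r. yh_rel d m n l r} \<subseteq> carrier (yh_free m n)"
      by (auto dest: yh_rel_closed intro: yh_free_diff)
    ultimately show ?thesis by blast
  qed
  ultimately have "yh_ideal d m n \<subseteq> ?J"
    unfolding yh_ideal_def by (rule F.genideal_minimal)
  then show ?thesis by blast
qed

lemma yh_incl_class: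
  assumes "n \<le> n'" "f \<in> carrier (yh_free m n)"
  shows "yh_incl d m n' (yh_class d m n f) = yh_class d m n' f"
proof -
  interpret I': ideal "yh_ideal d m n'" "yh_free m n'" by (rule ideal_yh_ideal)
  interpret I: ideal "yh_ideal d m n" "yh_free m n" by (rule ideal_yh_ideal)
  have add: "a \<in> yh_ideal d m n' \<Longrightarrow> b \<in> yh_ideal d m n' \<Longrightarrow> a + b \<in> yh_ideal d m n'" for a b
    using additive_subgroup.a_closed[OF I'.additive_subgroup_axioms, of a b] by simp
  have 0: "0 \<in> yh_ideal d m n"
    using additive_subgroup.zero_closed[OF I.additive_subgroup_axioms] by simp
  show ?thesis
    unfolding yh_incl_def yh_class_def a_r_coset_def' set_add_def set_mult_def
    using add subsetD[OF yh_ideal_mono[OF assms(1)]] 0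
    by (auto simp flip: add.assoc)
qed

lemma YH_0_iso: "yh_scal d m 0 \<in> ring_iso (\<R> m) (YH d m 0)"
proof -
  interpret I: ideal "yh_ideal d m 0" "yh_free m 0" by (rule ideal_yh_ideal)
  have "\<not> yh_rel d m 0 l r" for l r
    by (auto elim: yh_rel.cases)
  then have "yh_ideal d m 0 = Idl\<^bsub>yh_free m 0\<^esub> {}"
    by (simp add: yh_ideal_def)
  also have "\<dots> \<subseteq> {\<zero>\<^bsub>yh_free m 0\<^esub>}"
    by (rule I.genideal_minimal[OF I.zeroideal]) simp
  finally have "yh_ideal d m 0 = {0}"
    using additive_subgroup.zero_closed[OF I.additive_subgroup_axioms] by auto
  then have cls: "yh_class d m 0 f = {f}" for f
    by (simp add: yh_class_def a_r_coset_def')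
  have scal_hom: "scal \<in> ring_hom (\<R> m) (yh_free m 0)"
    by (rule ring_hom_memI)
      (simp_all add: yh_free_scal, simp_all add: scal_def mult_single single_add)
  have "yh_class d m 0 \<circ> scal \<in> ring_hom (\<R> m) (YH d m 0)"
    by (rule ring_hom_trans[OF scal_hom yh_class_hom])
  then have hom: "yh_scal d m 0 \<in> ring_hom (\<R> m) (YH d m 0)"
    by (simp add: comp_def yh_scal_def[abs_def])
  moreover have "inj_on (yh_scal d m 0) (carrier (\<R> m))"
    by (rule inj_onI) (metis cls lookup_single_eq scal_def singleton_inject yh_scal_def)
  moreover have "A \<in> yh_scal d m 0 ` carrier (\<R> m)" if "A \<in> carrier (YH d m 0)" for A
  proof -
    from that obtain f where f: "f \<in> carrier (yh_free m 0)" and A: "A = yh_class d m 0 f"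
      by (rule yh_class_cases)
    have "f = scal (Poly_Mapping.lookup f 0)"
    proof (rule poly_mapping_eqI)
      fix w
      show "Poly_Mapping.lookup f w = Poly_Mapping.lookup (scal (Poly_Mapping.lookup f 0)) w"
        using f by (cases w)
          (auto simp: scal_def lookup_single when_def carrier_yh_free_iff yh_gens_def
            zero_free_word_def)
    qed
    then show ?thesis
      using f A by (metis carrier_yh_free_iff image_eqI yh_scal_def)
  qed
  ultimately show ?thesis
    by (auto simp: ring_iso_def bij_betw_def ring_hom_closed)
qed

subsection \<open>Relative traces\<close>

definition yh_W :: "nat \<Rightarrow> enat \<Rightarrow> nat \<Rightarrow> nat \<Rightarrow> int \<Rightarrow> int \<Rightarrow> yh_elem"
  where "yh_W d m k J a b =
    foldr (\<otimes>\<^bsub>YH d m k\<^esub>) (map (\<lambda>i. inv\<^bsub>YH d m k\<^esub> (yh_g d m k i)) (rev [1..<Suc J])) \<one>\<^bsub>YH d m k\<^esub>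
    \<otimes>\<^bsub>YH d m k\<^esub> (yh_X d m k [^]\<^bsub>YH d m k\<^esub> a)
    \<otimes>\<^bsub>YH d m k\<^esub> (yh_t d m k 1 [^]\<^bsub>YH d m k\<^esub> b)
    \<otimes>\<^bsub>YH d m k\<^esub> foldr (\<otimes>\<^bsub>YH d m k\<^esub>) (map (yh_g d m k) [1..<k]) \<one>\<^bsub>YH d m k\<^esub>"

definition yh_linear :: "nat \<Rightarrow> enat \<Rightarrow> nat \<Rightarrow> nat \<Rightarrow> (yh_elem \<Rightarrow> yh_elem) \<Rightarrow> bool"
  where "yh_linear d m n n' f \<longleftrightarrow>
    f \<in> carrier (YH d m n) \<rightarrow> carrier (YH d m n') \<and>
    (\<forall>A \<in> carrier (YH d m n). \<forall>B \<in> carrier (YH d m n).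
      f (A \<oplus>\<^bsub>YH d m n\<^esub> B) = f A \<oplus>\<^bsub>YH d m n'\<^esub> f B) \<and>
    (\<forall>c \<in> carrier (\<R> m). \<forall>A \<in> carrier (YH d m n).
      f (yh_scal d m n c \<otimes>\<^bsub>YH d m n\<^esub> A) = yh_scal d m n' c \<otimes>\<^bsub>YH d m n'\<^esub> f A)"

text \<open>
  The family is \<^const>\<open>extensional\<close>, both in the index and in each argument, so that equality of
  HOL functions is equality of the families of maps.
\<close>

definition relative_trace_chain ::
    "nat \<Rightarrow> enat \<Rightarrow> laurent \<Rightarrow> (int \<Rightarrow> int \<Rightarrow> laurent) \<Rightarrow> (nat \<Rightarrow> yh_elem \<Rightarrow> yh_elem) \<Rightarrow> bool"
  where "relative_trace_chain d m z x tr \<longleftrightarrow>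
    tr \<in> (\<Pi>\<^sub>E k\<in>{1..}. carrier (YH d m k) \<rightarrow>\<^sub>E carrier (YH d m (k - 1))) \<and>
    (\<forall>k\<ge>1. yh_linear d m k (k - 1) (tr k)) \<and>
    (\<forall>a \<in> E_set m. \<forall>b \<in> {0..<int d}.
      tr 1 ((yh_X d m 1 [^]\<^bsub>YH d m 1\<^esub> a) \<otimes>\<^bsub>YH d m 1\<^esub> (yh_t d m 1 1 [^]\<^bsub>YH d m 1\<^esub> b))
        = yh_scal d m 0 (x a b)) \<and>
    (\<forall>k\<ge>2.
      (\<forall>u \<in> carrier (YH d m (k - 1)). \<forall>v \<in> carrier (YH d m (k - 1)). \<forall>Z \<in> carrier (YH d m k).
        tr k (yh_incl d m k u \<otimes>\<^bsub>YH d m k\<^esub> Z \<otimes>\<^bsub>YH d m k\<^esub> yh_incl d m k v)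
          = u \<otimes>\<^bsub>YH d m (k - 1)\<^esub> tr k Z \<otimes>\<^bsub>YH d m (k - 1)\<^esub> v) \<and>
      (\<forall>u \<in> carrier (YH d m (k - 1)). \<forall>\<epsilon> \<in> {1, -1 :: int}.
        tr k ((yh_g d m k (k - 1) [^]\<^bsub>YH d m k\<^esub> \<epsilon>) \<otimes>\<^bsub>YH d m k\<^esub> yh_incl d m k u
                \<otimes>\<^bsub>YH d m k\<^esub> (yh_g d m k (k - 1) [^]\<^bsub>YH d m k\<^esub> (- \<epsilon>)))
          = yh_incl d m (k - 1) (tr (k - 1) u)) \<and>
      (\<forall>Z \<in> carrier (YH d m k).
        tr (k - 1) (tr k (yh_g d m k (k - 1) \<otimes>\<^bsub>YH d m k\<^esub> Z))
          = tr (k - 1) (tr k (Z \<otimes>\<^bsub>YH d m k\<^esub> yh_g d m k (k - 1)))) \<and>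
      tr k (yh_g d m k (k - 1)) = yh_scal d m (k - 1) z)"

end

theory Submission
  imports Defs
begin

text \<open>
  The relations of \<open>Y(d,m,n+1)\<close> let every element be written as a sum of \<open>W\<^sup>(\<^sup>n\<^sup>+\<^sup>1\<^sup>)_{J,a,b} w\<close>
  with \<open>w\<close> in \<open>Y(d,m,n)\<close>; the trace axioms determine the value on each of these when
  \<open>a \<in> E_m\<close>, and the cyclotomic relation is a linear recurrence in \<open>a\<close> with invertible
  extreme coefficients, so it determines the values for all other \<open>a\<close>.

  For existence no basis is needed. Functions of \<open>(J,a,b)\<close> with values in \<open>Y(d,m,n)\<close> that satisfy
  this recurrence and are periodic in \<open>b\<close> carry a right action of \<open>Y(d,m,n+1)\<close>, namely that
  on right-linear functionals. The values prescribed for the trace are such a function \<open>F\<close>,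
  and the trace of \<open>Z\<close> is \<open>F Z\<close> evaluated at \<open>W = 1\<close>. The same action shows that \<open>Y(d,m,n)\<close>
  embeds into \<open>Y(d,m,n+1)\<close>, so that all levels live in one ring.

  The only delicate axiom is \<open>tr (tr (g Z)) = tr (tr (Z g))\<close> for \<open>Z = g\<^sup>-\<^sup>1 y\<^sup>a t\<^sup>b g y\<^sup>N t\<^sup>c\<close>, where \<open>y\<close> and
  \<open>t\<close> are the conjugates of \<open>X_1\<close> and \<open>t_1\<close> at the top level. Moving the powers of \<open>y\<close> one at
  a time through \<open>g\<^sup>-\<^sup>1 y\<^sup>a t\<^sup>b g\<close> changes the double trace by differences \<open>\<phi>(i+1) - \<phi>(N-1-i)\<close>, whose
  sum telescopes.
\<close>

subsection \<open>Integer powers of an invertible element\<close>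

text \<open>A relation of Y(d,m,n+1) has to be verified on an arbitrary function of (J,a,b), whose
  values at different J are unrelated. It therefore splits into one case per position of J relative
  to the indices of the generators, and each case compares coefficients in Y(d,m,n). The exponent a
  runs over all integers because multiplication by X_1 leaves E_m: the recurrence takes the place of
  reduction by the cyclotomic polynomial, and one formula for X_1 serves every m. The price is that
  the cyclotomic relation itself must be shown to act as zero.

  The trace has to be linear on both sides. On the right this is built into the functionals. On the
  left it says that a generator of Y(d,m,n) acts on F by multiplying its values from the left, and
  this is where the prescribed values matter (\<open>F0_left\<close>).

  Embedding of the levels cannot be read off in the direct limit, where an element might vanish
  because of relations of a higher level. It is first proved in a ring whose kernel on level n is
  the ideal of that level by construction.\<close>

definition zpow :: "'a::monoid_mult \<Rightarrow> 'a \<Rightarrow> int \<Rightarrow> 'a"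
  where "zpow x y a = (if a \<ge> 0 then x ^ nat a else y ^ nat (- a))"

lemma zpow_0 [simp]: "zpow x y 0 = 1"
  and zpow_1 [simp]: "zpow x y 1 = x"
  and zpow_minus_1 [simp]: "zpow x y (-1) = y"
  by (simp_all add: zpow_def)

lemma zpow_Suc:
  assumes "x * y = 1" "y * x = 1"
  shows "zpow x y (a + 1) = x * zpow x y a"
proof (cases "a \<ge> 0")
  case True
  then show ?thesis by (simp add: zpow_def nat_add_distrib)
next
  case False
  then have "nat (- a) = Suc (nat (- (a + 1)))" by simp
  then show ?thesis using False assms
    by (auto simp: zpow_def simp flip: mult.assoc)
qed

lemma zpow_pred:
  assumes "x * y = 1" "y * x = 1"
  shows "zpow x y (a - 1) = y * zpow x y a"
proof -
  have "y * zpow x y a = y * (x * zpow x y (a - 1))" using zpow_Suc[OF assms, of "a - 1"] by simp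
  then show ?thesis using assms by (simp flip: mult.assoc)
qed

lemma zpow_add:
  assumes "x * y = 1" "y * x = 1"
  shows "zpow x y (a + b) = zpow x y a * zpow x y b"
proof (induction a rule: int_induct[where k = 0])
  case (step1 i)
  then show ?case using zpow_Suc[OF assms, of i] zpow_Suc[OF assms, of "i + b"]
    by (simp add: mult.assoc add.commute add.left_commute)
next
  case (step2 i)
  then show ?case using zpow_pred[OF assms, of i] zpow_pred[OF assms, of "i + b"]
    by (simp add: mult.assoc algebra_simps)
qed simp

lemma commute_power: "x * c = c * (y :: 'a::monoid_mult) \<Longrightarrow> x ^ k * c = c * y ^ k"
  by (induction k) (simp_all add: mult.assoc, simp flip: mult.assoc)

text \<open>Commutation is kept in the form \<open>x * c = c * y\<close> because t_j and g_i change
  their index when they pass another factor; \<open>c\<close> need not be invertible.\<close>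

lemma inverse_intertwine:
  fixes x :: "'a::monoid_mult"
  assumes "x * c = c * y" "x' * x = 1" "y * y' = 1"
  shows "x' * c = c * y'"
proof -
  have "x' * c = x' * c * (y * y')" using assms by simp
  also have "\<dots> = x' * (x * c) * y'" using assms by (simp add: mult.assoc)
  also have "\<dots> = (x' * x) * c * y'" by (simp add: mult.assoc)
  finally show ?thesis using assms by simp
qed

lemma intertwine_mult:
  fixes c :: "'a::semigroup_mult"
  assumes "a * c = c * b" "b * c' = c' * b'"
  shows "a * (c * c') = c * c' * b'"
  using assms by (metis mult.assoc)

lemma intertwine_inverse:
  fixes c :: "'a::monoid_mult"
  assumes "a * c = c * b" "c' * c = 1" "c * c' = 1"
  shows "b * c' = c' * a"
proof -
  have "b * c' = c' * c * b * c'" using assms by simp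
  also have "\<dots> = c' * (a * c) * c'" unfolding assms(1) by (simp only: mult.assoc)
  also have "\<dots> = c' * a * (c * c')" by (simp add: mult.assoc)
  finally show ?thesis using assms by simp
qed

lemma zpow_intertwine:
  fixes x :: "'a::monoid_mult"
  assumes "x * c = c * y" "x * x' = 1" "x' * x = 1" "y * y' = 1" "y' * y = 1"
  shows "zpow x x' a * c = c * zpow y y' a"
  using commute_power[OF assms(1)] commute_power[OF inverse_intertwine[OF assms(1,3,4)]]
  by (simp add: zpow_def)

text \<open>Both \<open>X\<close> with \<open>g_1\<close> and the conjugate of \<open>X\<close> in \<open>Y(d,m,k)\<close> with \<open>g_k\<close> are instances.
  The defect of the identity for \<open>a + 1\<close> is the defect for \<open>a\<close> times the unit
  \<open>g\<^sup>-\<^sup>1 x g\<close>, so the integer induction runs in both directions.\<close>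

lemma braid_commutator:
  fixes x y g h e :: "'a::ring_1"
  assumes x: "x * y = 1" "y * x = 1" and g: "g * h = 1" "h * g = 1" "h = g - e"
    and e: "e * x = x * e" "e * g = g * e"
    and braid: "x * g * x * g = g * x * g * x"
  shows "x * h * zpow x y a * g = h * zpow x y a * g * x + e * (x * g * zpow x y a - zpow x y (a + 1) * g)"
proof -
  \<comment> \<open>The conjugates \<open>Y a\<close> multiply like powers of one element;
    \<open>D a\<close> is the difference of the two sides.\<close>
  define Y where "Y = (\<lambda>a. h * zpow x y a * g)"
  define D where "D = (\<lambda>a. x * Y a - Y a * x - e * (x * g * zpow x y a - zpow x y (a + 1) * g))"
  have eh: "e * h = h * e"
    using inverse_intertwine[of g e g h h] g e by simp
  have ey: "e * y = y * e"
    using inverse_intertwine[of x e x y y] x e by simp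
  have eX: "e * zpow x y a = zpow x y a * e" for a
    using zpow_intertwine[of x e x y y a] x e by simp
  \<comment> \<open>The braid relation says that x commutes with g x g, hence so do all its
    powers.\<close>
  have Z: "zpow x y a * (g * x * g) = (g * x * g) * zpow x y a" for a
    by (rule zpow_intertwine) (use x braid in \<open>simp_all add: mult.assoc\<close>)
  have zp: "zpow x y (a + 1) = x * zpow x y a" "zpow x y (a + 1) = zpow x y a * x" for a
    using zpow_Suc[OF x, of a] zpow_add[OF x, of a 1] by simp_all
  have Y_Suc: "Y (a + 1) = Y a * Y 1" for a
  proof -
    have "Y a * Y 1 = h * zpow x y a * (g * h) * x * g" by (simp add: Y_def mult.assoc)
    then show ?thesis using zp(2)[of a] by (simp add: g(1) Y_def mult.assoc)
  qed
  have Y_inv: "Y 1 * Y (-1) = 1"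
  proof -
    have "Y 1 * Y (-1) = h * x * (g * h) * y * g" by (simp add: Y_def mult.assoc)
    also have "\<dots> = h * (x * y) * g" by (simp add: g(1) mult.assoc)
    finally show ?thesis by (simp add: x(1) g(2))
  qed
  have gY: "g * Y 1 = x * g"
    using g by (simp add: Y_def flip: mult.assoc)
  have ex: "x * (e * w) = e * (x * w)" for w
    using e(1) by (metis mult.assoc)
  \<comment> \<open>This is the braid relation after substitution of
    \<open>h = g - e\<close>.\<close>
  have D1: "D 1 = 0"
  proof -
    have "x * Y 1 = x * g * x * g - x * e * x * g"
      by (simp add: Y_def g(3) algebra_simps)
    moreover have "Y 1 * x = g * x * g * x - e * x * g * x"
      by (simp add: Y_def g(3) algebra_simps)
    ultimately show ?thesis
      unfolding D_def using braid zp(1)[of 1] by (simp add: algebra_simps ex)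
  qed
  have D_Suc: "D (a + 1) = D a * Y 1" for a
  proof -
    have eY: "e * Y a = Y a * e"
    proof -
      have "e * Y a = (e * h) * zpow x y a * g" by (simp add: Y_def mult.assoc)
      also have "\<dots> = h * (e * zpow x y a) * g" by (simp add: eh mult.assoc)
      also have "\<dots> = h * zpow x y a * (e * g)" by (simp add: eX mult.assoc)
      finally show ?thesis by (simp add: e(2) Y_def mult.assoc)
    qed
    have Yxg: "Y a * x * g = x * g * zpow x y a"
    proof -
      have "Y a * x * g = h * (zpow x y a * (g * x * g))" by (simp add: Y_def mult.assoc)
      also have "\<dots> = h * g * x * g * zpow x y a" unfolding Z by (simp add: mult.assoc)
      finally show ?thesis using g by simp
    qed
    have Yxg': "Y a * (x * (g * w)) = x * (g * (zpow x y a * w))" for w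
      using arg_cong[OF Yxg, of "\<lambda>u. u * w"] by (simp add: mult.assoc)
    \<comment> \<open>The case \<open>a = 1\<close> is multiplied by \<open>Y a\<close> from the
      left; \<open>Y a\<close> then passes \<open>e\<close> and is absorbed by means of
      \<open>Yxg\<close>.\<close>
    have "x * Y 1 = Y 1 * x + e * (x * g * x - x * x * g)"
      using D1 zp(1)[of 1] by (simp add: D_def algebra_simps)
    then have "Y a * (x * Y 1) = Y a * Y 1 * x + (Y a * e) * (x * g * x - x * x * g)"
      by (simp add: distrib_left mult.assoc)
    also have "\<dots> = Y a * Y 1 * x + e * (Y a * x * g * x - Y a * x * (x * g))"
      unfolding eY[symmetric] by (simp add: right_diff_distrib mult.assoc)
    also have "Y a * x * (x * g) = Y a * x * g * Y 1"
      by (simp add: gY mult.assoc)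
    also have "Y a * x * g * x = x * g * zpow x y (a + 1)"
      by (simp add: Yxg' zp(2) mult.assoc)
    finally have *: "Y a * x * Y 1 = Y (a + 1) * x + e * (x * g * zpow x y (a + 1) - x * g * zpow x y a * Y 1)"
      by (simp add: Yxg' Y_Suc mult.assoc)
    have **: "zpow x y (a + 1) * g * Y 1 = zpow x y (a + 1 + 1) * g"
      unfolding zp(2)[of "a+1"] by (simp add: gY mult.assoc)
    have "D a * Y 1 = x * (Y a * Y 1) - Y a * x * Y 1
        - e * (x * g * zpow x y a * Y 1 - zpow x y (a + 1) * g * Y 1)"
      by (simp add: D_def left_diff_distrib right_diff_distrib mult.assoc)
    also have "\<dots> = D (a + 1)"
      unfolding * ** Y_Suc[symmetric] by (simp add: D_def right_diff_distrib)
    finally show ?thesis by simp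
  qed
  have "D a = 0"
  proof (induction a rule: int_induct[where k = 0])
    case base
    have "x * h * g = x" by (simp add: g(2) mult.assoc)
    then show ?case by (simp add: D_def Y_def g(2))
  next
    case (step1 i)
    then show ?case by (simp add: D_Suc)
  next
    case (step2 i)
    have "D i * Y (-1) = D (i - 1) * (Y 1 * Y (-1))"
      using D_Suc[of "i - 1"] by (simp add: mult.assoc)
    then show ?case using step2 Y_inv by simp
  qed
  then show ?thesis by (simp add: D_def Y_def algebra_simps)
qed

subsection \<open>Sums over a period\<close>

lemma sum_period_shift:
  fixes h :: "int \<Rightarrow> 'a::comm_monoid_add"
  assumes h: "\<And>s. h (s + int d) = h s"
  shows "(\<Sum>s<d. h (int s + c)) = (\<Sum>s<d. h (int s))"
proof -
  have 1: "(\<Sum>s<d. h' (int s + 1)) = (\<Sum>s<d. h' (int s))"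
    if h': "\<And>s. h' (s + int d) = h' s" for h' :: "int \<Rightarrow> 'a"
  proof (cases d)
    case (Suc k)
    have "(\<Sum>s<d. h' (int s + 1)) = (\<Sum>s<k. h' (int (Suc s))) + h' (0 + int d)"
      by (simp add: Suc add.commute)
    also have "\<dots> = h' 0 + (\<Sum>s<k. h' (int (Suc s)))"
      unfolding h' by (simp add: add.commute)
    also have "\<dots> = (\<Sum>s<d. h' (int s))"
      unfolding Suc sum.lessThan_Suc_shift by simp
    finally show ?thesis .
  qed simp
  show ?thesis
  proof (induction c rule: int_induct[where k = 0])
    case (step1 i)
    have "h (s + int d + i) = h (s + i)" for s
      using h[of "s + i"] by (simp add: algebra_simps)
    then show ?case using step1 1[of "\<lambda>s. h (s + i)"] by (simp add: algebra_simps)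
  next
    case (step2 i)
    have "h (s + int d + (i - 1)) = h (s + (i - 1))" for s
      using h[of "s + (i - 1)"] by (simp add: algebra_simps)
    then show ?case using step2 1[of "\<lambda>s. h (s + (i - 1))"] by (simp add: algebra_simps)
  qed simp
qed

lemma sum_period_uminus:
  fixes h :: "int \<Rightarrow> 'a::comm_monoid_add"
  assumes h: "\<And>s. h (s + int d) = h s"
  shows "(\<Sum>s<d. h (- int s)) = (\<Sum>s<d. h (int s))"
proof -
  have "(\<Sum>s<d. h (- int s)) = (\<Sum>s<d. h (- int (d - Suc s)))"
    by (rule sum.nat_diff_reindex[symmetric])
  also have "\<dots> = (\<Sum>s<d. h (int s + (1 - int d)))"
    by (rule sum.cong) (auto simp: of_nat_diff algebra_simps)
  finally show ?thesis using sum_period_shift[of h d, OF h] by simp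
qed

subsection \<open>The relations in an arbitrary ring\<close>

definition per :: "nat \<Rightarrow> (int \<Rightarrow> 'a) \<Rightarrow> bool"
  where "per d h \<longleftrightarrow> (\<forall>b. h (b + int d) = h b)"

text \<open>The base ring enters only through the central element \<open>dl\<close>, which stands
  for (q - q^{-1})/d; the cyclotomic relation is added later. The functions \<open>t\<close> and
  \<open>g\<close> are constrained only up to level n, so that the same functions can serve every
  level.\<close>

locale yokonuma =
  fixes d n :: nat and dl :: "'a::ring_1" and t g :: "nat \<Rightarrow> 'a" and X Xi :: 'a
  assumes d_pos: "0 < d"
    and dl_central: "dl * a = a * dl"
    and g_far: "\<lbrakk>1 \<le> i; Suc i < j; j < n\<rbrakk> \<Longrightarrow> g i * g j = g j * g i"
    and g_braid: "\<lbrakk>1 \<le> i; Suc i < n\<rbrakk> \<Longrightarrow> g i * (g (Suc i) * g i) = g (Suc i) * (g i * g (Suc i))"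
    and t_comm: "\<lbrakk>1 \<le> i; i \<le> n; 1 \<le> j; j \<le> n\<rbrakk> \<Longrightarrow> t i * t j = t j * t i"
    and t_g: "\<lbrakk>1 \<le> i; i < n; 1 \<le> j; j \<le> n\<rbrakk> \<Longrightarrow> t j * g i = g i * t (transpose i (Suc i) j)"
    and t_order: "\<lbrakk>1 \<le> j; j \<le> n\<rbrakk> \<Longrightarrow> t j ^ d = 1"
    and g_square: "\<lbrakk>1 \<le> i; i < n\<rbrakk> \<Longrightarrow>
      g i * g i = 1 + dl * (\<Sum>s<d. t i ^ s * t (Suc i) ^ (d - s)) * g i"
    and X_Xi: "1 \<le> n \<Longrightarrow> X * Xi = 1" and Xi_X: "1 \<le> n \<Longrightarrow> Xi * X = 1"
    and X_braid: "2 \<le> n \<Longrightarrow> X * g 1 * X * g 1 = g 1 * X * g 1 * X"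
    and X_g: "\<lbrakk>2 \<le> i; i < n\<rbrakk> \<Longrightarrow> X * g i = g i * X"
    and X_t: "\<lbrakk>1 \<le> j; j \<le> n\<rbrakk> \<Longrightarrow> X * t j = t j * X"
begin

text \<open>Reducing the exponent modulo d gives negative powers without an inverse, and makes
  periodicity hold for every index j, whether constrained or not.\<close>

definition tp :: "nat \<Rightarrow> int \<Rightarrow> 'a"
  where "tp j s = t j ^ nat (s mod int d)"

text \<open>For j = i + 1 this is (q - q^{-1}) e_i. General pairs arise when it is moved past other
  factors, which permutes the indices.\<close>

definition de :: "nat \<Rightarrow> nat \<Rightarrow> 'a"
  where "de i j = dl * (\<Sum>s<d. tp i (int s) * tp j (- int s))"

definition gi :: "nat \<Rightarrow> 'a"
  where "gi i = g i - de i (Suc i)"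

abbreviation Xp :: "int \<Rightarrow> 'a"
  where "Xp \<equiv> zpow X Xi"

text \<open>The prefix g_J^{-1} ... g_1^{-1} of W; \<open>Gp\<close> is the suffix g_1 ... g_j. For
  equal index they are inverse to each other.\<close>

primrec Gi :: "nat \<Rightarrow> 'a"
  where "Gi 0 = 1" | "Gi (Suc J) = gi (Suc J) * Gi J"

primrec Gp :: "nat \<Rightarrow> 'a"
  where "Gp 0 = 1" | "Gp (Suc j) = Gp j * g (Suc j)"

lemma tp_period [simp]: "tp j (s + int d) = tp j s"
  by (simp add: tp_def)

lemma tp_0 [simp]: "tp j 0 = 1"
  by (simp add: tp_def)

lemma t_pow_mod: "1 \<le> j \<Longrightarrow> j \<le> n \<Longrightarrow> t j ^ k = t j ^ (k mod d)"
proof -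
  assume j: "1 \<le> j" "j \<le> n"
  have "t j ^ k = t j ^ (d * (k div d) + k mod d)" by simp
  also have "\<dots> = (t j ^ d) ^ (k div d) * t j ^ (k mod d)"
    by (simp only: power_add power_mult)
  finally show "t j ^ k = t j ^ (k mod d)" using t_order[OF j] by simp
qed

lemma tp_int: "1 \<le> j \<Longrightarrow> j \<le> n \<Longrightarrow> tp j (int k) = t j ^ k"
  using t_pow_mod[of j k] by (simp add: tp_def nat_mod_distrib)

lemma tp_1: "1 \<le> j \<Longrightarrow> j \<le> n \<Longrightarrow> tp j 1 = t j"
  using tp_int[of j 1] by simp

lemma tp_add: "1 \<le> j \<Longrightarrow> j \<le> n \<Longrightarrow> tp j (s + r) = tp j s * tp j r"
proof -
  assume j: "1 \<le> j" "j \<le> n"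
  have "tp j s * tp j r = tp j (int (nat (s mod int d) + nat (r mod int d)))"
    unfolding tp_int[OF j] by (simp add: tp_def power_add)
  also have "int (nat (s mod int d) + nat (r mod int d)) = s mod int d + r mod int d"
    using d_pos by simp
  finally show "tp j (s + r) = tp j s * tp j r"
    by (simp add: tp_def mod_simps)
qed

lemma tp_neg: "1 \<le> j \<Longrightarrow> j \<le> n \<Longrightarrow> s \<le> d \<Longrightarrow> tp j (- int s) = t j ^ (d - s)"
  using tp_int[of j "d - s"] tp_period[of j "- int s"] by (simp add: of_nat_diff)

lemma tp_intertwine:
  assumes "t i * c = c * t j"
  shows "tp i s * c = c * tp j s"
  unfolding tp_def by (rule commute_power[OF assms])

lemma tp_t: "1 \<le> i \<Longrightarrow> i \<le> n \<Longrightarrow> 1 \<le> j \<Longrightarrow> j \<le> n \<Longrightarrow> tp i s * t j = t j * tp i s"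
  by (rule tp_intertwine[OF t_comm])

lemma tp_comm: "1 \<le> i \<Longrightarrow> i \<le> n \<Longrightarrow> 1 \<le> j \<Longrightarrow> j \<le> n \<Longrightarrow> tp i s * tp j r = tp j r * tp i s"
  by (metis tp_intertwine tp_t)

lemma tp_X: "1 \<le> j \<Longrightarrow> j \<le> n \<Longrightarrow> tp j s * X = X * tp j s"
  by (rule tp_intertwine) (simp add: X_t)

lemma tp_Xp: "1 \<le> j \<Longrightarrow> j \<le> n \<Longrightarrow> tp j s * Xp a = Xp a * tp j s"
  using zpow_intertwine[of X "tp j s" X Xi Xi a] tp_X X_Xi Xi_X by simp

lemma tp_Xi: "1 \<le> j \<Longrightarrow> j \<le> n \<Longrightarrow> tp j s * Xi = Xi * tp j s"
  using tp_Xp[of j s "-1"] by simp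

lemma t_g_1: "1 \<le> i \<Longrightarrow> i < n \<Longrightarrow> t i * g i = g i * t (Suc i)"
  using t_g[of i i] by simp

lemma t_g_2: "1 \<le> i \<Longrightarrow> i < n \<Longrightarrow> t (Suc i) * g i = g i * t i"
  using t_g[of i "Suc i"] by simp

lemma t_g_far: "1 \<le> i \<Longrightarrow> i < n \<Longrightarrow> 1 \<le> j \<Longrightarrow> j \<le> n \<Longrightarrow> j \<noteq> i \<Longrightarrow> j \<noteq> Suc i \<Longrightarrow> t j * g i = g i * t j"
  using t_g[of i j] by (simp add: transpose_def)

lemma tp_g_1: "1 \<le> i \<Longrightarrow> i < n \<Longrightarrow> tp i s * g i = g i * tp (Suc i) s"
  by (rule tp_intertwine[OF t_g_1])

lemma tp_g_2: "1 \<le> i \<Longrightarrow> i < n \<Longrightarrow> tp (Suc i) s * g i = g i * tp i s"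
  by (rule tp_intertwine[OF t_g_2])

lemma tp_g_far: "1 \<le> i \<Longrightarrow> i < n \<Longrightarrow> 1 \<le> j \<Longrightarrow> j \<le> n \<Longrightarrow> j \<noteq> i \<Longrightarrow> j \<noteq> Suc i \<Longrightarrow> tp j s * g i = g i * tp j s"
  by (rule tp_intertwine[OF t_g_far])

lemma de_intertwine:
  assumes "\<And>s. tp i s * c = c * tp i' s" "\<And>s. tp j s * c = c * tp j' s"
  shows "de i j * c = c * de i' j'"
proof -
  have "tp i s * tp j r * c = c * (tp i' s * tp j' r)" for s r
    by (simp add: mult.assoc assms(2)) (simp add: assms(1) flip: mult.assoc)
  then show ?thesis
    by (simp add: de_def mult.assoc sum_distrib_left sum_distrib_right)
      (simp add: dl_central[of c] flip: mult.assoc)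
qed

lemma de_sym: "1 \<le> i \<Longrightarrow> i \<le> n \<Longrightarrow> 1 \<le> j \<Longrightarrow> j \<le> n \<Longrightarrow> de i j = de j i"
  using sum_period_uminus[where h = "\<lambda>s. tp i s * tp j (- s)" and d = d] tp_period[of j "- _ - int d"]
  by (simp add: de_def tp_comm[of i j])

lemma g_square_de: "1 \<le> i \<Longrightarrow> i < n \<Longrightarrow> g i * g i = 1 + de i (Suc i) * g i"
  by (simp add: g_square de_def tp_int tp_neg)

lemma de_X: "\<lbrakk>1 \<le> i; i \<le> n; 1 \<le> j; j \<le> n\<rbrakk> \<Longrightarrow> de i j * X = X * de i j"
  by (rule de_intertwine) (simp_all add: tp_X)

lemma de_Xp: "\<lbrakk>1 \<le> i; i \<le> n; 1 \<le> j; j \<le> n\<rbrakk> \<Longrightarrow> de i j * Xp a = Xp a * de i j"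
  by (rule de_intertwine) (simp_all add: tp_Xp)

lemma de_g: "1 \<le> i \<Longrightarrow> i < n \<Longrightarrow> de i (Suc i) * g i = g i * de i (Suc i)"
  using de_intertwine[of i "g i" "Suc i" "Suc i" i] de_sym[of "Suc i" i]
  by (simp add: tp_g_1 tp_g_2)

lemma g_gi: "1 \<le> i \<Longrightarrow> i < n \<Longrightarrow> g i * gi i = 1"
  and gi_g: "1 \<le> i \<Longrightarrow> i < n \<Longrightarrow> gi i * g i = 1"
  by (simp_all add: gi_def algebra_simps g_square_de de_g)

lemma tp_gi_1: "1 \<le> i \<Longrightarrow> i < n \<Longrightarrow> tp i s * gi i = gi i * tp (Suc i) s"
  using intertwine_inverse[OF tp_g_2 gi_g g_gi] by simp

lemma tp_gi_2: "1 \<le> i \<Longrightarrow> i < n \<Longrightarrow> tp (Suc i) s * gi i = gi i * tp i s"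
  using intertwine_inverse[OF tp_g_1 gi_g g_gi] by simp

lemma tp_gi_far: "1 \<le> i \<Longrightarrow> i < n \<Longrightarrow> 1 \<le> j \<Longrightarrow> j \<le> n \<Longrightarrow> j \<noteq> i \<Longrightarrow> j \<noteq> Suc i \<Longrightarrow> tp j s * gi i = gi i * tp j s"
  using intertwine_inverse[OF tp_g_far gi_g g_gi] by simp

lemma g_gi_far: "\<lbrakk>1 \<le> i; i < n; 1 \<le> j; j < n; Suc i < j \<or> Suc j < i\<rbrakk> \<Longrightarrow> g i * gi j = gi j * g i"
  using inverse_intertwine[of "g j" "g i" "g j" "gi j" "gi j"] g_far[of i j] g_far[of j i] gi_g[of j] g_gi[of j]
  by auto

lemma X_gi: "2 \<le> i \<Longrightarrow> i < n \<Longrightarrow> X * gi i = gi i * X"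
  using inverse_intertwine[of "g i" X "g i" "gi i" "gi i"] X_g[of i] gi_g[of i] g_gi[of i]
  by simp

text \<open>The braid relation multiplied by \<open>gi (Suc i) * gi i\<close> on both sides.\<close>

lemma g_gi_gi: "1 \<le> i \<Longrightarrow> Suc i < n \<Longrightarrow> g i * (gi (Suc i) * gi i) = gi (Suc i) * (gi i * g (Suc i))"
proof -
  assume i: "1 \<le> i" "Suc i < n"
  have "gi (Suc i) * (gi i * g (Suc i)) = (gi (Suc i) * gi i) * (g (Suc i) * g i * g (Suc i)) * (gi (Suc i) * gi i)"
    using i by (simp add: mult.assoc) (simp add: g_gi flip: mult.assoc)
  also have "\<dots> = (gi (Suc i) * gi i) * (g i * g (Suc i) * g i) * (gi (Suc i) * gi i)"
    using g_braid[OF i] by (simp add: mult.assoc)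
  also have "\<dots> = gi (Suc i) * (gi i * g i) * g (Suc i) * g i * (gi (Suc i) * gi i)"
    by (simp add: mult.assoc)
  also have "\<dots> = g i * (gi (Suc i) * gi i)"
    using i by (simp add: gi_g)
  finally show ?thesis by simp
qed

lemma tp_Gi_top: "J < n \<Longrightarrow> tp (Suc J) s * Gi J = Gi J * tp 1 s"
proof (induction J)
  case (Suc J)
  have "tp (Suc (Suc J)) s * Gi (Suc J) = gi (Suc J) * (tp (Suc J) s * Gi J)"
    using Suc.prems by (simp add: tp_gi_2 flip: mult.assoc)
  then show ?case using Suc by (simp add: mult.assoc)
qed simp

lemma tp_Gi_far: "Suc J < j \<Longrightarrow> j \<le> n \<Longrightarrow> tp j s * Gi J = Gi J * tp j s"
proof (induction J)
  case (Suc J)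
  have "tp j s * Gi (Suc J) = gi (Suc J) * (tp j s * Gi J)"
    using Suc.prems by (simp add: tp_gi_far flip: mult.assoc)
  then show ?case using Suc by (simp add: mult.assoc)
qed simp

lemma tp_Gi_low: "1 \<le> j \<Longrightarrow> j \<le> J \<Longrightarrow> J < n \<Longrightarrow> tp j s * Gi J = Gi J * tp (Suc j) s"
proof (induction J)
  case (Suc J)
  show ?case
  proof (cases "j = Suc J")
    case True
    have "tp j s * Gi (Suc J) = gi (Suc J) * (tp (Suc (Suc J)) s * Gi J)"
      using Suc.prems True by (simp add: tp_gi_1 flip: mult.assoc)
    then show ?thesis using Suc True by (simp add: mult.assoc tp_Gi_far)
  next
    case False
    have "tp j s * Gi (Suc J) = gi (Suc J) * (tp j s * Gi J)"
      using Suc.prems False by (simp add: tp_gi_far flip: mult.assoc)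
    then show ?thesis using Suc False by (simp add: mult.assoc)
  qed
qed simp

lemma g_Gi_far: "Suc J < i \<Longrightarrow> i < n \<Longrightarrow> g i * Gi J = Gi J * g i"
proof (induction J)
  case (Suc J)
  have "g i * Gi (Suc J) = gi (Suc J) * (g i * Gi J)"
    using Suc.prems by (simp add: g_gi_far flip: mult.assoc)
  then show ?case using Suc by (simp add: mult.assoc)
qed simp

lemma g_Gi_low: "1 \<le> i \<Longrightarrow> i < J \<Longrightarrow> J < n \<Longrightarrow> g i * Gi J = Gi J * g (Suc i)"
proof (induction J)
  case (Suc J)
  show ?case
  proof (cases "i = J")
    case True
    then obtain K where K: "J = Suc K" using Suc by (cases J) auto
    have "g i * Gi (Suc J) = (g (Suc K) * (gi (Suc (Suc K)) * gi (Suc K))) * Gi K"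
      by (simp add: True K mult.assoc)
    also have "\<dots> = gi (Suc (Suc K)) * gi (Suc K) * (g (Suc (Suc K)) * Gi K)"
      using Suc K True by (simp add: g_gi_gi mult.assoc)
    finally show ?thesis using Suc K True by (simp add: g_Gi_far mult.assoc)
  next
    case False
    have "g i * Gi (Suc J) = gi (Suc J) * (g i * Gi J)"
      using Suc.prems False by (simp add: g_gi_far flip: mult.assoc)
    then show ?thesis using Suc False by (simp add: mult.assoc)
  qed
qed simp

text \<open>The factors of \<open>Gi J\<close> other than the last one, g_1^{-1}, commute with X_1
  and t_1. Isolating g_1^{-1} reduces moving X_1 through W to a relation between X_1 and g_1
  alone.\<close>

lemma X_Gi_split:
  assumes "J < n" "1 \<le> J"
  obtains G' where "Gi J = G' * gi 1" "X * G' = G' * X" "\<And>s. tp 1 s * G' = G' * tp 1 s"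
    "\<And>s. tp (Suc J) s * G' = G' * tp 2 s"
proof -
  have "\<exists>G'. Gi J = G' * gi 1 \<and> X * G' = G' * X \<and> (\<forall>s. tp 1 s * G' = G' * tp 1 s) \<and>
      (\<forall>s. tp (Suc J) s * G' = G' * tp 2 s)"
    using assms(2,1)
  proof (induction J rule: nat_induct_at_least)
    case base
    then show ?case by (intro exI[of _ 1]) (simp add: numeral_2_eq_2)
  next
    case (Suc J)
    then obtain G' where G: "Gi J = G' * gi 1" "X * G' = G' * X" "\<And>s. tp 1 s * G' = G' * tp 1 s"
      "\<And>s. tp (Suc J) s * G' = G' * tp 2 s" by auto
    have "X * (gi (Suc J) * G') = gi (Suc J) * G' * X"
      by (rule intertwine_mult) (use Suc X_gi[of "Suc J"] G(2) in simp_all)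
    moreover have "tp 1 s * (gi (Suc J) * G') = gi (Suc J) * G' * tp 1 s" for s
      by (rule intertwine_mult) (use Suc tp_gi_far[of "Suc J" 1] G(3)[of s] in simp_all)
    moreover have "tp (Suc (Suc J)) s * (gi (Suc J) * G') = gi (Suc J) * G' * tp 2 s" for s
      by (rule intertwine_mult) (use Suc tp_gi_2[of "Suc J"] G(4)[of s] in simp_all)
    ultimately show ?case
      by (intro exI[of _ "gi (Suc J) * G'"]) (simp add: G(1) mult.assoc)
  qed
  then show ?thesis using that by blast
qed

lemma tp_Gp_1: "j < n \<Longrightarrow> tp 1 s * Gp j = Gp j * tp (Suc j) s"
proof (induction j)
  case (Suc j)
  have "tp 1 s * Gp (Suc j) = Gp j * (tp (Suc j) s * g (Suc j))"
    using Suc by (simp flip: mult.assoc)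
  then show ?case using Suc by (simp add: tp_g_1 mult.assoc)
qed simp

lemma tp_Gp_far: "Suc j < i \<Longrightarrow> i \<le> n \<Longrightarrow> tp i s * Gp j = Gp j * tp i s"
proof (induction j)
  case (Suc j)
  have "tp i s * Gp (Suc j) = Gp j * (tp i s * g (Suc j))"
    using Suc by (simp flip: mult.assoc)
  then show ?case using Suc by (simp add: tp_g_far mult.assoc)
qed simp

lemma tp_Gp_low: "1 \<le> i \<Longrightarrow> i \<le> j \<Longrightarrow> j < n \<Longrightarrow> tp (Suc i) s * Gp j = Gp j * tp i s"
proof (induction j)
  case (Suc j)
  show ?case
  proof (cases "i = Suc j")
    case True
    then have "tp (Suc i) s * Gp (Suc j) = Gp j * (tp (Suc (Suc j)) s * g (Suc j))"
      using Suc tp_Gp_far[of j "Suc (Suc j)" s] by (simp flip: mult.assoc)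
    then show ?thesis using Suc True by (simp add: tp_g_2 mult.assoc)
  next
    case False
    have "tp (Suc i) s * Gp (Suc j) = Gp j * (tp i s * g (Suc j))"
      using Suc False by (simp flip: mult.assoc)
    then show ?thesis using Suc False by (simp add: tp_g_far mult.assoc)
  qed
qed simp

lemma g_Gp_far: "Suc j < i \<Longrightarrow> i < n \<Longrightarrow> g i * Gp j = Gp j * g i"
proof (induction j)
  case (Suc j)
  have "g i * Gp (Suc j) = Gp j * (g i * g (Suc j))"
    using Suc by (simp flip: mult.assoc)
  then show ?case using Suc by (simp add: g_far mult.assoc)
qed simp

lemma g_Gp_low: "1 \<le> i \<Longrightarrow> i < j \<Longrightarrow> j < n \<Longrightarrow> g (Suc i) * Gp j = Gp j * g i"
proof (induction j)
  case (Suc j)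
  show ?case
  proof (cases "i = j")
    case True
    then obtain k where k: "j = Suc k" using Suc by (cases j) auto
    have "g (Suc i) * Gp (Suc j) = (g (Suc (Suc k)) * Gp k) * (g (Suc k) * g (Suc (Suc k)))"
      by (simp add: True k mult.assoc)
    also have "\<dots> = Gp k * (g (Suc (Suc k)) * (g (Suc k) * g (Suc (Suc k))))"
      using Suc k True by (simp add: g_Gp_far mult.assoc)
    also have "\<dots> = Gp k * (g (Suc k) * (g (Suc (Suc k)) * g (Suc k)))"
      using Suc k True by (simp add: g_braid)
    finally show ?thesis using k True by (simp add: mult.assoc)
  next
    case False
    have "g (Suc i) * Gp (Suc j) = Gp j * (g i * g (Suc j))"
      using Suc False by (simp flip: mult.assoc)
    moreover have "i < j" using Suc False by simp
    ultimately show ?thesis using Suc.prems g_far[of i "Suc j"] by (simp add: mult.assoc)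
  qed
qed simp

lemma Gp_Gi: "j < n \<Longrightarrow> Gp j * Gi j = 1"
proof (induction j)
  case (Suc j)
  have "Gp (Suc j) * Gi (Suc j) = Gp j * (g (Suc j) * gi (Suc j)) * Gi j"
    by (simp add: mult.assoc)
  then show ?case using Suc by (simp add: g_gi)
qed simp

lemma Gi_Gp: "j < n \<Longrightarrow> Gi j * Gp j = 1"
proof (induction j)
  case (Suc j)
  have "Gi (Suc j) * Gp (Suc j) = gi (Suc j) * (Gi j * Gp j) * g (Suc j)"
    by (simp add: mult.assoc)
  then show ?case using Suc by (simp add: gi_g)
qed simp

lemma X_commutator:
  assumes "2 \<le> n"
  shows "X * gi 1 * Xp a * g 1 = gi 1 * Xp a * g 1 * X + de 1 2 * (X * g 1 * Xp a - Xp (a + 1) * g 1)"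
proof (rule braid_commutator)
  show "gi 1 = g 1 - de 1 2" by (simp add: gi_def numeral_2_eq_2)
  show "g 1 * gi 1 = 1" "gi 1 * g 1 = 1" "de 1 2 * g 1 = g 1 * de 1 2"
    using assms g_gi[of 1] gi_g[of 1] de_g[of 1] by (simp_all add: numeral_2_eq_2)
qed (use assms X_braid in \<open>simp_all add: X_Xi Xi_X de_X\<close>)

end

subsection \<open>The dual of the free module on the \<open>W\<^sup>(\<^sup>k\<^sup>)\<close>\<close>

text \<open>
  For \<open>k = n + 1\<close>, a right \<open>Y(d,m,n)\<close>-linear functional on \<open>Y(d,m,k)\<close> is recorded by its values
  \<open>F J a b\<close> at \<open>W\<^sup>(\<^sup>k\<^sup>)_{J,a,b}\<close>, with \<open>a\<close> and \<open>b\<close> ranging over all integers. The operators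
  below are the right action of the generators of \<open>Y(d,m,k)\<close> on such functionals, read off from
  the left multiplication of \<open>W\<^sup>(\<^sup>k\<^sup>)_{J,a,b}\<close> by the generators.
\<close>

type_synonym 'a fnl = "nat \<Rightarrow> int \<Rightarrow> int \<Rightarrow> 'a"

context yokonuma
begin

text \<open>In (q - q^{-1}) e_i W one of the two t's joins t_1^b and raises b, while the other
  passes through W and leaves on the right as t_j. \<open>DE\<close> is the resulting value of a
  functional; see \<open>de_W\<close>.\<close>

definition DE :: "nat \<Rightarrow> (int \<Rightarrow> 'a) \<Rightarrow> int \<Rightarrow> 'a"
  where "DE j h b = dl * (\<Sum>s<d. h (b + int s) * tp j (- int s))"

lemma DE_add: "DE j (\<lambda>b. h b + h' b) b = DE j h b + DE j h' b"
  and DE_diff: "DE j (\<lambda>b. h b - h' b) b = DE j h b - DE j h' b"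
  by (simp_all add: DE_def algebra_simps sum.distrib sum_subtractf)

lemma DE_lmult: "DE j (\<lambda>b. c * h b) b = c * DE j h b"
  by (simp add: DE_def sum_distrib_left mult.assoc) (simp add: dl_central[of c] flip: mult.assoc)

lemma DE_right:
  assumes "\<And>s. tp i s * c = c * tp j s"
  shows "DE j (\<lambda>b. h b * c) b = DE i h b * c"
  by (simp add: DE_def sum_distrib_right sum_distrib_left mult.assoc assms)

lemma DE_arg: "DE j (\<lambda>b. h (b + r)) b = DE j h (b + r)"
  by (simp add: DE_def algebra_simps)

text \<open>Up to a factor, the sum over a full period projects onto the functions for which raising
  b by one is right multiplication by t_j.\<close>

lemma DE_shift:
  assumes "per d h" "1 \<le> j" "j \<le> n"
  shows "DE j h (b + r) = DE j h b * tp j r"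
proof -
  have p: "h (s + int d) = h s" for s using assms by (simp add: per_def)
  have q: "h (b + (s + int d)) = h (b + s)" for s using p[of "b + s"] by (simp add: algebra_simps)
  have "tp j (r - (s + int d)) = tp j (r - s)" for s
    using tp_period[of j "r - s - int d"] by (simp add: algebra_simps)
  then have "(\<Sum>s<d. h (b + (int s + r)) * tp j (r - (int s + r))) = (\<Sum>s<d. h (b + int s) * tp j (r - int s))"
    using sum_period_shift[of "\<lambda>s. h (b + s) * tp j (r - s)" d r] q by simp
  moreover have "tp j (r - s) = tp j (- s) * tp j r" for s
    using tp_add[OF assms(2,3), of "-s" r] by (simp add: algebra_simps)
  ultimately show ?thesis
    by (simp add: DE_def sum_distrib_right mult.assoc algebra_simps)
qed

lemma DE_period: "per d h \<Longrightarrow> per d (DE j h)"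
  unfolding per_def DE_def
proof
  fix b assume h: "\<forall>b. h (b + int d) = h b"
  have "h (b + int d + int s) = h (b + int s)" for s
    using h[rule_format, of "b + int s"] by (simp add: algebra_simps)
  then show "dl * (\<Sum>s<d. h (b + int d + int s) * tp j (- int s)) = dl * (\<Sum>s<d. h (b + int s) * tp j (- int s))"
    by simp
qed

text \<open>By \<open>DE_shift\<close> the inner function already changes by powers of t_j, so the
  outer sum collapses to the factor \<open>de j i\<close>.\<close>

lemma DE_DE:
  assumes "per d h" "1 \<le> j" "j \<le> n"
  shows "DE i (DE j h) b = DE j h b * de j i"
proof -
  have "DE i (DE j h) b = dl * (DE j h b * (\<Sum>s<d. tp j (int s) * tp i (- int s)))"
    unfolding DE_def[of i "DE j h"] by (simp add: DE_shift[OF assms] sum_distrib_left mult.assoc)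
  also have "\<dots> = DE j h b * (dl * (\<Sum>s<d. tp j (int s) * tp i (- int s)))"
    by (simp add: dl_central[of "DE j h b"] flip: mult.assoc)
  finally show ?thesis by (simp add: de_def)
qed

lemma DE_comm:
  assumes "1 \<le> i" "i \<le> n" "1 \<le> j" "j \<le> n"
  shows "DE i (DE j h) b = DE j (DE i h) b"
proof -
  have "DE i (DE j h) b = dl * (dl * (\<Sum>s<d. \<Sum>r<d. h (b + int s + int r) * tp j (- int r) * tp i (- int s)))" for i j
    by (simp add: DE_def sum_distrib_left sum_distrib_right mult.assoc)
  moreover have "(\<Sum>s<d. \<Sum>r<d. h (b + int s + int r) * tp j (- int r) * tp i (- int s)) =
      (\<Sum>s<d. \<Sum>r<d. h (b + int s + int r) * tp i (- int r) * tp j (- int s))"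
    by (subst sum.swap) (simp add: mult.assoc tp_comm[OF assms] algebra_simps)
  ultimately show ?thesis by simp
qed

text \<open>The third case is g_i = g_i^{-1} + (q - q^{-1}) e_i: the first term lengthens the prefix
  of W, the second one gives \<open>DE\<close>. In the last case g_i passes the prefix unchanged and
  the suffix lowers its index.\<close>

definition opg :: "nat \<Rightarrow> 'a fnl \<Rightarrow> 'a fnl"
  where "opg i F J a b =
    (if i < J then F J a b * g i else if i = J then F (J - 1) a b
     else if i = Suc J then F (Suc J) a b + DE (Suc J) (F J a) b else F J a b * g (i - 1))"

definition opt :: "nat \<Rightarrow> 'a fnl \<Rightarrow> 'a fnl"
  where "opt j F J a b =
    (if j \<le> J then F J a b * t j else if j = Suc J then F J a (b + 1) else F J a b * t (j - 1))"

text \<open>For J > 0, X_1 meets the factor g_1^{-1}. The correction comes from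
  \<open>X_commutator\<close>: its two terms lead to the elements W with J = 0 and exponents 1 and a
  + 1, followed by \<open>Gi (J - 1)\<close>, the form in which the remaining prefix leaves the
  suffix.\<close>

definition opX :: "'a fnl \<Rightarrow> 'a fnl"
  where "opX F J a b = (if J = 0 then F 0 (a + 1) b else F J a b * X +
    (DE J (F 0 1) b * Gi (J - 1) * Xp a - DE J (F 0 (a + 1)) b * Gi (J - 1)))"

text \<open>This is \<open>opX\<close> solved for its argument, using that at J = 0 it is the shift
  of a.\<close>

definition opXi :: "'a fnl \<Rightarrow> 'a fnl"
  where "opXi F J a b = (if J = 0 then F 0 (a - 1) b else F J a b * Xi -
    (DE J (F 0 0) b * Gi (J - 1) * Xp (a - 1) - DE J (F 0 a) b * Gi (J - 1) * Xi))"

definition ope :: "nat \<Rightarrow> 'a fnl \<Rightarrow> 'a fnl"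
  where "ope i F J a b = dl * (\<Sum>s<d. (opt (Suc i) ^^ (d - s)) ((opt i ^^ s) F) J a b)"

definition opgi :: "nat \<Rightarrow> 'a fnl \<Rightarrow> 'a fnl"
  where "opgi i F J a b = opg i F J a b - ope i F J a b"

lemma opg_lt: "i < J \<Longrightarrow> opg i F J a = (\<lambda>b. F J a b * g i)"
  and opg_at: "opg (Suc J) F (Suc J) a = F J a"
  and opg_up: "opg (Suc J) F J a = (\<lambda>b. F (Suc J) a b + DE (Suc J) (F J a) b)"
  and opg_gt: "J < i \<Longrightarrow> opg (Suc i) F J a = (\<lambda>b. F J a b * g i)"
  by (auto simp: opg_def fun_eq_iff)

lemma opt_le: "j \<le> J \<Longrightarrow> opt j F J a = (\<lambda>b. F J a b * t j)"
  and opt_at: "opt (Suc J) F J a = (\<lambda>b. F J a (b + 1))"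
  and opt_gt: "J < j \<Longrightarrow> opt (Suc j) F J a = (\<lambda>b. F J a b * t j)"
  by (auto simp: opt_def fun_eq_iff)

lemma opX_0: "opX F 0 a = F 0 (a + 1)"
  and opX_Suc: "opX F (Suc J) a = (\<lambda>b. F (Suc J) a b * X +
    (DE (Suc J) (F 0 1) b * Gi J * Xp a - DE (Suc J) (F 0 (a + 1)) b * Gi J))"
  and opXi_0: "opXi F 0 a = F 0 (a - 1)"
  and opXi_Suc: "opXi F (Suc J) a = (\<lambda>b. F (Suc J) a b * Xi -
    (DE (Suc J) (F 0 0) b * Gi J * Xp (a - 1) - DE (Suc J) (F 0 a) b * Gi J * Xi))"
  by (auto simp: opX_def opXi_def fun_eq_iff)

lemmas op_simps = opg_lt opg_at opg_up opg_gt opt_le opt_at opt_gt opX_0 opX_Suc opXi_0 opXi_Suc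

definition perF :: "'a fnl \<Rightarrow> bool"
  where "perF F \<longleftrightarrow> (\<forall>J\<le>n. \<forall>a. per d (F J a))"

lemma perF_D: "perF F \<Longrightarrow> J \<le> n \<Longrightarrow> per d (F J a)"
  by (simp add: perF_def)

lemma per_add: "per d h \<Longrightarrow> per d h' \<Longrightarrow> per d (\<lambda>b. h b + h' b)"
  and per_diff: "per d h \<Longrightarrow> per d h' \<Longrightarrow> per d (\<lambda>b. h b - h' b)"
  and per_mult: "per d h \<Longrightarrow> per d (\<lambda>b. h b * c)"
  and per_arg: "per d h \<Longrightarrow> per d (\<lambda>b. h (b + r))"
  by (auto simp: per_def) (metis add.assoc add.commute)

lemma perF_opg: "perF F \<Longrightarrow> 1 \<le> i \<Longrightarrow> i \<le> n \<Longrightarrow> perF (opg i F)"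
  unfolding perF_def
proof (intro allI impI)
  fix J a assume F: "\<forall>J\<le>n. \<forall>a. per d (F J a)" and i: "1 \<le> i" "i \<le> n" and J: "J \<le> n"
  then obtain i' where i': "i = Suc i'" by (cases i) auto
  consider "i < J" | "J = i" | "J = i'" | "J < i'" using i' by linarith
  then show "per d (opg i F J a)"
    by cases (use F i J in \<open>simp_all add: i' op_simps per_mult per_add DE_period\<close>)
qed

lemma perF_opt: "perF F \<Longrightarrow> 1 \<le> j \<Longrightarrow> perF (opt j F)"
  unfolding perF_def
proof (intro allI impI)
  fix J a assume F: "\<forall>J\<le>n. \<forall>a. per d (F J a)" and i: "1 \<le> j" and J: "J \<le> n"
  then obtain i' where i': "j = Suc i'" by (cases j) auto
  consider "j \<le> J" | "J = i'" | "J < i'" using i' by linarith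
  then show "per d (opt j F J a)"
    by cases (use F i J in \<open>simp_all add: i' op_simps per_mult per_arg\<close>)
qed

lemma perF_opX: "perF F \<Longrightarrow> perF (opX F)"
  unfolding perF_def
proof (intro allI impI)
  fix J a assume F: "\<forall>J\<le>n. \<forall>a. per d (F J a)" and J: "J \<le> n"
  then show "per d (opX F J a)"
    by (cases J) (simp_all add: op_simps per_mult per_add per_diff DE_period)
qed

lemma perF_opXi: "perF F \<Longrightarrow> perF (opXi F)"
  unfolding perF_def
proof (intro allI impI)
  fix J a assume F: "\<forall>J\<le>n. \<forall>a. per d (F J a)" and J: "J \<le> n"
  then show "per d (opXi F J a)"
    by (cases J) (simp_all add: op_simps per_mult per_add per_diff DE_period)
qed

lemma g_far': "\<lbrakk>1 \<le> i; i < n; 1 \<le> j; j < n; Suc i < j \<or> Suc j < i\<rbrakk> \<Longrightarrow> g i * g j = g j * g i"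
  using g_far[of i j] g_far[of j i] by auto

lemma opg_far:
  assumes "1 \<le> i" "Suc i < j" "j \<le> n" "J \<le> n"
  shows "opg j (opg i F) J a b = opg i (opg j F) J a b"
proof -
  obtain i' j' where ij: "i = Suc i'" "j = Suc j'" using assms by (cases i; cases j) auto
  consider "j < J" | "J = j" | "J = j'" | "i < J" "J < j'" | "J = i" | "J = i'" | "J < i'"
    using assms ij by linarith
  then show ?thesis
  proof cases
    case 1
    then show ?thesis using assms g_far[of i j] by (simp add: op_simps mult.assoc)
  next
    case 2
    then show ?thesis using assms ij by (simp add: op_simps)
  next
    case 3
    then have "DE (Suc J) (\<lambda>b. F J a b * g i) b = DE (Suc J) (F J a) b * g i"
      using assms ij by (intro DE_right tp_g_far) auto
    then show ?thesis using 3 assms ij by (simp add: op_simps distrib_right)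
  next
    case 4
    then show ?thesis using assms ij g_far'[of i j'] by (simp add: op_simps mult.assoc)
  next
    case 5
    then show ?thesis using assms ij by (simp add: op_simps)
  next
    case 6
    then have "DE (Suc J) (\<lambda>b. F J a b * g j') b = DE (Suc J) (F J a) b * g j'"
      using assms ij by (intro DE_right tp_g_far) auto
    then show ?thesis using 6 assms ij by (simp add: op_simps distrib_right)
  next
    case 7
    then show ?thesis using assms ij g_far[of i' j'] by (simp add: op_simps mult.assoc)
  qed
qed

text \<open>Two correction terms meet only for J = i - 1. There g_i^2 is expanded by the quadratic
  relation, and \<open>DE_DE\<close> matches the additional term.\<close>

lemma opg_braid:
  assumes F: "perF F" and i: "1 \<le> i" "Suc i \<le> n" and J: "J \<le> n"
  shows "opg i (opg (Suc i) (opg i F)) J a b = opg (Suc i) (opg i (opg (Suc i) F)) J a b"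
proof -
  obtain i' where i': "i = Suc i'" using i by (cases i) auto
  consider "Suc i < J" | "J = Suc i" | "J = i" | "J = i'" | "J < i'" using i' by linarith
  then show ?thesis
  proof cases
    case 1
    then show ?thesis using i J g_braid[of i] by (simp add: op_simps mult.assoc)
  next
    case 2
    then show ?thesis using i i' by (simp add: op_simps)
  next
    case 3
    have "DE (Suc i) (\<lambda>b. F i' a b * g i) b = DE i (F i' a) b * g i"
      using i by (intro DE_right tp_g_1) auto
    then show ?thesis using 3 i i' by (simp add: op_simps distrib_right)
  next
    case 4
    have p: "per d (F i' a)" using F i i' by (simp add: perF_def)
    have *: "DE i (\<lambda>b. h b * g i) b = DE (Suc i) h b * g i" for h b
      using i by (intro DE_right tp_g_2) auto
    have "DE (Suc i) (F i' a) b * g i * g i = DE (Suc i) (F i' a) b + DE (Suc i) (F i' a) b * de (Suc i) i * g i"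
      using i by (simp add: mult.assoc g_square_de distrib_left de_sym[of "Suc i" i])
    moreover have "DE i (DE (Suc i) (F i' a)) b = DE (Suc i) (F i' a) b * de (Suc i) i"
      using p i by (intro DE_DE) auto
    moreover have "DE (Suc i) (DE i (F i' a)) b = DE i (DE (Suc i) (F i' a)) b"
      using i by (intro DE_comm) auto
    ultimately show ?thesis using 4 i i'
      by (simp add: op_simps distrib_right *[unfolded i'] DE_add mult.assoc)
  next
    case 5
    then show ?thesis using i i' J g_braid[of i'] by (simp add: op_simps mult.assoc)
  qed
qed

lemma opt_pow:
  assumes "1 \<le> j" "j \<le> Suc n" "J \<le> n"
  shows "(opt j ^^ s) F J a b =
    (if j \<le> J then F J a b * t j ^ s else if j = Suc J then F J a (b + int s) else F J a b * t (j - 1) ^ s)"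
proof (induction s arbitrary: b)
  case (Suc s)
  have e: "b + int (Suc s) = b + 1 + int s" by simp
  show ?case
    unfolding e funpow.simps(2) comp_def opt_def[of j "(opt j ^^ s) F"] Suc.IH
    by (simp add: mult.assoc power_commutes)
qed simp

lemma opt_order:
  assumes "perF F" "1 \<le> j" "j \<le> Suc n" "J \<le> n"
  shows "(opt j ^^ d) F J a b = F J a b"
  using assms by (auto simp: opt_pow t_order perF_def per_def)

lemma opt_comm:
  assumes "1 \<le> i" "i \<le> Suc n" "1 \<le> j" "j \<le> Suc n" "J \<le> n"
  shows "opt i (opt j F) J a b = opt j (opt i F) J a b"
  using assms t_comm[of i j] t_comm[of i "j - 1"] t_comm[of "i - 1" j] t_comm[of "i - 1" "j - 1"]
  by (auto simp: opt_def mult.assoc)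

lemma opt_opg:
  assumes F: "perF F" and i: "1 \<le> i" "i \<le> n" and j: "1 \<le> j" "j \<le> Suc n" and J: "J \<le> n"
  shows "opg i (opt j F) J a b = opt (transpose i (Suc i) j) (opg i F) J a b"
proof -
  obtain i' j' where ij: "i = Suc i'" "j = Suc j'" using i j by (cases i; cases j) auto
  have p: "per d (F i' a)" using F ij i by (simp add: perF_def)
  consider "j = i" | "j = Suc i" | "j \<noteq> i" "j \<noteq> Suc i" by blast
  then show ?thesis
  proof cases
    case 1
    consider "i < J" | "J = i" | "J = i'" | "J < i'" using ij by linarith
    then show ?thesis
    proof cases
      case a: 1
      then show ?thesis using 1 i J t_g_1[of i] by (simp add: op_simps mult.assoc)
    next
      case 2
      then show ?thesis using 1 i J ij by (simp add: op_simps)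
    next
      case 3
      have "DE i (\<lambda>b. F i' a (b + 1)) b = DE i (F i' a) (b + 1)" by (rule DE_arg)
      also have "\<dots> = DE i (F i' a) b * tp i 1" using p i by (intro DE_shift)
      finally show ?thesis using 1 3 i J ij by (simp add: op_simps tp_1 distrib_right)
    next
      case 4
      then show ?thesis using 1 i J ij t_g_1[of i'] by (simp add: op_simps mult.assoc)
    qed
  next
    case 2
    consider "i < J" | "J = i" | "J = i'" | "J < i'" using ij by linarith
    then show ?thesis
    proof cases
      case a: 1
      then show ?thesis using 2 i J t_g_2[of i] by (simp add: op_simps mult.assoc)
    next
      case b: 2
      then show ?thesis using 2 i J ij by (simp add: op_simps)
    next
      case 3
      have "DE i (\<lambda>b. F i' a b * t i) b = DE i (F i' a) b * t i"
        using i by (intro DE_right tp_t) auto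
      also have "\<dots> = DE i (F i' a) (b + 1)" using p i DE_shift[of "F i' a" i b 1] by (simp add: tp_1)
      finally show ?thesis using 2 3 i J ij by (simp add: op_simps)
    next
      case 4
      then show ?thesis using 2 i J ij t_g_2[of i'] by (simp add: op_simps mult.assoc)
    qed
  next
    case 3
    have *: "DE i (\<lambda>b. F i' a b * t k) b = DE i (F i' a) b * t k" if "1 \<le> k" "k \<le> n" for k
      using i that by (intro DE_right tp_t) auto
    have tr: "transpose i (Suc i) j = j" using 3 by (simp add: transpose_def)
    consider "i < J" | "J = i" | "J = i'" | "J < i'" using ij by linarith
    then show ?thesis
    proof cases
      case a: 1
      consider "j \<le> J" | "J = j'" | "J < j'" using ij by linarith
      then show ?thesis
        by cases (use tr 3 a i j J ij t_g_far[of i j] t_g_far[of i j'] in \<open>simp_all add: op_simps mult.assoc\<close>)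
    next
      case b: 2
      consider "j \<le> i'" | "i < j'" using ij 3 by linarith
      then show ?thesis
        by cases (use tr 3 b i j J ij in \<open>simp_all add: op_simps mult.assoc\<close>)
    next
      case c: 3
      consider "j \<le> i'" | "i < j'" using ij 3 by linarith
      then show ?thesis
        by cases (use tr 3 c i j J ij *[of j] *[of j'] in \<open>simp_all add: op_simps mult.assoc distrib_right\<close>)
    next
      case e: 4
      consider "j \<le> J" | "J = j'" | "J < j'" using ij by linarith
      then show ?thesis
        by cases (use tr 3 e i j J ij t_g_far[of i' j] t_g_far[of i' j'] in \<open>simp_all add: op_simps mult.assoc\<close>)
    qed
  qed
qed

lemma ope_lt: "Suc i \<le> J \<Longrightarrow> J \<le> n \<Longrightarrow> 1 \<le> i \<Longrightarrow> ope i F J a = (\<lambda>b. F J a b * de i (Suc i))"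
  by (rule ext) (simp add: ope_def opt_pow de_def tp_int tp_neg sum_distrib_left mult.assoc,
      simp add: dl_central[of "F _ _ _"] flip: mult.assoc)

text \<open>Compared with J = i - 1 the two t's exchange their roles: here t_{i+1} raises b and t_i
  passes to the right. Reversing the sum over a period shows that the result is again
  \<open>DE i\<close>.\<close>

lemma ope_at:
  assumes "perF F" "1 \<le> i" "i \<le> n"
  shows "ope i F i a = DE i (F i a)"
proof
  fix b
  have p: "F i a (c + int d) = F i a c" for c using assms by (simp add: perF_def per_def)
  have r: "F i a (b + (int d - int s)) = F i a (b - int s)" for s
    using p[of "b - int s"] by (simp add: add.commute add_diff_eq)
  have "ope i F i a b = dl * (\<Sum>s<d. F i a (b + - int s) * tp i (int s))"
    using assms by (simp add: ope_def opt_pow tp_int of_nat_diff r)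
  also have "(\<Sum>s<d. F i a (b + - int s) * tp i (int s)) = (\<Sum>s<d. F i a (b + int s) * tp i (- int s))"
  proof -
    define h where "h = (\<lambda>s. F i a (b + s) * tp i (- s))"
    have "h (s + int d) = h s" for s
      using p[of "b + s"] tp_period[of i "- (s + int d)"] by (simp add: h_def add.assoc)
    from sum_period_uminus[of h, OF this] show ?thesis by (simp add: h_def)
  qed
  finally show "ope i F i a b = DE i (F i a) b" by (simp add: DE_def)
qed

lemma ope_up:
  assumes "Suc J \<le> n"
  shows "ope (Suc J) F J a = DE (Suc J) (F J a)"
  using assms by (intro ext) (simp add: ope_def opt_pow DE_def tp_neg)

lemma ope_gt:
  assumes "J < i" "Suc i \<le> n"
  shows "ope (Suc i) F J a = (\<lambda>b. F J a b * de i (Suc i))"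
  using assms by (intro ext) (simp add: ope_def opt_pow de_def tp_int tp_neg sum_distrib_left mult.assoc,
      simp add: dl_central[of "F _ _ _"] flip: mult.assoc)

lemma opg_square:
  assumes F: "perF F" and i: "1 \<le> i" "i \<le> n" and J: "J \<le> n"
  shows "opg i (opg i F) J a b = F J a b + opg i (ope i F) J a b"
proof -
  obtain i' where i': "i = Suc i'" using i by (cases i) auto
  consider "i < J" | "J = i" | "J = i'" | "J < i'" using i' by linarith
  then show ?thesis
  proof cases
    case 1
    then show ?thesis using i J by (simp add: op_simps ope_lt g_square_de mult.assoc distrib_left)
  next
    case 2
    then show ?thesis using F i J i' by (simp add: op_simps ope_up)
  next
    case 3
    then show ?thesis using F i J i' ope_at[of F i a] by (simp add: op_simps ope_up DE_add)
  next
    case 4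
    then show ?thesis using i J i' g_square_de[of i'] by (simp add: op_simps ope_gt mult.assoc distrib_left)
  qed
qed

lemma opgi_down:
  assumes "Suc J \<le> n"
  shows "opgi (Suc J) F J a b = F (Suc J) a b"
  using assms by (simp add: opgi_def op_simps ope_up)

lemma opX_opXi:
  assumes F: "perF F" and J: "J \<le> n"
  shows "opX (opXi F) J a b = F J a b" "opXi (opX F) J a b = F J a b"
proof -
  consider "J = 0" | K where "J = Suc K" by (cases J) auto
  then have "opX (opXi F) J a b = F J a b \<and> opXi (opX F) J a b = F J a b"
  proof cases
    case 2
    have z: "Xp a * Xi = Xp (a - 1)" "Xp (a - 1) * X = Xp a" for a
      using zpow_add[OF X_Xi Xi_X, of a "-1"] zpow_add[OF X_Xi Xi_X, of "a-1" 1] J 2 by simp_all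
    have n: "1 \<le> n" using J 2 by simp
    show ?thesis using J 2 by (simp add: op_simps X_Xi[OF n] Xi_X[OF n] z mult.assoc distrib_right left_diff_distrib)
  qed (simp add: op_simps)
  then show "opX (opXi F) J a b = F J a b" "opXi (opX F) J a b = F J a b" by auto
qed

end

section \<open>Compatibility of the operator of X_1 with the operators of g_i and t_j\<close>

context yokonuma
begin

lemma g_Xp: "2 \<le> i \<Longrightarrow> i < n \<Longrightarrow> g i * Xp a = Xp a * g i"
  using zpow_intertwine[of X "g i" X Xi Xi a] X_g[of i] X_Xi Xi_X by simp

lemma t_Gi_top: "J < n \<Longrightarrow> t (Suc J) * Gi J = Gi J * t 1"
  using tp_Gi_top[of J 1] by (simp add: tp_1)

lemma t_Gi_low: "1 \<le> j \<Longrightarrow> j \<le> J \<Longrightarrow> J < n \<Longrightarrow> t j * Gi J = Gi J * t (Suc j)"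
  using tp_Gi_low[of j J 1] by (simp add: tp_1)

lemma t_Gi_far: "Suc J < j \<Longrightarrow> j \<le> n \<Longrightarrow> t j * Gi J = Gi J * t j"
  using tp_Gi_far[of J j 1] by (simp add: tp_1)

lemma t_X: "1 \<le> j \<Longrightarrow> j \<le> n \<Longrightarrow> t j * X = X * t j"
  by (simp add: X_t)

lemma t_Xp: "1 \<le> j \<Longrightarrow> j \<le> n \<Longrightarrow> t j * Xp a = Xp a * t j"
  using tp_Xp[of j 1] by (simp add: tp_1)

lemma assoc_swap: "x * y = u * v \<Longrightarrow> x * (y * w) = u * (v * w)" for x :: 'a
  by (metis mult.assoc)

lemma opX_opg:
  assumes F: "perF F" and i: "2 \<le> i" "i \<le> n" and J: "J \<le> n"
  shows "opg i (opX F) J a b = opX (opg i F) J a b"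
proof (cases J)
  case 0
  obtain i' where "i = Suc i'" using i by (cases i) auto
  then show ?thesis using 0 i by (simp add: op_simps)
next
  case (Suc K)
  obtain i' where i': "i = Suc i'" "1 \<le> i'" using i by (cases i) auto
  have o0: "opg i F 0 c = (\<lambda>b. F 0 c b * g i')" for c
    using i' by (simp add: op_simps)
  consider "i < J" | "J = i" | "J = i'" | "J < i'" using i' by linarith
  then show ?thesis
  proof cases
    case 1
    have D: "DE J (\<lambda>b. h b * g i') b = DE J h b * g i'" for h
      using 1 i' J by (intro DE_right tp_g_far) auto
    have G: "g i' * Gi K = Gi K * g i"
      using 1 i' J Suc by (simp add: g_Gi_low)
    show ?thesis
      using 1 i i' J Suc X_g[of i] D o0 assoc_swap[OF G] assoc_swap[OF g_Xp[of i a]] g_Xp[of i a] G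
      by (simp add: op_simps mult.assoc distrib_right left_diff_distrib)
  next
    case 2
    obtain K' where K': "K = Suc K'" using 2 i' Suc by (cases K) auto
    have D: "DE (Suc K) (\<lambda>b. h b * g K) b = DE K h b * g K" for h
      using 2 i Suc K' by (intro DE_right tp_g_1) auto
    have G: "g K * Gi K = Gi K'"
      using 2 i Suc K' g_gi[of K] by (simp flip: mult.assoc)
    have iK: "i' = K" using 2 i' Suc by simp
    show ?thesis
      unfolding 2[symmetric] Suc opg_at opX_Suc o0[unfolded 2[symmetric] Suc iK] D
      unfolding K' opX_Suc using G assoc_swap[of "g K" "Gi K" "Gi K'" 1]
      by (simp add: K' mult.assoc del: Gi.simps)
  next
    \<comment> \<open>Here i = J + 1. The \<open>de\<close> term obtained by applying
      \<open>DE (Suc J)\<close> to the correction cancels the one in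
      \<open>gi J = g J - de J (Suc J)\<close>, the first factor of \<open>Gi J\<close>.\<close>
    case 3
    have D: "DE J (\<lambda>b. h b * g J) b = DE (Suc J) h b * g J" for h
      using 3 i i' J Suc by (intro DE_right tp_g_2) auto
    have D1: "DE (Suc J) (\<lambda>b. F J a b * X) b = DE (Suc J) (F J a) b * X"
      using 3 i i' by (intro DE_right tp_X) auto
    have D2: "DE (Suc J) (\<lambda>b. DE J (F 0 c) b * Gi K * v) b = DE (Suc J) (F 0 c) b * de J (Suc J) * Gi K * v"
      if "v = 1 \<or> v = Xp a" for v c
    proof -
      have "DE (Suc J) (\<lambda>b. DE J (F 0 c) b * (Gi K * v)) b = DE (Suc J) (DE J (F 0 c)) b * (Gi K * v)"
      proof (rule DE_right)
        fix s
        show "tp (Suc J) s * (Gi K * v) = Gi K * v * tp (Suc J) s"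
          by (rule intertwine_mult[OF tp_Gi_far]) (use 3 i i' Suc that tp_Xp in auto)
      qed
      also have "DE (Suc J) (DE J (F 0 c)) b = DE J (DE (Suc J) (F 0 c)) b"
        using 3 i i' Suc by (intro DE_comm) auto
      also have "\<dots> = DE (Suc J) (F 0 c) b * de (Suc J) J"
        using F 3 i i' Suc by (intro DE_DE perF_D) auto
      finally show ?thesis using 3 i i' Suc de_sym[of "Suc J" J] by (simp add: mult.assoc)
    qed
    have "DE (Suc J) (opX F J a) b = DE (Suc J) (F J a) b * X + (DE (Suc J) (F 0 1) b * de J (Suc J) * Gi K * Xp a
        - DE (Suc J) (F 0 (a + 1)) b * de J (Suc J) * Gi K)"
      using D2[of "Xp a" 1] D2[of 1 "a + 1"] D1 by (simp add: Suc opX_Suc DE_add DE_diff)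
    then show ?thesis
      unfolding i'(1) 3[symmetric] opg_up
      unfolding Suc opX_Suc o0[unfolded i'(1) 3[symmetric] Suc] D[unfolded Suc] opg_up
      by (simp add: gi_def mult.assoc distrib_right distrib_left left_diff_distrib right_diff_distrib)
  next
    case 4
    have D: "DE J (\<lambda>b. h b * g i') b = DE J h b * g i'" for h
      using 4 i i' J Suc by (intro DE_right tp_g_far) auto
    have G: "g i' * Gi K = Gi K * g i'"
      using 4 i i' J Suc by (simp add: g_Gi_far)
    show ?thesis
      using 4 i i' J Suc X_g[of i'] D o0 assoc_swap[OF G] assoc_swap[OF g_Xp[of i' a]] g_Xp[of i' a] G
      by (simp add: op_simps mult.assoc distrib_right left_diff_distrib)
  qed
qed

lemma opX_opt:
  assumes F: "perF F" and j: "1 \<le> j" "j \<le> Suc n" and J: "J \<le> n"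
  shows "opt j (opX F) J a b = opX (opt j F) J a b"
proof (cases J)
  case 0
  obtain j' where "j = Suc j'" using j by (cases j) auto
  then show ?thesis using 0 j by (cases j') (simp_all add: op_simps)
next
  case (Suc K)
  obtain j' where j': "j = Suc j'" using j by (cases j) auto
  have pF: "per d (F 0 c)" for c using F by (simp add: perF_def)
  have sh: "DE J (F 0 c) (b + 1) = DE J (F 0 c) b * t J" for c b
    using DE_shift[OF pF, of J c b 1] J Suc by (simp add: tp_1)
  have sh': "DE J (\<lambda>b. F 0 c (b + 1)) b = DE J (F 0 c) b * t J" for c b
    unfolding DE_arg by (rule sh)
  have D: "DE J (\<lambda>b. h b * t l) b = DE J h b * t l" if "1 \<le> l" "l \<le> n" for h l
    using that J Suc by (intro DE_right tp_t) auto
  consider "j = 1" | "2 \<le> j" "j \<le> J" | "J = j'" | "J < j'" using j' j by linarith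
  then show ?thesis
  proof cases
    case 1
    have o0: "opt j F 0 c = (\<lambda>b. F 0 c (b + 1))" for c
      unfolding 1 using opt_at[of 0 F c] by simp
    have G: "t (Suc K) * Gi K = Gi K * t 1" using J Suc by (simp add: t_Gi_top)
    show ?thesis
      unfolding Suc opX_Suc o0 sh'[unfolded Suc]
      using 1 J Suc t_X[of 1] G assoc_swap[OF G] t_Xp[of 1 a]
      by (simp add: op_simps mult.assoc distrib_right left_diff_distrib)
  next
    case 2
    then have j2: "1 \<le> j'" using j' by simp
    have o0: "opt j F 0 c = (\<lambda>b. F 0 c b * t j')" for c
      using j' j2 by (simp add: op_simps)
    have G: "t j' * Gi K = Gi K * t j" using j' j2 2 J Suc by (simp add: t_Gi_low)
    have D': "DE (Suc K) (\<lambda>b. h b * t j') b = DE (Suc K) h b * t j'" for h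
      using D[of j'] j' j2 2 J Suc by simp
    show ?thesis
      unfolding Suc opX_Suc o0 D'
      using 2 j J Suc t_X[of j] G assoc_swap[OF G] t_Xp[of j a]
      by (simp add: op_simps mult.assoc distrib_right left_diff_distrib)
  next
    case 3
    have jj: "j = Suc (Suc K)" using 3 j' Suc by simp
    have o0: "opt j F 0 c = (\<lambda>b. F 0 c b * t J)" for c
      using j' 3 Suc by (simp add: op_simps)
    have D': "DE (Suc K) (\<lambda>b. h b * t (Suc K)) b = DE (Suc K) h b * t (Suc K)" for h
      using D[of J] J Suc by simp
    show ?thesis
      unfolding Suc opX_Suc o0[unfolded Suc] D' sh[unfolded Suc, symmetric]
      unfolding jj opt_at opX_Suc ..
  next
    case 4
    have o0: "opt j F 0 c = (\<lambda>b. F 0 c b * t j')" for c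
      using j' 4 by (simp add: op_simps)
    have G: "t j' * Gi K = Gi K * t j'" using j' 4 j J Suc by (simp add: t_Gi_far)
    have D': "DE (Suc K) (\<lambda>b. h b * t j') b = DE (Suc K) h b * t j'" for h
      using D[of j'] j j' 4 Suc by simp
    show ?thesis
      unfolding Suc opX_Suc o0 D'
      using 4 j j' J Suc t_X[of j'] G assoc_swap[OF G] t_Xp[of j' a]
      by (simp add: op_simps mult.assoc distrib_right left_diff_distrib)
  qed
qed

text \<open>The correction is rewritten with g_1^{-1}, the factor that appears in
  \<open>opX\<close>; the terms quadratic in \<open>de 1 2\<close> cancel because it commutes with
  X.\<close>

lemma X_commutator':
  assumes "2 \<le> n"
  shows "X * gi 1 * Xp a * g 1 = gi 1 * Xp a * g 1 * X + de 1 2 * X * gi 1 * Xp a - de 1 2 * Xp (a + 1) * gi 1"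
proof -
  have g: "g 1 = gi 1 + de 1 2" by (simp add: gi_def numeral_2_eq_2)
  have e: "de 1 2 * Xp a = Xp a * de 1 2" "de 1 2 * Xp (a + 1) = Xp (a + 1) * de 1 2"
    using assms by (simp_all add: de_Xp)
  have z: "X * Xp a = Xp (a + 1)" using zpow_Suc[OF X_Xi Xi_X] assms by simp
  have "X * g 1 * Xp a - Xp (a + 1) * g 1 = X * gi 1 * Xp a - Xp (a + 1) * gi 1 + (X * (de 1 2 * Xp a) - Xp (a + 1) * de 1 2)"
    unfolding g by (simp add: algebra_simps)
  also have "X * (de 1 2 * Xp a) - Xp (a + 1) * de 1 2 = 0"
    unfolding e by (simp add: z flip: mult.assoc)
  finally have *: "X * g 1 * Xp a - Xp (a + 1) * g 1 = X * gi 1 * Xp a - Xp (a + 1) * gi 1" by simp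
  show ?thesis
    using X_commutator[OF assms, of a] unfolding * by (simp add: right_diff_distrib mult.assoc)
qed

text \<open>The two sides are the coefficients of the value of F at J = 0, a = 1 in the two sides of
  \<open>opX_braid\<close>.\<close>

lemma X_commutator'':
  assumes "2 \<le> n"
  shows "gi 1 * Xp a * g 1 * X * g 1 + de 1 2 * X * gi 1 * Xp a * g 1 - de 1 2 * Xp (a + 1) =
    de 1 2 * gi 1 * Xp a * g 1 * X + X * gi 1 * Xp a + de 1 2 * de 1 2 * X * gi 1 * Xp a
      - de 1 2 * de 1 2 * Xp (a + 1) * gi 1"
proof -
  have g: "g 1 = gi 1 + de 1 2" by (simp add: gi_def numeral_2_eq_2)
  have z: "X * Xp a = Xp (a + 1)" using zpow_Suc[OF X_Xi Xi_X] assms by simp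
  have "Xp a * (g 1 * X * g 1) = g 1 * X * g 1 * Xp a"
    by (rule zpow_intertwine) (use assms X_braid X_Xi Xi_X in \<open>simp_all add: mult.assoc\<close>)
  then have "gi 1 * Xp a * g 1 * X * g 1 = (gi 1 * g 1) * X * g 1 * Xp a"
    by (simp add: mult.assoc)
  also have "\<dots> = X * gi 1 * Xp a + X * (de 1 2 * Xp a)"
    using gi_g[of 1] assms unfolding g by (simp add: algebra_simps)
  also have "X * (de 1 2 * Xp a) = de 1 2 * Xp (a + 1)"
    using assms de_X[of 1 2] by (simp add: z[symmetric] flip: mult.assoc)
  finally have 1: "gi 1 * Xp a * g 1 * X * g 1 = X * gi 1 * Xp a + de 1 2 * Xp (a + 1)" .
  have "de 1 2 * (X * gi 1 * Xp a * g 1) = de 1 2 * gi 1 * Xp a * g 1 * X + de 1 2 * de 1 2 * X * gi 1 * Xp a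
      - de 1 2 * de 1 2 * Xp (a + 1) * gi 1"
    unfolding X_commutator'[OF assms] by (simp add: algebra_simps)
  then show ?thesis unfolding 1 by (simp add: mult.assoc)
qed

lemma opg_opX_0: "opg 1 (opX F) 0 c = (\<lambda>b. F 1 c b * X + DE 1 (F 0 1) b * Xp c)"
  using opg_up[of 0 "opX F" c] opX_Suc[of F 0 c] by (simp add: opX_0)

text \<open>For J = 0 and J = 1 both sides are expanded directly. For J \<ge> 2 they are
  combinations of F_J, F_{0,1}, F_{0,a+1}, F_{1,1}, F_{1,a+1}; the first four coefficients agree by
  the braid relation, \<open>X_commutator''\<close>, the definition of \<open>gi\<close>, and
  \<open>X_commutator'\<close>, and the last ones are identical.\<close>

lemma opX_braid:
  assumes F: "perF F" and n: "1 \<le> n" and J: "J \<le> n"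
  shows "opg 1 (opX (opg 1 (opX F))) J a b = opX (opg 1 (opX (opg 1 F))) J a b"
proof -
  note One_nat_def [simp del]
  have z: "X * Xp a = Xp (a + 1)" "Xp a * X = Xp (a + 1)" for a
    using zpow_Suc[OF X_Xi Xi_X] zpow_add[OF X_Xi Xi_X, of a 1] n by simp_all
  have F01: "opg 1 F 0 c = (\<lambda>b. F 1 c b + DE 1 (F 0 c) b)" for c
    using opg_up[of 0 F c] by (simp add: One_nat_def)
  have F11: "opg 1 F' 1 c = F' 0 c" for c F'
    using opg_at[of 0 F' c] by (simp add: One_nat_def)
  have DX: "DE j (\<lambda>b. h b * X) b = DE j h b * X" if "1 \<le> j" "j \<le> n" for h j b
    using that by (intro DE_right tp_X)
  have DXp: "DE j (\<lambda>b. h b * Xp c) b = DE j h b * Xp c" if "1 \<le> j" "j \<le> n" for h j b c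
    using that by (intro DE_right tp_Xp)
  consider "J = 0" | "J = 1" | K where "J = Suc K" "1 \<le> K"
    by (cases J; cases "J - 1") auto
  then show ?thesis
  proof cases
    case 1
    show ?thesis
      unfolding 1 opg_opX_0 opX_0 F11
      by (simp add: opg_opX_0 F11 F01 DE_add DX n mult.assoc z distrib_right)
  next
    case 2
    have Q1: "opg 1 (opX (opg 1 F)) 1 a = opg 1 F 0 (a + 1)"
      unfolding F11 opX_0 ..
    show ?thesis
      unfolding 2 F11 opX_0 opg_opX_0
      using opX_Suc[of "opg 1 (opX (opg 1 F))" 0 a, folded One_nat_def] opg_opX_0[of "opg 1 F"]
      by (simp add: opX_0 Q1 F11 F01 DE_add DX DXp n mult.assoc z distrib_right)
  next
    case (3 K)
    have n2: "2 \<le> n" using 3 J by simp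
    obtain G' where G: "Gi K = G' * gi 1" "X * G' = G' * X" "\<And>s. tp 1 s * G' = G' * tp 1 s"
      "\<And>s. tp (Suc K) s * G' = G' * tp 2 s"
      using X_Gi_split[of K] 3 J by auto
    have eG: "de J 1 * G' = G' * de 1 2"
      using de_intertwine[of J G' 2 1 1] G(3,4) 3 n2 de_sym[of 2 1] by simp
    define A where "A = (\<lambda>c. DE J (F 0 c) b)"
    define B where "B = (\<lambda>c. DE J (F 1 c) b)"
    have pF: "per d (F i c)" if "i \<le> n" for i c using F that by (simp add: perF_def)
    have DD: "DE J (DE 1 h) b = DE J h b * de J 1" if "per d h" for h
      using DE_comm[of J 1 h b] DE_DE[OF that, of J 1 b] 3 n J by simp
    have J1: "1 \<le> J" using 3 by simp
    have Ad: "DE J (F 0 c) b = A c" for c by (simp add: A_def)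
    have P0: "DE J (opg 1 (opX F) 0 c) b = B c * X + A 1 * de J 1 * Xp c" for c
      unfolding opg_opX_0 using n by (simp add: DE_add DX[OF J1 J] DXp[OF J1 J] DD pF A_def B_def)
    have o0: "DE J (opg 1 F 0 c) b = B c + A c * de J 1" for c
      unfolding F01 by (simp add: DE_add DD pF n A_def B_def)
    have Q0: "DE J (opg 1 (opX (opg 1 F)) 0 c) b = A c * X + (B 1 + A 1 * de J 1) * de J 1 * Xp c" for c
    proof -
      have "per d (opg 1 F 0 1)" using perF_opg[OF F, of 1] n by (simp add: perF_def)
      then show ?thesis
        unfolding opg_opX_0 F11 using DD o0 by (simp add: DE_add DX[OF J1 J] DXp[OF J1 J] A_def)
    qed
    have lt: "opg 1 F' J a = (\<lambda>b. F' J a b * g 1)" for F' using 3 by (simp add: opg_lt)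
    have oX: "opX F' J a b = F' J a b * X + (DE J (F' 0 1) b * G' * gi 1 * Xp a - DE J (F' 0 (a + 1)) b * G' * gi 1)" for F'
      using opX_Suc[of F' K a] 3 G(1) by (simp add: mult.assoc)
    have X: "X * (G' * w) = G' * (X * w)" for w using assoc_swap[OF G(2)] .
    have XG: "Xp c * (G' * w) = G' * (Xp c * w)" for w c
      by (rule assoc_swap, rule zpow_intertwine) (use G(2) X_Xi Xi_X n in simp_all)
    have gg: "gi 1 * (g 1 * w) = w" for w
      using gi_g[of 1] n2 by (simp flip: mult.assoc)
    have gg': "gi 1 * g 1 = 1" using gi_g[of 1] n2 by simp
    note simps = X XG assoc_swap[OF eG] gg gg' mult.assoc algebra_simps
    have L: "opg 1 (opX (opg 1 (opX F))) J a b = F J a b * (X * g 1 * X * g 1)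
        + A 1 * G' * (gi 1 * Xp a * g 1 * X * g 1 + de 1 2 * X * gi 1 * Xp a * g 1 - de 1 2 * Xp (a + 1))
        - A (a + 1) * G' * (X * g 1) + B 1 * G' * (X * gi 1 * Xp a * g 1) - B (a + 1) * G' * X"
      unfolding lt oX P0 Ad by (simp add: simps)
    have R: "opX (opg 1 (opX (opg 1 F))) J a b = F J a b * (g 1 * X * g 1 * X)
        + A 1 * G' * (de 1 2 * gi 1 * Xp a * g 1 * X + X * gi 1 * Xp a + de 1 2 * de 1 2 * X * gi 1 * Xp a
      - de 1 2 * de 1 2 * Xp (a + 1) * gi 1)
        - A (a + 1) * G' * (de 1 2 * X + X * gi 1)
        + B 1 * G' * (gi 1 * Xp a * g 1 * X + de 1 2 * X * gi 1 * Xp a - de 1 2 * Xp (a + 1) * gi 1)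
        - B (a + 1) * G' * X"
      unfolding lt oX Q0 o0 Ad by (simp add: simps)
    have "X * g 1 = de 1 2 * X + X * gi 1"
      using de_X[of 1 2] n2 gi_def[of 1] by (simp add: Suc_1 right_diff_distrib)
    then show ?thesis
      unfolding L R X_commutator'[OF n2] X_commutator''[OF n2] using X_braid[OF n2] by simp
  qed
qed

end

lemma in_yh_gens [simp]:
  "GenT i \<in> yh_gens k \<longleftrightarrow> 1 \<le> i \<and> i \<le> k" "GenG i \<in> yh_gens k \<longleftrightarrow> 1 \<le> i \<and> i < k"
  "GenX \<in> yh_gens k \<longleftrightarrow> 1 \<le> k" "GenXinv \<in> yh_gens k \<longleftrightarrow> 1 \<le> k"
  by (auto simp: yh_gens_def)

section \<open>The elements W themselves obey the formulas that define the operators\<close>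

context yokonuma
begin

fun gen :: "yh_gen \<Rightarrow> 'a"
  where "gen (GenT j) = t j" | "gen (GenG i) = g i" | "gen GenX = X" | "gen GenXinv = Xi"

fun op :: "yh_gen \<Rightarrow> 'a fnl \<Rightarrow> 'a fnl"
  where "op (GenT j) = opt j" | "op (GenG i) = opg i" | "op GenX = opX" | "op GenXinv = opXi"

text \<open>At level j + 1 no operator looks at values with J > j. So a function may be replaced by
  one that agrees with it on a lower level only, as is done in \<open>F0_left\<close>.\<close>

lemma op_cong:
  assumes "x \<in> yh_gens (Suc j)" "J \<le> j" "\<And>J a b. J \<le> j \<Longrightarrow> F J a b = F' J a b"
  shows "op x F J a b = op x F' J a b"
proof -
  have *: "F J a = F' J a" if "J \<le> j" for J a using that assms(3) by (intro ext)
  show ?thesis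
    using assms(1,2) * by (cases x) (auto simp: opg_def opt_def opX_def opXi_def)
qed

lemma op_add: "op x (\<lambda>J a b. F J a b + F' J a b) J a b = op x F J a b + op x F' J a b"
  by (cases x) (auto simp: opg_def opt_def opX_def opXi_def DE_add algebra_simps)

text \<open>The operators multiply values from the right, and \<open>dl\<close> is central. Hence a
  factor on the left can be pulled out of the whole action, which is the source of left linearity of
  the trace.\<close>

lemma op_lmult: "op x (\<lambda>J a b. c * F J a b) J a b = c * op x F J a b"
  by (cases x) (auto simp: opg_def opt_def opX_def opXi_def DE_lmult algebra_simps)

text \<open>The superscript is shifted: this is W^{(j+1)}_{J,a,b}, with b an arbitrary integer
  thanks to \<open>tp\<close>.\<close>

definition W :: "nat \<Rightarrow> 'a fnl"
  where "W j J a b = Gi J * (Xp a * (tp 1 b * Gp j))"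

lemma per_W: "per d (W j J a)"
  by (simp add: per_def W_def)

lemma gi_Gp_low: "1 \<le> i \<Longrightarrow> i < j \<Longrightarrow> j < n \<Longrightarrow> gi (Suc i) * Gp j = Gp j * gi i"
  using gi_g[of "Suc i"]
    inverse_intertwine[of "g (Suc i)" "Gp j" "g i" "gi (Suc i)" "gi i"] g_Gp_low[of i j] g_gi[of i] by simp

text \<open>After g_1^{-1} g_1 is cancelled, the remaining factors with indices K + 1, ..., 2 pass
  through g_1 ... g_j, and each index drops by one.\<close>

lemma Gi_Gp_shift: "K < j \<Longrightarrow> j < n \<Longrightarrow> Gi (Suc K) * (g 1 * Gp j) = Gp j * Gi K"
proof (induction K)
  case 0
  have "Gi (Suc 0) * (g 1 * Gp j) = (gi 1 * g 1) * Gp j" by (simp add: mult.assoc)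
  then show ?case using 0 gi_g[of 1] by simp
next
  case (Suc K)
  have "Gi (Suc (Suc K)) * (g 1 * Gp j) = gi (Suc (Suc K)) * (Gi (Suc K) * (g 1 * Gp j))"
    by (simp add: mult.assoc)
  also have "\<dots> = (gi (Suc (Suc K)) * Gp j) * Gi K" using Suc by (simp add: mult.assoc)
  also have "\<dots> = Gp j * Gi (Suc K)" using Suc.prems by (simp add: gi_Gp_low mult.assoc)
  finally show ?case .
qed

lemma X_Gp_split:
  assumes "1 \<le> j" "j < n"
  obtains R where "Gp j = g 1 * R" "X * R = R * X"
proof -
  have "\<exists>R. Gp j = g 1 * R \<and> X * R = R * X"
    using assms
  proof (induction j rule: nat_induct_at_least)
    case base
    then show ?case by (intro exI[of _ 1]) simp
  next
    case (Suc j)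
    then obtain R where R: "Gp j = g 1 * R" "X * R = R * X" by auto
    have "X * (R * g (Suc j)) = R * g (Suc j) * X"
      by (rule intertwine_mult) (use R Suc X_g[of "Suc j"] in simp_all)
    then show ?case by (intro exI[of _ "R * g (Suc j)"]) (simp add: R mult.assoc)
  qed
  then show ?thesis using that by blast
qed

text \<open>The element passes through the four factors of W in turn: it is \<open>c\<close> before
  the prefix, \<open>e\<close> in the middle, where it commutes with X and t_1, and
  \<open>c'\<close> after the suffix.\<close>

lemma W_pass:
  assumes "c * Gi J = Gi J * e" "e * X = X * e" "e * t 1 = t 1 * e" "e * Gp j = Gp j * c'" "1 \<le> n"
  shows "c * W j J a b = W j J a b * c'"
proof -
  have "Xp a * e = e * Xp a"
    by (rule zpow_intertwine) (use assms X_Xi Xi_X in simp_all)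
  moreover have "tp 1 b * e = e * tp 1 b"
    by (rule tp_intertwine) (use assms in simp)
  ultimately show ?thesis
    unfolding W_def
    by (intro intertwine_mult[OF assms(1)] intertwine_mult[of e "Xp a" e] intertwine_mult[of e "tp 1 b" e]
      assms(4)) simp_all
qed

lemma tp_W_top:
  assumes "J \<le> j" "j < n"
  shows "tp (Suc J) s * W j J a b = W j J a (b + s)"
proof -
  have "tp (Suc J) s * W j J a b = (tp (Suc J) s * Gi J) * (Xp a * (tp 1 b * Gp j))"
    by (simp add: W_def mult.assoc)
  also have "\<dots> = Gi J * ((tp 1 s * Xp a) * (tp 1 b * Gp j))"
    using assms by (simp add: tp_Gi_top mult.assoc)
  also have "\<dots> = Gi J * (Xp a * ((tp 1 s * tp 1 b) * Gp j))"
    using assms by (simp add: tp_Xp mult.assoc)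
  finally show ?thesis using assms tp_add[of 1 s b] by (simp add: W_def add.commute)
qed

lemma de_W:
  assumes "Suc J \<le> j" "j < n"
  shows "de (Suc J) (Suc (Suc J)) * W j J a b = DE (Suc J) (W j J a) b"
proof -
  note 1 = tp_W_top[of J j]
  have 2: "tp (Suc (Suc J)) s * W j J a b = W j J a b * tp (Suc J) s" for s b
    by (rule W_pass[where e = "tp (Suc (Suc J)) s"])
      (use assms in \<open>simp_all add: tp_Gi_far tp_X tp_t tp_Gp_low\<close>)
  show ?thesis
    by (simp add: de_def DE_def sum_distrib_left sum_distrib_right mult.assoc 2)
      (use assms in \<open>simp add: 1 flip: mult.assoc\<close>)
qed

lemma g_W:
  assumes i: "1 \<le> i" "i \<le> j" and J: "J \<le> j" "j < n"
  shows "g i * W j J a b = opg i (W j) J a b"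
proof -
  obtain i' where i': "i = Suc i'" using i by (cases i) auto
  consider "i < J" | "J = i" | "J = i'" | "J < i'" using i' by linarith
  then show ?thesis
  proof cases
    case 1
    have "g i * W j J a b = W j J a b * g i"
      by (rule W_pass[where e = "g (Suc i)"])
        (use 1 i J g_Gi_low[of i J] X_g[of "Suc i"] t_g_far[of "Suc i" 1] g_Gp_low[of i j] in simp_all)
    then show ?thesis using 1 by (simp add: op_simps)
  next
    case 2
    have "g i * W j J a b = (g i * gi i) * W j i' a b" by (simp add: W_def i' 2 mult.assoc)
    then show ?thesis using 2 i J i' g_gi[of i] by (simp add: op_simps)
  next
    case 3
    have "g i * W j J a b = gi i * W j J a b + de i (Suc i) * W j J a b"
      by (simp add: gi_def left_diff_distrib)
    then show ?thesis using 3 i' i J de_W[of J j a b] by (simp add: op_simps W_def mult.assoc)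
  next
    case 4
    have "g i * W j J a b = W j J a b * g i'"
      by (rule W_pass[where e = "g i"])
        (use 4 i' i J g_Gi_far[of J i] X_g[of "i"] t_g_far[of i 1] g_Gp_low[of i' j] in simp_all)
    then show ?thesis using 4 i' by (simp add: op_simps)
  qed
qed

lemma t_W:
  assumes i: "1 \<le> i" "i \<le> Suc j" and J: "J \<le> j" "j < n"
  shows "t i * W j J a b = opt i (W j) J a b"
proof -
  obtain i' where i': "i = Suc i'" using i by (cases i) auto
  consider "i \<le> J" | "J = i'" | "J < i'" using i' by linarith
  then show ?thesis
  proof cases
    case 1
    have "t i * W j J a b = W j J a b * t i"
      by (rule W_pass[where e = "t (Suc i)"])
        (use 1 i J t_Gi_low[of i J] tp_Gp_low[of i j 1] in \<open>simp_all add: t_X t_comm tp_1\<close>)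
    then show ?thesis using 1 by (simp add: op_simps)
  next
    case 2
    have "t i * W j J a b = (t (Suc J) * Gi J) * (Xp a * (tp 1 b * Gp j))"
      by (simp add: W_def i' 2 mult.assoc)
    also have "\<dots> = Gi J * ((t 1 * Xp a) * (tp 1 b * Gp j))"
      using J by (simp add: t_Gi_top mult.assoc)
    also have "\<dots> = Gi J * (Xp a * ((tp 1 1 * tp 1 b) * Gp j))"
      using J by (simp add: t_Xp tp_1 mult.assoc)
    finally show ?thesis using 2 i' J tp_add[of 1 1 b] by (simp add: W_def op_simps add.commute)
  next
    case 3
    have "t i * W j J a b = W j J a b * t i'"
      by (rule W_pass[where e = "t i"])
        (use 3 i i' J t_Gi_far[of J i] tp_Gp_low[of i' j 1] in \<open>simp_all add: t_X t_comm tp_1\<close>)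
    then show ?thesis using 3 i' by (simp add: op_simps)
  qed
qed

text \<open>X_1 fails to commute only with the last factor of \<open>Gi J\<close> and the first
  factor of \<open>Gp j\<close>. These two are isolated around X_1^a, where
  \<open>X_commutator\<close> applies.\<close>

lemma X_W:
  assumes J: "J \<le> j" "j < n"
  shows "X * W j J a b = opX (W j) J a b"
proof (cases J)
  case 0
  then show ?thesis using J zpow_Suc[OF X_Xi Xi_X, of a] by (simp add: op_simps W_def mult.assoc)
next
  case (Suc K)
  note One_nat_def [simp del]
  have n: "2 \<le> n" "1 \<le> n" using Suc J by simp_all
  obtain G' where G: "Gi J = G' * gi 1" "X * G' = G' * X" "\<And>s. tp 1 s * G' = G' * tp 1 s"
      "\<And>s. tp (Suc J) s * G' = G' * tp 2 s"
    using X_Gi_split[of J] Suc J by auto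
  obtain R where R: "Gp j = g 1 * R" "X * R = R * X"
    using X_Gp_split[of j] Suc J by auto
  have XR: "Xp a * R = R * Xp a" for a
    by (rule zpow_intertwine) (use R X_Xi Xi_X n in simp_all)
  have XG: "Xp a * G' = G' * Xp a" for a
    by (rule zpow_intertwine) (use G X_Xi Xi_X n in simp_all)
  have eG: "G' * de 1 2 = de 1 (Suc J) * G'"
    using de_intertwine[of 1 G' 1 "Suc J" 2] G(3,4) by simp
  have GGp: "G' * Gp j = Gp j * Gi K"
  proof -
    have "G' * Gp j = G' * (gi 1 * g 1) * Gp j" using gi_g[of 1] n by simp
    also have "\<dots> = Gi (Suc K) * (g 1 * Gp j)" using G(1) Suc by (simp add: mult.assoc)
    finally show ?thesis using Gi_Gp_shift[of K j] Suc J by simp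
  qed
  have tg: "tp 1 b * g 1 = g 1 * tp 2 b" using tp_g_1[of 1 b] n by (simp add: Suc_1)
  have DEW: "DE J (W j 0 c) b = de 1 (Suc J) * W j 0 c b" for c
  proof -
    have 1: "tp (Suc J) s * W j 0 c b = W j 0 c b * tp J s" for s b
      by (rule W_pass[where e = "tp (Suc J) s"])
        (use Suc J in \<open>simp_all add: tp_X tp_t tp_Gp_low\<close>)
    have 2: "tp 1 s * W j 0 c b = W j 0 c (b + s)" for s b
      using tp_W_top[of 0 j s c b] J by (simp add: One_nat_def)
    show ?thesis
      by (simp add: de_def DE_def sum_distrib_left sum_distrib_right mult.assoc 1)
        (simp add: 2 flip: mult.assoc)
  qed
  \<comment> \<open>\<open>G'\<close> turns \<open>de 1 2\<close> into \<open>de 1 (Suc J)\<close>,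
    then passes through the W with J = 0 and leaves the suffix \<open>Gp j\<close> as
    \<open>Gi K\<close>.\<close>
  have main: "de 1 (Suc J) * W j 0 c b * Gi K * v = G' * de 1 2 * Xp c * tp 1 b * Gp j * v" for c v
  proof -
    have "G' * de 1 2 * Xp c * tp 1 b * Gp j * v = de 1 (Suc J) * ((G' * Xp c) * tp 1 b * Gp j * v)"
      by (simp add: eG mult.assoc)
    also have "\<dots> = de 1 (Suc J) * (Xp c * (G' * tp 1 b) * Gp j * v)"
      by (simp add: assoc_swap[OF XG] mult.assoc)
    also have "\<dots> = de 1 (Suc J) * (Xp c * tp 1 b * (G' * Gp j) * v)"
      by (simp add: G(3)[symmetric] mult.assoc)
    finally show ?thesis by (simp add: GGp W_def mult.assoc)
  qed
  have "X * W j J a b = (X * G') * gi 1 * Xp a * (tp 1 b * g 1) * R"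
    by (simp add: W_def G(1) R(1) mult.assoc)
  also have "\<dots> = G' * (X * gi 1 * Xp a * g 1) * tp 2 b * R"
    by (simp add: G(2) tg mult.assoc)
  also have "\<dots> = G' * gi 1 * Xp a * g 1 * (X * tp 2 b) * R
      + G' * de 1 2 * X * g 1 * (Xp a * tp 2 b) * R - G' * de 1 2 * Xp (a + 1) * (g 1 * tp 2 b) * R"
    unfolding X_commutator[OF n(1)] by (simp add: distrib_left distrib_right left_diff_distrib right_diff_distrib mult.assoc)
  also have "G' * gi 1 * Xp a * g 1 * (X * tp 2 b) * R = G' * gi 1 * Xp a * (g 1 * tp 2 b) * (X * R)"
    using n assoc_swap[OF tp_X[of 2 b]] by (simp add: mult.assoc)
  also have "\<dots> = W j J a b * X"
    by (simp add: tg[symmetric] R W_def G(1) mult.assoc)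
  also have "G' * de 1 2 * X * g 1 * (Xp a * tp 2 b) * R = G' * de 1 2 * X * (g 1 * tp 2 b) * (Xp a * R)"
    using n assoc_swap[OF tp_Xp[of 2 b]] by (simp add: mult.assoc)
  also have "\<dots> = G' * de 1 2 * Xp 1 * tp 1 b * Gp j * Xp a"
    by (simp add: tg[symmetric] XR R(1) mult.assoc)
  also have "G' * de 1 2 * Xp (a + 1) * (g 1 * tp 2 b) * R = G' * de 1 2 * Xp (a + 1) * tp 1 b * Gp j * 1"
    by (simp add: tg[symmetric] R(1) mult.assoc)
  finally show ?thesis
    unfolding main[symmetric] DEW[symmetric] unfolding Suc opX_Suc by (simp add: add_diff_eq)
qed

lemma gen_W:
  assumes "x \<in> yh_gens (Suc j)" "J \<le> j" "j < n"
  shows "gen x * W j J a b = op x (W j) J a b"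
proof (cases x)
  \<comment> \<open>No separate computation for X_1^{-1}: \<open>opXi\<close> is inverse to
    \<open>opX\<close>, which acts on W as left multiplication by X.\<close>
  case GenXinv
  have "opXi (opX (W j)) J a b = op GenXinv (\<lambda>J a b. X * W j J a b) J a b"
    using op_cong[of GenXinv j J "opX (W j)" "\<lambda>J a b. X * W j J a b" a b] assms X_W by simp
  then have "X * opXi (W j) J a b = opXi (opX (W j)) J a b"
    by (simp only: op_lmult) simp
  also have "\<dots> = W j J a b" using opX_opXi(2)[of "W j" J a b] assms per_W by (simp add: perF_def)
  finally have "Xi * W j J a b = Xi * X * opXi (W j) J a b" by (simp add: mult.assoc)
  then show ?thesis using GenXinv Xi_X assms by simp
qed (use assms in \<open>auto simp: g_W t_W X_W\<close>)

lemma W_0: "j < n \<Longrightarrow> W j j 0 0 = 1"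
  by (simp add: W_def Gi_Gp)

lemma W_Suc: "W (Suc j) J a b = W j J a b * g (Suc j)"
  by (simp add: W_def mult.assoc)

lemma W_top: "W (Suc j) (Suc j) a b = gi (Suc j) * W j j a b * g (Suc j)"
  by (simp add: W_def mult.assoc)

end

subsection \<open>Induction over the free algebra and over the defining ideal\<close>

text \<open>Words grow by a letter on the left, which matches \<open>act_letter_mult\<close> and
  left multiplication of W by a generator.\<close>

lemma yh_free_induct [consumes 1, case_names zero add scal letter]:
  assumes f: "f \<in> carrier (yh_free m n)"
    and zero: "P 0"
    and add: "\<And>f h. f \<in> carrier (yh_free m n) \<Longrightarrow> h \<in> carrier (yh_free m n) \<Longrightarrow> P f \<Longrightarrow> P h \<Longrightarrow> P (f + h)"
    and scal: "\<And>c. c \<in> carrier (\<R> m) \<Longrightarrow> P (scal c)"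
    and letter: "\<And>x f. x \<in> yh_gens n \<Longrightarrow> f \<in> carrier (yh_free m n) \<Longrightarrow> P f \<Longrightarrow> P (letter x * f)"
  shows "P f"
proof -
  have word: "P (Poly_Mapping.single (Word xs) c) \<and> Poly_Mapping.single (Word xs) c \<in> carrier (yh_free m n)"
    if "set xs \<subseteq> yh_gens n" "c \<in> carrier (\<R> m)" for xs c
    using that(1)
  proof (induction xs)
    case Nil
    then show ?case using scal[OF that(2)] yh_free_scal[OF that(2)]
      by (simp add: scal_def zero_free_word_def)
  next
    case (Cons x xs)
    have "Poly_Mapping.single (Word (x # xs)) c = letter x * Poly_Mapping.single (Word xs) c"
      by (simp add: letter_def mult_single plus_free_word_def)
    then show ?case using Cons letter[of x] yh_free_mult[OF yh_free_letter] by simp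
  qed
  have "P (\<Sum>w\<in>A. Poly_Mapping.single w (Poly_Mapping.lookup f w)) \<and>
      (\<Sum>w\<in>A. Poly_Mapping.single w (Poly_Mapping.lookup f w)) \<in> carrier (yh_free m n)"
    if "finite A" "A \<subseteq> Poly_Mapping.keys f" for A
    using that
  proof (induction A)
    case (insert w A)
    then have "set (letters w) \<subseteq> yh_gens n" "Poly_Mapping.lookup f w \<in> carrier (\<R> m)"
      using f by (auto simp: carrier_yh_free_iff in_keys_iff)
    then have "P (Poly_Mapping.single w (Poly_Mapping.lookup f w)) \<and>
        Poly_Mapping.single w (Poly_Mapping.lookup f w) \<in> carrier (yh_free m n)"
      using word[of "letters w"] by simp
    then show ?case using insert by (auto intro: add yh_free_add)
  qed (simp add: zero)
  moreover have "f = (\<Sum>w\<in>Poly_Mapping.keys f. Poly_Mapping.single w (Poly_Mapping.lookup f w))"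
    by (rule poly_mapping_eqI) (auto simp: lookup_sum lookup_single when_def in_keys_iff)
  ultimately show ?thesis by (metis finite_keys order_refl)
qed

lemma yh_ideal_induct:
  assumes f: "f \<in> yh_ideal d m n"
    and sub: "A \<subseteq> carrier (yh_free m n)"
    and zero: "0 \<in> A"
    and diff: "\<And>f h. f \<in> A \<Longrightarrow> h \<in> A \<Longrightarrow> f - h \<in> A"
    and mult: "\<And>f h. f \<in> A \<Longrightarrow> h \<in> carrier (yh_free m n) \<Longrightarrow> h * f \<in> A"
      "\<And>f h. f \<in> A \<Longrightarrow> h \<in> carrier (yh_free m n) \<Longrightarrow> f * h \<in> A"
    and rel: "\<And>l r. yh_rel d m n l r \<Longrightarrow> l - r \<in> A"
  shows "f \<in> A"
proof -
  interpret R: ring "yh_free m n" by (rule ring_yh_free)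
  have neg: "- a \<in> A" if "a \<in> A" for a using diff[OF zero that] by simp
  have inv: "\<ominus>\<^bsub>yh_free m n\<^esub> a = - a" if "a \<in> A" for a
    using that sub by (intro R.minus_equality) (auto simp: yh_free_uminus)
  have "subgroup A (add_monoid (yh_free m n))"
  proof (rule group.subgroupI)
    show "group (add_monoid (yh_free m n))" by (rule R.a_group)
    fix a b assume a: "a \<in> A"
    show "inv\<^bsub>add_monoid (yh_free m n)\<^esub> a \<in> A"
      using inv[OF a] neg[OF a] by (simp add: a_inv_def)
    assume b: "b \<in> A"
    show "a \<otimes>\<^bsub>add_monoid (yh_free m n)\<^esub> b \<in> A"
      using diff[OF a neg[OF b]] by simp
  qed (use sub zero in auto)
  then have "ideal A (yh_free m n)"
    by (intro idealI ring_yh_free) (use mult in auto)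
  then have "yh_ideal d m n \<subseteq> A"
    unfolding yh_ideal_def using rel by (intro R.genideal_minimal) auto
  then show ?thesis using f by blast
qed

subsection \<open>Linear recurrences\<close>

text \<open>The operator (E - v_1) ... (E - v_k) for the shift E of sequences. On the powers of X it
  is multiplication by the cyclotomic polynomial; see \<open>shifts_zpow\<close>.\<close>

primrec shifts :: "'a::ring_1 list \<Rightarrow> (int \<Rightarrow> 'a) \<Rightarrow> int \<Rightarrow> 'a"
  where "shifts [] h = h"
  | "shifts (v # vs) h = (\<lambda>a. shifts vs h (a + 1) - v * shifts vs h a)"

lemma shifts_add: "shifts vs (\<lambda>a. h a + h' a) a = shifts vs h a + shifts vs h' a"
  by (induction vs arbitrary: a) (simp_all add: algebra_simps)

lemma shifts_diff: "shifts vs (\<lambda>a. h a - h' a) a = shifts vs h a - shifts vs h' a"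
  by (induction vs arbitrary: a) (simp_all add: right_diff_distrib)

lemma shifts_rmult: "shifts vs (\<lambda>a. h a * c) a = shifts vs h a * c"
  by (induction vs arbitrary: a) (simp_all add: algebra_simps)

lemma shifts_zero: "shifts vs (\<lambda>a. 0) a = 0"
  by (induction vs arbitrary: a) simp_all

lemma shifts_lmult:
  assumes "\<And>v. v \<in> set vs \<Longrightarrow> v * c = c * v"
  shows "shifts vs (\<lambda>a. c * h a) a = c * shifts vs h a"
  using assms
proof (induction vs arbitrary: a)
  case (Cons v vs)
  have "v * (c * w) = c * (v * w)" for w
    using Cons.prems[of v] by (simp flip: mult.assoc)
  then show ?case using Cons by (simp add: right_diff_distrib)
qed simp

lemma shifts_arg: "shifts vs (\<lambda>a. h (a + r)) a = shifts vs h (a + r)"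
  by (induction vs arbitrary: a) (simp_all add: algebra_simps)

lemma shifts_zpow:
  assumes "x * y = 1" "y * x = 1" "\<And>v. v \<in> set vs \<Longrightarrow> v * x = x * v"
  shows "shifts vs (zpow x y) a = prod_list (map (\<lambda>v. x - v) vs) * zpow x y a"
  using assms(3)
proof (induction vs arbitrary: a)
  case (Cons v vs)
  have "v * x = x * v" "\<And>u. u \<in> set vs \<Longrightarrow> u * x = x * u" using Cons.prems by simp_all
  then have "x * prod_list (map (\<lambda>v. x - v) vs) = prod_list (map (\<lambda>v. x - v) vs) * x"
  proof (induction vs)
    case (Cons v vs)
    have "x * ((x - v) * prod_list (map (\<lambda>v. x - v) vs)) = (x - v) * prod_list (map (\<lambda>v. x - v) vs) * x"
      by (rule intertwine_mult[of x _ x]) (use Cons in \<open>simp_all add: algebra_simps\<close>)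
    then show ?case by simp
  qed simp
  then have "prod_list (map (\<lambda>v. x - v) vs) * zpow x y (a + 1) = x * prod_list (map (\<lambda>v. x - v) vs) * zpow x y a"
    using zpow_Suc[OF assms(1,2), of a] by (simp add: mult.assoc)
  then show ?case using Cons by (simp add: algebra_simps)
qed simp

lemma (in yokonuma) shifts_DE:
  assumes "\<And>v. v \<in> set vs \<Longrightarrow> (\<And>c. v * c = c * v)"
  shows "shifts vs (\<lambda>a. DE j (H a) b) a = DE j (\<lambda>b. shifts vs (\<lambda>a. H a b) a) b"
  by (induction vs arbitrary: a) (simp_all add: DE_diff DE_lmult)

subsection \<open>The action of the free algebra on functionals\<close>

lemma scal_0: "scal 0 = (0 :: 'g free_alg)" and scal_1: "scal 1 = (1 :: 'g free_alg)"
  and scal_add: "scal (a + b) = scal a + (scal b :: 'g free_alg)"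
  and scal_mult: "scal (a * b) = scal a * (scal b :: 'g free_alg)"
  by (simp_all add: scal_def single_add mult_single)

text \<open>\<open>ev\<close> realises Y(d,m,n) in the ring. Additivity and multiplicativity are
  assumed on level n only, since the concrete map has a default value outside its domain.\<close>

locale yokonuma_algebra = yokonuma d n dl t g X Xi
  for d n and dl :: "'a::ring_1" and t g and X Xi +
  fixes m :: enat and ev :: "yh_gen free_alg \<Rightarrow> 'a"
  assumes ev_add: "f \<in> carrier (yh_free m n) \<Longrightarrow> h \<in> carrier (yh_free m n) \<Longrightarrow> ev (f + h) = ev f + ev h"
    and ev_mult: "f \<in> carrier (yh_free m n) \<Longrightarrow> h \<in> carrier (yh_free m n) \<Longrightarrow> ev (f * h) = ev f * ev h"
    and ev_1: "ev 1 = 1"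
    and ev_central: "c \<in> carrier (\<R> m) \<Longrightarrow> ev (scal c) * a = a * ev (scal c)"
    and ev_letter: "x \<in> yh_gens n \<Longrightarrow> ev (letter x) = gen x"
    and dl_eq: "dl = ev (scal (lvar IndQ 1 - lvar IndQ (-1))) * ev (scal (lconst (1 / of_nat d)))"
    and cyc: "m = enat k \<Longrightarrow> 1 \<le> n \<Longrightarrow>
      prod_list (map (\<lambda>v. X - v) (map (\<lambda>i. ev (scal (lvar (IndV i) 1))) [1..<Suc k])) = 0"
begin

abbreviation sc :: "laurent \<Rightarrow> 'a" where "sc c \<equiv> ev (scal c)"

definition vs :: "nat list \<Rightarrow> 'a list"
  where "vs is = map (\<lambda>i. sc (lvar (IndV i) 1)) is"

lemma ev_0: "ev 0 = 0"
  using ev_add[of 0 0] by simp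

lemma sc_add: "a \<in> carrier (\<R> m) \<Longrightarrow> b \<in> carrier (\<R> m) \<Longrightarrow> sc (a + b) = sc a + sc b"
  by (simp add: scal_add ev_add yh_free_scal)

lemma sc_mult: "a \<in> carrier (\<R> m) \<Longrightarrow> b \<in> carrier (\<R> m) \<Longrightarrow> sc (a * b) = sc a * sc b"
  by (simp add: scal_mult ev_mult yh_free_scal)

lemma sc_0: "sc 0 = 0" and sc_1: "sc 1 = 1"
  by (simp_all add: scal_0 ev_0 scal_1 ev_1)

text \<open>For m = \<infinity> every sequence qualifies, so that finite and infinite m run through
  the same argument.\<close>

definition rcr :: "(int \<Rightarrow> 'a) \<Rightarrow> bool"
  where "rcr h \<longleftrightarrow> (\<forall>k a. m = enat k \<longrightarrow> shifts (vs [1..<Suc k]) h a = 0)"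

lemma lvar_V: "m = enat k \<Longrightarrow> i \<in> set [1..<Suc k] \<Longrightarrow> lvar (IndV i) e \<in> carrier (\<R> m)"
  by (rule laurent_ring_lvar) (auto simp: indets_def)

lemma vs_central: "m = enat k \<Longrightarrow> v \<in> set (vs [1..<Suc k]) \<Longrightarrow> v * c = c * v"
  unfolding vs_def using ev_central lvar_V by (auto simp del: upt_Suc)

lemma rcr_zero: "rcr (\<lambda>a. 0)"
  by (simp add: rcr_def shifts_zero)

lemma rcr_add: "rcr h \<Longrightarrow> rcr h' \<Longrightarrow> rcr (\<lambda>a. h a + h' a)"
  and rcr_diff: "rcr h \<Longrightarrow> rcr h' \<Longrightarrow> rcr (\<lambda>a. h a - h' a)"
  and rcr_rmult: "rcr h \<Longrightarrow> rcr (\<lambda>a. h a * c)"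
  and rcr_arg: "rcr h \<Longrightarrow> rcr (\<lambda>a. h (a + r))"
  by (simp_all add: rcr_def shifts_add shifts_diff shifts_rmult shifts_arg)

lemma rcr_lmult: "rcr h \<Longrightarrow> rcr (\<lambda>a. c * h a)"
  unfolding rcr_def
proof (intro allI impI)
  fix k a assume "\<forall>k a. m = enat k \<longrightarrow> shifts (vs [1..<Suc k]) h a = 0" "m = enat k"
  then show "shifts (vs [1..<Suc k]) (\<lambda>a. c * h a) a = 0"
    using shifts_lmult[of "vs [1..<Suc k]" c h a, OF vs_central[of k]] by (simp del: upt_Suc)
qed

lemma rcr_Xp: "1 \<le> n \<Longrightarrow> rcr (zpow X Xi)"
  unfolding rcr_def
proof (intro allI impI)
  fix k a assume "1 \<le> n" "m = enat k"
  then have "shifts (vs [1..<Suc k]) Xp a = prod_list (map (\<lambda>v. X - v) (vs [1..<Suc k])) * Xp a"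
    by (intro shifts_zpow X_Xi Xi_X vs_central[of k])
  also have "prod_list (map (\<lambda>v. X - v) (vs [1..<Suc k])) = 0"
    unfolding vs_def by (rule cyc) fact+
  finally show "shifts (vs [1..<Suc k]) Xp a = 0" by simp
qed

lemma rcr_DE: "(\<And>b. rcr (\<lambda>a. H a b)) \<Longrightarrow> rcr (\<lambda>a. DE j (H a) b)"
  unfolding rcr_def
proof (intro allI impI)
  fix k a assume H: "\<And>b. \<forall>k a. m = enat k \<longrightarrow> shifts (vs [1..<Suc k]) (\<lambda>a. H a b) a = 0" and m: "m = enat k"
  have "shifts (vs [1..<Suc k]) (\<lambda>a. DE j (H a) b) a = DE j (\<lambda>b. shifts (vs [1..<Suc k]) (\<lambda>a. H a b) a) b"
    using vs_central[OF m] by (intro shifts_DE)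
  also have "\<dots> = DE j (\<lambda>b. 0) b" using H m by simp
  finally show "shifts (vs [1..<Suc k]) (\<lambda>a. DE j (H a) b) a = 0" by (simp add: DE_def)
qed

text \<open>These two conditions are what t_1^d = 1 and the cyclotomic relation force on the values
  of a functional at the elements W.\<close>

definition adm :: "'a fnl \<Rightarrow> bool"
  where "adm F \<longleftrightarrow> perF F \<and> (\<forall>J\<le>n. \<forall>b. rcr (\<lambda>a. F J a b))"

lemma adm_perF: "adm F \<Longrightarrow> perF F"
  by (simp add: adm_def)

lemma adm_op:
  assumes F: "adm F" and x: "x \<in> yh_gens (Suc n)"
  shows "adm (op x F)"
proof -
  have p: "perF (op x F)"
    using F x by (cases x) (auto simp: adm_def perF_opg perF_opt perF_opX perF_opXi)
  have r: "rcr (\<lambda>a. F J a b)" if "J \<le> n" for J b using F that by (simp add: adm_def)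
  have r0: "rcr (\<lambda>a. F 0 (a + 1) b)" "rcr (\<lambda>a. F 0 a b)" for b
    using rcr_arg[OF r[of 0 b], of 1] r[of 0 b] by simp_all
  have "rcr (\<lambda>a. op x F J a b)" if J: "J \<le> n" for J b
  proof (cases x)
    case (GenT j)
    then show ?thesis using J r
      by (cases "j \<le> J"; cases "j = Suc J") (simp_all add: opt_def rcr_rmult)
  next
    case (GenG i)
    then show ?thesis using J r x
      by (cases "i < J"; cases "i = J"; cases "i = Suc J") (auto simp: opg_def intro!: rcr_rmult rcr_add rcr_DE)
  next
    case GenX
    show ?thesis
    proof (cases J)
      case 0
      then show ?thesis using GenX r0 by (simp add: opX_def)
    next
      case (Suc K)
      have "rcr (\<lambda>a. (DE J (F 0 1) b * Gi K) * Xp a)"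
        using J Suc by (intro rcr_lmult rcr_Xp) simp
      then show ?thesis using GenX Suc J r r0
        by (simp add: opX_def) (intro rcr_add rcr_diff rcr_rmult rcr_DE; simp)
    qed
  next
    case GenXinv
    show ?thesis
    proof (cases J)
      case 0
      then show ?thesis using GenXinv rcr_arg[OF r[of 0 b], of "-1"] by (simp add: opXi_def)
    next
      case (Suc K)
      have "rcr (\<lambda>a. (DE J (F 0 0) b * Gi K) * Xp (a + - 1))"
        using J Suc by (intro rcr_lmult rcr_arg rcr_Xp) simp
      then show ?thesis using GenXinv Suc J r r0
        by (simp add: opXi_def) (intro rcr_add rcr_diff rcr_rmult rcr_DE; simp)
    qed
  qed
  then show ?thesis using p by (simp add: adm_def)
qed

lemma adm_cong: "adm F \<Longrightarrow> (\<And>J a b. J \<le> n \<Longrightarrow> F' J a b = F J a b) \<Longrightarrow> adm F'"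
  unfolding adm_def perF_def per_def by simp

lemma adm_zero: "adm (\<lambda>J a b. 0)"
  and adm_add: "adm F \<Longrightarrow> adm F' \<Longrightarrow> adm (\<lambda>J a b. F J a b + F' J a b)"
  and adm_lmult: "adm F \<Longrightarrow> adm (\<lambda>J a b. c * F J a b)"
  by (simp_all add: adm_def perF_def per_def rcr_zero rcr_add rcr_lmult)

text \<open>A right action: the first letter of a word acts first, so \<open>f * h\<close> applies
  \<open>f\<close> before \<open>h\<close>. The ring enters through the coefficients and the
  operators only, hence letters of level n + 1 may act although \<open>ev\<close> is controlled on
  level n.\<close>

definition act :: "yh_gen free_alg \<Rightarrow> 'a fnl \<Rightarrow> 'a fnl"
  where "act f F J a b = (\<Sum>w\<in>Poly_Mapping.keys f. sc (Poly_Mapping.lookup f w) * fold op (letters w) F J a b)"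

lemma act_superset:
  assumes "finite A" "Poly_Mapping.keys f \<subseteq> A"
  shows "act f F J a b = (\<Sum>w\<in>A. sc (Poly_Mapping.lookup f w) * fold op (letters w) F J a b)"
  unfolding act_def by (rule sum.mono_neutral_left) (use assms in \<open>auto simp: in_keys_iff sc_0\<close>)

lemma act_0: "act 0 F J a b = 0"
  by (simp add: act_def)

lemma act_add:
  assumes "f \<in> carrier (yh_free m k)" "h \<in> carrier (yh_free m k)"
  shows "act (f + h) F J a b = act f F J a b + act h F J a b"
proof -
  let ?A = "Poly_Mapping.keys f \<union> Poly_Mapping.keys h"
  have "act (f + h) F J a b = (\<Sum>w\<in>?A. sc (Poly_Mapping.lookup (f + h) w) * fold op (letters w) F J a b)"
    by (rule act_superset) (use Poly_Mapping.keys_add[of f h] in auto)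
  also have "\<dots> = (\<Sum>w\<in>?A. sc (Poly_Mapping.lookup f w) * fold op (letters w) F J a b) +
      (\<Sum>w\<in>?A. sc (Poly_Mapping.lookup h w) * fold op (letters w) F J a b)"
    using assms by (simp add: lookup_add sc_add carrier_yh_free_iff distrib_right sum.distrib)
  also have "\<dots> = act f F J a b + act h F J a b"
    by (simp add: act_superset[of ?A f] act_superset[of ?A h])
  finally show ?thesis .
qed

lemma act_uminus:
  assumes "f \<in> carrier (yh_free m k)"
  shows "act (- f) F J a b = - act f F J a b"
  using act_add[OF assms yh_free_uminus[OF assms], of F J a b] by (simp add: act_0 eq_neg_iff_add_eq_0 add.commute)

lemma act_diff:
  assumes "f \<in> carrier (yh_free m k)" "h \<in> carrier (yh_free m k)"
  shows "act (f - h) F J a b = act f F J a b - act h F J a b"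
  using act_add[OF assms(1) yh_free_uminus[OF assms(2)]] act_uminus[OF assms(2)] by simp

lemma act_single: "act (Poly_Mapping.single w c) F J a b = sc c * fold op (letters w) F J a b"
  using act_superset[of "{w}" "Poly_Mapping.single w c"] by simp

lemma act_sum:
  assumes "\<And>i. i \<in> I \<Longrightarrow> f i \<in> carrier (yh_free m k)"
  shows "act (sum f I) F J a b = (\<Sum>i\<in>I. act (f i) F J a b)"
  using assms
proof (induction I rule: infinite_finite_induct)
  case (insert i I)
  then show ?case using act_add[of "f i" k "sum f I"] yh_free_sum[of I f m k] by simp
qed (simp_all add: act_0)

lemma yh_free_single:
  assumes "f \<in> carrier (yh_free m k)" "w \<in> Poly_Mapping.keys f"
  shows "Poly_Mapping.single w (Poly_Mapping.lookup f w) \<in> carrier (yh_free m k)"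
  using assms by (auto simp: carrier_yh_free_iff lookup_single when_def in_keys_iff)

lemma poly_mapping_decomp:
  "f = (\<Sum>w\<in>Poly_Mapping.keys f. Poly_Mapping.single w (Poly_Mapping.lookup f w))"
  by (rule poly_mapping_eqI) (auto simp: lookup_sum lookup_single when_def in_keys_iff)

lemma act_scal_mult:
  assumes f: "f \<in> carrier (yh_free m k)" and c: "c \<in> carrier (\<R> m)"
  shows "act (scal c * f) F J a b = sc c * act f F J a b"
proof -
  have "scal c * f = (\<Sum>w\<in>Poly_Mapping.keys f. scal c * Poly_Mapping.single w (Poly_Mapping.lookup f w))"
    by (subst (1) poly_mapping_decomp[of f]) (simp add: sum_distrib_left)
  then have "act (scal c * f) F J a b =
      (\<Sum>w\<in>Poly_Mapping.keys f. act (scal c * Poly_Mapping.single w (Poly_Mapping.lookup f w)) F J a b)"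
    using yh_free_mult[OF yh_free_scal[OF c] yh_free_single[OF f]] by (simp add: act_sum[where k = k])
  also have "\<dots> = (\<Sum>w\<in>Poly_Mapping.keys f. sc c * (sc (Poly_Mapping.lookup f w) * fold op (letters w) F J a b))"
    using f c by (simp add: scal_def[of c] mult_single act_single sc_mult carrier_yh_free_iff mult.assoc)
  finally show ?thesis by (simp add: act_def sum_distrib_left)
qed

lemma act_letter_mult:
  assumes f: "f \<in> carrier (yh_free m k)" and x: "x \<in> yh_gens k"
  shows "act (letter x * f) F J a b = act f (op x F) J a b"
proof -
  have "letter x * f = (\<Sum>w\<in>Poly_Mapping.keys f. letter x * Poly_Mapping.single w (Poly_Mapping.lookup f w))"
    by (subst (1) poly_mapping_decomp[of f]) (simp add: sum_distrib_left)
  then have "act (letter x * f) F J a b =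
      (\<Sum>w\<in>Poly_Mapping.keys f. act (letter x * Poly_Mapping.single w (Poly_Mapping.lookup f w)) F J a b)"
    using yh_free_mult[OF yh_free_letter[OF x] yh_free_single[OF f]] by (simp add: act_sum[where k = k])
  also have "\<dots> = (\<Sum>w\<in>Poly_Mapping.keys f. sc (Poly_Mapping.lookup f w) * fold op (letters w) (op x F) J a b)"
    by (simp add: letter_def mult_single act_single plus_free_word_def)
  finally show ?thesis by (simp add: act_def)
qed

lemma act_scal: "act (scal c) F J a b = sc c * F J a b"
  by (simp add: scal_def act_single zero_free_word_def)

lemma act_1: "act 1 F = F"
  using act_scal[of 1 F] by (intro ext) (simp add: scal_1 sc_1 ev_1)

lemma act_letter: "x \<in> yh_gens k \<Longrightarrow> act (letter x) F = op x F"
  using act_letter_mult[of 1 k x F] by (intro ext) (simp add: act_1)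

lemma act_fadd:
  assumes "f \<in> carrier (yh_free m k)"
  shows "act f (\<lambda>J a b. F J a b + F' J a b) J a b = act f F J a b + act f F' J a b"
  using assms
proof (induction f arbitrary: F F' J a b rule: yh_free_induct)
  case (letter x f)
  have "op x (\<lambda>J a b. F J a b + F' J a b) = (\<lambda>J a b. op x F J a b + op x F' J a b)"
    by (intro ext) (rule op_add)
  then show ?case using letter by (simp add: act_letter_mult)
qed (simp_all add: act_0 act_add act_scal algebra_simps)

lemma act_flmult:
  assumes "f \<in> carrier (yh_free m k)"
  shows "act f (\<lambda>J a b. c * F J a b) J a b = c * act f F J a b"
  using assms
proof (induction f arbitrary: F J a b rule: yh_free_induct)
  case (letter x f)
  have "op x (\<lambda>J a b. c * F J a b) = (\<lambda>J a b. c * op x F J a b)"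
    by (intro ext) (rule op_lmult)
  then show ?case using letter by (simp add: act_letter_mult)
next
  case (scal c')
  then show ?case using ev_central[of c' c] by (simp add: act_scal flip: mult.assoc)
qed (simp_all add: act_0 act_add algebra_simps)

lemma act_fdiff:
  assumes "f \<in> carrier (yh_free m k)"
  shows "act f (\<lambda>J a b. F J a b - F' J a b) J a b = act f F J a b - act f F' J a b"
  using act_fadd[OF assms, of F "\<lambda>J a b. - 1 * F' J a b" J a b] act_flmult[OF assms, of "-1" F' J a b] by simp

lemma act_mult:
  assumes f: "f \<in> carrier (yh_free m k)" and h: "h \<in> carrier (yh_free m k)"
  shows "act (f * h) F = act h (act f F)"
  using f
proof (induction f arbitrary: F rule: yh_free_induct)
  case zero
  \<comment> \<open>The zero function is written as a left multiple by 0, to which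
    \<open>act_flmult\<close> applies.\<close>
  have "act h (\<lambda>J a b. 0 * 0) J a b = 0" for J a b
    by (subst act_flmult[OF h]) simp
  then show ?case by (intro ext) (simp add: act_0 act_0[of F, abs_def])
next
  case (add f f')
  have "act (f + f') F = (\<lambda>J a b. act f F J a b + act f' F J a b)"
    using add by (intro ext act_add)
  then show ?case using add h
    by (intro ext) (simp add: distrib_right act_add[OF yh_free_mult yh_free_mult] act_fadd[OF h])
next
  case (scal c)
  have "act (scal c) F = (\<lambda>J a b. sc c * F J a b)" by (intro ext act_scal)
  then show ?case using scal h by (intro ext) (simp add: act_scal_mult act_flmult)
next
  case (letter x f)
  have "act (letter x * f) F = act f (op x F)"
    using letter by (intro ext act_letter_mult)
  moreover have "act (letter x * (f * h)) F = act (f * h) (op x F)"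
    using letter yh_free_mult[OF _ h] by (intro ext act_letter_mult) auto
  ultimately show ?case using letter by (simp add: mult.assoc)
qed

lemma act_power:
  assumes "x \<in> yh_gens k"
  shows "act (letter x ^ s) F = (op x ^^ s) F"
proof (induction s arbitrary: F)
  case (Suc s)
  have "act (letter x ^ Suc s) F = act (letter x ^ s) (op x F)"
    using assms yh_free_power[OF yh_free_letter[of x k m], of s] by (intro ext) (simp add: act_letter_mult)
  then show ?case using Suc by (simp add: funpow_swap1)
qed (simp add: act_1)

lemma act_adm:
  assumes "f \<in> carrier (yh_free m (Suc n))" "adm F"
  shows "adm (act f F)"
  using assms
proof (induction f arbitrary: F rule: yh_free_induct)
  case zero
  show ?case by (rule adm_cong[OF adm_zero]) (simp add: act_0)
next
  case (add f h)
  show ?case by (rule adm_cong[OF adm_add[OF add(3,4)]]) (use add in \<open>simp_all add: act_add\<close>)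
next
  case (scal c)
  show ?case by (rule adm_cong[OF adm_lmult[OF scal(2)]]) (simp add: act_scal)
next
  case (letter x f)
  show ?case by (rule adm_cong[OF letter(3)[OF adm_op]]) (use letter in \<open>simp_all add: act_letter_mult\<close>)
qed

lemma act_cong:
  assumes "f \<in> carrier (yh_free m (Suc n))" "\<And>J a b. J \<le> n \<Longrightarrow> F J a b = F' J a b" "J \<le> n"
  shows "act f F J a b = act f F' J a b"
  using assms
proof (induction f arbitrary: F F' J a b rule: yh_free_induct)
  case (add f h)
  have "act f F J a b = act f F' J a b" "act h F J a b = act h F' J a b"
    by (rule add.IH; use add.prems in blast)+
  then show ?case using add.hyps by (simp add: act_add)
next
  case (letter x f)
  have "op x F J a b = op x F' J a b" if "J \<le> n" for J a b
    using letter that by (intro op_cong[of x n]) auto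
  then have "act f (op x F) J a b = act f (op x F') J a b"
    by (intro letter.IH letter.prems)
  then show ?case using letter.hyps by (simp add: act_letter_mult)
qed (simp_all add: act_0 act_scal)

end

section \<open>The defining ideal of level n + 1 acts as zero on admissible functions\<close>

context yokonuma_algebra
begin

abbreviation car :: "yh_gen free_alg set" where "car \<equiv> carrier (yh_free m (Suc n))"

lemma car_letter: "x \<in> yh_gens (Suc n) \<Longrightarrow> letter x \<in> car"
  by (rule yh_free_letter)

lemmas act_mult' = act_mult[where k = "Suc n"]
lemmas act_letter' = act_letter[where k = "Suc n"]

lemma op_diff: "op x (\<lambda>J a b. F J a b - F' J a b) J a b = op x F J a b - op x F' J a b"
  using op_add[of x F "\<lambda>J a b. - 1 * F' J a b" J a b] op_lmult[of x "-1" F' J a b] by simp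

lemma delta_in: "lvar IndQ 1 - lvar IndQ (-1) \<in> carrier (\<R> m)"
  by (intro laurent_ring_diff laurent_ring_lvar) (auto simp: indets_def)

lemma yh_e_in: "1 \<le> i \<Longrightarrow> i < k \<Longrightarrow> yh_e d i \<in> carrier (yh_free m k)"
  unfolding yh_e_def
  by (intro yh_free_mult yh_free_scal laurent_ring_lconst yh_free_sum yh_free_power yh_free_letter) auto

lemma act_e:
  assumes "1 \<le> i" "i \<le> n"
  shows "act (scal (lvar IndQ 1 - lvar IndQ (-1)) * yh_e d i) F = ope i F"
proof (intro ext)
  fix J a b
  have l: "letter (GenT i) ^ s * letter (GenT (Suc i)) ^ r \<in> car" for s r
    using assms by (intro yh_free_mult yh_free_power car_letter) auto
  have "act (letter (GenT i) ^ s * letter (GenT (Suc i)) ^ r) F = (opt (Suc i) ^^ r) ((opt i ^^ s) F)" for s r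
    using assms yh_free_power[OF car_letter, of "GenT i" s] yh_free_power[OF car_letter, of "GenT (Suc i)" r]
    by (simp add: act_mult' act_power[where k = "Suc n"])
  then have "act (\<Sum>s<d. letter (GenT i) ^ s * letter (GenT (Suc i)) ^ (d - s)) F J a b =
      (\<Sum>s<d. (opt (Suc i) ^^ (d - s)) ((opt i ^^ s) F) J a b)"
    using l by (simp add: act_sum[where k = "Suc n"])
  moreover have dlw: "sc (lvar IndQ 1 - lvar IndQ (-1)) * (sc (lconst (1 / of_nat d)) * w) = dl * w" for w
    using dl_eq by (simp add: mult.assoc)
  have "act (scal (lvar IndQ 1 - lvar IndQ (-1)) * yh_e d i) F J a b =
      dl * act (\<Sum>s<d. letter (GenT i) ^ s * letter (GenT (Suc i)) ^ (d - s)) F J a b"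
    unfolding yh_e_def dlw[symmetric]
    using yh_free_sum[of "{..<d}" "\<lambda>s. letter (GenT i) ^ s * letter (GenT (Suc i)) ^ (d - s)" m "Suc n"] l
    by (simp add: act_scal_mult[where k = "Suc n"] yh_free_mult yh_free_scal laurent_ring_lconst delta_in)
  ultimately show "act (scal (lvar IndQ 1 - lvar IndQ (-1)) * yh_e d i) F J a b = ope i F J a b"
    by (simp add: ope_def)
qed

definition gi_rep :: "nat \<Rightarrow> yh_gen free_alg"
  where "gi_rep i = letter (GenG i) - scal (lvar IndQ 1 - lvar IndQ (-1)) * yh_e d i"

lemma gi_rep_in: "1 \<le> i \<Longrightarrow> i < k \<Longrightarrow> gi_rep i \<in> carrier (yh_free m k)"
  unfolding gi_rep_def by (intro yh_free_diff yh_free_mult yh_free_letter yh_free_scal delta_in yh_e_in) auto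

lemma act_gi_rep:
  assumes "1 \<le> i" "i \<le> n"
  shows "act (gi_rep i) F = opgi i F"
proof (intro ext)
  fix J a b
  have "letter (GenG i) \<in> car" "scal (lvar IndQ 1 - lvar IndQ (-1)) * yh_e d i \<in> car"
    using assms by (auto intro!: car_letter yh_free_mult yh_free_scal delta_in yh_e_in)
  then show "act (gi_rep i) F J a b = opgi i F J a b"
    using assms by (simp add: gi_rep_def act_diff[where k = "Suc n"] act_e act_letter' opgi_def)
qed

lemma adm_opgi: "adm F \<Longrightarrow> 1 \<le> i \<Longrightarrow> i \<le> n \<Longrightarrow> adm (opgi i F)"
  using act_adm[OF gi_rep_in[of i "Suc n"], of F] act_gi_rep[of i F] by simp

lemma opg_opgi:
  assumes "adm F" "1 \<le> i" "i \<le> n" "J \<le> n"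
  shows "opg i (opgi i F) J a b = F J a b"
  using op_diff[of "GenG i" "opg i F" "ope i F" J a b] opg_square[of F i J a b] assms
  by (simp add: opgi_def[abs_def] adm_perF)

definition Xpoly :: "nat list \<Rightarrow> yh_gen free_alg"
  where "Xpoly is = prod_list (map (\<lambda>i. letter GenX - scal (lvar (IndV i) 1)) is)"

context
  fixes k assumes m: "m = enat k"
begin

lemma lvar_in: "i \<in> {1..<Suc k} \<Longrightarrow> lvar (IndV i) e \<in> carrier (\<R> m)"
  by (rule lvar_V[OF m]) (simp del: upt_Suc)

lemma Xpoly_factor_in: "i \<in> {1..<Suc k} \<Longrightarrow> letter GenX - scal (lvar (IndV i) 1) \<in> car"
  using lvar_in by (intro yh_free_diff car_letter yh_free_scal) auto

lemma Xpoly_in: "set is \<subseteq> {1..<Suc k} \<Longrightarrow> Xpoly is \<in> car"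
  unfolding Xpoly_def by (intro yh_free_prod_list) (use Xpoly_factor_in in auto)

lemma Xpoly_Cons:
  assumes "set (i # is) \<subseteq> {1..<Suc k}"
  shows "act (Xpoly (i # is)) F = act (Xpoly is) (\<lambda>J a b. opX F J a b - sc (lvar (IndV i) 1) * F J a b)"
proof -
  have c: "letter GenX \<in> car" "scal (lvar (IndV i) 1) \<in> car"
    using lvar_in[of i] assms by (auto intro!: car_letter yh_free_scal)
  have "act (letter GenX - scal (lvar (IndV i) 1)) F = (\<lambda>J a b. opX F J a b - sc (lvar (IndV i) 1) * F J a b)"
    by (intro ext) (simp add: act_diff[OF c] act_letter' act_scal)
  moreover have "Xpoly (i # is) = (letter GenX - scal (lvar (IndV i) 1)) * Xpoly is"
    by (simp add: Xpoly_def)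
  ultimately show ?thesis
    using act_mult'[OF Xpoly_factor_in[of i] Xpoly_in[of "is"]] assms by simp
qed

lemma adm_factor: "adm F \<Longrightarrow> i \<in> {1..<Suc k} \<Longrightarrow> adm (\<lambda>J a b. opX F J a b - sc (lvar (IndV i) 1) * F J a b)"
  using Xpoly_Cons[of i "[]" F] act_adm[OF Xpoly_in[of "[i]"], of F] by (simp add: Xpoly_def act_1)

text \<open>At J = 0 the operator of X_1 is the shift of a, so the cyclotomic polynomial acts as the
  recurrence operator.\<close>

lemma Xpoly_0:
  "set is \<subseteq> {1..<Suc k} \<Longrightarrow> act (Xpoly is) F 0 a b = shifts (vs is) (\<lambda>a. F 0 a b) a"
proof (induction "is" arbitrary: F)
  case (Cons i "is")
  have "sc (lvar (IndV i) 1) * c = c * sc (lvar (IndV i) 1)" for c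
    using ev_central lvar_in[of i] Cons.prems by simp
  then have "shifts (vs is) (\<lambda>a. sc (lvar (IndV i) 1) * F 0 a b) a = sc (lvar (IndV i) 1) * shifts (vs is) (\<lambda>a. F 0 a b) a"
    by (intro shifts_lmult) simp
  then show ?case
    using Cons by (simp add: Xpoly_Cons shifts_diff opX_0 shifts_arg[of _ "\<lambda>a. F 0 a b"] vs_def)
qed (simp add: Xpoly_def act_1 vs_def)

lemma Xpoly_1:
  "set is \<subseteq> {1..<Suc k} \<Longrightarrow> act (Xpoly is) F 1 0 b = F 1 0 b * prod_list (map (\<lambda>v. X - v) (vs is))"
proof (induction "is" arbitrary: F)
  case (Cons i "is")
  have "sc (lvar (IndV i) 1) * c = c * sc (lvar (IndV i) 1)" for c
    using ev_central lvar_in[of i] Cons.prems by simp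
  \<comment> \<open>At a = 0 the two correction terms of \<open>opX\<close> coincide and cancel, so
    X_1 acts by right multiplication.\<close>
  then have "opX F 1 0 b - sc (lvar (IndV i) 1) * F 1 0 b = F 1 0 b * (X - sc (lvar (IndV i) 1))"
    using opX_Suc[of F 0 0] by (simp add: right_diff_distrib)
  then show ?case
    using Cons by (simp add: Xpoly_Cons vs_def mult.assoc)
qed (simp add: Xpoly_def act_1 vs_def)

lemma Xpoly_commute:
  assumes z: "z \<in> car"
    and comm: "\<And>F J a b. adm F \<Longrightarrow> J \<le> n \<Longrightarrow> opX (act z F) J a b = act z (opX F) J a b"
  shows "set is \<subseteq> {1..<Suc k} \<Longrightarrow> adm F \<Longrightarrow> J \<le> n \<Longrightarrow>
    act (Xpoly is) (act z F) J a b = act z (act (Xpoly is) F) J a b"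
proof (induction "is" arbitrary: F)
  case (Cons i "is")
  let ?v = "sc (lvar (IndV i) 1)"
  let ?H = "\<lambda>J a b. opX F J a b - ?v * F J a b"
  have "opX (act z F) J a b - ?v * act z F J a b = act z ?H J a b" if "J \<le> n" for J a b
    using comm[OF Cons.prems(2) that]
    by (simp add: act_fdiff[OF z, of "opX F" "\<lambda>J a b. ?v * F J a b"] act_flmult[OF z])
  then have "act (Xpoly is) (\<lambda>J a b. opX (act z F) J a b - ?v * act z F J a b) J a b =
      act (Xpoly is) (act z ?H) J a b"
    using Cons.prems by (intro act_cong[OF Xpoly_in]) auto
  also have "\<dots> = act z (act (Xpoly is) ?H) J a b"
    using Cons.prems by (intro Cons.IH adm_factor) auto
  finally show ?case using Cons.prems by (simp add: Xpoly_Cons)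
qed (simp add: Xpoly_def act_1)

lemma Xpoly_all_0: "adm F \<Longrightarrow> act (Xpoly [1..<Suc k]) F 0 a b = 0"
proof -
  assume "adm F"
  then have "rcr (\<lambda>a. F 0 a b)" by (simp add: adm_def)
  then have "shifts (vs [1..<Suc k]) (\<lambda>a. F 0 a b) a = 0" using m unfolding rcr_def by blast
  then show ?thesis using Xpoly_0[of "[1..<Suc k]" F a b] by (simp del: upt_Suc)
qed

text \<open>
  \<open>X\<close> commutes with \<open>Z = g_1 X g_1\<close>, and \<open>Z W_{1,a,b} = W_{1,a+1,b}\<close> up to a combination of the
  \<open>W_{0,a+1,*}\<close>; hence it suffices to treat \<open>a = 0\<close>, where \<open>X\<close> commutes with \<open>W_{1,0,b}\<close>.
\<close>

lemma Xpoly_all_1: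
  assumes n: "1 \<le> n"
  shows "adm F \<Longrightarrow> act (Xpoly [1..<Suc k]) F 1 a b = 0"
proof -
  note One_nat_def [simp del] upt_Suc [simp del]
  let ?p = "Xpoly [1..<Suc k]"
  define Z where "Z = (\<lambda>F. opg 1 (opX (opg 1 F)))"
  define z where "z = letter (GenG 1) * (letter GenX * letter (GenG 1))"
  have lg: "letter (GenG 1) \<in> car" "letter GenX \<in> car" using n by (auto intro: car_letter)
  have z: "z \<in> car" unfolding z_def using lg by (intro yh_free_mult)
  have actz: "act z F = Z F" for F
    using n lg by (simp add: z_def Z_def act_mult' yh_free_mult act_letter')
  have pin: "?p \<in> car" by (rule Xpoly_in) simp
  have ZF: "adm (Z F)" if "adm F" for F
    using act_adm[OF z that] actz by simp
  have "opX (act z F) J a b = act z (opX F) J a b" if "adm F" "J \<le> n" for F J a b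
    unfolding actz Z_def using opX_braid[OF adm_perF[OF that(1)] n that(2)] by simp
  then have comm: "act ?p (Z F) J a b = Z (act ?p F) J a b" if "adm F" "J \<le> n" for F J a b
    using Xpoly_commute[OF z _ _ that, of "[1..<Suc k]"] by (simp add: actz)
  have Z1: "Z G 1 a b = G 1 (a + 1) b + DE 1 (G 0 (a + 1)) b" for G a b
    using opg_at[of 0 "opX (opg 1 G)" a] opg_up[of 0 G "a + 1"] unfolding Z_def One_nat_def[symmetric] by (simp add: opX_0)
  \<comment> \<open>The \<open>DE\<close> term in \<open>Z1\<close> involves values at J = 0 only,
    where the polynomial is already known to give 0.\<close>
  have step: "act ?p F 1 (a + 1) b = act ?p (Z F) 1 a b" if "adm F" for F a b
  proof -
    have "act ?p F 0 (a + 1) = (\<lambda>b. 0)" using Xpoly_all_0[OF that] by (intro ext)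
    then show ?thesis using comm[OF that n, of a b] Z1[of "act ?p F" a b] by (simp add: DE_def)
  qed
  have zero: "act ?p F 1 0 b = 0" for F
    using Xpoly_1[of "[1..<Suc k]" F b] cyc[OF m n] by (simp add: vs_def)
  show "act ?p F 1 a b = 0" if "adm F"
    using that
  proof (induction a arbitrary: F rule: int_induct[where k = 0])
    case base
    show ?case by (rule zero)
  next
    case (step1 i)
    then show ?case using step ZF by simp
  next
    case (step2 i)
    \<comment> \<open>A preimage of F under \<open>Z\<close>; it allows the step from a to a -
      1.\<close>
    define F' where "F' = opgi 1 (opXi (opgi 1 F))"
    have a1: "adm (opgi 1 F)" using step2 n by (intro adm_opgi) auto
    have a2: "adm (opXi (opgi 1 F))" using adm_op[OF a1, of GenXinv] by simp
    have aF': "adm F'" unfolding F'_def using a2 n by (intro adm_opgi) auto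
    have "Z F' J a b = F J a b" if J: "J \<le> n" for J a b
    proof -
      have 1: "opg 1 F' J a b = opXi (opgi 1 F) J a b" if "J \<le> n" for J a b
        unfolding F'_def using opg_opgi[OF a2 _ n that] by simp
      have 2: "opX (opg 1 F') J a b = opgi 1 F J a b" if "J \<le> n" for J a b
        using op_cong[of GenX n J "opg 1 F'" "opXi (opgi 1 F)" a b] 1 that
          opX_opXi(1)[OF adm_perF[OF a1] that, of a b] by simp
      show ?thesis
        unfolding Z_def
        using op_cong[of "GenG 1" n J "opX (opg 1 F')" "opgi 1 F" a b] 2 J n opg_opgi[OF step2(3) _ n J, of a b]
        by simp
    qed
    then have "act ?p F 1 (i - 1) b = act ?p (Z F') 1 (i - 1) b"
      using n by (intro act_cong[OF pin]) auto
    also have "\<dots> = act ?p F' 1 i b" using step[OF aF', of "i - 1" b] by simp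
    finally show ?case using step2 aF' by simp
  qed
qed

lemma Xpoly_all:
  assumes "J \<le> n" "adm F"
  shows "act (Xpoly [1..<Suc k]) F J a b = 0"
  using assms
proof (induction J arbitrary: F a b)
  case 0
  then show ?case using Xpoly_all_0 by blast
next
  case (Suc J)
  let ?p = "Xpoly [1..<Suc k]"
  show ?case
  proof (cases J)
    case 0
    then show ?thesis using Xpoly_all_1[of F a b] Suc by simp
  next
    case J: (Suc K)
    let ?g = "letter (GenG (Suc J))"
    have lg: "?g \<in> car" using Suc by (intro car_letter) simp
    have actg: "act ?g F = opg (Suc J) F" for F
      using Suc by (simp add: act_letter')
    have aF: "adm (opgi (Suc J) F)" using Suc by (intro adm_opgi) auto
    have "act ?p F (Suc J) a b = act ?p (act ?g (opgi (Suc J) F)) (Suc J) a b"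
      using Suc.prems opg_opgi[of F "Suc J"] by (intro act_cong[OF Xpoly_in]) (auto simp: actg simp del: upt_Suc)
    also have "\<dots> = act ?g (act ?p (opgi (Suc J) F)) (Suc J) a b"
    proof (rule Xpoly_commute[OF lg])
      fix F J' a b assume "adm F" "J' \<le> n"
      then show "opX (act ?g F) J' a b = act ?g (opX F) J' a b"
        unfolding actg using Suc.prems J opX_opg[of F "Suc J" J' a b] by (simp add: adm_perF)
    qed (use Suc.prems aF in auto)
    also have "\<dots> = act ?p (opgi (Suc J) F) J a b"
      unfolding actg by (simp add: opg_at)
    also have "\<dots> = 0" using Suc aF by (simp del: upt_Suc)
    finally show ?thesis .
  qed
qed

end

lemma act_rel:
  assumes "yh_rel d m (Suc n) l r" "adm F" "J \<le> n"
  shows "act l F J a b = act r F J a b"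
  using assms(1)
proof cases
  case (far_comm i j)
  then consider "Suc i < j" | "Suc j < i" by linarith
  then show ?thesis
    using far_comm opg_far[of i j J F a b] opg_far[of j i J F a b] assms
    by cases (auto simp: act_mult' car_letter act_letter')
next
  case (braid i)
  then show ?thesis using opg_braid[of F i J a b] assms
    by (simp add: act_mult' car_letter act_letter' yh_free_mult adm_perF)
next
  case (t_comm i j)
  then show ?thesis using opt_comm[of i j J F a b] assms
    by (simp add: act_mult' car_letter act_letter')
next
  case (t_g i j)
  then have "transpose i (Suc i) j \<in> {1..Suc n}" by (auto simp: transpose_def)
  then show ?thesis using t_g opt_opg[of F i j J a b] assms
    by (simp add: act_mult' car_letter act_letter' adm_perF)
next
  case (t_order j)
  then show ?thesis using opt_order[of F j J a b] assms
    by (simp add: act_power[where k = "Suc n"] act_1 adm_perF)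
next
  case (quadratic i)
  let ?e = "scal (lvar IndQ 1 - lvar IndQ (-1)) * yh_e d i"
  have e: "?e \<in> car" using quadratic by (intro yh_free_mult yh_free_scal delta_in yh_e_in) auto
  have g: "letter (GenG i) \<in> car" using quadratic by (intro car_letter) auto
  have "act (?e * letter (GenG i)) F = opg i (ope i F)"
    using quadratic by (simp add: act_mult'[OF e g] act_e act_letter')
  then show ?thesis
    using quadratic opg_square[of F i J a b] assms act_add[OF yh_free_1 yh_free_mult[OF e g], of F J a b]
    by (simp add: act_mult'[OF g g] act_letter' act_1 adm_perF power2_eq_square)
next
  case X_inv_r
  then show ?thesis using opX_opXi[of F J a b] assms
    by (simp add: act_mult' car_letter act_letter' act_1 adm_perF)
next
  case X_inv_l
  then show ?thesis using opX_opXi[of F J a b] assms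
    by (simp add: act_mult' car_letter act_letter' act_1 adm_perF)
next
  case X_braid
  then show ?thesis using opX_braid[of F J a b] assms
    by (simp add: act_mult' car_letter act_letter' yh_free_mult adm_perF)
next
  case (X_g i)
  then show ?thesis using opX_opg[of F i J a b] assms
    by (simp add: act_mult' car_letter act_letter' adm_perF)
next
  case (X_t j)
  then show ?thesis using opX_opt[of F j J a b] assms
    by (simp add: act_mult' car_letter act_letter' adm_perF)
next
  case (cyclotomic k)
  then show ?thesis using Xpoly_all[of k J F a b] assms by (simp add: act_0 Xpoly_def del: upt_Suc)
qed

lemma act_ideal:
  assumes "f \<in> yh_ideal d m (Suc n)" "adm F" "J \<le> n"
  shows "act f F J a b = 0"
proof -
  let ?A = "{f \<in> car. \<forall>F J a b. adm F \<longrightarrow> J \<le> n \<longrightarrow> act f F J a b = 0}"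
  have "f \<in> ?A"
    using assms(1)
  proof (rule yh_ideal_induct)
    show "0 \<in> ?A" by (simp add: act_0)
  next
    fix f h assume "f \<in> ?A" "h \<in> ?A"
    then show "f - h \<in> ?A" by (auto simp: act_diff[where k = "Suc n"] intro: yh_free_diff)
  next
    fix f h assume f: "f \<in> ?A" and h: "h \<in> car"
    then show "h * f \<in> ?A" by (auto simp: act_mult' intro: yh_free_mult act_adm)
    have "act (f * h) F J a b = 0" if "adm F" "J \<le> n" for F J a b
    proof -
      have "act (f * h) F J a b = act h (\<lambda>J a b. 0 * 0) J a b"
        using f that by (simp add: act_mult'[OF _ h] act_cong[OF h, of "act f F" "\<lambda>J a b. 0"])
      also have "\<dots> = 0" by (subst act_flmult[OF h]) simp
      finally show ?thesis .
    qed
    then show "f * h \<in> ?A" using f h by (auto intro: yh_free_mult)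
  next
    fix l r assume "yh_rel d m (Suc n) l r"
    then show "l - r \<in> ?A"
      using yh_rel_closed[of d m "Suc n" l r] act_rel by (auto simp: act_diff[where k = "Suc n"] intro: yh_free_diff)
  qed auto
  then show ?thesis using assms by blast
qed

text \<open>The index (n,0,0) belongs to W = 1. Through it the generators of Y(d,m,n) pass to the
  right unchanged, the corrections of X_1 cancelling at a = 0; this is right linearity of a
  functional.\<close>

lemma op_top:
  assumes "x \<in> yh_gens n"
  shows "op x F n 0 0 = F n 0 0 * gen x"
proof -
  have "1 \<le> n" using assms by (auto simp: yh_gens_def split: if_splits)
  then obtain K where K: "n = Suc K" by (cases n) auto
  show ?thesis using assms K
    by (cases x) (auto simp: opg_lt opt_le opX_Suc opXi_Suc)
qed

lemma act_top:
  assumes "h \<in> carrier (yh_free m n)"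
  shows "act h F n 0 0 = F n 0 0 * ev h"
  using assms
proof (induction h arbitrary: F rule: yh_free_induct)
  case (letter x h)
  then show ?case
    using act_letter_mult[OF letter(2,1), of F n 0 0] ev_mult[OF yh_free_letter[OF letter(1)] letter(2)]
    by (simp add: op_top ev_letter mult.assoc)
qed (simp_all add: act_0 ev_0 act_add ev_add act_scal ev_central algebra_simps)

end

subsection \<open>The augmentation\<close>

definition tot :: "('a \<Rightarrow>\<^sub>0 'b::comm_monoid_add) \<Rightarrow> 'b"
  where "tot f = (\<Sum>k\<in>Poly_Mapping.keys f. Poly_Mapping.lookup f k)"

lemma tot_superset: "finite A \<Longrightarrow> Poly_Mapping.keys f \<subseteq> A \<Longrightarrow> tot f = (\<Sum>k\<in>A. Poly_Mapping.lookup f k)"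
  unfolding tot_def by (rule sum.mono_neutral_left) (auto simp: in_keys_iff)

lemma tot_add: "tot (f + h) = tot f + tot h"
proof -
  let ?A = "Poly_Mapping.keys f \<union> Poly_Mapping.keys h"
  have "tot (f + h) = (\<Sum>k\<in>?A. Poly_Mapping.lookup (f + h) k)"
    by (rule tot_superset) (use Poly_Mapping.keys_add[of f h] in auto)
  then show ?thesis
    by (simp add: lookup_add sum.distrib tot_superset[of ?A f] tot_superset[of ?A h])
qed

lemma tot_single [simp]: "tot (Poly_Mapping.single k c) = c"
  using tot_superset[of "{k}" "Poly_Mapping.single k c"] by simp

lemma tot_0 [simp]: "tot 0 = 0"
  by (simp add: tot_def)

lemma tot_sum: "tot (sum f A) = (\<Sum>i\<in>A. tot (f i))"
  by (induction A rule: infinite_finite_induct) (simp_all add: tot_add)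

lemma poly_mapping_sum_single:
  "f = (\<Sum>k\<in>Poly_Mapping.keys f. Poly_Mapping.single k (Poly_Mapping.lookup f k))"
  by (rule poly_mapping_eqI) (auto simp: lookup_sum lookup_single when_def in_keys_iff)

lemma tot_mult: "tot (f * h) = tot f * tot (h :: 'a::monoid_add \<Rightarrow>\<^sub>0 'b::semiring_0)"
proof -
  have "f * h = (\<Sum>a\<in>Poly_Mapping.keys f. \<Sum>b\<in>Poly_Mapping.keys h.
      Poly_Mapping.single (a + b) (Poly_Mapping.lookup f a * Poly_Mapping.lookup h b))"
    by (subst (1) poly_mapping_sum_single[of f], subst (1) poly_mapping_sum_single[of h])
      (simp add: sum_product mult_single)
  then show ?thesis by (simp add: tot_sum sum_product tot_def[of f] tot_def[of h])
qed

definition aug :: "'g free_alg \<Rightarrow> complex"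
  where "aug f = tot (tot f)"

lemma tot_one: "tot (1 :: 'a::monoid_add \<Rightarrow>\<^sub>0 'b::semiring_1) = 1"
  by (simp flip: single_one)

lemma aug_simps [simp]:
  "aug 0 = 0" "aug 1 = 1" "aug (f + h) = aug f + aug h" "aug (f * h) = aug f * aug h"
  "aug (letter x) = 1" "aug (scal c) = tot c"
  by (simp_all add: aug_def tot_add tot_mult letter_def scal_def tot_one)

lemma aug_diff [simp]: "aug (f - h) = aug f - aug h"
  using aug_simps(3)[of "f - h" h] by (simp del: aug_simps)

lemma aug_sum [simp]: "aug (sum f A) = (\<Sum>i\<in>A. aug (f i))"
  by (induction A rule: infinite_finite_induct) simp_all

lemma aug_power [simp]: "aug (f ^ k) = aug f ^ k"
  by (induction k) simp_all

lemma tot_lvar [simp]: "tot (lvar i e) = 1" and tot_lconst [simp]: "tot (lconst c) = c"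
  by (simp_all add: lvar_def lconst_def)

lemma tot_diff: "tot (f - h) = tot f - tot (h :: 'a \<Rightarrow>\<^sub>0 'b::ab_group_add)"
  using tot_add[of "f - h" h] by simp

text \<open>Setting all variables to 1 kills q - q^{-1} and every factor X_1 - v_i; as m > 0, the
  cyclotomic product has at least one such factor.\<close>

lemma aug_rel:
  assumes "yh_rel d m n l r" "0 < d" "0 < m"
  shows "aug l = aug r"
  using assms(1)
proof cases
  case (quadratic i)
  then show ?thesis using assms by (simp add: tot_diff)
next
  case (cyclotomic k)
  have "aug (prod_list (map (\<lambda>i. letter GenX - scal (lvar (IndV i) 1)) is)) = 0" if "is \<noteq> []" for "is"
    using that by (cases "is") auto
  moreover have "[1..<Suc k] \<noteq> []" using cyclotomic assms by (cases k) (auto simp: zero_enat_def)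
  ultimately show ?thesis using cyclotomic by simp
qed simp_all

lemma yh_ideal_sub: "yh_ideal d m n \<subseteq> carrier (yh_free m n)"
  using ideal.Icarr[OF ideal_yh_ideal] by blast

lemma yh_ideal_0: "0 \<in> yh_ideal d m n"
  using additive_subgroup.zero_closed[OF ideal.axioms(1)[OF ideal_yh_ideal]] by simp

lemma yh_ideal_add: "f \<in> yh_ideal d m n \<Longrightarrow> h \<in> yh_ideal d m n \<Longrightarrow> f + h \<in> yh_ideal d m n"
  using additive_subgroup.a_closed[OF ideal.axioms(1)[OF ideal_yh_ideal], of f d m n h] by simp

lemma yh_ideal_lmult: "f \<in> yh_ideal d m n \<Longrightarrow> h \<in> carrier (yh_free m n) \<Longrightarrow> h * f \<in> yh_ideal d m n"
  using ideal.I_l_closed[OF ideal_yh_ideal, of f d m n h] by simp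

lemma yh_ideal_rmult: "f \<in> yh_ideal d m n \<Longrightarrow> h \<in> carrier (yh_free m n) \<Longrightarrow> f * h \<in> yh_ideal d m n"
  using ideal.I_r_closed[OF ideal_yh_ideal, of f d m n h] by simp

lemma yh_ideal_uminus: "f \<in> yh_ideal d m n \<Longrightarrow> - f \<in> yh_ideal d m n"
  using yh_ideal_lmult[of f d m n "- 1"] yh_free_uminus[OF yh_free_1] by simp

lemma yh_ideal_rel: "yh_rel d m n l r \<Longrightarrow> l - r \<in> yh_ideal d m n"
  unfolding yh_ideal_def
  by (intro subsetD[OF ring.genideal_self[OF ring_yh_free]]) (auto dest: yh_rel_closed intro: yh_free_diff)

lemma aug_ideal:
  assumes "f \<in> yh_ideal d m n" "0 < d" "0 < m"
  shows "aug f = 0"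
proof -
  have "f \<in> {f \<in> carrier (yh_free m n). aug f = 0}"
    by (rule yh_ideal_induct[OF assms(1)])
      (use aug_rel[OF _ assms(2,3)] yh_rel_closed in \<open>auto intro: yh_free_diff yh_free_mult\<close>)
  then show ?thesis by simp
qed

lemma yh_class_eq_iff:
  assumes "f \<in> carrier (yh_free m n)" "h \<in> carrier (yh_free m n)"
  shows "yh_class d m n f = yh_class d m n h \<longleftrightarrow> f - h \<in> yh_ideal d m n"
proof
  interpret I: ideal "yh_ideal d m n" "yh_free m n" by (rule ideal_yh_ideal)
  show "yh_class d m n f = yh_class d m n h" if "f - h \<in> yh_ideal d m n"
  proof -
    have "f \<in> yh_class d m n h"
      using that by (auto simp: yh_class_def a_r_coset_def' intro!: bexI[of _ "f - h"])
    then show ?thesis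
      using I.a_repr_independence'[of f h] assms unfolding yh_class_def by simp
  qed
  assume "yh_class d m n f = yh_class d m n h"
  moreover have "f \<in> yh_class d m n f"
    using yh_ideal_0 by (auto simp: yh_class_def a_r_coset_def' intro!: bexI[of _ 0])
  ultimately show "f - h \<in> yh_ideal d m n"
    by (auto simp: yh_class_def a_r_coset_def')
qed

lemma scal_commute: "scal c * f = f * scal c"
proof -
  have "scal c * f = (\<Sum>w\<in>Poly_Mapping.keys f. scal c * Poly_Mapping.single w (Poly_Mapping.lookup f w))"
    by (subst (1) poly_mapping_sum_single[of f]) (simp add: sum_distrib_left)
  also have "\<dots> = (\<Sum>w\<in>Poly_Mapping.keys f. Poly_Mapping.single w (Poly_Mapping.lookup f w) * scal c)"
    by (simp add: scal_def mult_single mult.commute)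
  also have "\<dots> = f * scal c"
    by (subst (3) poly_mapping_sum_single[of f]) (simp add: sum_distrib_right)
  finally show ?thesis .
qed

subsection \<open>A ring type containing all the \<open>Y(d,m,n)\<close>\<close>

text \<open>
  A type cannot depend on \<open>d\<close>, \<open>m\<close>, \<open>n\<close>, so \<open>yh_univ\<close> is the product of all the \<open>Y(d,m,n)\<close>,
  including the direct limits \<open>n = \<infinity>\<close>. To keep the unit and all the relations, \<open>Y(d,m,n)\<close> is
  embedded by the identity in its own component and by the augmentation, which sends all
  generators and indeterminates to 1, in the others.
\<close>

type_synonym yh_par = "nat \<times> enat \<times> enat"

definition ucar :: "yh_par \<Rightarrow> yh_gen free_alg set"
  where "ucar = (\<lambda>(d, m, n). \<Union>k\<in>{k. enat k \<le> n}. carrier (yh_free m k))"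

definition uid :: "yh_par \<Rightarrow> yh_gen free_alg set"
  where "uid = (\<lambda>(d, m, n). \<Union>k\<in>{k. enat k \<le> n}. yh_ideal d m k)"

lemma ucarI: "f \<in> carrier (yh_free m k) \<Longrightarrow> enat k \<le> n \<Longrightarrow> f \<in> ucar (d, m, n)"
  by (auto simp: ucar_def)

lemma uidI: "f \<in> yh_ideal d m k \<Longrightarrow> enat k \<le> n \<Longrightarrow> f \<in> uid (d, m, n)"
  by (auto simp: uid_def)

lemma ucar2E:
  assumes "f \<in> ucar (d, m, n)" "h \<in> ucar (d, m, n)"
  obtains k where "enat k \<le> n" "f \<in> carrier (yh_free m k)" "h \<in> carrier (yh_free m k)"
proof -
  obtain i j where "enat i \<le> n" "f \<in> carrier (yh_free m i)" "enat j \<le> n" "h \<in> carrier (yh_free m j)"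
    using assms by (auto simp: ucar_def)
  then show ?thesis
    using that[of i] that[of j] yh_free_mono[of i j m] yh_free_mono[of j i m]
    by (cases "i \<le> j") auto
qed

lemma uid2E:
  assumes "f \<in> uid (d, m, n)" "h \<in> uid (d, m, n)"
  obtains k where "enat k \<le> n" "f \<in> yh_ideal d m k" "h \<in> yh_ideal d m k"
proof -
  obtain i j where "enat i \<le> n" "f \<in> yh_ideal d m i" "enat j \<le> n" "h \<in> yh_ideal d m j"
    using assms by (auto simp: uid_def)
  then show ?thesis
    using that[of i] that[of j] yh_ideal_mono[of i j d m] yh_ideal_mono[of j i d m]
    by (cases "i \<le> j") auto
qed

lemma uid_ucarE:
  assumes "f \<in> uid (d, m, n)" "h \<in> ucar (d, m, n)"
  obtains k where "enat k \<le> n" "f \<in> yh_ideal d m k" "h \<in> carrier (yh_free m k)"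
proof -
  obtain i j where "enat i \<le> n" "f \<in> yh_ideal d m i" "enat j \<le> n" "h \<in> carrier (yh_free m j)"
    using assms by (auto simp: uid_def ucar_def)
  then show ?thesis
    using that[of i] that[of j] yh_ideal_mono[of i j d m] yh_free_mono[of j i m]
    by (cases "i \<le> j") auto
qed

lemma ucar_scal: "c \<in> carrier (\<R> m) \<Longrightarrow> scal c \<in> ucar (d, m, n)"
  by (rule ucarI[of _ _ 0]) (simp_all add: yh_free_scal flip: zero_enat_def)

lemma ucar_aug: "scal (lconst c) \<in> ucar p"
  by (cases p) (simp add: ucar_scal laurent_ring_lconst)

lemma ucar_0: "0 \<in> ucar p" and ucar_1: "1 \<in> ucar p"
  by (cases p; use ucarI[of _ _ 0] in \<open>force simp flip: zero_enat_def\<close>)+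

lemma ucar_add: "f \<in> ucar p \<Longrightarrow> h \<in> ucar p \<Longrightarrow> f + h \<in> ucar p"
  by (cases p, hypsubst, erule (1) ucar2E) (rule ucarI[OF yh_free_add])

lemma ucar_mult: "f \<in> ucar p \<Longrightarrow> h \<in> ucar p \<Longrightarrow> f * h \<in> ucar p"
  by (cases p, hypsubst, erule (1) ucar2E) (rule ucarI[OF yh_free_mult])

lemma ucar_uminus: "f \<in> ucar p \<Longrightarrow> - f \<in> ucar p"
  by (cases p) (auto simp: ucar_def intro: yh_free_uminus)

lemma ucar_diff: "f \<in> ucar p \<Longrightarrow> h \<in> ucar p \<Longrightarrow> f - h \<in> ucar p"
  using ucar_add[of f p "- h"] ucar_uminus[of h p] by simp

lemma uid_0: "0 \<in> uid p"
  by (cases p; use uidI[OF yh_ideal_0, of 0] in \<open>force simp flip: zero_enat_def\<close>)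

lemma uid_add: "f \<in> uid p \<Longrightarrow> h \<in> uid p \<Longrightarrow> f + h \<in> uid p"
  by (cases p, hypsubst, erule (1) uid2E) (rule uidI[OF yh_ideal_add])

lemma uid_uminus: "f \<in> uid p \<Longrightarrow> - f \<in> uid p"
  by (cases p) (auto simp: uid_def intro: yh_ideal_uminus)

lemma uid_lmult: "f \<in> uid p \<Longrightarrow> h \<in> ucar p \<Longrightarrow> h * f \<in> uid p"
  by (cases p, hypsubst, erule (1) uid_ucarE) (rule uidI[OF yh_ideal_lmult])

lemma uid_rmult: "f \<in> uid p \<Longrightarrow> h \<in> ucar p \<Longrightarrow> f * h \<in> uid p"
  by (cases p, hypsubst, erule (1) uid_ucarE) (rule uidI[OF yh_ideal_rmult])

definition ueq :: "(yh_par \<Rightarrow> yh_gen free_alg) \<Rightarrow> (yh_par \<Rightarrow> yh_gen free_alg) \<Rightarrow> bool"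
  where "ueq F H \<longleftrightarrow> (\<forall>p. F p \<in> ucar p \<and> H p \<in> ucar p \<and> F p - H p \<in> uid p)"

lemma ueqI: "(\<And>p. F p \<in> ucar p) \<Longrightarrow> (\<And>p. H p \<in> ucar p) \<Longrightarrow> (\<And>p. F p - H p \<in> uid p) \<Longrightarrow> ueq F H"
  and ueqD: "ueq F H \<Longrightarrow> F p \<in> ucar p" "ueq F H \<Longrightarrow> H p \<in> ucar p" "ueq F H \<Longrightarrow> F p - H p \<in> uid p"
  unfolding ueq_def by blast+

lemma ueq_refl: "ueq F F \<longleftrightarrow> (\<forall>p. F p \<in> ucar p)"
  by (simp add: ueq_def uid_0)

quotient_type yh_univ = "yh_par \<Rightarrow> yh_gen free_alg" / partial: ueq
proof (rule part_equivpI)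
  show "\<exists>F. ueq F F" by (rule exI[of _ "\<lambda>p. 0"]) (simp add: ueq_refl ucar_0)
  show "symp ueq"
  proof (rule sympI)
    fix F H assume F: "ueq F H"
    have "H p - F p \<in> uid p" for p using uid_uminus[OF ueqD(3)[OF F], of p] by simp
    then show "ueq H F" by (rule ueqI[OF ueqD(2,1)[OF F]])
  qed
  show "transp ueq"
  proof (rule transpI)
    fix F G H assume F: "ueq F G" and G: "ueq G H"
    have "F p - H p \<in> uid p" for p using uid_add[OF ueqD(3)[OF F] ueqD(3)[OF G], of p] by simp
    then show "ueq F H" by (rule ueqI[OF ueqD(1)[OF F] ueqD(2)[OF G]])
  qed
qed

instantiation yh_univ :: ring_1
begin

lift_definition zero_yh_univ :: yh_univ is "\<lambda>p. 0"
  by (simp add: ueq_refl ucar_0)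

lift_definition one_yh_univ :: yh_univ is "\<lambda>p. 1"
  by (simp add: ueq_refl ucar_1)

lift_definition plus_yh_univ :: "yh_univ \<Rightarrow> yh_univ \<Rightarrow> yh_univ" is "\<lambda>F H p. F p + H p"
proof (rule ueqI)
  fix F F' H H' p
  assume F: "ueq F F'" and H: "ueq H H'"
  note * = ueqD[OF F, of p] ueqD[OF H, of p]
  show "F p + H p \<in> ucar p" "F' p + H' p \<in> ucar p" using * by (auto intro: ucar_add)
  have "(F p + H p) - (F' p + H' p) = (F p - F' p) + (H p - H' p)" by simp
  then show "(F p + H p) - (F' p + H' p) \<in> uid p" using uid_add[OF *(3,6)] by (simp only:)
qed

lift_definition uminus_yh_univ :: "yh_univ \<Rightarrow> yh_univ" is "\<lambda>F p. - F p"
proof (rule ueqI)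
  fix F F' p
  assume F: "ueq F F'"
  note * = ueqD[OF F, of p]
  show "- F p \<in> ucar p" "- F' p \<in> ucar p" using * by (auto intro: ucar_uminus)
  show "- F p - - F' p \<in> uid p" using uid_uminus[OF *(3)] by simp
qed

lift_definition minus_yh_univ :: "yh_univ \<Rightarrow> yh_univ \<Rightarrow> yh_univ" is "\<lambda>F H p. F p - H p"
proof (rule ueqI)
  fix F F' H H' p
  assume F: "ueq F F'" and H: "ueq H H'"
  note * = ueqD[OF F, of p] ueqD[OF H, of p]
  show "F p - H p \<in> ucar p" "F' p - H' p \<in> ucar p" using * by (auto intro: ucar_diff)
  have "(F p - H p) - (F' p - H' p) = (F p - F' p) + - (H p - H' p)" by simp
  then show "(F p - H p) - (F' p - H' p) \<in> uid p" using uid_add[OF *(3) uid_uminus[OF *(6)]] by (simp only:)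
qed

lift_definition times_yh_univ :: "yh_univ \<Rightarrow> yh_univ \<Rightarrow> yh_univ" is "\<lambda>F H p. F p * H p"
proof (rule ueqI)
  fix F F' H H' p
  assume F: "ueq F F'" and H: "ueq H H'"
  note * = ueqD[OF F, of p] ueqD[OF H, of p]
  show "F p * H p \<in> ucar p" "F' p * H' p \<in> ucar p" using * by (auto intro: ucar_mult)
  have "F p * H p - F' p * H' p = (F p - F' p) * H p + F' p * (H p - H' p)"
    by (simp add: algebra_simps)
  then show "F p * H p - F' p * H' p \<in> uid p"
    using uid_add[OF uid_rmult[OF *(3,4)] uid_lmult[OF *(6,2)]] by (simp only:)
qed

instance
proof
  fix a b c :: yh_univ
  note r = ueq_refl ucar_add ucar_mult ucar_diff ucar_uminus ucar_0 ucar_1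
  show "a * b * c = a * (b * c)" by transfer (simp add: r mult.assoc)
  show "1 * a = a" "a * 1 = a" by (transfer; simp add: r)+
  show "a + b + c = a + (b + c)" by transfer (simp add: r add.assoc)
  show "a + b = b + a" by transfer (simp add: r add.commute)
  show "0 + a = a" by transfer (simp add: r)
  show "- a + a = 0" by transfer (simp add: r)
  show "a - b = a + - b" by transfer (simp add: r)
  show "(a + b) * c = a * c + b * c" by transfer (simp add: r distrib_right)
  show "a * (b + c) = a * b + a * c" by transfer (simp add: r distrib_left)
  \<comment> \<open>Decided in the component (0,0,0), which is a base ring by
    \<open>YH_0_iso\<close>.\<close>
  show "(0 :: yh_univ) \<noteq> 1"
  proof (transfer, rule notI)
    assume "ueq (\<lambda>p. 0) (\<lambda>p. 1)"
    then have "(0::yh_gen free_alg) - 1 \<in> uid (0, 0, 0)" unfolding ueq_def by blast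
    then have "(0::yh_gen free_alg) - 1 \<in> yh_ideal 0 0 0" by (auto simp: uid_def zero_enat_def)
    then have "yh_class 0 0 0 0 = yh_class 0 0 0 1"
      by (subst yh_class_eq_iff) simp_all
    then have "yh_scal 0 0 0 0 = yh_scal 0 0 0 1"
      by (simp add: yh_scal_def scal_def)
    then have "(0::laurent) = 1"
      using YH_0_iso[of 0 0] unfolding ring_iso_def bij_betw_def by (auto dest: inj_onD)
    then show False by simp
  qed
qed

end

text \<open>The value 0 for \<open>f\<close> outside \<open>ucar p\<close> makes the embedding
  total.\<close>

definition ufam :: "yh_par \<Rightarrow> yh_gen free_alg \<Rightarrow> yh_par \<Rightarrow> yh_gen free_alg"
  where "ufam p f q = (if q = p then if f \<in> ucar p then f else 0 else scal (lconst (aug f)))"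

lemma ufam_ucar: "ufam p f q \<in> ucar q"
  by (simp add: ufam_def ucar_0 ucar_aug)

lift_definition uemb :: "yh_par \<Rightarrow> yh_gen free_alg \<Rightarrow> yh_univ" is ufam
  by (simp add: ueq_refl ufam_ucar)

lemma lconst_hom: "lconst (a + b) = lconst a + lconst b" "lconst (a * b) = lconst a * lconst b"
  "lconst 0 = 0" "lconst 1 = 1"
  by (simp_all add: lconst_def single_add mult_single)

lemma uemb_add:
  assumes "f \<in> ucar p" "h \<in> ucar p"
  shows "uemb p (f + h) = uemb p f + uemb p h"
proof -
  have "ufam p (f + h) = (\<lambda>q. ufam p f q + ufam p h q)"
    using assms by (intro ext) (simp add: ufam_def ucar_add lconst_hom scal_add scal_mult scal_0 scal_1)
  then show ?thesis by transfer (simp add: ueq_refl ucar_add ufam_ucar)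
qed

lemma uemb_mult:
  assumes "f \<in> ucar p" "h \<in> ucar p"
  shows "uemb p (f * h) = uemb p f * uemb p h"
proof -
  have "ufam p (f * h) = (\<lambda>q. ufam p f q * ufam p h q)"
    using assms by (intro ext) (simp add: ufam_def ucar_mult lconst_hom scal_add scal_mult scal_0 scal_1)
  then show ?thesis by transfer (simp add: ueq_refl ucar_mult ufam_ucar)
qed

lemma uemb_1: "uemb p 1 = 1"
proof -
  have "ufam p 1 = (\<lambda>q. 1)"
    by (intro ext) (simp add: ufam_def ucar_1 lconst_hom scal_add scal_mult scal_0 scal_1)
  then show ?thesis by transfer (simp add: ueq_refl ucar_1)
qed

lemma uemb_scal_commute: "c \<in> carrier (\<R> m) \<Longrightarrow> uemb (d, m, n) (scal c) * a = a * uemb (d, m, n) (scal c)"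
proof (transfer, rule ueqI)
  fix c m d n a p
  assume c: "c \<in> carrier (\<R> m)" and "ueq a a"
  from ueqD(1)[OF this(2)] have a: "a p \<in> ucar p" .
  show "ufam (d, m, n) (scal c) p * a p \<in> ucar p" "a p * ufam (d, m, n) (scal c) p \<in> ucar p"
    by (rule ucar_mult[OF ufam_ucar a], rule ucar_mult[OF a ufam_ucar])
  have "ufam (d, m, n) (scal c) p * a p = a p * ufam (d, m, n) (scal c) p"
    using c by (simp add: ufam_def ucar_scal scal_commute[of c] scal_commute[of "lconst (tot c)"])
  then show "ufam (d, m, n) (scal c) p * a p - a p * ufam (d, m, n) (scal c) p \<in> uid p"
    by (simp only: diff_self uid_0)
qed

text \<open>The component (d,m,n) decides: an element of the ideal has augmentation 0, so all the
  other components then agree as well.\<close>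

lemma uemb_eq_iff:
  assumes "0 < d" "0 < m" "f \<in> ucar (d, m, n)" "h \<in> ucar (d, m, n)"
  shows "uemb (d, m, n) f = uemb (d, m, n) h \<longleftrightarrow> f - h \<in> uid (d, m, n)"
proof -
  have iff: "uemb p f = uemb p h \<longleftrightarrow> (\<forall>q. ufam p f q - ufam p h q \<in> uid q)" for p
    by transfer (simp add: ueq_def ufam_ucar)
  show ?thesis
  proof
    assume "uemb (d, m, n) f = uemb (d, m, n) h"
    then have "ufam (d, m, n) f (d, m, n) - ufam (d, m, n) h (d, m, n) \<in> uid (d, m, n)"
      unfolding iff by blast
    then show "f - h \<in> uid (d, m, n)" using assms(3,4) by (simp add: ufam_def)
  next
    assume fh: "f - h \<in> uid (d, m, n)"
    then obtain k where "f - h \<in> yh_ideal d m k" by (auto simp: uid_def)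
    from aug_ideal[OF this assms(1,2)] have "aug f = aug h" by simp
    then have "ufam (d, m, n) f q - ufam (d, m, n) h q \<in> uid q" for q
      using fh assms(3,4) by (cases "q = (d, m, n)") (simp_all add: ufam_def uid_0)
    then show "uemb (d, m, n) f = uemb (d, m, n) h" unfolding iff by blast
  qed
qed

text \<open>The level n is allowed to be smaller than N in order to cover both N = n, needed for
  injectivity, and N = \<infinity>, needed to have all levels in one ring.\<close>

lemma world:
  assumes d: "0 < d" and m: "0 < m" and n: "enat n \<le> N"
  defines "ev \<equiv> uemb (d, m, N)"
  shows "yokonuma_algebra d n (ev (scal (lvar IndQ 1 - lvar IndQ (-1))) * ev (scal (lconst (1 / of_nat d))))
    (\<lambda>j. ev (letter (GenT j))) (\<lambda>i. ev (letter (GenG i))) (ev (letter GenX)) (ev (letter GenXinv)) m ev"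
proof -
  let ?p = "(d, m, N)"
  let ?dl = "ev (scal (lvar IndQ 1 - lvar IndQ (-1))) * ev (scal (lconst (1 / of_nat d)))"
  have c: "f \<in> ucar ?p" if "f \<in> carrier (yh_free m n)" for f
    by (rule ucarI[OF that n])
  have l: "letter x \<in> ucar ?p" if "x \<in> yh_gens n" for x
    by (intro c yh_free_letter that)
  have mult: "f \<in> ucar ?p \<Longrightarrow> h \<in> ucar ?p \<Longrightarrow> ev (f * h) = ev f * ev h" for f h
    unfolding ev_def by (rule uemb_mult)
  have add: "f \<in> ucar ?p \<Longrightarrow> h \<in> ucar ?p \<Longrightarrow> ev (f + h) = ev f + ev h" for f h
    unfolding ev_def by (rule uemb_add)
  have one: "ev 1 = 1" unfolding ev_def by (rule uemb_1)
  have zero: "ev 0 = 0" using add[of 0 0] by (simp add: ucar_0)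
  have diff: "f \<in> ucar ?p \<Longrightarrow> h \<in> ucar ?p \<Longrightarrow> ev (f - h) = ev f - ev h" for f h
    using add[of "f - h" h] by (simp add: ucar_diff)
  have pw: "ev (f ^ k) = ev f ^ k \<and> f ^ k \<in> ucar ?p" if "f \<in> ucar ?p" for f k
    using that by (induction k) (simp_all add: one mult ucar_1 ucar_mult)
  have sum: "ev (sum f A) = (\<Sum>i\<in>A. ev (f i)) \<and> sum f A \<in> ucar ?p" if "\<And>i. i \<in> A \<Longrightarrow> f i \<in> ucar ?p" for f and A :: "nat set"
    using that by (induction A rule: infinite_finite_induct) (simp_all add: zero add ucar_0 ucar_add)
  have prod: "ev (prod_list fs) = prod_list (map ev fs) \<and> prod_list fs \<in> ucar ?p" if "set fs \<subseteq> ucar ?p" for fs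
    using that by (induction fs) (simp_all add: one mult ucar_1 ucar_mult)
  have rel: "ev x = ev y" if "yh_rel d m n x y" for x y
    unfolding ev_def
    using uemb_eq_iff[OF d m c c] yh_rel_closed[OF that] uidI[OF yh_ideal_rel[OF that] n] by blast
  have central: "ev (scal c) * a = a * ev (scal c)" if "c \<in> carrier (\<R> m)" for c a
    unfolding ev_def by (rule uemb_scal_commute[OF that])
  have q: "lvar IndQ 1 - lvar IndQ (-1) \<in> carrier (\<R> m)"
    by (intro laurent_ring_diff laurent_ring_lvar) (auto simp: indets_def)
  have v: "lvar (IndV i) 1 \<in> carrier (\<R> m)" if "m = enat k" "i \<in> {1..<Suc k}" for i k
    using that by (intro laurent_ring_lvar) (auto simp: indets_def)
  interpret yokonuma d n ?dl "\<lambda>j. ev (letter (GenT j))" "\<lambda>i. ev (letter (GenG i))" "ev (letter GenX)" "ev (letter GenXinv)"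
  proof
    show "?dl * a = a * ?dl" for a
      by (rule intertwine_mult[OF central[OF q, symmetric] central[OF laurent_ring_lconst, symmetric], symmetric])
    show "ev (letter (GenG i)) * ev (letter (GenG j)) = ev (letter (GenG j)) * ev (letter (GenG i))"
      if "1 \<le> i" "Suc i < j" "j < n" for i j
      using rel[OF yh_rel.far_comm[of i n j d m]] that by (simp add: mult l)
    show "ev (letter (GenG i)) * (ev (letter (GenG (Suc i))) * ev (letter (GenG i))) =
        ev (letter (GenG (Suc i))) * (ev (letter (GenG i)) * ev (letter (GenG (Suc i))))"
      if "1 \<le> i" "Suc i < n" for i
      using rel[OF yh_rel.braid[of i n d m]] that by (simp add: mult l ucar_mult mult.assoc)
    show "ev (letter (GenT i)) * ev (letter (GenT j)) = ev (letter (GenT j)) * ev (letter (GenT i))"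
      if "1 \<le> i" "i \<le> n" "1 \<le> j" "j \<le> n" for i j
      using rel[OF yh_rel.t_comm[of i n j d m]] that by (simp add: mult l)
    show "ev (letter (GenT j)) * ev (letter (GenG i)) =
        ev (letter (GenG i)) * ev (letter (GenT (transpose i (Suc i) j)))"
      if "1 \<le> i" "i < n" "1 \<le> j" "j \<le> n" for i j
      using rel[OF yh_rel.t_g[of i n j d m]] that by (simp add: mult l transpose_def)
    show "ev (letter (GenT j)) ^ d = 1" if "1 \<le> j" "j \<le> n" for j
      using rel[OF yh_rel.t_order[of j n d m]] that pw[of "letter (GenT j)" d] by (simp add: l one)
    show "ev (letter (GenG i)) * ev (letter (GenG i)) = 1 +
        ?dl * (\<Sum>s<d. ev (letter (GenT i)) ^ s * ev (letter (GenT (Suc i))) ^ (d - s)) * ev (letter (GenG i))"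
      if i: "1 \<le> i" "i < n" for i
    proof -
      let ?S = "\<Sum>s<d. letter (GenT i) ^ s * letter (GenT (Suc i)) ^ (d - s)"
      have li: "letter (GenG i) \<in> ucar ?p" "letter (GenT i) \<in> ucar ?p" "letter (GenT (Suc i)) \<in> ucar ?p"
        using i by (auto intro!: l)
      have S: "ev ?S = (\<Sum>s<d. ev (letter (GenT i)) ^ s * ev (letter (GenT (Suc i))) ^ (d - s)) \<and> ?S \<in> ucar ?p"
        using sum[of "{..<d}" "\<lambda>s. letter (GenT i) ^ s * letter (GenT (Suc i)) ^ (d - s)"] li
        by (simp add: mult pw ucar_mult)
      have e: "ev (yh_e d i) = ev (scal (lconst (1 / of_nat d))) * ev ?S \<and> yh_e d i \<in> ucar ?p"
        unfolding yh_e_def using S by (simp add: mult ucar_aug ucar_mult)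
      have "ev (letter (GenG i) ^ 2) = ev (1 + scal (lvar IndQ 1 - lvar IndQ (-1)) * yh_e d i * letter (GenG i))"
        using rel[OF yh_rel.quadratic[of i n d m]] i by simp
      then show ?thesis
        using li e S by (simp add: power2_eq_square add mult ucar_mult ucar_1 one ucar_scal[OF q] mult.assoc)
    qed
    show "ev (letter GenX) * ev (letter GenXinv) = 1" "ev (letter GenXinv) * ev (letter GenX) = 1" if "1 \<le> n"
      using rel[OF yh_rel.X_inv_r[of n d m]] rel[OF yh_rel.X_inv_l[of n d m]] that by (simp_all add: mult l one)
    show "ev (letter GenX) * ev (letter (GenG 1)) * ev (letter GenX) * ev (letter (GenG 1)) =
        ev (letter (GenG 1)) * ev (letter GenX) * ev (letter (GenG 1)) * ev (letter GenX)" if "2 \<le> n"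
      using rel[OF yh_rel.X_braid[of n d m]] that by (simp add: mult l ucar_mult)
    show "ev (letter GenX) * ev (letter (GenG i)) = ev (letter (GenG i)) * ev (letter GenX)" if "2 \<le> i" "i < n" for i
      using rel[OF yh_rel.X_g[of i n d m]] that by (simp add: mult l)
    show "ev (letter GenX) * ev (letter (GenT i)) = ev (letter (GenT i)) * ev (letter GenX)" if "1 \<le> i" "i \<le> n" for i
      using rel[OF yh_rel.X_t[of i n d m]] that by (simp add: mult l)
  qed (rule d)
  show ?thesis
  proof
    show "ev (letter x) = gen x" for x by (cases x) simp_all
    fix k assume k: "m = enat k" "1 \<le> n"
    let ?fs = "map (\<lambda>i. letter GenX - scal (lvar (IndV i) 1)) [1..<Suc k]"
    have fs: "letter GenX \<in> ucar ?p" "\<And>i. i \<in> set [1..<Suc k] \<Longrightarrow> scal (lvar (IndV i) 1) \<in> ucar ?p"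
      using l[of GenX] k(2) ucar_scal[OF v[OF k(1)]] by (simp_all del: upt_Suc)
    then have fs': "set ?fs \<subseteq> ucar ?p" by (auto intro!: ucar_diff simp del: upt_Suc)
    have "ev (prod_list ?fs) = 0"
      using rel[OF yh_rel.cyclotomic[OF k(2,1)]] zero by (simp del: upt_Suc)
    moreover have "map ev ?fs = map (\<lambda>v. ev (letter GenX) - v) (map (\<lambda>i. ev (scal (lvar (IndV i) 1))) [1..<Suc k])"
      using fs by (simp add: diff del: upt_Suc)
    ultimately show "prod_list (map (\<lambda>v. ev (letter GenX) - v) (map (\<lambda>i. ev (scal (lvar (IndV i) 1))) [1..<Suc k])) = 0"
      using conjunct1[OF prod[OF fs']] by (simp only:)
  qed (auto simp: add mult c one central)
qed

subsection \<open>Solving the recurrences\<close>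

text \<open>Invertibility of v lets the recursion run downwards too. The set C records where the
  values lie: it will be the carrier of the base ring, inside the larger type of Laurent
  polynomials.\<close>

lemma first_order_recurrence:
  fixes v v' c :: "'a::ring_1"
  assumes v: "v * v' = 1" "v' * v = 1"
    and C: "c \<in> C" "v \<in> C" "v' \<in> C" "\<And>a. G a \<in> C"
      "\<And>y y'. y \<in> C \<Longrightarrow> y' \<in> C \<Longrightarrow> y + y' \<in> C \<and> y - y' \<in> C \<and> y * y' \<in> C"
  obtains h :: "int \<Rightarrow> 'a" where "h 0 = c" "\<And>a. h (a + 1) = v * h a + G a" "\<And>a. h a \<in> C"
proof -
  define up where "up = rec_nat c (\<lambda>n y. v * y + G (int n))"
  define down where "down = rec_nat c (\<lambda>n y. v' * (y - G (- int n - 1)))"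
  define h where "h = (\<lambda>a. if a \<ge> 0 then up (nat a) else down (nat (- a)))"
  have 0: "up 0 = c" "down 0 = c" by (simp_all add: up_def down_def)
  have S: "up (Suc n) = v * up n + G (int n)" "down (Suc n) = v' * (down n - G (- int n - 1))" for n
    by (simp_all add: up_def down_def)
  have 1: "h 0 = c" by (simp add: h_def 0)
  have 2: "h (a + 1) = v * h a + G a" for a
  proof (cases "a \<ge> 0")
    case True
    then show ?thesis using S(1)[of "nat a"] by (simp add: h_def nat_add_distrib)
  next
    case False
    define n where "n = nat (- a - 1)"
    have a: "a = - int n - 1" "nat (- a) = Suc n" using False by (simp_all add: n_def)
    have "h (a + 1) = down n" using a 0 by (cases "n = 0") (auto simp: h_def)
    moreover have "v * h a = down n - G a"
      using a S(2)[of n] v by (simp add: h_def flip: mult.assoc)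
    ultimately show ?thesis by simp
  qed
  have "up n \<in> C \<and> down n \<in> C" for n
    by (induction n) (simp_all add: 0 S C)
  then have "h a \<in> C" for a by (simp add: h_def)
  with 1 2 show ?thesis by (rule that)
qed

lemma shifts_first:
  assumes "\<And>u c. u \<in> set vs \<Longrightarrow> u * v = v * (u :: 'a::ring_1)"
  shows "shifts (v # vs) h a = shifts vs (\<lambda>a. h (a + 1) - v * h a) a"
  using assms by (simp add: shifts_diff shifts_arg[of _ h] shifts_lmult)

text \<open>One factor is split off: \<open>x (a + 1) - v * x a\<close> is extended first, by
  induction on the number of factors, and a first-order recurrence with initial value
  \<open>x 0\<close> then recovers the sequence.\<close>

lemma shifts_extend:
  fixes vs :: "'a::comm_ring_1 list"
  assumes C: "\<And>y y'. y \<in> C \<Longrightarrow> y' \<in> C \<Longrightarrow> y + y' \<in> C \<and> y - y' \<in> C \<and> y * y' \<in> C" "0 \<in> C"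
    and vs: "\<And>v. v \<in> set vs \<Longrightarrow> v \<in> C \<and> (\<exists>v' \<in> C. v * v' = 1)"
    and x: "\<And>a. 0 \<le> a \<Longrightarrow> a < int (length vs) \<Longrightarrow> x a \<in> C"
  shows "\<exists>h. (\<forall>a. h a \<in> C) \<and> (\<forall>a. shifts vs h a = 0) \<and> (\<forall>a. 0 \<le> a \<longrightarrow> a < int (length vs) \<longrightarrow> h a = x a)"
  using vs x
proof (induction vs arbitrary: x)
  case Nil
  then show ?case using C(2) by (intro exI[of _ "\<lambda>a. 0"]) simp
next
  case (Cons v vs)
  obtain v' where v: "v \<in> C" "v' \<in> C" "v * v' = 1" using Cons.prems(1)[of v] by auto
  have "x (a + 1) - v * x a \<in> C" if "0 \<le> a" "a < int (length vs)" for a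
    using Cons.prems(2)[of a] Cons.prems(2)[of "a + 1"] that C(1) v by simp
  then obtain G where G: "\<And>a. G a \<in> C" "\<And>a. shifts vs G a = 0"
      "\<And>a. 0 \<le> a \<Longrightarrow> a < int (length vs) \<Longrightarrow> G a = x (a + 1) - v * x a"
    using Cons.IH[of "\<lambda>a. x (a + 1) - v * x a"] Cons.prems(1) by (metis list.set_intros(2))
  obtain h where h: "h 0 = x 0" "\<And>a. h (a + 1) = v * h a + G a" "\<And>a. h a \<in> C"
    using first_order_recurrence[of v v' "x 0" C G] v Cons.prems(2)[of 0] G(1) C(1)
    by (auto simp: mult.commute)
  have "shifts (v # vs) h a = 0" for a
    using G(2) h(2) by (subst shifts_first) (simp_all add: mult.commute)
  moreover have "h (int n) = x (int n)" if "n < length (v # vs)" for n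
    using that
  proof (induction n)
    case (Suc n)
    then show ?case using h(2)[of "int n"] G(3)[of "int n"] by (simp add: add.commute)
  qed (simp add: h)
  then have "h a = x a" if "0 \<le> a" "a < int (length (v # vs))" for a
    using that by (metis nat_less_iff int_nat_eq)
  ultimately show ?case using h(3) by blast
qed

text \<open>By induction \<open>h (a + 1) - v * h a\<close> vanishes, so h is a geometric sequence
  with h 0 = 0; the inverse of v covers the negative indices.\<close>

lemma shifts_unique:
  fixes vs :: "'a::ring_1 list"
  assumes "\<And>v. v \<in> set vs \<Longrightarrow> (\<exists>v'. v' * v = 1)" "\<And>v c. v \<in> set vs \<Longrightarrow> v * c = c * v"
    and "\<And>a. shifts vs h a = 0" "\<And>a. 0 \<le> a \<Longrightarrow> a < int (length vs) \<Longrightarrow> h a = 0"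
  shows "h a = 0"
  using assms
proof (induction vs arbitrary: h a)
  case (Cons v vs)
  let ?G = "\<lambda>a. h (a + 1) - v * h a"
  have "?G a = 0" for a
  proof (rule Cons.IH)
    show "shifts vs ?G a = 0" for a
      using Cons.prems(2)[of _ v] Cons.prems(3)[of a] by (subst shifts_first[symmetric]) auto
    show "?G a = 0" if "0 \<le> a" "a < int (length vs)" for a
      using Cons.prems(4)[of a] Cons.prems(4)[of "a + 1"] that by simp
  qed (use Cons.prems in auto)
  then have G: "h (a + 1) = v * h a" for a by simp
  obtain v' where v: "v' * v = 1" using Cons.prems(1)[of v] by auto
  show ?case
  proof (induction a rule: int_induct[where k = 0])
    case (step2 i)
    have "h (i - 1) = v' * v * h (i - 1)" using v by simp
    then show ?case using G[of "i - 1"] step2 by (simp add: mult.assoc)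
  qed (simp_all add: Cons.prems(4) G)
qed simp

definition lvars :: "nat list \<Rightarrow> laurent list"
  where "lvars is = map (\<lambda>i. lvar (IndV i) 1) is"

lemma lvar_unit: "lvar i e * lvar i (- e) = 1"
  by (simp add: lvar_def mult_single flip: single_add single_one)

text \<open>The recurrence extends the parameters in a, periodicity extends them in b. For m =
  \<infinity> the set E_m already contains all integers.\<close>

lemma parameter_extension:
  assumes x: "\<And>a b. a \<in> E_set m \<Longrightarrow> b \<in> {0..<int d} \<Longrightarrow> x a b \<in> carrier (\<R> m)" and d: "0 < d"
  obtains x' where "\<And>a b. x' a b \<in> carrier (\<R> m)" "\<And>a b. x' a (b + int d) = x' a b"
    "\<And>k a b. m = enat k \<Longrightarrow> shifts (lvars [1..<Suc k]) (\<lambda>a. x' a b) a = 0"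
    "\<And>a b. a \<in> E_set m \<Longrightarrow> b \<in> {0..<int d} \<Longrightarrow> x' a b = x a b"
proof -
  have "\<exists>h. (\<forall>a. h a \<in> carrier (\<R> m)) \<and> (\<forall>k a. m = enat k \<longrightarrow> shifts (lvars [1..<Suc k]) h a = 0) \<and>
      (\<forall>a\<in>E_set m. h a = x a b)" if b: "b \<in> {0..<int d}" for b
  proof (cases m)
    case (enat k)
    have "\<exists>h. (\<forall>a. h a \<in> carrier (\<R> m)) \<and> (\<forall>a. shifts (lvars [1..<Suc k]) h a = 0) \<and>
      (\<forall>a. 0 \<le> a \<longrightarrow> a < int (length (lvars [1..<Suc k])) \<longrightarrow> h a = x a b)"
    proof (rule shifts_extend)
      fix v assume "v \<in> set (lvars [1..<Suc k])"
      then obtain i where i: "i \<in> {1..<Suc k}" "v = lvar (IndV i) 1" by (auto simp: lvars_def simp del: upt_Suc)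
      then have "IndV i \<in> indets m" using enat by (auto simp: indets_def)
      then show "v \<in> carrier (\<R> m) \<and> (\<exists>v'\<in>carrier (\<R> m). v * v' = 1)"
        using i lvar_unit[of "IndV i" 1] laurent_ring_lvar by blast
    next
      fix a assume "0 \<le> a" "a < int (length (lvars [1..<Suc k]))"
      then show "x a b \<in> carrier (\<R> m)" using x b enat by (simp add: E_set_def lvars_def del: upt_Suc)
    qed (auto intro: laurent_ring_add laurent_ring_diff laurent_ring_mult)
    then obtain h where h: "\<forall>a. h a \<in> carrier (\<R> m)" "\<forall>a. shifts (lvars [1..<Suc k]) h a = 0"
      "\<forall>a. 0 \<le> a \<longrightarrow> a < int (length (lvars [1..<Suc k])) \<longrightarrow> h a = x a b" by blast
    have "length (lvars [1..<Suc k]) = k" by (simp add: lvars_def del: upt_Suc)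
    then show ?thesis using h enat by (intro exI[of _ h]) (simp add: E_set_def del: upt_Suc)
  next
    case infinity
    then show ?thesis using x b by (intro exI[of _ "\<lambda>a. x a b"]) (auto simp: E_set_def)
  qed
  then have "\<forall>b. \<exists>h. b \<in> {0..<int d} \<longrightarrow> (\<forall>a. h a \<in> carrier (\<R> m)) \<and>
      (\<forall>k a. m = enat k \<longrightarrow> shifts (lvars [1..<Suc k]) h a = 0) \<and> (\<forall>a\<in>E_set m. h a = x a b)" by blast
  from choice[OF this] obtain H where H: "\<And>b. b \<in> {0..<int d} \<Longrightarrow> (\<forall>a. H b a \<in> carrier (\<R> m)) \<and>
      (\<forall>k a. m = enat k \<longrightarrow> shifts (lvars [1..<Suc k]) (H b) a = 0) \<and> (\<forall>a\<in>E_set m. H b a = x a b)"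
    by blast
  have dm: "b mod int d \<in> {0..<int d}" for b using d by simp
  show ?thesis
  proof (rule that[of "\<lambda>a b. H (b mod int d) a"])
    show "shifts (lvars [1..<Suc k]) (\<lambda>a. H (b mod int d) a) a = 0" if "m = enat k" for k a b
      using H[OF dm, of b] that by auto
  qed (use H dm in auto)
qed

section \<open>Representatives of the W in the free algebra, and injectivity of one inclusion of
  levels\<close>

context yokonuma_algebra
begin

lemma sc_shifts:
  assumes m: "m = enat k" and h: "\<And>a. h a \<in> carrier (\<R> m)"
  shows "set is \<subseteq> {1..<Suc k} \<Longrightarrow> shifts (vs is) (\<lambda>a. sc (h a)) a = sc (shifts (lvars is) h a) \<and>
    shifts (lvars is) h a \<in> carrier (\<R> m)"
proof (induction "is" arbitrary: a)
  case Nil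
  then show ?case using h by (simp add: vs_def lvars_def)
next
  case (Cons i "is")
  let ?v = "lvar (IndV i) 1"
  have v: "?v \<in> carrier (\<R> m)" using lvar_in[OF m] Cons.prems by simp
  have IH: "shifts (vs is) (\<lambda>a. sc (h a)) a = sc (shifts (lvars is) h a)"
    "shifts (lvars is) h a \<in> carrier (\<R> m)" for a using Cons by auto
  have n: "sc (- c) = - sc c" if "c \<in> carrier (\<R> m)" for c
    using sc_add[OF that laurent_ring_uminus[OF that]] by (simp add: sc_0 eq_neg_iff_add_eq_0 add.commute)
  have "sc (c - c') = sc c - sc c'" if "c \<in> carrier (\<R> m)" "c' \<in> carrier (\<R> m)" for c c'
    using sc_add[OF that(1) laurent_ring_uminus[OF that(2)]] n[OF that(2)] by simp
  then show ?case
    using IH v by (simp add: vs_def lvars_def sc_mult laurent_ring_mult laurent_ring_diff)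
qed

lemma rcr_sc:
  assumes "\<And>a. h a \<in> carrier (\<R> m)" "\<And>k a. m = enat k \<Longrightarrow> shifts (lvars [1..<Suc k]) h a = 0"
  shows "rcr (\<lambda>a. sc (h a))"
  unfolding rcr_def using sc_shifts[of _ h "[1..<Suc _]"] assms by (auto simp: sc_0 simp del: upt_Suc)

primrec Gi_rep :: "nat \<Rightarrow> yh_gen free_alg"
  where "Gi_rep 0 = 1" | "Gi_rep (Suc J) = gi_rep (Suc J) * Gi_rep J"

primrec Gp_rep :: "nat \<Rightarrow> yh_gen free_alg"
  where "Gp_rep 0 = 1" | "Gp_rep (Suc j) = Gp_rep j * letter (GenG (Suc j))"

definition W_rep :: "nat \<Rightarrow> nat \<Rightarrow> int \<Rightarrow> int \<Rightarrow> yh_gen free_alg"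
  where "W_rep j J a b = Gi_rep J *
    ((if a \<ge> 0 then letter GenX ^ nat a else letter GenXinv ^ nat (- a)) *
    (letter (GenT 1) ^ nat (b mod int d) * Gp_rep j))"

lemma Gi_rep_in: "J < k \<Longrightarrow> Gi_rep J \<in> carrier (yh_free m k)"
  by (induction J) (auto intro!: yh_free_mult gi_rep_in)

lemma Gp_rep_in: "j < k \<Longrightarrow> Gp_rep j \<in> carrier (yh_free m k)"
  by (induction j) (auto intro!: yh_free_mult yh_free_letter)

lemma W_rep_in: "j < k \<Longrightarrow> J < k \<Longrightarrow> W_rep j J a b \<in> carrier (yh_free m k)"
  unfolding W_rep_def
  by (auto intro!: yh_free_mult Gi_rep_in Gp_rep_in yh_free_power yh_free_letter)

text \<open>Each inverse generator raises the index that is read by one (\<open>opgi_down\<close>),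
  starting from J = 0. In \<open>act_Gp_rep\<close> the factors g lead the index from the top down
  to 0.\<close>

lemma act_Gi_rep: "J \<le> n \<Longrightarrow> act (Gi_rep J) F 0 a b = F J a b"
proof (induction J arbitrary: F)
  case (Suc J)
  have "act (Gi_rep (Suc J)) F = act (Gi_rep J) (opgi (Suc J) F)"
    using Suc.prems gi_rep_in[of "Suc J" "Suc n"] Gi_rep_in[of J "Suc n"]
    by (simp add: act_mult' act_gi_rep)
  then show ?case using Suc by (simp add: opgi_down)
qed (simp add: act_1)

lemma act_Gp_rep: "j \<le> n \<Longrightarrow> act (Gp_rep j) F j 0 0 = F 0 0 0"
proof (induction j)
  case (Suc j)
  have "act (Gp_rep (Suc j)) F = opg (Suc j) (act (Gp_rep j) F)"
    using Suc.prems Gp_rep_in[of j "Suc n"] car_letter[of "GenG (Suc j)"]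
    by (simp add: act_mult' act_letter')
  then show ?case using Suc by (simp add: opg_at)
qed (simp add: act_1)

text \<open>This confirms that a function is the table of values of the functional that it encodes:
  acting by W and evaluating at W = 1 gives the entry at W.\<close>

lemma act_W_rep:
  assumes F: "adm F" and J: "J \<le> n"
  shows "act (W_rep n J a b) F n 0 0 = F J a b"
proof -
  define x where "x = (if a \<ge> 0 then letter GenX ^ nat a else letter GenXinv ^ nat (- a) :: yh_gen free_alg)"
  define y where "y = (letter (GenT 1) ^ nat (b mod int d) :: yh_gen free_alg)"
  have in_car: "x \<in> car" "y \<in> car" "Gi_rep J \<in> car" "Gp_rep n \<in> car"
    using J by (auto simp: x_def y_def intro!: yh_free_power car_letter Gi_rep_in Gp_rep_in)
  have Xs: "(opX ^^ k) F' 0 c b = F' 0 (c + int k) b" "(opXi ^^ k) F' 0 c b = F' 0 (c - int k) b" for k F' c b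
    by (induction k arbitrary: c) (simp_all add: opX_0 opXi_0 algebra_simps)
  have ax: "act x F' 0 c b = F' 0 (c + a) b" for F' c b
    using Xs[of "nat a" F' c b] Xs[of "nat (- a)" F' c b] act_power[of GenX "Suc n"] act_power[of GenXinv "Suc n"]
    by (simp add: x_def)
  have ts: "(opt 1 ^^ k) F' 0 c b = F' 0 c (b + int k)" for k F' c b
    using opt_pow[of 1 0 k F' c b] by simp
  have ay: "act y F' 0 c 0 = F' 0 c (b mod int d)" for F' c
    using ts[of "nat (b mod int d)" F' c 0] act_power[of "GenT 1" "Suc n"] d_pos by (simp add: y_def)
  have "act (W_rep n J a b) F = act (Gp_rep n) (act y (act x (act (Gi_rep J) F)))"
    unfolding W_rep_def x_def[symmetric] y_def[symmetric]
    using in_car by (simp add: act_mult' yh_free_mult)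
  then have "act (W_rep n J a b) F n 0 0 = F J a (b mod int d)"
    using act_Gp_rep[of n] act_Gi_rep[OF J, of F] by (simp add: ay ax)
  also have "\<dots> = F J a b"
  proof -
    have p: "F J a (c + int d) = F J a c" for c
      using F J by (simp add: adm_def perF_def per_def)
    have "F J a (c + int d * int k) = F J a c" for c k
    proof (induction k)
      case (Suc k)
      then show ?case using p[of "c + int d * int k"] by (simp add: algebra_simps)
    qed simp
    note q = this
    show ?thesis
    proof (cases "b div int d \<ge> 0")
      case True
      then show ?thesis using q[of "b mod int d" "nat (b div int d)"] by simp
    next
      case False
      then show ?thesis using q[of b "nat (- (b div int d))"] by (simp add: minus_mult_div_eq_mod)
    qed
  qed
  finally show ?thesis .
qed

end

text \<open>A functional supported at J = n with value 1 at W = 1 detects Y(d,m,n): by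
  \<open>act_top\<close> the element f gives \<open>ev f\<close> there, whereas an element of the
  larger ideal gives 0.\<close>

lemma (in yokonuma_algebra) ideal_descent:
  assumes inj: "\<And>f. f \<in> carrier (yh_free m n) \<Longrightarrow> ev f = 0 \<Longrightarrow> f \<in> yh_ideal d m n"
    and f: "f \<in> carrier (yh_free m n)" "f \<in> yh_ideal d m (Suc n)" and m: "0 < m"
  shows "f \<in> yh_ideal d m n"
proof -
  \<comment> \<open>A delta function; its extension to all integers is admissible and keeps the
    value 1 at (0,0), because 0 \<in> E_m.\<close>
  define x where "x = (\<lambda>(a :: int) (b :: int). if a = 0 \<and> b = 0 then 1 else 0 :: laurent)"
  have "x a b \<in> carrier (\<R> m)" for a b by (simp add: x_def)
  then obtain x' where x': "\<And>a b. x' a b \<in> carrier (\<R> m)" "\<And>a b. x' a (b + int d) = x' a b"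
    "\<And>k a b. m = enat k \<Longrightarrow> shifts (lvars [1..<Suc k]) (\<lambda>a. x' a b) a = 0"
    "\<And>a b. a \<in> E_set m \<Longrightarrow> b \<in> {0..<int d} \<Longrightarrow> x' a b = x a b"
    using parameter_extension[of m d x] d_pos by metis
  define F where "F = (\<lambda>J a b. if J = n then sc (x' a b) else 0)"
  have "0 \<in> E_set m" using m by (cases m) (auto simp: E_set_def zero_enat_def)
  then have F1: "F n 0 0 = 1" using x'(4)[of 0 0] d_pos by (simp add: F_def x_def sc_1 ev_1)
  have "adm F"
    unfolding adm_def perF_def
  proof (intro conjI allI impI)
    show "per d (F J a)" for J a using x'(2) by (simp add: F_def per_def)
    show "rcr (\<lambda>a. F J a b)" for J b
      using rcr_sc[of "\<lambda>a. x' a b"] x'(1,3) by (cases "J = n") (simp_all add: F_def rcr_zero)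
  qed
  then have "act f F n 0 0 = 0" using f by (intro act_ideal) auto
  then have "ev f = 0" using act_top[OF f(1), of F] F1 by simp
  then show ?thesis using inj f by blast
qed

subsection \<open>The direct limit of the \<open>Y(d,m,n)\<close>\<close>

text \<open>
  The level \<open>0\<close> is extended only to inherit the constants; \<open>alg\<close> provides the relations of all
  levels. From here on indices are shifted: \<open>W n J a b\<close> is \<open>W\<^sup>(\<^sup>n\<^sup>+\<^sup>1\<^sup>)_{J,a,b}\<close> and \<open>TR n\<close> below is
  \<open>tr_{n+1}\<close>.
\<close>

locale yh_limit = yokonuma_algebra d 0 dl t g X Xi m ev
  for d :: nat and dl :: "'a::ring_1" and t g :: "nat \<Rightarrow> 'a" and X Xi :: 'a and m :: enat
    and ev :: "yh_gen free_alg \<Rightarrow> 'a" +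
  assumes m_pos: "0 < m"
    and alg: "yokonuma_algebra d n dl t g X Xi m ev"
    and ev_ideal: "f \<in> yh_ideal d m n \<Longrightarrow> ev f = 0"
    and ev_inj: "f \<in> carrier (yh_free m n) \<Longrightarrow> ev f = 0 \<Longrightarrow> f \<in> yh_ideal d m n"
begin

definition S :: "nat \<Rightarrow> 'a set"
  where "S n = ev ` carrier (yh_free m n)"

lemma S_induct [consumes 1, case_names zero add scal letter]:
  assumes "u \<in> S n" "P 0" "\<And>u v. u \<in> S n \<Longrightarrow> v \<in> S n \<Longrightarrow> P u \<Longrightarrow> P v \<Longrightarrow> P (u + v)"
    "\<And>c. c \<in> carrier (\<R> m) \<Longrightarrow> P (sc c)" "\<And>x u. x \<in> yh_gens n \<Longrightarrow> u \<in> S n \<Longrightarrow> P u \<Longrightarrow> P (gen x * u)"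
  shows "P u"
proof -
  interpret A: yokonuma_algebra d n dl t g X Xi m ev by (rule alg)
  obtain f where f: "f \<in> carrier (yh_free m n)" "u = ev f" using assms(1) by (auto simp: S_def)
  have "P (ev f)"
    using f(1)
  proof (induction f rule: yh_free_induct)
    case (letter x f)
    then show ?case using assms(5)[of x "ev f"] A.ev_letter[OF letter(1)] A.ev_mult[OF yh_free_letter[OF letter(1)] letter(2)]
      by (simp add: S_def)
  next
    case (add f h)
    then show ?case using assms(3)[of "ev f" "ev h"] by (simp add: A.ev_add S_def)
  qed (simp_all add: assms(2,4) A.ev_0)
  then show ?thesis using f by simp
qed

lemma S_add: "u \<in> S n \<Longrightarrow> v \<in> S n \<Longrightarrow> u + v \<in> S n"
proof -
  interpret A: yokonuma_algebra d n dl t g X Xi m ev by (rule alg)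
  assume "u \<in> S n" "v \<in> S n"
  then obtain f h where "f \<in> carrier (yh_free m n)" "u = ev f" "h \<in> carrier (yh_free m n)" "v = ev h"
    by (auto simp: S_def)
  then show "u + v \<in> S n"
    using yh_free_add[of f m n h] by (simp add: S_def flip: A.ev_add)
qed

lemma S_mult: "u \<in> S n \<Longrightarrow> v \<in> S n \<Longrightarrow> u * v \<in> S n"
proof -
  interpret A: yokonuma_algebra d n dl t g X Xi m ev by (rule alg)
  assume "u \<in> S n" "v \<in> S n"
  then obtain f h where "f \<in> carrier (yh_free m n)" "u = ev f" "h \<in> carrier (yh_free m n)" "v = ev h"
    by (auto simp: S_def)
  then show "u * v \<in> S n"
    using yh_free_mult[of f m n h] by (simp add: S_def flip: A.ev_mult)
qed

lemma S_sc: "c \<in> carrier (\<R> m) \<Longrightarrow> sc c \<in> S n"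
  by (auto simp: S_def yh_free_scal)

lemma S_0: "0 \<in> S n" and S_1: "1 \<in> S n"
proof -
  interpret A: yokonuma_algebra d n dl t g X Xi m ev by (rule alg)
  show "0 \<in> S n" "1 \<in> S n" using S_sc[of 0] S_sc[of 1] by (simp_all add: A.sc_0 sc_1)
qed

lemma S_uminus: "u \<in> S n \<Longrightarrow> - u \<in> S n"
proof -
  interpret A: yokonuma_algebra d n dl t g X Xi m ev by (rule alg)
  have "sc (- 1) + sc 1 = 0"
    using A.sc_add[of "- 1" 1] laurent_ring_uminus[of 1] by (simp add: A.sc_0)
  then have "sc (- 1) = - 1" by (simp add: sc_1 eq_neg_iff_add_eq_0)
  then show "u \<in> S n \<Longrightarrow> - u \<in> S n" using S_mult[OF S_sc, of "- 1" u n] laurent_ring_uminus[of 1] by simp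
qed

lemma S_diff: "u \<in> S n \<Longrightarrow> v \<in> S n \<Longrightarrow> u - v \<in> S n"
  using S_add[of u n "- v"] S_uminus[of v n] by simp

lemma S_sum: "(\<And>i. i \<in> A \<Longrightarrow> f i \<in> S n) \<Longrightarrow> sum f A \<in> S n"
  by (induction A rule: infinite_finite_induct) (auto intro: S_0 S_add)

lemma S_power: "u \<in> S n \<Longrightarrow> u ^ k \<in> S n"
  by (induction k) (auto intro: S_1 S_mult)

lemma S_mono: "n \<le> n' \<Longrightarrow> S n \<subseteq> S n'"
  unfolding S_def using yh_free_mono by blast

lemma S_gen: "x \<in> yh_gens n \<Longrightarrow> gen x \<in> S n"
proof -
  interpret A: yokonuma_algebra d n dl t g X Xi m ev by (rule alg)
  show "x \<in> yh_gens n \<Longrightarrow> gen x \<in> S n" using A.ev_letter[of x] imageI[OF yh_free_letter[of x n m], of ev] by (simp add: S_def)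
qed

lemma S_Suc: "u \<in> S n \<Longrightarrow> u \<in> S (Suc n)"
  using S_mono[of n "Suc n"] by auto

lemma S_t: "1 \<le> j \<Longrightarrow> j \<le> n \<Longrightarrow> t j \<in> S n"
  and S_g: "1 \<le> i \<Longrightarrow> i < n \<Longrightarrow> g i \<in> S n"
  and S_X: "1 \<le> n \<Longrightarrow> X \<in> S n" and S_Xi: "1 \<le> n \<Longrightarrow> Xi \<in> S n"
proof -
  interpret A: yokonuma_algebra d n dl t g X Xi m ev by (rule alg)
  show "1 \<le> j \<Longrightarrow> j \<le> n \<Longrightarrow> t j \<in> S n" "1 \<le> i \<Longrightarrow> i < n \<Longrightarrow> g i \<in> S n" "1 \<le> n \<Longrightarrow> X \<in> S n" "1 \<le> n \<Longrightarrow> Xi \<in> S n"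
    using S_gen[of "GenT j" n] S_gen[of "GenG i" n] S_gen[of GenX n] S_gen[of GenXinv n] by simp_all
qed

lemma S_Xp: "1 \<le> n \<Longrightarrow> Xp a \<in> S n"
  by (simp add: zpow_def S_power S_X S_Xi)

lemma S_tp: "1 \<le> j \<Longrightarrow> j \<le> n \<Longrightarrow> tp j s \<in> S n"
proof -
  interpret A: yokonuma_algebra d n dl t g X Xi m ev by (rule alg)
  show "1 \<le> j \<Longrightarrow> j \<le> n \<Longrightarrow> tp j s \<in> S n" by (simp add: A.tp_def S_power S_t)
qed

lemma S_dl: "dl \<in> S n"
proof -
  interpret A: yokonuma_algebra d n dl t g X Xi m ev by (rule alg)
  show ?thesis using S_mult[OF S_sc[OF A.delta_in] S_sc[OF laurent_ring_lconst]] A.dl_eq by simp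
qed

lemma S_de: "1 \<le> i \<Longrightarrow> i \<le> n \<Longrightarrow> 1 \<le> j \<Longrightarrow> j \<le> n \<Longrightarrow> de i j \<in> S n"
proof -
  interpret A: yokonuma_algebra d n dl t g X Xi m ev by (rule alg)
  show "1 \<le> i \<Longrightarrow> i \<le> n \<Longrightarrow> 1 \<le> j \<Longrightarrow> j \<le> n \<Longrightarrow> de i j \<in> S n"
    by (auto simp: A.de_def intro!: S_mult S_dl S_sum S_tp)
qed

lemma S_gi: "1 \<le> i \<Longrightarrow> i < n \<Longrightarrow> gi i \<in> S n"
proof -
  interpret A: yokonuma_algebra d n dl t g X Xi m ev by (rule alg)
  show "1 \<le> i \<Longrightarrow> i < n \<Longrightarrow> gi i \<in> S n" by (auto simp: A.gi_def intro!: S_diff S_g S_de)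
qed

lemma S_Gi: "J < n \<Longrightarrow> Gi J \<in> S n"
proof -
  interpret A: yokonuma_algebra d n dl t g X Xi m ev by (rule alg)
  show "J < n \<Longrightarrow> Gi J \<in> S n" by (induction J) (auto intro!: S_mult S_gi S_1)
qed

lemma S_Gp: "j < n \<Longrightarrow> Gp j \<in> S n"
proof -
  interpret A: yokonuma_algebra d n dl t g X Xi m ev by (rule alg)
  show "j < n \<Longrightarrow> Gp j \<in> S n" by (induction j) (auto intro!: S_mult S_g S_1)
qed

lemma S_W: "j < n \<Longrightarrow> J < n \<Longrightarrow> W j J a b \<in> S n"
proof -
  interpret A: yokonuma_algebra d n dl t g X Xi m ev by (rule alg)
  show "j < n \<Longrightarrow> J < n \<Longrightarrow> W j J a b \<in> S n"
    by (auto simp: A.W_def intro!: S_mult S_Gi S_Gp S_Xp S_tp)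
qed

inductive spn :: "nat \<Rightarrow> 'a \<Rightarrow> bool" for n :: nat
  where spn_W: "J \<le> n \<Longrightarrow> w \<in> S n \<Longrightarrow> spn n (W n J a b * w)"
  | spn_add: "spn n u \<Longrightarrow> spn n v \<Longrightarrow> spn n (u + v)"

lemma spn_0: "spn n 0"
  using spn_W[of 0 n 0] S_0 by simp

lemma spn_sum: "(\<And>i. i \<in> A \<Longrightarrow> spn n (f i)) \<Longrightarrow> spn n (sum f A)"
  by (induction A rule: infinite_finite_induct) (auto intro: spn_0 spn_add)

lemma spn_right:
  assumes "spn n Z" "w \<in> S n"
  shows "spn n (Z * w)"
  using assms(1)
proof induction
  case (spn_W J v a b)
  then show ?case using spn.spn_W[OF spn_W(1) S_mult[OF spn_W(2) assms(2)]] by (simp add: mult.assoc)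
next
  case (spn_add u v)
  then show ?case by (simp add: distrib_right spn.spn_add)
qed

lemma spn_diff: "spn n u \<Longrightarrow> spn n v \<Longrightarrow> spn n (u - v)"
  using spn_add[OF _ spn_right[of n v "- 1"]] S_uminus[OF S_1] by simp

lemma spn_op:
  assumes x: "x \<in> yh_gens (Suc n)" and J: "J \<le> n"
  shows "spn n (op x (W n) J a b)"
proof -
  interpret A: yokonuma_algebra d n dl t g X Xi m ev by (rule alg)
  have W1: "spn n (W n J a b)" if "J \<le> n" for J a b
    using spn_W[OF that S_1] by simp
  have D: "spn n (DE j (W n J a) b)" if "J \<le> n" "1 \<le> j" "j \<le> n" for j J a b
  proof -
    have "DE j (W n J a) b = (\<Sum>s<d. W n J a (b + int s) * (tp j (- int s) * dl))"
      by (simp add: A.DE_def sum_distrib_left A.dl_central[of "_ * _"] mult.assoc)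
    then show ?thesis using that by (auto intro!: spn_sum spn_right W1 S_mult S_tp S_dl)
  qed
  show ?thesis
  proof (cases x)
    case (GenT j)
    then show ?thesis using x J by (auto simp: A.opt_def intro!: spn_right W1 S_t)
  next
    case (GenG i)
    then show ?thesis using x J by (auto simp: A.opg_def intro!: spn_right spn_add W1 S_g D)
  next
    case GenX
    then show ?thesis using x J
      by (auto simp: A.opX_def intro!: spn_right spn_add spn_diff W1 S_X S_Xp S_Gi D)
  next
    case GenXinv
    then show ?thesis using x J
      by (auto simp: A.opXi_def intro!: spn_right spn_add spn_diff W1 S_Xi S_Xp S_Gi D)
  qed
qed

text \<open>Scalars lie in the span because W with index (n,0,0) is 1. Left multiplication by a
  generator preserves it: by \<open>gen_W\<close> it is an operator formula, which is a right
  combination of elements W.\<close>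

lemma S_spn: "Z \<in> S (Suc n) \<Longrightarrow> spn n Z"
proof (induction Z rule: S_induct)
  case (scal c)
  interpret A: yokonuma_algebra d "Suc n" dl t g X Xi m ev by (rule alg)
  show ?case using spn_W[OF le_refl S_sc[OF scal], of n 0 0] by (simp add: A.W_0)
next
  case (letter x u)
  interpret A: yokonuma_algebra d "Suc n" dl t g X Xi m ev by (rule alg)
  from letter(3) show ?case
  proof induction
    case (spn_W J w a b)
    have "gen x * (W n J a b * w) = op x (W n) J a b * w"
      using A.gen_W[OF letter(1) spn_W(1)] by (simp flip: mult.assoc)
    then show ?case
      using spn_right[OF spn_op[OF letter(1) spn_W(1)] spn_W(2)] by simp
  next
    case (spn_add u v)
    then show ?case by (simp add: distrib_left spn.spn_add)
  qed
qed (auto intro: spn_0 spn_add)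

lemma S_span [consumes 1, case_names W add]:
  assumes "Z \<in> S (Suc n)" "\<And>J a b w. J \<le> n \<Longrightarrow> w \<in> S n \<Longrightarrow> P (W n J a b * w)"
    "\<And>u v. u \<in> S (Suc n) \<Longrightarrow> v \<in> S (Suc n) \<Longrightarrow> P u \<Longrightarrow> P v \<Longrightarrow> P (u + v)"
  shows "P Z"
proof -
  from S_spn[OF assms(1)] have "Z \<in> S (Suc n) \<and> P Z"
  proof induction
    case (spn_W J w a b)
    then show ?case
      using assms(2) S_W[of n "Suc n" J a b] S_mono[of n "Suc n"] by (auto intro!: S_mult)
  next
    case (spn_add u v)
    then show ?case using assms(3) by (auto intro!: S_add)
  qed
  then show ?thesis by simp
qed

lemma sc_central: "c \<in> carrier (\<R> m) \<Longrightarrow> sc c * u = u * sc c"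
  by (rule ev_central)

lemma S_commute:
  assumes "u \<in> S n" "\<And>x. x \<in> yh_gens n \<Longrightarrow> v * gen x = gen x * v"
  shows "v * u = u * v"
  using assms(1)
proof (induction u rule: S_induct)
  case (letter x u)
  then show ?case using intertwine_mult[OF assms(2), of x u v] by simp
next
  case (add u u')
  then show ?case by (simp add: distrib_left distrib_right)
next
  case (scal c)
  then show ?case by (rule sc_central[symmetric])
qed simp

lemma g_S: "u \<in> S p \<Longrightarrow> g (Suc p) * u = u * g (Suc p)"
proof (rule S_commute)
  interpret A: yokonuma_algebra d "Suc (Suc p)" dl t g X Xi m ev by (rule alg)
  fix x assume x: "x \<in> yh_gens p"
  show "g (Suc p) * gen x = gen x * g (Suc p)"
  proof (cases x)
    case (GenT j)
    then show ?thesis using x A.t_g_far[of "Suc p" j] by simp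
  next
    case (GenG i)
    then show ?thesis using x A.g_far[of i "Suc p"] by simp
  next
    case GenX
    then show ?thesis using x A.X_g[of "Suc p"] by simp
  next
    case GenXinv
    then show ?thesis using x A.g_Xp[of "Suc p" "-1"] by simp
  qed
qed

lemma t_S: "u \<in> S p \<Longrightarrow> t (Suc p) * u = u * t (Suc p)"
proof (rule S_commute)
  interpret A: yokonuma_algebra d "Suc (Suc p)" dl t g X Xi m ev by (rule alg)
  fix x assume x: "x \<in> yh_gens p"
  show "t (Suc p) * gen x = gen x * t (Suc p)"
  proof (cases x)
    case (GenT j)
    then show ?thesis using x A.t_comm[of "Suc p" j] by simp
  next
    case (GenG i)
    then show ?thesis using x A.t_g_far[of i "Suc p"] by simp
  next
    case GenX
    then show ?thesis using A.t_X[of "Suc p"] by simp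
  next
    case GenXinv
    then show ?thesis using A.t_Xp[of "Suc p" "-1"] by simp
  qed
qed

lemma tp_S: "u \<in> S p \<Longrightarrow> tp (Suc p) s * u = u * tp (Suc p) s"
proof -
  interpret A: yokonuma_algebra d "Suc (Suc p)" dl t g X Xi m ev by (rule alg)
  show "u \<in> S p \<Longrightarrow> tp (Suc p) s * u = u * tp (Suc p) s" by (rule A.tp_intertwine[OF t_S])
qed

end

subsection \<open>The relative traces\<close>

text \<open>Here \<open>x\<close> is the parameter family after its extension to all
  integers.\<close>

locale yh_trace = yh_limit +
  fixes z :: laurent and x :: "int \<Rightarrow> int \<Rightarrow> laurent"
  assumes z_in: "z \<in> carrier (\<R> m)" and x_in: "x a b \<in> carrier (\<R> m)"
    and x_period: "x a (b + int d) = x a b"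
    and x_rec: "m = enat k \<Longrightarrow> shifts (lvars [1..<Suc k]) (\<lambda>a. x a b) a = 0"
begin

text \<open>The values prescribed in the theorem. As \<open>TR n\<close> is tr_{n+1}, the element
  \<open>W (n - 1)\<close> is the one with superscript n.\<close>

definition F0 :: "nat \<Rightarrow> 'a fnl"
  where "F0 n J a b = (if J < n then sc z * W (n - 1) J a b else sc (x a b))"

text \<open>The constant \<open>act\<close> does not involve the level, so the one inherited from
  level 0 is the action at every level; admissibility does involve it. By \<open>TR_ev\<close> the
  chosen representative does not matter.\<close>

definition TR :: "nat \<Rightarrow> 'a \<Rightarrow> 'a"
  where "TR n u = act
    (SOME f. f \<in> carrier (yh_free m (Suc n)) \<and> ev f = u) (F0 n) n 0 0"

lemma adm_F0: "yokonuma_algebra.adm d n m ev (F0 n)"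
proof -
  interpret A: yokonuma_algebra d n dl t g X Xi m ev by (rule alg)
  show ?thesis
    unfolding A.adm_def A.perF_def
  proof (intro conjI allI impI)
    show "per d (F0 n J a)" for J a
      using A.per_W by (simp add: per_def F0_def x_period)
    show "rcr (\<lambda>a. F0 n J a b)" for J b
    proof (cases "J < n")
      case True
      then show ?thesis
        by (auto simp: F0_def A.W_def intro!: A.rcr_lmult A.rcr_rmult A.rcr_Xp)
    next
      case False
      then show ?thesis using A.rcr_sc[of "\<lambda>a. x a b"] x_in x_rec by (simp add: F0_def)
    qed
  qed
qed

lemma TR_ev:
  assumes f: "f \<in> carrier (yh_free m (Suc n))"
  shows "TR n (ev f) = act f (F0 n) n 0 0"
proof -
  interpret A: yokonuma_algebra d n dl t g X Xi m ev by (rule alg)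
  interpret B: yokonuma_algebra d "Suc n" dl t g X Xi m ev by (rule alg)
  define h where "h = (SOME h. h \<in> carrier (yh_free m (Suc n)) \<and> ev h = ev f)"
  have h: "h \<in> carrier (yh_free m (Suc n))" "ev h = ev f"
    using someI[of "\<lambda>h. h \<in> carrier (yh_free m (Suc n)) \<and> ev h = ev f", OF conjI[OF f refl]] by (simp_all add: h_def)
  have "ev (h - f) + ev f = ev h"
    using B.ev_add[OF yh_free_diff[OF h(1) f] f] by simp
  then have "h - f \<in> yh_ideal d m (Suc n)" using h f by (intro ev_inj yh_free_diff) auto
  then have "A.act (h - f) (F0 n) n 0 0 = 0" by (rule A.act_ideal[OF _ adm_F0]) simp
  then show ?thesis using A.act_diff[OF h(1) f] by (simp add: TR_def flip: h_def)
qed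

lemma TR_add: "u \<in> S (Suc n) \<Longrightarrow> v \<in> S (Suc n) \<Longrightarrow> TR n (u + v) = TR n u + TR n v"
proof -
  interpret A: yokonuma_algebra d n dl t g X Xi m ev by (rule alg)
  interpret B: yokonuma_algebra d "Suc n" dl t g X Xi m ev by (rule alg)
  assume "u \<in> S (Suc n)" "v \<in> S (Suc n)"
  then obtain f h where f: "f \<in> carrier (yh_free m (Suc n))" "u = ev f" and h: "h \<in> carrier (yh_free m (Suc n))" "v = ev h"
    by (auto simp: S_def)
  have "u + v = ev (f + h)" using f h B.ev_add by simp
  then show ?thesis using f h TR_ev[OF yh_free_add[OF f(1) h(1)]] by (simp add: TR_ev A.act_add)
qed

lemma TR_right:
  assumes "Z \<in> S (Suc n)" "w \<in> S n"
  shows "TR n (Z * w) = TR n Z * w"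
proof -
  interpret A: yokonuma_algebra d n dl t g X Xi m ev by (rule alg)
  interpret B: yokonuma_algebra d "Suc n" dl t g X Xi m ev by (rule alg)
  obtain f h where f: "f \<in> carrier (yh_free m (Suc n))" "Z = ev f" and h: "h \<in> carrier (yh_free m n)" "w = ev h"
    using assms by (auto simp: S_def)
  have h': "h \<in> carrier (yh_free m (Suc n))" using h(1) yh_free_mono[of n "Suc n" m] by auto
  have "Z * w = ev (f * h)" using f h h' B.ev_mult by simp
  then show ?thesis
    using f h h' TR_ev[OF yh_free_mult[OF f(1) h']] by (simp add: TR_ev A.act_mult A.act_top)
qed

text \<open>Left linearity on the level of the prescribed values. For J < n it is
  \<open>gen_W\<close> one level below. For J = n the values are central scalars, and what has to be
  shown is that the corrections of X_1 cancel.\<close>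

lemma F0_left:
  assumes y: "y \<in> yh_gens n" and J: "J \<le> n"
  shows "op y (F0 n) J a b = gen y * F0 n J a b"
proof -
  interpret A: yokonuma_algebra d n dl t g X Xi m ev by (rule alg)
  have n: "1 \<le> n" using y by (auto simp: yh_gens_def split: if_splits)
  then obtain K where K: "n = Suc K" by (cases n) auto
  show ?thesis
  proof (cases "J < n")
    case True
    have "op y (F0 n) J a b = op y (\<lambda>J a b. sc z * W K J a b) J a b"
      using y True by (intro A.op_cong[of y K]) (auto simp: K F0_def)
    also have "\<dots> = sc z * (gen y * W K J a b)"
      using A.gen_W[of y K J a b] y True by (simp add: A.op_lmult K)
    finally show ?thesis using True z_in by (simp add: K F0_def sc_central[of z "gen y"] flip: mult.assoc)
  next
    case False
    then have Jn: "J = n" using J by simp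
    \<comment> \<open>The powers t_1^s and t_1^{-s} meet after \<open>Gp K * Gi K = 1\<close>, so
      the sum is d times one term. The corrections then differ only in the position of powers of
      X_1.\<close>
    have D: "DE n (F0 n 0 c) b * Gi K = dl * (of_nat d * (sc z * (Xp c * tp 1 b)))" for c
    proof -
      have "DE n (F0 n 0 c) b * Gi K = dl * (\<Sum>s<d. sc z * Xp c * tp 1 (b + int s) * Gp K * (tp n (- int s) * Gi K))"
        by (simp add: A.DE_def F0_def K A.W_def sum_distrib_right mult.assoc)
      also have "\<dots> = dl * (\<Sum>s<d. sc z * Xp c * tp 1 (b + int s) * (Gp K * Gi K) * tp 1 (- int s))"
        using A.tp_Gi_top[of K] by (simp add: K mult.assoc)
      also have "\<dots> = dl * (\<Sum>s<d. sc z * Xp c * tp 1 b)"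
      proof -
        have "tp 1 (b + int s) * tp 1 (- int s) = tp 1 b" for s
          using A.tp_add[of 1 "b + int s" "- int s"] n by simp
        then show ?thesis using A.Gp_Gi[of K] by (simp add: K mult.assoc)
      qed
      finally show ?thesis by (simp add: mult.assoc)
    qed
    have z1: "X * Xp a = Xp (a + 1)" "Xp a * Xi = Xp (a - 1)"
      using zpow_Suc[OF A.X_Xi A.Xi_X, of a] zpow_add[OF A.X_Xi A.Xi_X, of a "-1"] n by simp_all
    have c1: "tp 1 b * Xp a = Xp a * tp 1 b" "tp 1 b * Xp (a - 1) = Xp (a - 1) * tp 1 b" "tp 1 b * Xi = Xi * tp 1 b"
      using A.tp_Xp[of 1 b] A.tp_Xi[of 1 b] n by simp_all
    have "op y (F0 n) n a b = sc (x a b) * gen y"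
    proof (cases y)
      case GenX
      have "DE n (F0 n 0 1) b * Gi K * Xp a = DE n (F0 n 0 (a + 1)) b * Gi K"
        unfolding D z1(1)[symmetric] by (simp only: zpow_1 mult.assoc c1)
      then show ?thesis using GenX by (simp add: K A.opX_Suc) (simp add: F0_def)
    next
      case GenXinv
      have "DE n (F0 n 0 0) b * Gi K * Xp (a - 1) = DE n (F0 n 0 a) b * Gi K * Xi"
        unfolding D by (simp only: zpow_0 mult_1_left mult.assoc c1)
          (simp only: z1(2)[symmetric] mult.assoc)
      then show ?thesis using GenXinv by (simp add: K A.opXi_Suc) (simp add: F0_def)
    qed (use y in \<open>auto simp: A.opg_def A.opt_def F0_def\<close>)
    then show ?thesis using sc_central[OF x_in, of a b "gen y"] by (simp add: Jn F0_def)
  qed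
qed

lemma TR_sc:
  assumes "Z \<in> S (Suc n)" "c \<in> carrier (\<R> m)"
  shows "TR n (sc c * Z) = sc c * TR n Z"
  using TR_right[OF assms(1) S_sc[OF assms(2), of n]] by (simp add: sc_central[OF assms(2)])

text \<open>A letter in front of a representative acts first, and on \<open>F0 n\<close> it is
  multiplication from the left, which commutes with the rest of the action.\<close>

lemma TR_left:
  assumes "u \<in> S n" "Z \<in> S (Suc n)"
  shows "TR n (u * Z) = u * TR n Z"
  using assms(1)
proof (induction u rule: S_induct)
  case zero
  have "TR n (sc 0 * Z) = sc 0 * TR n Z" using assms by (intro TR_sc) auto
  then show ?case by (simp add: sc_0)
next
  case (add u v)
  have "u * Z \<in> S (Suc n)" "v * Z \<in> S (Suc n)"
    using add assms S_mono[of n "Suc n"] by (auto intro!: S_mult)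
  then show ?case using add by (simp add: TR_add distrib_right)
next
  case (scal c)
  then show ?case using assms by (simp add: TR_sc)
next
  case (letter y u)
  interpret A: yokonuma_algebra d n dl t g X Xi m ev by (rule alg)
  interpret B: yokonuma_algebra d "Suc n" dl t g X Xi m ev by (rule alg)
  have y: "y \<in> yh_gens (Suc n)" using letter(1) by (cases y) (auto split: if_splits)
  have "u * Z \<in> S (Suc n)" using letter assms S_mono[of n "Suc n"] by (auto intro!: S_mult)
  then obtain f where f: "f \<in> carrier (yh_free m (Suc n))" "u * Z = ev f" by (auto simp: S_def)
  have "gen y * u * Z = ev (letter y * f)"
    using f y B.ev_mult[OF yh_free_letter[OF y] f(1)] by (simp add: B.ev_letter mult.assoc)
  then have "TR n (gen y * u * Z) = act f (op y (F0 n)) n 0 0"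
    using f y TR_ev[OF yh_free_mult[OF yh_free_letter[OF y] f(1)]] by (simp add: A.act_letter_mult)
  also have "\<dots> = act f (\<lambda>J a b. gen y * F0 n J a b) n 0 0"
    using F0_left[OF letter(1)] by (intro A.act_cong[OF f(1)]) auto
  also have "\<dots> = gen y * TR n (u * Z)"
    using f by (simp add: A.act_flmult[OF f(1)] TR_ev)
  finally show ?case using letter(3) by (simp add: mult.assoc)
qed

lemma ev_W_rep:
  assumes "j < n" "J < n"
  shows "ev (W_rep j J a b) = W j J a b"
proof -
  interpret A: yokonuma_algebra d n dl t g X Xi m ev by (rule alg)
  have pw: "f \<in> carrier (yh_free m n) \<Longrightarrow> ev (f ^ k) = ev f ^ k" for f k
    by (induction k) (simp_all add: ev_1 A.ev_mult yh_free_power)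
  have l: "y \<in> yh_gens n \<Longrightarrow> letter y \<in> carrier (yh_free m n)" for y by (rule yh_free_letter)
  have sum: "ev (sum f A) = (\<Sum>i\<in>A. ev (f i)) \<and> sum f A \<in> carrier (yh_free m n)"
    if "\<And>i. i \<in> A \<Longrightarrow> f i \<in> carrier (yh_free m n)" for f and A :: "nat set"
    using that by (induction A rule: infinite_finite_induct) (simp_all add: ev_0 A.ev_add yh_free_add)
  have gi: "ev (gi_rep i) = gi i" if i: "1 \<le> i" "i < n" for i
  proof -
    let ?S = "\<Sum>s<d. letter (GenT i) ^ s * letter (GenT (Suc i)) ^ (d - s)"
    let ?q = "lvar IndQ 1 - lvar IndQ (-1)"
    have S: "ev ?S = (\<Sum>s<d. t i ^ s * t (Suc i) ^ (d - s)) \<and> ?S \<in> carrier (yh_free m n)"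
      using sum[of "{..<d}" "\<lambda>s. letter (GenT i) ^ s * letter (GenT (Suc i)) ^ (d - s)"] i
      by (simp add: A.ev_mult pw l yh_free_power yh_free_mult A.ev_letter)
    have "ev (scal ?q * yh_e d i) = sc ?q * (sc (lconst (1 / of_nat d)) * ev ?S)"
      unfolding yh_e_def using S
      by (simp add: A.ev_mult yh_free_mult yh_free_scal laurent_ring_lconst A.delta_in)
    also have "\<dots> = (sc ?q * sc (lconst (1 / of_nat d))) * ev ?S" by (simp add: mult.assoc)
    also have "\<dots> = dl * ev ?S" by (simp only: A.dl_eq[symmetric])
    also have "\<dots> = de i (Suc i)"
      using S i by (simp add: A.de_def A.tp_int A.tp_neg)
    finally have e: "ev (scal ?q * yh_e d i) = de i (Suc i)" .
    have in_car: "scal ?q * yh_e d i \<in> carrier (yh_free m n)" "letter (GenG i) \<in> carrier (yh_free m n)"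
      using i by (auto intro!: yh_free_mult yh_free_scal A.delta_in A.yh_e_in l)
    have "ev (gi_rep i) + ev (scal ?q * yh_e d i) = ev (letter (GenG i))"
      using A.ev_add[OF A.gi_rep_in[OF i] in_car(1)] by (simp add: A.gi_rep_def)
    then show ?thesis using i e by (simp add: A.ev_letter A.gi_def eq_diff_eq)
  qed
  have Gi: "ev (Gi_rep J) = Gi J" if "J < n" for J
    using that by (induction J) (simp_all add: ev_1 A.ev_mult A.gi_rep_in A.Gi_rep_in gi)
  have Gp: "ev (Gp_rep j) = Gp j" if "j < n" for j
    using that by (induction j) (simp_all add: ev_1 A.ev_mult l A.Gp_rep_in A.ev_letter)
  have xa: "ev (if a \<ge> 0 then letter GenX ^ nat a else letter GenXinv ^ nat (- a)) = Xp a"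
    using assms by (simp add: zpow_def pw l A.ev_letter)
  have in_car: "(if a \<ge> 0 then letter GenX ^ nat a else letter GenXinv ^ nat (- a)) \<in> carrier (yh_free m n)"
    "letter (GenT 1) ^ nat (b mod int d) \<in> carrier (yh_free m n)" "Gi_rep J \<in> carrier (yh_free m n)"
    "Gp_rep j \<in> carrier (yh_free m n)"
    using assms by (auto intro!: yh_free_power l A.Gi_rep_in A.Gp_rep_in)
  show ?thesis
    unfolding W_rep_def A.W_def A.tp_def A.ev_mult[OF in_car(3) yh_free_mult[OF in_car(1) yh_free_mult[OF in_car(2,4)]]]
      A.ev_mult[OF in_car(1) yh_free_mult[OF in_car(2,4)]] A.ev_mult[OF in_car(2,4)] xa
    using assms by (simp add: Gi Gp pw l A.ev_letter)
qed

lemma TR_W: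
  assumes "J \<le> n"
  shows "TR n (W n J a b) = F0 n J a b"
proof -
  interpret A: yokonuma_algebra d n dl t g X Xi m ev by (rule alg)
  have "W_rep n J a b \<in> carrier (yh_free m (Suc n))" using assms by (intro A.W_rep_in) auto
  then show ?thesis
    using TR_ev[of "W_rep n J a b" n] ev_W_rep[of n "Suc n" J a b] A.act_W_rep[OF adm_F0, of J a b] assms by simp
qed

lemma TR_W_mult:
  assumes "J \<le> n" "w \<in> S n"
  shows "TR n (W n J a b * w) = F0 n J a b * w"
  using TR_right[OF S_W assms(2), of n J a b] TR_W assms by simp

lemma TR_S: "Z \<in> S (Suc n) \<Longrightarrow> TR n Z \<in> S n"
proof (induction Z rule: S_span)
  case (W J a b w)
  then show ?case
    by (auto simp: TR_W_mult F0_def intro!: S_mult S_sc S_W z_in x_in)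
qed (simp add: TR_add S_add)

lemma S_g_top: "g (Suc p) \<in> S (Suc (Suc p))" and S_gi_top: "gi (Suc p) \<in> S (Suc (Suc p))"
  by (rule S_g; simp) (rule S_gi; simp)

lemma TR_0: "TR n 0 = 0"
  using TR_add[OF S_0 S_0, of n] by simp

lemma TR_uminus: "u \<in> S (Suc n) \<Longrightarrow> TR n (- u) = - TR n u"
  using TR_add[of u n "- u"] S_uminus[of u] TR_0[of n] by (simp add: eq_neg_iff_add_eq_0 add.commute)

lemma TR_diff: "u \<in> S (Suc n) \<Longrightarrow> v \<in> S (Suc n) \<Longrightarrow> TR n (u - v) = TR n u - TR n v"
  using TR_add[of u n "- v"] TR_uminus[of v n] S_uminus[of v] by simp

lemma TR_sum: "(\<And>i. i \<in> A \<Longrightarrow> f i \<in> S (Suc n)) \<Longrightarrow> TR n (sum f A) = (\<Sum>i\<in>A. TR n (f i))"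
  by (induction A rule: infinite_finite_induct) (simp_all add: TR_0 TR_add S_sum)

lemma TR_dl: "u \<in> S (Suc n) \<Longrightarrow> TR n (dl * u) = dl * TR n u"
  by (rule TR_left[OF S_dl])

lemma TR_g:
  assumes "u \<in> S (Suc p)" "v \<in> S (Suc p)"
  shows "TR (Suc p) (u * g (Suc p) * v) = sc z * u * v"
proof -
  interpret A: yokonuma_algebra d "Suc (Suc p)" dl t g X Xi m ev by (rule alg)
  have g: "g (Suc p) \<in> S (Suc (Suc p))" by (rule S_g) auto
  have u: "u \<in> S (Suc (Suc p))" using assms S_mono[of "Suc p" "Suc (Suc p)"] by auto
  \<comment> \<open>The generator g_{p+1} is the element W of the next level with J = p and a = b =
    0, so its prescribed value is z.\<close>
  have "g (Suc p) = W (Suc p) p 0 0" using A.W_0[of p] A.W_Suc[of p p 0 0] by simp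
  then have "TR (Suc p) (g (Suc p)) = sc z"
    using TR_W[of p "Suc p" 0 0] A.W_0[of p] by (simp add: F0_def)
  then show ?thesis
    using TR_right[OF S_mult[OF u g] assms(2)] TR_left[OF assms(1) g] by (simp add: sc_central[OF z_in])
qed

lemma gi_W_g:
  assumes "J < p"
  shows "gi (Suc p) * W p J a b * g (Suc p) = W p J a b * g (Suc p) * gi p"
proof -
  interpret A: yokonuma_algebra d "Suc (Suc p)" dl t g X Xi m ev by (rule alg)
  have "gi (Suc p) * W (Suc p) J a b = W (Suc p) J a b * gi p"
  proof (rule A.W_pass[where e = "gi (Suc p)"])
    show "gi (Suc p) * Gi J = Gi J * gi (Suc p)"
      using inverse_intertwine[of "g (Suc p)" "Gi J" "g (Suc p)" "gi (Suc p)" "gi (Suc p)"]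
        A.g_Gi_far[of J "Suc p"] A.g_gi[of "Suc p"] A.gi_g[of "Suc p"] assms by simp
    show "gi (Suc p) * X = X * gi (Suc p)" using A.X_gi[of "Suc p"] assms by simp
    show "gi (Suc p) * t 1 = t 1 * gi (Suc p)"
      using A.tp_gi_far[of "Suc p" 1 1] assms by (simp add: A.tp_1)
    show "gi (Suc p) * Gp (Suc p) = Gp (Suc p) * gi p" using A.gi_Gp_low[of p "Suc p"] assms by simp
  qed simp
  then show ?thesis by (simp add: A.W_Suc mult.assoc)
qed

text \<open>For u = W with J = p the conjugate is the top element of the next level, with the same
  parameter as value. For J < p the inverse of g_{p+1} passes through and becomes g_p^{-1}; once the
  trace has removed g_{p+1}, it cancels the last factor g_p of W.\<close>

lemma TR_conj_inv:
  assumes "u \<in> S (Suc p)"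
  shows "TR (Suc p) (gi (Suc p) * u * g (Suc p)) = TR p u"
  using assms
proof (induction u rule: S_span)
  case (W J a b w)
  interpret A: yokonuma_algebra d "Suc (Suc p)" dl t g X Xi m ev by (rule alg)
  have w: "w \<in> S (Suc p)" using W S_mono[of p "Suc p"] by auto
  have "gi (Suc p) * (W p J a b * w) * g (Suc p) = gi (Suc p) * W p J a b * g (Suc p) * w"
    using g_S[OF W(2)] by (simp add: mult.assoc)
  also have "TR (Suc p) \<dots> = F0 p J a b * w"
  proof (cases "J < p")
    case True
    then obtain q where q: "p = Suc q" by (cases p) auto
    have in_S: "W p J a b \<in> S (Suc p)" "gi p * w \<in> S (Suc p)"
      using True q w by (auto intro!: S_W S_mult S_gi)
    have "TR (Suc p) (gi (Suc p) * W p J a b * g (Suc p) * w) = TR (Suc p) (W p J a b * g (Suc p) * (gi p * w))"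
      unfolding gi_W_g[OF True] by (simp add: mult.assoc)
    also have "\<dots> = sc z * W q J a b * (g p * gi p) * w"
    proof -
      have "W p J a b = W q J a b * g p" unfolding q by (rule A.W_Suc)
      then show ?thesis unfolding TR_g[OF in_S] by (simp only: mult.assoc)
    qed
    also have "g p * gi p = 1" by (rule A.g_gi) (use q in auto)
    also have "sc z * W q J a b * 1 = F0 p J a b" using True by (simp add: q F0_def)
    finally show ?thesis .
  next
    case False
    then have "J = p" using W by simp
    then have "gi (Suc p) * W p J a b * g (Suc p) = W (Suc p) (Suc p) a b" by (simp add: A.W_top)
    then show ?thesis using TR_W_mult[OF le_refl w, of a b] \<open>J = p\<close> by (simp add: F0_def)
  qed
  finally show ?case using TR_W_mult[OF W] by simp
next
  case (add u v)
  have "gi (Suc p) * u * g (Suc p) \<in> S (Suc (Suc p))" "gi (Suc p) * v * g (Suc p) \<in> S (Suc (Suc p))"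
    by (intro S_mult S_gi_top S_g_top S_Suc add)+
  then show ?case using add(1,2) by (simp add: TR_add add(3,4) distrib_left distrib_right)
qed

text \<open>The average of u over conjugation by powers of t_j, scaled by q - q^{-1}. It is what the
  trace makes of e_{p+1} u g_{p+1} and g_{p+1} u e_{p+1}, up to the factor z.\<close>

definition CC :: "nat \<Rightarrow> 'a \<Rightarrow> 'a"
  where "CC j u = dl * (\<Sum>s<d. tp j (int s) * u * tp j (- int s))"

lemma CC_S: "1 \<le> j \<Longrightarrow> j \<le> n \<Longrightarrow> u \<in> S n \<Longrightarrow> CC j u \<in> S n"
  unfolding CC_def by (intro S_mult S_dl S_sum S_tp)

lemma CC_neg: "CC j u = dl * (\<Sum>s<d. tp j (- int s) * u * tp j (int s))"
proof -
  have "tp j (- (s + int d)) = tp j (- s)" for s using tp_period[of j "- (s + int d)"] by simp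
  then show ?thesis
    using sum_period_uminus[of "\<lambda>s. tp j s * u * tp j (- s)" d] by (simp add: CC_def)
qed

text \<open>The element t_{p+2} commutes with u and turns into t_{p+1} when it passes g_{p+1}; so
  the idempotent becomes conjugation by powers of t_{p+1}.\<close>

lemma
  fixes p
  assumes u: "u \<in> S (Suc p)"
  defines "e \<equiv> de (Suc p) (Suc (Suc p))"
  shows de_u_g: "e * u * g (Suc p) = dl * (\<Sum>s<d. tp (Suc p) (int s) * u * g (Suc p) * tp (Suc p) (- int s))"
    and TR_e_u_g: "TR (Suc p) (e * u * g (Suc p)) = sc z * CC (Suc p) u"
    and TR_g_u_e: "TR (Suc p) (g (Suc p) * u * e) = sc z * CC (Suc p) u"
proof -
  interpret A: yokonuma_algebra d "Suc (Suc p)" dl t g X Xi m ev by (rule alg)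
  let ?t = "tp (Suc p)" and ?t' = "tp (Suc (Suc p))" and ?g = "g (Suc p)"
  have tg: "?t' s * ?g = ?g * ?t s" for s by (rule A.tp_g_2) auto
  have tu: "?t' s * u = u * ?t' s" for s by (rule tp_S[OF u])
  have tS: "?t s \<in> S (Suc p)" for s by (rule S_tp) auto
  have gS: "?g \<in> S (Suc (Suc p))" by (rule S_g) auto
  have uS: "S (Suc p) \<subseteq> S (Suc (Suc p))" by (rule S_mono) simp
  have *: "?t (int s) * ?t' (- int s) * u * ?g = ?t (int s) * u * ?g * ?t (- int s)" for s
  proof -
    have "?t (int s) * ?t' (- int s) * u * ?g = ?t (int s) * (?t' (- int s) * u) * ?g" by (simp add: mult.assoc)
    also have "\<dots> = ?t (int s) * u * (?t' (- int s) * ?g)" unfolding tu by (simp add: mult.assoc)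
    finally show ?thesis unfolding tg by (simp add: mult.assoc)
  qed
  show eug: "e * u * ?g = dl * (\<Sum>s<d. ?t (int s) * u * ?g * ?t (- int s))"
    unfolding e_def A.de_def by (simp add: sum_distrib_right mult.assoc) (simp add: * flip: mult.assoc)
  have s1: "?t (int s) * u * ?g * ?t (- int s) \<in> S (Suc (Suc p))" for s
    using u tS uS gS by (intro S_mult) auto
  show "TR (Suc p) (e * u * ?g) = sc z * CC (Suc p) u"
  proof -
    have "TR (Suc p) (?t (int s) * u * ?g * ?t (- int s)) = sc z * (?t (int s) * u * ?t (- int s))" for s
      unfolding TR_g[OF S_mult[OF tS u] tS] by (simp only: mult.assoc)
    then have "TR (Suc p) (e * u * ?g) = dl * (sc z * (\<Sum>s<d. ?t (int s) * u * ?t (- int s)))"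
      unfolding eug sum_distrib_left[of "sc z"] using s1 by (simp add: TR_dl S_sum TR_sum)
    then show ?thesis unfolding CC_def assoc_swap[OF dl_central] .
  qed
  have **: "?g * u * (?t (int s) * ?t' (- int s)) = ?t (- int s) * ?g * (u * ?t (int s))" for s
  proof -
    have c: "?t (int s) * ?t' (- int s) = ?t' (- int s) * ?t (int s)" by (rule A.tp_comm) auto
    have "?g * u * (?t (int s) * ?t' (- int s)) = ?g * (u * ?t' (- int s)) * ?t (int s)"
      unfolding c by (simp add: mult.assoc)
    also have "\<dots> = (?g * ?t' (- int s)) * u * ?t (int s)" unfolding tu[symmetric] by (simp add: mult.assoc)
    also have "?g * ?t' (- int s) = ?t (- int s) * ?g" using A.tp_g_1[of "Suc p" "- int s"] by simp
    finally show ?thesis by (simp add: mult.assoc)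
  qed
  have "?g * u * e = dl * (\<Sum>s<d. ?g * u * (?t (int s) * ?t' (- int s)))"
    unfolding e_def A.de_def by (simp add: sum_distrib_left mult.assoc) (simp add: dl_central[of "?g"] dl_central[of u] flip: mult.assoc, simp add: dl_central[of u] mult.assoc)
  then have gue: "?g * u * e = dl * (\<Sum>s<d. ?t (- int s) * ?g * (u * ?t (int s)))" unfolding ** .
  have s2: "?t (- int s) * ?g * (u * ?t (int s)) \<in> S (Suc (Suc p))" for s
    using u tS uS gS by (intro S_mult) auto
  show "TR (Suc p) (?g * u * e) = sc z * CC (Suc p) u"
  proof -
    have "TR (Suc p) (?t (- int s) * ?g * (u * ?t (int s))) = sc z * (?t (- int s) * u * ?t (int s))" for s
      unfolding TR_g[OF tS S_mult[OF u tS]] by (simp only: mult.assoc)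
    then have "TR (Suc p) (?g * u * e) = dl * (sc z * (\<Sum>s<d. ?t (- int s) * u * ?t (int s)))"
      unfolding gue sum_distrib_left[of "sc z"] using s2 by (simp add: TR_dl S_sum TR_sum)
    then show ?thesis unfolding CC_neg assoc_swap[OF dl_central] .
  qed
qed

text \<open>The conjugates g u g^{-1} and g^{-1} u g differ by e u g - g u e, and both of these
  terms have the trace \<open>sc z * CC (Suc p) u\<close>.\<close>

lemma TR_conj:
  assumes u: "u \<in> S (Suc p)"
  shows "TR (Suc p) (g (Suc p) * u * gi (Suc p)) = TR p u"
    and TR_g_u_g: "TR (Suc p) (g (Suc p) * u * g (Suc p)) = TR p u + sc z * CC (Suc p) u"
proof -
  interpret A: yokonuma_algebra d "Suc (Suc p)" dl t g X Xi m ev by (rule alg)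
  let ?e = "de (Suc p) (Suc (Suc p))" and ?g = "g (Suc p)" and ?h = "gi (Suc p)"
  have h: "?h = ?g - ?e" by (simp add: A.gi_def)
  have in_S: "u \<in> S (Suc (Suc p))" "?g \<in> S (Suc (Suc p))" "?h \<in> S (Suc (Suc p))" "?e \<in> S (Suc (Suc p))"
    using u S_mono[of "Suc p" "Suc (Suc p)"] by (auto intro!: S_g S_gi S_de)
  have 1: "?g * u * ?g = ?h * u * ?g + ?e * u * ?g" by (simp add: h algebra_simps)
  have 2: "?g * u * ?h = ?h * u * ?g + ?e * u * ?g - ?g * u * ?e" by (simp add: h algebra_simps)
  have e: "TR (Suc p) (?h * u * ?g) = TR p u" "TR (Suc p) (?e * u * ?g) = sc z * CC (Suc p) u"
    "TR (Suc p) (?g * u * ?e) = sc z * CC (Suc p) u"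
    by (rule TR_conj_inv[OF u], rule TR_e_u_g[OF u], rule TR_g_u_e[OF u])
  have S: "?h * u * ?g \<in> S (Suc (Suc p))" "?e * u * ?g \<in> S (Suc (Suc p))" "?g * u * ?e \<in> S (Suc (Suc p))"
    using in_S by (auto intro!: S_mult)
  show "TR (Suc p) (?g * u * ?g) = TR p u + sc z * CC (Suc p) u"
    unfolding 1 using S e by (simp add: TR_add)
  show "TR (Suc p) (?g * u * ?h) = TR p u"
    unfolding 2 using S e by (simp add: TR_add TR_diff S_add)
qed

text \<open>The trace property for the single element t_{p+1}; it is needed to rotate the powers of
  t_{p+1} in \<open>CC\<close>.\<close>

lemma TR_t_commute:
  assumes "Z \<in> S (Suc p)"
  shows "TR p (t (Suc p) * Z) = TR p (Z * t (Suc p))"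
  using assms
proof (induction Z rule: S_span)
  case (W J a b w)
  interpret A: yokonuma_algebra d "Suc (Suc p)" dl t g X Xi m ev by (rule alg)
  have "t (Suc p) * (W p J a b * w) = opt (Suc p) (W p) J a b * w"
    using A.t_W[of "Suc p" p J a b] W by (simp flip: mult.assoc)
  moreover have wt: "W p J a b * w * t (Suc p) = W p J a b * t (Suc p) * w"
    using t_S[OF W(2)] by (simp add: mult.assoc)
  moreover have "TR p (opt (Suc p) (W p) J a b * w) = TR p (W p J a b * t (Suc p) * w)"
  proof (cases "J < p")
    case True
    then obtain q where q: "p = Suc q" by (cases p) auto
    have tw: "t p * w \<in> S p" using W True by (intro S_mult S_t) auto
    have WS: "W q J a b \<in> S p" using True q by (intro S_W) auto
    have "TR p (opt (Suc p) (W p) J a b * w) = F0 p J a b * (t p * w)"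
      using TR_W_mult[OF W(1) tw, of a b] True by (simp add: A.opt_gt mult.assoc)
    also have "\<dots> = sc z * (W q J a b * t p) * w" using True q by (simp add: F0_def mult.assoc)
    also have "\<dots> = TR p (W q J a b * t p * g p * w)"
      using TR_g[of "W q J a b * t p" q w] W WS tw True q by (simp add: S_mult S_t)
    also have "W q J a b * t p * g p = W p J a b * t (Suc p)"
      using A.t_g_1[of p] q by (simp add: A.W_Suc mult.assoc)
    finally show ?thesis .
  next
    case False
    then have J: "J = p" using W by simp
    have "W p p a b * t (Suc p) = W p p a (b + 1)"
      using A.tp_Gp_1[of p 1] A.tp_add[of 1 b 1] by (simp add: A.W_def A.tp_1 mult.assoc)
    then show ?thesis by (simp add: J A.opt_at)
  qed
  ultimately show ?case by simp
next
  case (add u v)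
  have "t (Suc p) * w \<in> S (Suc p)" "w * t (Suc p) \<in> S (Suc p)" if "w \<in> S (Suc p)" for w
    using that by (auto intro!: S_mult S_t)
  then show ?case using add by (simp add: distrib_left distrib_right TR_add)
qed

lemma TR_tp_commute:
  assumes "Z \<in> S (Suc p)"
  shows "TR p (tp (Suc p) s * Z) = TR p (Z * tp (Suc p) s)"
proof -
  have "TR p (t (Suc p) ^ k * Z) = TR p (Z * t (Suc p) ^ k)" for k
    using assms
  proof (induction k arbitrary: Z)
    case (Suc k)
    have "t (Suc p) ^ k * Z \<in> S (Suc p)" "Z * t (Suc p) \<in> S (Suc p)"
      using Suc.prems by (auto intro!: S_mult S_power S_t)
    then show ?case
      using TR_t_commute[of "t (Suc p) ^ k * Z" p] Suc.IH[of "Z * t (Suc p)"] by (simp add: mult.assoc)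
  qed simp
  then show ?thesis by (simp add: tp_def)
qed

text \<open>\<open>CC\<close> is self-adjoint for the pairing given by \<open>TR p (u * v)\<close>:
  in each summand one power of t_{p+1} is rotated to the other end.\<close>

lemma TR_CC:
  assumes u: "u \<in> S (Suc p)" and v: "v \<in> S (Suc p)"
  shows "TR p (CC (Suc p) u * v) = TR p (u * CC (Suc p) v)"
proof -
  let ?t = "tp (Suc p)"
  have tS: "?t s \<in> S (Suc p)" for s by (rule S_tp) auto
  have c: "u * dl = dl * u" by (rule dl_central[symmetric])
  have "TR p (CC (Suc p) u * v) = dl * (\<Sum>s<d. TR p (?t (int s) * (u * ?t (- int s) * v)))"
    using u v tS by (simp add: CC_def sum_distrib_right mult.assoc TR_dl TR_sum S_mult S_sum)
  also have "\<dots> = dl * (\<Sum>s<d. TR p (u * ?t (- int s) * v * ?t (int s)))"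
    using u v tS by (simp add: TR_tp_commute S_mult)
  also have "\<dots> = TR p (u * CC (Suc p) v)"
  proof -
    have "u * CC (Suc p) v = dl * (\<Sum>s<d. u * ?t (- int s) * v * ?t (int s))"
      by (simp only: CC_neg assoc_swap[OF c] sum_distrib_left mult.assoc)
    then show ?thesis using u v tS by (simp add: TR_dl TR_sum S_mult S_sum)
  qed
  finally show ?thesis .
qed

end

subsection \<open>The double trace\<close>

text \<open>With \<psi> an antiderivative of \<phi> on all integers, the function
  \<open>h i - \<psi> (i + 1) - \<psi> (N - i)\<close> is constant. So N may have either
  sign.\<close>

lemma telescope_reflection:
  fixes h \<phi> :: "int \<Rightarrow> 'a::ring_1"
  assumes "\<And>i. h (i + 1) - h i = \<phi> (i + 1) - \<phi> (N - 1 - i)"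
  shows "h N - h 0 = \<phi> N - \<phi> 0"
proof -
  obtain \<psi> where \<psi>: "\<And>i. \<psi> (i + 1) = \<psi> i + \<phi> i"
    using first_order_recurrence[of 1 1 0 UNIV \<phi>] by auto
  define k where "k = (\<lambda>i. h i - \<psi> (i + 1) - \<psi> (N - i))"
  have "k (i + 1) = k i" for i
    using assms[of i] \<psi>[of "i + 1"] \<psi>[of "N - 1 - i"] by (simp add: k_def algebra_simps)
  then have "k i = k 0" for i
    by (induction i rule: int_induct[where k = 0]) (simp_all, metis diff_add_cancel)
  then have "k N = k 0" .
  then show ?thesis using \<psi>[of N] \<psi>[of 0] by (simp add: k_def algebra_simps)
qed

lemma sum_period_reflect:
  fixes h :: "int \<Rightarrow> 'a::comm_monoid_add"
  assumes h: "\<And>s. h (s + int d) = h s"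
  shows "(\<Sum>s<d. h (r - int s)) = (\<Sum>s<d. h (int s))"
proof -
  have p: "h (r + (s + int d)) = h (r + s)" for s using h[of "r + s"] by (simp add: add.assoc)
  have "(\<Sum>s<d. h (r - int s)) = (\<Sum>s<d. h (r + int s))"
    using sum_period_uminus[of "\<lambda>s. h (r + s)" d, OF p] by simp
  also have "\<dots> = (\<Sum>s<d. h (int s))"
    using sum_period_shift[of h d r, OF h] by (simp add: add.commute)
  finally show ?thesis .
qed

context yh_trace
begin

text \<open>This is y^a t_{p+1}^b for the conjugate y = g_p^{-1} ... g_1^{-1} X_1 g_1 ... g_p, which
  commutes with t_{p+1}; the exponents add by \<open>Y_mult\<close>.\<close>

definition Y :: "nat \<Rightarrow> int \<Rightarrow> int \<Rightarrow> 'a"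
  where "Y p a b = W p p a b"

lemma Y_S: "Y p a b \<in> S (Suc p)"
  unfolding Y_def by (intro S_W) auto

lemma Y_mult: "Y p a b * Y p a' b' = Y p (a + a') (b + b')"
proof -
  interpret A: yokonuma_algebra d "Suc (Suc p)" dl t g X Xi m ev by (rule alg)
  have "Y p a b * Y p a' b' = Gi p * (Xp a * (tp 1 b * (Gp p * Gi p) * (Xp a' * (tp 1 b' * Gp p))))"
    by (simp add: Y_def A.W_def mult.assoc)
  also have "\<dots> = Gi p * (Xp a * ((tp 1 b * Xp a') * (tp 1 b' * Gp p)))"
    using A.Gp_Gi[of p] by (simp add: mult.assoc)
  also have "\<dots> = Gi p * ((Xp a * Xp a') * ((tp 1 b * tp 1 b') * Gp p))"
    using A.tp_Xp[of 1 b a'] by (simp add: mult.assoc)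
  also have "\<dots> = Y p (a + a') (b + b')"
    using zpow_add[OF A.X_Xi A.Xi_X, of a a'] A.tp_add[of 1 b b'] by (simp add: Y_def A.W_def)
  finally show ?thesis .
qed

lemma Y_0: "Y p 0 0 = 1"
proof -
  interpret A: yokonuma_algebra d "Suc (Suc p)" dl t g X Xi m ev by (rule alg)
  show ?thesis using A.W_0[of p] by (simp add: Y_def)
qed

lemma tp_Y: "tp (Suc p) s = Y p 0 s"
proof -
  interpret A: yokonuma_algebra d "Suc (Suc p)" dl t g X Xi m ev by (rule alg)
  have "tp (Suc p) s * Y p 0 0 = Y p 0 (0 + s)"
    unfolding Y_def using A.tp_W_top[of p p] by simp
  then show ?thesis by (simp add: Y_0)
qed

lemma Y_zpow: "zpow (Y p 1 0) (Y p (-1) 0) a = Y p a 0"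
proof -
  have inv: "Y p 1 0 * Y p (-1) 0 = 1" "Y p (-1) 0 * Y p 1 0 = 1"
    by (simp_all add: Y_mult Y_0)
  show ?thesis
  proof (induction a rule: int_induct[where k = 0])
    case (step1 i)
    then show ?case using zpow_Suc[OF inv, of i] by (simp add: Y_mult add.commute)
  next
    case (step2 i)
    then show ?case using zpow_pred[OF inv, of i] by (simp add: Y_mult)
  qed (simp add: Y_0)
qed

lemma TR_Y: "TR p (Y p a b) = sc (x a b)"
  using TR_W[of p p a b] by (simp add: Y_def F0_def)

text \<open>Conjugation by g_{p+2} g_{p+1} carries y to its analogue at the next level and, by the
  braid relation, g_{p+1} to g_{p+2}; so the relation is transported from X_1 and g_1.\<close>

lemma Y_braid: "Y p 1 0 * g (Suc p) * Y p 1 0 * g (Suc p) = g (Suc p) * Y p 1 0 * g (Suc p) * Y p 1 0"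
proof (induction p)
  case 0
  interpret A: yokonuma_algebra d 2 dl t g X Xi m ev by (rule alg)
  show ?case using A.X_braid by (simp add: Y_def A.W_def)
next
  case (Suc p)
  interpret A: yokonuma_algebra d "Suc (Suc (Suc p))" dl t g X Xi m ev by (rule alg)
  let ?y = "Y p 1 0" and ?g1 = "g (Suc p)" and ?g2 = "g (Suc (Suc p))" and ?h1 = "gi (Suc p)" and ?h2 = "gi (Suc (Suc p))"
  have gh: "?g1 * ?h1 = 1" "?h1 * ?g1 = 1" "?g2 * ?h2 = 1" "?h2 * ?g2 = 1"
    using A.g_gi A.gi_g by simp_all
  have cancel: "?g1 * (?h1 * w) = w" "?h1 * (?g1 * w) = w" "?g2 * (?h2 * w) = w" "?h2 * (?g2 * w) = w" for w
    using gh by (simp_all flip: mult.assoc)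
  have y2: "?y * (?g2 * w) = ?g2 * (?y * w)" for w
    using assoc_swap[OF g_S[OF Y_S[of p 1 0]]] by simp
  \<comment> \<open>As y commutes with g_{p+2}, the pair g_{p+2}^{-1}, g_{p+2} may be inserted
    around it.\<close>
  have Y': "Y (Suc p) 1 0 = ?h1 * (?h2 * (?y * (?g2 * ?g1)))"
    by (simp add: y2 cancel) (simp add: Y_def A.W_top mult.assoc)
  have g2: "?g2 = ?h1 * (?h2 * (?g1 * (?g2 * ?g1)))"
    using A.g_braid[of "Suc p"] by (simp add: cancel)
  define c c' where "c = ?g2 * ?g1" and "c' = ?h1 * ?h2"
  have cc: "c * c' = 1" using gh by (simp add: c_def c'_def mult.assoc cancel)
  have conj: "(c' * u * c) * (c' * v * c) = c' * (u * v) * c" for u v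
  proof -
    have "(c' * u * c) * (c' * v * c) = c' * u * (c * c') * (v * c)" by (simp only: mult.assoc)
    then show ?thesis by (simp add: cc mult.assoc)
  qed
  have Yc: "Y (Suc p) 1 0 = c' * ?y * c" and gc: "?g2 = c' * ?g1 * c"
    using Y' g2 by (simp_all add: c_def c'_def mult.assoc)
  have "Y (Suc p) 1 0 * ?g2 = c' * (?y * ?g1) * c" "?g2 * Y (Suc p) 1 0 = c' * (?g1 * ?y) * c"
    unfolding Yc by (subst gc, rule conj)+
  then have "(Y (Suc p) 1 0 * ?g2) * (Y (Suc p) 1 0 * ?g2) = c' * ((?y * ?g1) * (?y * ?g1)) * c"
    "(?g2 * Y (Suc p) 1 0) * (?g2 * Y (Suc p) 1 0) = c' * ((?g1 * ?y) * (?g1 * ?y)) * c"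
    by (simp_all only: conj)
  moreover have "(?y * ?g1) * (?y * ?g1) = (?g1 * ?y) * (?g1 * ?y)"
    using Suc by (simp only: mult.assoc)
  ultimately have "(Y (Suc p) 1 0 * ?g2) * (Y (Suc p) 1 0 * ?g2) = (?g2 * Y (Suc p) 1 0) * (?g2 * Y (Suc p) 1 0)"
    by simp
  then show ?case by (simp only: mult.assoc)
qed

text \<open>\<open>braid_commutator\<close> multiplied on the right by t_{p+2}^b. This factor passes
  y and becomes t_{p+1}^b at g_{p+1}, which supplies the exponent b.\<close>

lemma Y_commutator:
  fixes p a b
  defines "G \<equiv> g (Suc p)" and "H \<equiv> gi (Suc p)" and "e \<equiv> de (Suc p) (Suc (Suc p))"
  shows "Y p 1 0 * (H * Y p a b * G) = H * Y p a b * G * Y p 1 0 + e * (Y p 1 b * G * Y p a 0 - Y p (a + 1) b * G)"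
proof -
  interpret A: yokonuma_algebra d "Suc (Suc p)" dl t g X Xi m ev by (rule alg)
  let ?t' = "tp (Suc (Suc p)) b"
  have "Y p 1 0 * H * zpow (Y p 1 0) (Y p (-1) 0) a * G = H * zpow (Y p 1 0) (Y p (-1) 0) a * G * Y p 1 0
      + e * (Y p 1 0 * G * zpow (Y p 1 0) (Y p (-1) 0) a - zpow (Y p 1 0) (Y p (-1) 0) (a + 1) * G)"
  proof (rule braid_commutator)
    show "Y p 1 0 * Y p (- 1) 0 = 1" "Y p (- 1) 0 * Y p 1 0 = 1" by (simp_all add: Y_mult Y_0)
    show "G * H = 1" "H * G = 1" "H = G - e" "e * G = G * e"
      unfolding G_def H_def e_def using A.g_gi[of "Suc p"] A.gi_g[of "Suc p"] A.de_g[of "Suc p"] by (simp_all add: A.gi_def)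
    show "e * Y p 1 0 = Y p 1 0 * e"
      unfolding e_def by (rule A.de_intertwine) (simp_all add: tp_Y[of p] Y_mult tp_S[OF Y_S])
    show "Y p 1 0 * G * Y p 1 0 * G = G * Y p 1 0 * G * Y p 1 0" unfolding G_def by (rule Y_braid)
  qed
  then have 1: "Y p 1 0 * H * Y p a 0 * G = H * Y p a 0 * G * Y p 1 0 + e * (Y p 1 0 * G * Y p a 0 - Y p (a + 1) 0 * G)"
    unfolding Y_zpow .
  have t'Y: "?t' * Y p c 0 = Y p c 0 * ?t'" for c by (rule tp_S[OF Y_S])
  have Gt: "Y p c 0 * G * ?t' = Y p c b * G" for c
  proof -
    have "Y p c 0 * G * ?t' = Y p c 0 * (tp (Suc p) b * G)"
      unfolding G_def using A.tp_g_1[of "Suc p" b] by (simp add: mult.assoc)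
    then show ?thesis by (simp add: tp_Y Y_mult flip: mult.assoc)
  qed
  have "Y p 1 0 * (H * Y p a b * G) = (Y p 1 0 * H * Y p a 0 * G) * ?t'"
    using Gt[of a] by (simp add: mult.assoc)
  also have "\<dots> = H * (Y p a 0 * G * ?t') * Y p 1 0 + e * ((Y p 1 0 * G * ?t') * Y p a 0 - Y p (a + 1) 0 * G * ?t')"
    unfolding 1 by (simp add: distrib_right left_diff_distrib mult.assoc t'Y)
  also have "\<dots> = H * Y p a b * G * Y p 1 0 + e * (Y p 1 b * G * Y p a 0 - Y p (a + 1) b * G)"
    unfolding Gt by (simp add: mult.assoc)
  finally show ?thesis .
qed

abbreviation T2 :: "nat \<Rightarrow> 'a \<Rightarrow> 'a"
  where "T2 p Z \<equiv> TR p (TR (Suc p) Z)"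

text \<open>A convolution of the parameters over a period: the part without z in the double trace of
  \<open>T2_e_YgYg\<close>. By \<open>Q_shift\<close> it depends on b and c through b + c
  only.\<close>

definition Q :: "int \<Rightarrow> int \<Rightarrow> int \<Rightarrow> int \<Rightarrow> 'a"
  where "Q i j b c = dl * (\<Sum>s<d. sc (x i (b + int s)) * sc (x j (c - int s)))"

text \<open>The substitution of c - b - s for s exchanges the two factors, which are
  central.\<close>

lemma Q_sym: "Q i j b c = Q j i b c"
proof -
  define h where "h = (\<lambda>s. sc (x j (b + s)) * sc (x i (c - s)))"
  have "h (s + int d) = h s" for s
    using x_period[of j "b + s"] x_period[of i "c - (s + int d)"] by (simp add: h_def add.assoc)
  then have "(\<Sum>s<d. h (c - b - int s)) = (\<Sum>s<d. h (int s))" by (rule sum_period_reflect)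
  moreover have "h (c - b - s) = sc (x i (b + s)) * sc (x j (c - s))" for s
    using sc_central[OF x_in, of j "c - s" "sc (x i (b + s))"] by (simp add: h_def)
  ultimately show ?thesis by (simp add: Q_def h_def)
qed

lemma CC_Y: "CC (Suc p) (Y p a b) = dl * (of_nat d * Y p a b)"
  by (simp add: CC_def tp_Y Y_mult)

lemma T2_gYg:
  assumes u: "u \<in> S (Suc p)" and v: "v \<in> S (Suc p)"
  shows "T2 p (u * g (Suc p) * v * g (Suc p)) = TR p u * TR p v + sc z * TR p (u * CC (Suc p) v)"
    and "T2 p (g (Suc p) * u * g (Suc p) * v) = TR p u * TR p v + sc z * TR p (CC (Suc p) u * v)"
proof -
  have gvg: "g (Suc p) * w * g (Suc p) \<in> S (Suc (Suc p))" if "w \<in> S (Suc p)" for w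
    by (intro S_mult S_g_top S_Suc that)
  have C: "CC (Suc p) w \<in> S (Suc p)" if "w \<in> S (Suc p)" for w using that by (intro CC_S) auto
  have sz: "sc z \<in> S p" by (rule S_sc[OF z_in])
  have "TR (Suc p) (u * (g (Suc p) * v * g (Suc p))) = u * (TR p v + sc z * CC (Suc p) v)"
    unfolding TR_left[OF u gvg[OF v]] TR_g_u_g[OF v] ..
  also have "\<dots> = u * TR p v + sc z * (u * CC (Suc p) v)"
    using assoc_swap[OF sc_central[OF z_in, of u]] by (simp add: distrib_left)
  also have "TR p \<dots> = TR p u * TR p v + sc z * TR p (u * CC (Suc p) v)"
    using TR_right[OF u TR_S[OF v]] TR_left[OF sz S_mult[OF u C[OF v]]]
      TR_add[OF S_mult[OF u S_Suc[OF TR_S[OF v]]] S_mult[OF S_Suc[OF sz] S_mult[OF u C[OF v]]]] by simp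
  finally show "T2 p (u * g (Suc p) * v * g (Suc p)) = TR p u * TR p v + sc z * TR p (u * CC (Suc p) v)"
    by (simp add: mult.assoc)
  have "TR (Suc p) (g (Suc p) * u * g (Suc p) * v) = TR p u * v + sc z * (CC (Suc p) u * v)"
    unfolding TR_right[OF gvg[OF u] v] TR_g_u_g[OF u] by (simp add: distrib_right mult.assoc)
  also have "TR p \<dots> = TR p u * TR p v + sc z * TR p (CC (Suc p) u * v)"
    using TR_left[OF TR_S[OF u] v] TR_left[OF sz S_mult[OF C[OF u] v]]
      TR_add[OF S_mult[OF S_Suc[OF TR_S[OF u]] v] S_mult[OF S_Suc[OF sz] S_mult[OF C[OF u] v]]] by simp
  finally show "T2 p (g (Suc p) * u * g (Suc p) * v) = TR p u * TR p v + sc z * TR p (CC (Suc p) u * v)" .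
qed

lemma TR_of_nat: "u \<in> S (Suc n) \<Longrightarrow> TR n (of_nat k * u) = of_nat k * TR n u \<and> of_nat k * u \<in> S (Suc n)"
  by (induction k) (simp_all add: TR_0 S_0 TR_add S_add distrib_right)

lemma T2_Y: "TR p (dl * (of_nat d * Y p i b)) = dl * (of_nat d * sc (x i b))"
  using TR_of_nat[OF Y_S[of p i b], of d] by (simp add: TR_dl TR_Y)

text \<open>The idempotent is spread over the two factors Y as in \<open>de_u_g\<close>, and each
  summand is a case of \<open>T2_gYg\<close>. The term with z depends only on i + j and b + c, which
  makes it cancel in differences.\<close>

lemma T2_e_YgYg:
  "T2 p (de (Suc p) (Suc (Suc p)) * Y p i b * g (Suc p) * Y p j c * g (Suc p)) =
    Q i j b c + dl * (of_nat d * (sc z * (dl * (of_nat d * sc (x (i + j) (b + c))))))"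
proof -
  let ?g = "g (Suc p)" and ?K = "sc z * (dl * (of_nat d * sc (x (i + j) (b + c))))"
  have T: "T2 p (Y p i (b + int s) * ?g * Y p j (c - int s) * ?g) =
      sc (x i (b + int s)) * sc (x j (c - int s)) + ?K" for s
  proof -
    have "Y p i (b + int s) * CC (Suc p) (Y p j (c - int s)) =
        dl * (of_nat d * (Y p i (b + int s) * Y p j (c - int s)))"
      unfolding CC_Y assoc_swap[OF dl_central[of "Y p i (b + int s)", symmetric]]
        assoc_swap[OF mult_of_nat_commute[of d "Y p i (b + int s)", symmetric]] ..
    then have "Y p i (b + int s) * CC (Suc p) (Y p j (c - int s)) = dl * (of_nat d * Y p (i + j) (b + c))"
      by (simp add: Y_mult)
    then show ?thesis by (simp add: T2_gYg(1)[OF Y_S Y_S] TR_Y T2_Y)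
  qed
  have in_S: "Y p i (b + int s) * ?g * Y p j (c - int s) * ?g \<in> S (Suc (Suc p))" for s
    by (intro S_mult S_g_top S_Suc[OF Y_S])
  have tpY: "tp (Suc p) r * Y p k l = Y p k (l + r)" for r k l
    by (simp add: tp_Y Y_mult add.commute)
  have e: "tp (Suc p) (int s) * Y p i b * ?g * tp (Suc p) (- int s) * (Y p j c * ?g) =
      Y p i (b + int s) * ?g * Y p j (c - int s) * ?g" for s
  proof -
    have "tp (Suc p) (int s) * Y p i b * ?g * tp (Suc p) (- int s) * (Y p j c * ?g) =
        (tp (Suc p) (int s) * Y p i b) * ?g * (tp (Suc p) (- int s) * Y p j c) * ?g"
      by (simp only: mult.assoc)
    then show ?thesis unfolding tpY by simp
  qed
  have "de (Suc p) (Suc (Suc p)) * Y p i b * ?g * Y p j c * ?g =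
      (de (Suc p) (Suc (Suc p)) * Y p i b * ?g) * (Y p j c * ?g)" by (simp only: mult.assoc)
  also have "\<dots> = dl * (\<Sum>s<d. Y p i (b + int s) * ?g * Y p j (c - int s) * ?g)"
    unfolding de_u_g[OF Y_S] mult.assoc[of dl] sum_distrib_right e ..
  finally have "T2 p (de (Suc p) (Suc (Suc p)) * Y p i b * ?g * Y p j c * ?g) =
      dl * (\<Sum>s<d. T2 p (Y p i (b + int s) * ?g * Y p j (c - int s) * ?g))"
    using in_S TR_S[OF in_S] by (simp add: TR_dl TR_sum S_sum)
  then show ?thesis unfolding T Q_def by (simp add: sum.distrib distrib_left)
qed

lemma Q_shift: "Q i j b c = dl * (\<Sum>s<d. sc (x i (r + int s)) * sc (x j (b + c - r - int s)))"
proof -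
  define h where "h = (\<lambda>s. sc (x i s) * sc (x j (b + c - s)))"
  have "h (s + int d) = h s" for s
  proof -
    have "x j (b + c - s) = x j (b + c - (s + int d))"
      using x_period[of j "b + c - (s + int d)"] by (simp add: algebra_simps)
    then show ?thesis using x_period[of i s] by (simp add: h_def)
  qed
  from sum_period_shift[of h d b, OF this] sum_period_shift[of h d r, OF this]
  have "(\<Sum>s<d. h (int s + b)) = (\<Sum>s<d. h (int s + r))" by simp
  moreover have "h (int s + b) = sc (x i (b + int s)) * sc (x j (c - int s))"
    "h (int s + r) = sc (x i (r + int s)) * sc (x j (b + c - r - int s))" for s
    by (simp_all add: h_def algebra_simps)
  ultimately show ?thesis by (simp add: Q_def)
qed

lemma Q_neg: "Q i j b c = dl * (\<Sum>s<d. sc (x i (- int s)) * sc (x j (b + c + int s)))"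
proof -
  define h where "h = (\<lambda>s. sc (x i s) * sc (x j (b + c - s)))"
  have "h (s + int d) = h s" for s
  proof -
    have "x j (b + c - s) = x j (b + c - (s + int d))"
      using x_period[of j "b + c - (s + int d)"] by (simp add: algebra_simps)
    then show ?thesis using x_period[of i s] by (simp add: h_def)
  qed
  from sum_period_uminus[of h d, OF this]
  show ?thesis unfolding Q_shift[of i j b c 0] by (simp add: h_def)
qed

lemma TR_sc_Y_sum:
  shows "TR p (dl * (\<Sum>s<d. sc (x (i s) (j s)) * Y p (k s) (l s))) = dl * (\<Sum>s<d. sc (x (i s) (j s)) * sc (x (k s) (l s)))"
    and "dl * (\<Sum>s<d. sc (x (i s) (j s)) * Y p (k s) (l s)) \<in> S (Suc p)"
proof -
  define h where "h = (\<lambda>s. sc (x (i s) (j s)) * Y p (k s) (l s))"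
  have Tx: "TR p (h s) = sc (x (i s) (j s)) * sc (x (k s) (l s))" for s
    unfolding h_def TR_sc[OF Y_S x_in] TR_Y ..
  have h: "h s \<in> S (Suc p)" for s
    unfolding h_def by (intro S_mult S_sc[OF x_in] Y_S)
  have hs: "sum h {..<d} \<in> S (Suc p)" by (rule S_sum) (rule h)
  then have "dl * sum h {..<d} \<in> S (Suc p)" by (intro S_mult S_dl)
  moreover have "TR p (dl * sum h {..<d}) = dl * (\<Sum>s<d. TR p (h s))"
    unfolding TR_dl[OF hs] using TR_sum[of "{..<d}" h p] h by simp
  ultimately show "TR p (dl * (\<Sum>s<d. sc (x (i s) (j s)) * Y p (k s) (l s))) = dl * (\<Sum>s<d. sc (x (i s) (j s)) * sc (x (k s) (l s)))"
    and "dl * (\<Sum>s<d. sc (x (i s) (j s)) * Y p (k s) (l s)) \<in> S (Suc p)"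
    unfolding Tx by (simp_all only: h_def)
qed

text \<open>Only a power of t_{p+1} separates the last two factors g. It moves out to the left, and
  g^2 = 1 + (q - q^{-1}) g e leaves a term linear in g, a term with e, and a term in which g^{-1} Y
  g is the element Y of the next level; each has a known trace.\<close>

lemma T2_end:
  fixes p N a b c
  defines "G \<equiv> g (Suc p)" and "H \<equiv> gi (Suc p)"
  shows "T2 p (Y p N 0 * (H * Y p a b * G) * Y p 0 c * G) = sc z * sc (x (N + a) (b + c)) - Q 0 (a + N) b c + Q N a b c"
proof -
  interpret A: yokonuma_algebra d "Suc (Suc p)" dl t g X Xi m ev by (rule alg)
  define e where "e = de (Suc p) (Suc (Suc p))"
  let ?t = "tp (Suc p)" and ?t' = "tp (Suc (Suc p))"
  have GS: "G \<in> S (Suc (Suc p))" "H \<in> S (Suc (Suc p))" "e \<in> S (Suc (Suc p))" "?t s \<in> S (Suc p)" "?t' s \<in> S (Suc (Suc p))"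
    "Y p a b \<in> S (Suc (Suc p))" "Y p a b \<in> S (Suc p)" for s a b
    unfolding G_def H_def e_def by (auto intro!: S_g_top S_gi_top S_de S_tp S_Suc[OF Y_S] Y_S)
  have tS: "?t s \<in> S (Suc (Suc p))" for s by (rule S_tp) auto
  have tt: "?t r * ?t' s \<in> S (Suc (Suc p))" for r s by (intro S_mult tS GS)
  have t'Y: "?t' s * Y p i j = Y p i j * ?t' s" for s i j by (rule tp_S[OF Y_S])
  have Gt: "G * ?t s = ?t' s * G" "G * ?t' s = ?t s * G" "?t s * H = H * ?t' s" for s
    unfolding G_def H_def using A.tp_g_2[of "Suc p" s] A.tp_g_1[of "Suc p" s] A.tp_gi_1[of "Suc p" s] by simp_all
  have GG: "G * G = 1 + G * e"
    unfolding G_def e_def using A.g_square_de[of "Suc p"] A.de_g[of "Suc p"] by simp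
  have "Y p N 0 * (H * Y p a b * G) * Y p 0 c * G = Y p N 0 * H * Y p a b * (G * ?t c) * G"
    by (simp add: tp_Y mult.assoc)
  also have "\<dots> = Y p N 0 * H * (Y p a b * ?t' c) * (G * G)" unfolding Gt by (simp add: mult.assoc)
  also have "\<dots> = Y p N 0 * (H * ?t' c) * Y p a b * (G * G)" unfolding t'Y[symmetric] by (simp add: mult.assoc)
  also have "\<dots> = (Y p N 0 * ?t c) * (H * Y p a b * (G * G))" unfolding Gt(3)[symmetric] by (simp add: mult.assoc)
  also have "Y p N 0 * ?t c = Y p N c" by (simp add: tp_Y Y_mult)
  also have "H * Y p a b * (G * G) = G * Y p a b * 1 - e * Y p a b + H * Y p a b * G * e"
  proof -
    have "H = G - e" by (simp add: G_def H_def e_def A.gi_def)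
    then have "H * Y p a b = G * Y p a b * 1 - e * Y p a b" by (simp add: left_diff_distrib)
    then show ?thesis unfolding GG by (simp add: distrib_left mult.assoc)
  qed
  finally have 1: "Y p N 0 * (H * Y p a b * G) * Y p 0 c * G = Y p N c * (G * Y p a b * 1 - e * Y p a b + H * Y p a b * G * e)" .
  have TG: "TR (Suc p) (G * Y p a b * 1) = sc z * Y p a b"
    using TR_g[OF S_1 Y_S, of p a b] by (simp add: G_def)
  have TRt': "TR (Suc p) (?t' s) = sc (x 0 s)" for s
    using TR_Y[of "Suc p" 0 s] by (simp add: tp_Y)
  have Te: "TR (Suc p) (e * Y p a b) = dl * (\<Sum>s<d. sc (x 0 (- int s)) * Y p a (b + int s))"
  proof -
    have "e = dl * (\<Sum>s<d. ?t (int s) * ?t' (- int s))" by (simp add: e_def A.de_def)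
    then have "TR (Suc p) e = dl * (\<Sum>s<d. ?t (int s) * sc (x 0 (- int s)))"
      using tt GS(4,5) by (simp add: TR_dl TR_sum S_sum TR_left TRt')
    moreover have "?t (int s) * sc (x 0 (- int s)) * Y p a b = sc (x 0 (- int s)) * Y p a (b + int s)" for s
    proof -
      have "?t (int s) * sc (x 0 (- int s)) * Y p a b = sc (x 0 (- int s)) * (?t (int s) * Y p a b)"
        unfolding sc_central[OF x_in[of 0 "- int s"], of "?t (int s)", symmetric] by (rule mult.assoc)
      then show ?thesis by (simp add: tp_Y Y_mult add.commute)
    qed
    ultimately show ?thesis
      unfolding TR_right[OF GS(3) Y_S] by (simp add: sum_distrib_right mult.assoc)
  qed
  have TH: "TR (Suc p) (H * Y p a b * G * e) = dl * (\<Sum>s<d. sc (x a (b - int s)) * Y p 0 (int s))"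
  proof -
    have HYG: "H * Y p a b * G * (?t (int s) * ?t' (- int s)) = Y (Suc p) a (b - int s) * ?t (int s)" for s
    proof -
      have "H * Y p a b * G * (?t (int s) * ?t' (- int s)) = H * Y p a b * (G * ?t' (- int s)) * ?t (int s)"
        using A.tp_comm[of "Suc p" "Suc (Suc p)" "int s" "- int s"] by (simp add: mult.assoc)
      also have "\<dots> = H * (Y p a b * ?t (- int s)) * G * ?t (int s)" unfolding Gt by (simp add: mult.assoc)
      also have "Y p a b * ?t (- int s) = Y p a (b - int s)" by (simp add: tp_Y Y_mult)
      finally show ?thesis by (simp add: Y_def A.W_top G_def H_def)
    qed
    have "H * Y p a b * G * e = dl * (\<Sum>s<d. H * Y p a b * G * (?t (int s) * ?t' (- int s)))"
      by (simp only: e_def A.de_def assoc_swap[OF dl_central[of "H * Y p a b * G", symmetric]] sum_distrib_left)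
    then have "TR (Suc p) (H * Y p a b * G * e) = dl * (\<Sum>s<d. TR (Suc p) (Y (Suc p) a (b - int s) * ?t (int s)))"
      unfolding HYG using S_mult[OF Y_S tS] by (simp add: TR_dl TR_sum S_sum)
    then show ?thesis using GS by (simp add: TR_right[OF Y_S] TR_Y tp_Y)
  qed
  let ?R = "sc z * Y p a b - dl * (\<Sum>s<d. sc (x 0 (- int s)) * Y p a (b + int s)) + dl * (\<Sum>s<d. sc (x a (b - int s)) * Y p 0 (int s))"
  have "TR (Suc p) (G * Y p a b * 1 - e * Y p a b + H * Y p a b * G * e) = ?R"
    using GS by (simp add: TR_add TR_diff S_mult S_diff Te TH) (use TG in simp)
  moreover have "G * Y p a b * 1 - e * Y p a b + H * Y p a b * G * e \<in> S (Suc (Suc p))"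
    by (intro S_add S_diff S_mult S_1 GS)
  ultimately have 2: "TR (Suc p) (Y p N 0 * (H * Y p a b * G) * Y p 0 c * G) = Y p N c * ?R"
    unfolding 1 by (simp only: TR_left[OF Y_S])
  have sS: "sc (x i j) \<in> S k" for i j k by (rule S_sc[OF x_in])
  have Ysc: "Y p N c * (sc (x i j) * Y p k l) = sc (x i j) * Y p (N + k) (c + l)" for i j k l
    unfolding assoc_swap[OF sc_central[OF x_in[of i j], of "Y p N c", symmetric]] Y_mult ..
  have Yz: "Y p N c * (sc z * Y p k l) = sc z * Y p (N + k) (c + l)" for k l
    unfolding assoc_swap[OF sc_central[OF z_in, of "Y p N c", symmetric]] Y_mult ..
  have 3: "Y p N c * ?R = sc z * Y p (N + a) (c + b)
      - dl * (\<Sum>s<d. sc (x 0 (- int s)) * Y p (N + a) (c + (b + int s)))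
      + dl * (\<Sum>s<d. sc (x a (b - int s)) * Y p (N + 0) (c + int s))"
    by (simp only: distrib_left right_diff_distrib assoc_swap[OF dl_central[of "Y p N c", symmetric]]
        sum_distrib_left[of "Y p N c"] Ysc Yz)
  have 4: "TR p (sc z * Y p (N + a) (c + b)
      - dl * (\<Sum>s<d. sc (x 0 (- int s)) * Y p (N + a) (c + (b + int s)))
      + dl * (\<Sum>s<d. sc (x a (b - int s)) * Y p (N + 0) (c + int s))) = sc z * sc (x (N + a) (c + b))
      - dl * (\<Sum>s<d. sc (x 0 (- int s)) * sc (x (N + a) (c + (b + int s))))
      + dl * (\<Sum>s<d. sc (x a (b - int s)) * sc (x (N + 0) (c + int s)))"
  proof -
    let ?A = "dl * (\<Sum>s<d. sc (x 0 (- int s)) * Y p (N + a) (c + (b + int s)))"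
      and ?B = "dl * (\<Sum>s<d. sc (x a (b - int s)) * Y p (N + 0) (c + int s))"
    have z: "TR p (sc z * Y p (N + a) (c + b)) = sc z * sc (x (N + a) (c + b))" "sc z * Y p (N + a) (c + b) \<in> S (Suc p)"
      unfolding TR_sc[OF Y_S z_in] TR_Y by (rule refl) (intro S_mult S_sc z_in Y_S)
    note A = TR_sc_Y_sum[where i = "\<lambda>s. 0" and j = "\<lambda>s. - int s" and k = "\<lambda>s. N + a" and l = "\<lambda>s. c + (b + int s)" and p = p]
    note B = TR_sc_Y_sum[where i = "\<lambda>s. a" and j = "\<lambda>s. b - int s" and k = "\<lambda>s. N + 0" and l = "\<lambda>s. c + int s" and p = p]
    have "TR p (sc z * Y p (N + a) (c + b) - ?A + ?B) = TR p (sc z * Y p (N + a) (c + b)) - TR p ?A + TR p ?B"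
      unfolding TR_add[OF S_diff[OF z(2) A(2)] B(2)] TR_diff[OF z(2) A(2)] ..
    then show ?thesis unfolding z A(1) B(1) .
  qed
  have 5: "dl * (\<Sum>s<d. sc (x 0 (- int s)) * sc (x (N + a) (c + (b + int s)))) = Q 0 (a + N) b c"
  proof -
    have "a + N = N + a" "b + c + int s = c + (b + int s)" for s by simp_all
    then have "sc (x 0 (- int s)) * sc (x (N + a) (c + (b + int s))) = sc (x 0 (- int s)) * sc (x (a + N) (b + c + int s))" for s
      by metis
    then show ?thesis unfolding Q_neg[of 0 "a + N" b c] by (intro arg_cong[where f = "\<lambda>u. dl * u"] sum.cong refl)
  qed
  have 6: "dl * (\<Sum>s<d. sc (x a (b - int s)) * sc (x (N + 0) (c + int s))) = Q N a b c"
  proof -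
    have "sc (x a (b - int s)) * sc (x (N + 0) (c + int s)) = sc (x N (c + int s)) * sc (x a (b + c - c - int s))" for s
      using sc_central[OF x_in, of a "b - int s" "sc (x N (c + int s))"] by simp
    then show ?thesis unfolding Q_shift[of N a b c c] by (intro arg_cong[where f = "\<lambda>u. dl * u"] sum.cong refl)
  qed
  show ?thesis unfolding 2 3 4 5 6 unfolding add.commute[of c b] ..
qed

text \<open>\<open>h\<close> and \<open>\<phi>\<close> are the functions of \<open>telescope_reflection\<close>: \<open>h 0\<close> is the quantity wanted, and in
  \<open>h n\<close> the last two factors \<open>g\<close> become adjacent, so that the quadratic relation applies.\<close>

lemma T2_Y_Y:
  fixes p a b n c
  defines "G \<equiv> g (Suc p)" and "H \<equiv> gi (Suc p)"
  shows "T2 p (H * Y p a b * G * Y p n c * G) = sc z * sc (x (a + n) (b + c))"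
proof -
  interpret A: yokonuma_algebra d "Suc (Suc p)" dl t g X Xi m ev by (rule alg)
  define e where "e = de (Suc p) (Suc (Suc p))"
  define Z where "Z = H * Y p a b * G"
  define h where "h = (\<lambda>i. T2 p (Y p i 0 * Z * Y p (n - i) c * G))"
  define \<phi> where "\<phi> = (\<lambda>j. Q j (a + n - j) b c)"
  have GS: "G \<in> S (Suc (Suc p))" "e \<in> S (Suc (Suc p))" "Z \<in> S (Suc (Suc p))" "Y p a b \<in> S (Suc (Suc p))" for a b
    unfolding Z_def G_def H_def e_def by (auto intro!: S_mult S_g_top S_gi_top S_de S_Suc[OF Y_S])
  have T2_diff: "T2 p (u - v) = T2 p u - T2 p v" if "u \<in> S (Suc (Suc p))" "v \<in> S (Suc (Suc p))" for u v
    using that by (simp add: TR_diff TR_S)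
  have eY: "Y p i 0 * e = e * Y p i 0" for i
    unfolding e_def by (rule A.de_intertwine[symmetric]) (simp_all add: tp_Y[of p] Y_mult tp_S[OF Y_S])
  have comm: "Y p 1 0 * Z - Z * Y p 1 0 = e * (Y p 1 b * G * Y p a 0 - Y p (a + 1) b * G)"
    using Y_commutator[of p a b] by (simp add: Z_def G_def H_def e_def)
  have "h (i + 1) - h i = \<phi> (i + 1) - \<phi> (n - 1 - i)" for i
  proof -
    have Y1: "Y p (i + 1) 0 = Y p i 0 * Y p 1 0" "Y p (n - i) c = Y p 1 0 * Y p (n - 1 - i) c"
      by (simp_all add: Y_mult)
    have "h (i + 1) - h i = T2 p (Y p (i + 1) 0 * Z * Y p (n - (i + 1)) c * G - Y p i 0 * Z * Y p (n - i) c * G)"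
      unfolding h_def using GS by (intro T2_diff[symmetric] S_mult)
    also have "Y p (i + 1) 0 * Z * Y p (n - (i + 1)) c * G - Y p i 0 * Z * Y p (n - i) c * G
        = Y p i 0 * (Y p 1 0 * Z - Z * Y p 1 0) * Y p (n - 1 - i) c * G"
      unfolding Y1 by (simp add: algebra_simps)
    also have "\<dots> = (Y p i 0 * e) * (Y p 1 b * G * Y p a 0 - Y p (a + 1) b * G) * Y p (n - 1 - i) c * G"
      unfolding comm by (simp only: mult.assoc)
    also have "\<dots> = e * (Y p i 0 * Y p 1 b) * G * (Y p a 0 * Y p (n - 1 - i) c) * G
        - e * (Y p i 0 * Y p (a + 1) b) * G * Y p (n - 1 - i) c * G"
      unfolding eY by (simp add: left_diff_distrib right_diff_distrib mult.assoc)
    also have "T2 p \<dots> = T2 p (e * Y p (i + 1) b * G * Y p (a + (n - 1 - i)) c * G)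
        - T2 p (e * Y p (i + (a + 1)) b * G * Y p (n - 1 - i) c * G)"
      unfolding Y_mult using GS by (subst T2_diff) (auto intro!: S_mult)
    \<comment> \<open>In both terms the exponents of y add up to a + n, so the z-terms of
      \<open>T2_e_YgYg\<close> cancel.\<close>
    also have "\<dots> = Q (i + 1) (a + (n - 1 - i)) b c - Q (i + (a + 1)) (n - 1 - i) b c"
      unfolding e_def G_def T2_e_YgYg by (simp add: algebra_simps)
    also have "Q (i + (a + 1)) (n - 1 - i) b c = \<phi> (n - 1 - i)"
      unfolding \<phi>_def Q_sym[of "n - 1 - i"] by (simp add: algebra_simps)
    also have "Q (i + 1) (a + (n - 1 - i)) b c = \<phi> (i + 1)"
      unfolding \<phi>_def by (simp add: algebra_simps)
    finally show ?thesis .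
  qed
  then have "h n - h 0 = \<phi> n - \<phi> 0" by (rule telescope_reflection)
  moreover have "h n = sc z * sc (x (n + a) (b + c)) - Q 0 (a + n) b c + Q n a b c"
    unfolding h_def Z_def G_def H_def using T2_end[of p n a b c] by simp
  moreover have "h 0 = T2 p (Z * Y p n c * G)" by (simp add: h_def Y_0)
  \<comment> \<open>The difference \<open>\<phi> n - \<phi> 0\<close> is exactly the pair of
    \<open>Q\<close> terms in \<open>h n\<close>.\<close>
  ultimately show ?thesis by (simp add: \<phi>_def Z_def add.commute algebra_simps)
qed

text \<open>If J \<le> p, then Z = u g v with u and v in Y(d,m,p+1); both sides are a product of
  traces plus a \<open>CC\<close> term, and these agree by \<open>TR_CC\<close>. If J = p + 1, then
  g cancels g^{-1} on the left side, and on the right side v is expanded in turn: J' < p is settled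
  by the braid relation, J' = p by \<open>T2_Y_Y\<close>.\<close>

lemma T2_commute:
  assumes "Z \<in> S (Suc (Suc p))"
  shows "T2 p (g (Suc p) * Z) = T2 p (Z * g (Suc p))"
  using assms
proof (induction Z rule: S_span)
  case (add u v)
  have "g (Suc p) * u \<in> S (Suc (Suc p))" "g (Suc p) * v \<in> S (Suc (Suc p))"
    "u * g (Suc p) \<in> S (Suc (Suc p))" "v * g (Suc p) \<in> S (Suc (Suc p))"
    by (intro S_mult S_g_top add)+
  then show ?case using add(3,4) by (simp add: distrib_left distrib_right TR_add TR_S)
next
  case (W J a b v)
  interpret A: yokonuma_algebra d "Suc (Suc p)" dl t g X Xi m ev by (rule alg)
  let ?g = "g (Suc p)" and ?h = "gi (Suc p)"
  show ?case
  proof (cases "J \<le> p")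
    case True
    have u: "W p J a b \<in> S (Suc p)" using True by (intro S_W) auto
    have "T2 p (?g * (W (Suc p) J a b * v)) = T2 p (?g * W p J a b * ?g * v)"
      by (simp only: A.W_Suc mult.assoc)
    also have "\<dots> = T2 p (W p J a b * ?g * v * ?g)"
      unfolding T2_gYg[OF u W(2)] by (simp add: TR_CC[OF u W(2)])
    finally show ?thesis by (simp only: A.W_Suc mult.assoc)
  next
    case False
    then have J: "J = Suc p" using W by simp
    have WY: "W (Suc p) (Suc p) a b = ?h * Y p a b * ?g" by (simp only: A.W_top Y_def)
    have "T2 p (?g * (?h * Y p a b * ?g * v)) = T2 p (Y p a b * ?g * v)"
      using A.g_gi[of "Suc p"] by (simp flip: mult.assoc)
    also have "\<dots> = sc z * TR p (Y p a b * v)"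
      unfolding TR_g[OF Y_S W(2)] using TR_sc[OF S_mult[OF Y_S W(2)] z_in] by (simp add: mult.assoc)
    also have "\<dots> = T2 p (?h * Y p a b * ?g * v * ?g)"
      using W(2)
    proof (induction v rule: S_span)
      case (add u v)
      have "?h * Y p a b * ?g * u * ?g \<in> S (Suc (Suc p))" "?h * Y p a b * ?g * v * ?g \<in> S (Suc (Suc p))"
        by (intro S_mult S_gi_top S_g_top S_Suc Y_S add)+
      then show ?case
        using add(3,4) S_mult[OF Y_S add(1)] S_mult[OF Y_S add(2)]
        by (simp add: distrib_left distrib_right TR_add TR_S)
    next
      case (W J' n c w)
      have wg: "w * ?g = ?g * w" using g_S[OF W(2)] by simp
      have w: "w \<in> S (Suc p)" by (rule S_Suc[OF W(2)])
      show ?case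
      proof (cases "J' < p")
        case True
        then obtain q where q: "p = Suc q" by (cases p) auto
        define v where "v = W q J' n c"
        have v: "v \<in> S p" unfolding v_def using True q by (intro S_W) auto
        have Wv: "W p J' n c = v * g p" unfolding q v_def by (rule A.W_Suc)
        have gp: "g p \<in> S (Suc p)" using q by (intro S_g) auto
        have vg: "?g * v = v * ?g" by (rule g_S[OF v])
        have YS: "Y p a b * v * g p \<in> S (Suc p)"
          by (intro S_mult Y_S gp S_Suc[OF v])
        have "?h * Y p a b * ?g * (W p J' n c * w) * ?g = ?h * Y p a b * (?g * v) * g p * (w * ?g)"
          by (simp only: Wv mult.assoc)
        also have "\<dots> = ?h * Y p a b * v * (?g * (g p * ?g)) * w"
          unfolding vg wg by (simp only: mult.assoc)
        also have "?g * (g p * ?g) = g p * (?g * g p)"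
          using A.g_braid[of p] q by simp
        finally have "?h * Y p a b * ?g * (W p J' n c * w) * ?g = ?h * (Y p a b * v * g p) * ?g * (g p * w)"
          by (simp only: mult.assoc)
        moreover have "?h * (Y p a b * v * g p) * ?g \<in> S (Suc (Suc p))"
          by (intro S_mult S_gi_top S_g_top S_Suc[OF YS] S_Suc[OF Y_S] S_Suc[OF gp] S_Suc[OF S_Suc[OF v]])
        ultimately have "TR (Suc p) (?h * Y p a b * ?g * (W p J' n c * w) * ?g) = TR p (Y p a b * v * g p) * (g p * w)"
          using TR_right S_mult[OF gp w] TR_conj_inv[OF YS] by simp
        then have "T2 p (?h * Y p a b * ?g * (W p J' n c * w) * ?g) = TR p (Y p a b * v * g p) * (TR p (g p) * w)"
          using TR_left[OF TR_S[OF YS] S_mult[OF gp w]] TR_right[OF gp W(2)] by simp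
        also have "TR p (g p) = sc z"
          unfolding q using TR_g[OF S_1 S_1, of q] by simp
        also have "TR p (Y p a b * v * g p) * (sc z * w) = sc z * (TR p (Y p a b * v * g p) * w)"
          by (rule assoc_swap[OF sc_central[OF z_in, symmetric]])
        also have "\<dots> = sc z * TR p (Y p a b * (W p J' n c * w))"
          unfolding TR_right[OF YS W(2), symmetric] Wv by (simp only: mult.assoc)
        finally show ?thesis ..
      next
        case False
        then have J': "J' = p" using W by simp
        have Z: "?h * Y p a b * ?g * Y p n c * ?g \<in> S (Suc (Suc p))"
          by (intro S_mult S_gi_top S_g_top S_Suc[OF Y_S])
        have "?h * Y p a b * ?g * (W p p n c * w) * ?g = ?h * Y p a b * ?g * Y p n c * ?g * w"
          using wg by (simp add: Y_def mult.assoc)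
        then have "T2 p (?h * Y p a b * ?g * (W p p n c * w) * ?g) = sc z * sc (x (a + n) (b + c)) * w"
          using TR_right[OF Z w] TR_right[OF TR_S[OF Z] W(2)] T2_Y_Y[of p a b n c] by simp
        moreover have "TR p (Y p a b * (W p p n c * w)) = sc (x (a + n) (b + c)) * w"
          using TR_right[OF Y_S W(2), of "a + n" "b + c"] Y_mult[of p a b n c]
          by (simp add: TR_Y Y_def[of p n c] flip: mult.assoc)
        ultimately show ?thesis by (simp add: J' mult.assoc)
      qed
    qed
    finally show ?thesis unfolding J WY by (simp only: mult.assoc)
  qed
qed

end

subsection \<open>Transfer to the quotient rings\<close>

context yh_limit
begin

text \<open>The isomorphism from the quotient ring onto the subring \<open>S n\<close>. Under it the
  inclusions of levels become inclusions of sets; see \<open>\<kappa>_incl\<close>.\<close>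

definition \<kappa> :: "nat \<Rightarrow> yh_elem \<Rightarrow> 'a"
  where "\<kappa> n A = ev (SOME f. f \<in> carrier (yh_free m n) \<and> A = yh_class d m n f)"

lemma \<kappa>_class:
  assumes "f \<in> carrier (yh_free m n)"
  shows "\<kappa> n (yh_class d m n f) = ev f"
proof -
  interpret A: yokonuma_algebra d n dl t g X Xi m ev by (rule alg)
  define h where "h = (SOME h. h \<in> carrier (yh_free m n) \<and> yh_class d m n f = yh_class d m n h)"
  have h: "h \<in> carrier (yh_free m n)" "yh_class d m n f = yh_class d m n h"
    using someI[of "\<lambda>h. h \<in> carrier (yh_free m n) \<and> yh_class d m n f = yh_class d m n h", OF conjI[OF assms refl]]
    by (simp_all add: h_def)
  then have "f - h \<in> yh_ideal d m n" using yh_class_eq_iff[OF assms] by simp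
  then have "ev ((f - h) + h) = ev h"
    using A.ev_add[OF yh_free_diff[OF assms h(1)] h(1)] ev_ideal by simp
  then show ?thesis by (simp add: \<kappa>_def h_def)
qed

lemma class_in: "f \<in> carrier (yh_free m n) \<Longrightarrow> yh_class d m n f \<in> carrier (YH d m n)"
  by (rule ring_hom_closed[OF yh_class_hom])

lemma \<kappa>_S: "A \<in> carrier (YH d m n) \<Longrightarrow> \<kappa> n A \<in> S n"
  by (erule yh_class_cases) (simp add: \<kappa>_class S_def)

lemma \<kappa>_inj:
  assumes "A \<in> carrier (YH d m n)" "B \<in> carrier (YH d m n)" "\<kappa> n A = \<kappa> n B"
  shows "A = B"
proof -
  interpret A: yokonuma_algebra d n dl t g X Xi m ev by (rule alg)
  obtain f h where f: "f \<in> carrier (yh_free m n)" "A = yh_class d m n f"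
    and h: "h \<in> carrier (yh_free m n)" "B = yh_class d m n h"
    using assms(1,2) by (auto elim!: yh_class_cases)
  have "ev ((f - h) + h) = ev (f - h) + ev h" by (rule A.ev_add[OF yh_free_diff[OF f(1) h(1)] h(1)])
  moreover have "ev f = ev h" using assms(3) f h by (simp add: \<kappa>_class)
  ultimately have "ev (f - h) = 0" by simp
  then have "f - h \<in> yh_ideal d m n" by (rule ev_inj[OF yh_free_diff[OF f(1) h(1)]])
  then show ?thesis using yh_class_eq_iff[OF f(1) h(1)] f(2) h(2) by simp
qed

definition \<iota> :: "nat \<Rightarrow> 'a \<Rightarrow> yh_elem"
  where "\<iota> n = inv_into (carrier (YH d m n)) (\<kappa> n)"

lemma \<kappa>_surj: "u \<in> S n \<Longrightarrow> u \<in> \<kappa> n ` carrier (YH d m n)"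
  unfolding S_def using \<kappa>_class class_in by (auto intro!: image_eqI)

lemma \<iota>_in: "u \<in> S n \<Longrightarrow> \<iota> n u \<in> carrier (YH d m n)"
  unfolding \<iota>_def by (rule inv_into_into[OF \<kappa>_surj])

lemma \<kappa>_\<iota>: "u \<in> S n \<Longrightarrow> \<kappa> n (\<iota> n u) = u"
  unfolding \<iota>_def by (rule f_inv_into_f[OF \<kappa>_surj])

lemma \<iota>_\<kappa>: "A \<in> carrier (YH d m n) \<Longrightarrow> \<iota> n (\<kappa> n A) = A"
  by (rule \<kappa>_inj[OF \<iota>_in[OF \<kappa>_S] _ \<kappa>_\<iota>[OF \<kappa>_S]])

lemma \<kappa>_add: "A \<in> carrier (YH d m n) \<Longrightarrow> B \<in> carrier (YH d m n) \<Longrightarrow> \<kappa> n (A \<oplus>\<^bsub>YH d m n\<^esub> B) = \<kappa> n A + \<kappa> n B"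
  and \<kappa>_mult: "A \<in> carrier (YH d m n) \<Longrightarrow> B \<in> carrier (YH d m n) \<Longrightarrow> \<kappa> n (A \<otimes>\<^bsub>YH d m n\<^esub> B) = \<kappa> n A * \<kappa> n B"
proof -
  interpret A: yokonuma_algebra d n dl t g X Xi m ev by (rule alg)
  assume "A \<in> carrier (YH d m n)" "B \<in> carrier (YH d m n)"
  then obtain f h where f: "f \<in> carrier (yh_free m n)" "A = yh_class d m n f"
    and h: "h \<in> carrier (yh_free m n)" "B = yh_class d m n h"
    by (auto elim!: yh_class_cases)
  have "A \<oplus>\<^bsub>YH d m n\<^esub> B = yh_class d m n (f + h)" "A \<otimes>\<^bsub>YH d m n\<^esub> B = yh_class d m n (f * h)"
    using ring_hom_add[OF yh_class_hom f(1) h(1)] ring_hom_mult[OF yh_class_hom f(1) h(1)] f h by simp_all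
  then show "\<kappa> n (A \<oplus>\<^bsub>YH d m n\<^esub> B) = \<kappa> n A + \<kappa> n B" "\<kappa> n (A \<otimes>\<^bsub>YH d m n\<^esub> B) = \<kappa> n A * \<kappa> n B"
    using f h by (simp_all add: \<kappa>_class yh_free_add yh_free_mult A.ev_add A.ev_mult)
qed

lemma YH_one: "\<one>\<^bsub>YH d m n\<^esub> = yh_class d m n 1"
  using ring_hom_one[OF yh_class_hom] by simp

lemma \<kappa>_one: "\<kappa> n \<one>\<^bsub>YH d m n\<^esub> = 1"
  unfolding YH_one by (simp add: \<kappa>_class ev_1)

lemma YH_mult_in: "A \<in> carrier (YH d m n) \<Longrightarrow> B \<in> carrier (YH d m n) \<Longrightarrow> A \<otimes>\<^bsub>YH d m n\<^esub> B \<in> carrier (YH d m n)"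
  and YH_add_in: "A \<in> carrier (YH d m n) \<Longrightarrow> B \<in> carrier (YH d m n) \<Longrightarrow> A \<oplus>\<^bsub>YH d m n\<^esub> B \<in> carrier (YH d m n)"
  and YH_one_in: "\<one>\<^bsub>YH d m n\<^esub> \<in> carrier (YH d m n)"
proof -
  interpret R: ring "YH d m n" by (rule ring_YH)
  show "A \<in> carrier (YH d m n) \<Longrightarrow> B \<in> carrier (YH d m n) \<Longrightarrow> A \<otimes>\<^bsub>YH d m n\<^esub> B \<in> carrier (YH d m n)"
    "A \<in> carrier (YH d m n) \<Longrightarrow> B \<in> carrier (YH d m n) \<Longrightarrow> A \<oplus>\<^bsub>YH d m n\<^esub> B \<in> carrier (YH d m n)"
    "\<one>\<^bsub>YH d m n\<^esub> \<in> carrier (YH d m n)" by simp_all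
qed

lemma \<kappa>_incl:
  assumes "n \<le> n'" "A \<in> carrier (YH d m n)"
  shows "yh_incl d m n' A \<in> carrier (YH d m n')" and "\<kappa> n' (yh_incl d m n' A) = \<kappa> n A"
proof -
  obtain f where f: "f \<in> carrier (yh_free m n)" "A = yh_class d m n f"
    using assms(2) by (rule yh_class_cases)
  then have "f \<in> carrier (yh_free m n')" using yh_free_mono[OF assms(1)] by blast
  then show "yh_incl d m n' A \<in> carrier (YH d m n')" "\<kappa> n' (yh_incl d m n' A) = \<kappa> n A"
    using f yh_incl_class[OF assms(1) f(1)] by (simp_all add: class_in \<kappa>_class)
qed

lemma \<kappa>_scal:
  assumes "c \<in> carrier (\<R> m)"
  shows "yh_scal d m n c \<in> carrier (YH d m n)" and "\<kappa> n (yh_scal d m n c) = sc c"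
  unfolding yh_scal_def using yh_free_scal[OF assms] by (simp_all add: class_in \<kappa>_class)

lemma \<kappa>_letter:
  assumes "y \<in> yh_gens n"
  shows "yh_class d m n (letter y) \<in> carrier (YH d m n)" and "\<kappa> n (yh_class d m n (letter y)) = gen y"
proof -
  interpret A: yokonuma_algebra d n dl t g X Xi m ev by (rule alg)
  show "yh_class d m n (letter y) \<in> carrier (YH d m n)" "\<kappa> n (yh_class d m n (letter y)) = gen y"
    using yh_free_letter[OF assms] by (simp_all add: class_in \<kappa>_class A.ev_letter[OF assms])
qed

lemma \<kappa>_t:
  assumes "1 \<le> j" "j \<le> n"
  shows "yh_t d m n j \<in> carrier (YH d m n)" and "\<kappa> n (yh_t d m n j) = t j"
  unfolding yh_t_def using \<kappa>_letter[of "GenT j" n] assms by simp_all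

lemma \<kappa>_g:
  assumes "1 \<le> i" "i < n"
  shows "yh_g d m n i \<in> carrier (YH d m n)" and "\<kappa> n (yh_g d m n i) = g i"
  unfolding yh_g_def using \<kappa>_letter[of "GenG i" n] assms by simp_all

lemma \<kappa>_X:
  assumes "1 \<le> n"
  shows "yh_X d m n \<in> carrier (YH d m n)" and "\<kappa> n (yh_X d m n) = X"
  unfolding yh_X_def using \<kappa>_letter[of GenX n] assms by simp_all

lemma \<kappa>_inv:
  assumes A: "A \<in> carrier (YH d m n)" and v: "v \<in> S n" "\<kappa> n A * v = 1" "v * \<kappa> n A = 1"
  shows "inv\<^bsub>YH d m n\<^esub> A \<in> carrier (YH d m n)" and "\<kappa> n (inv\<^bsub>YH d m n\<^esub> A) = v"
proof -
  interpret R: ring "YH d m n" by (rule ring_YH)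
  have B: "\<iota> n v \<in> carrier (YH d m n)" by (rule \<iota>_in[OF v(1)])
  have "A \<otimes>\<^bsub>YH d m n\<^esub> \<iota> n v = \<one>\<^bsub>YH d m n\<^esub>" "\<iota> n v \<otimes>\<^bsub>YH d m n\<^esub> A = \<one>\<^bsub>YH d m n\<^esub>"
    by (rule \<kappa>_inj[where n = n]; use A B v in \<open>simp add: \<kappa>_mult \<kappa>_\<iota> \<kappa>_one\<close>)+
  then have "inv\<^bsub>YH d m n\<^esub> A = \<iota> n v" using R.inv_char[OF A B] by simp
  then show "inv\<^bsub>YH d m n\<^esub> A \<in> carrier (YH d m n)" "\<kappa> n (inv\<^bsub>YH d m n\<^esub> A) = v"
    using B v by (simp_all add: \<kappa>_\<iota>)
qed

lemma \<kappa>_pow: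
  assumes "A \<in> carrier (YH d m n)"
  shows "A [^]\<^bsub>YH d m n\<^esub> (k :: nat) \<in> carrier (YH d m n) \<and> \<kappa> n (A [^]\<^bsub>YH d m n\<^esub> k) = \<kappa> n A ^ k"
proof -
  interpret R: ring "YH d m n" by (rule ring_YH)
  show ?thesis
    by (induction k) (use assms in \<open>simp_all add: \<kappa>_one \<kappa>_mult power_commutes\<close>)
qed

lemma \<kappa>_int_pow:
  assumes A: "A \<in> carrier (YH d m n)" and v: "a < 0 \<Longrightarrow> v \<in> S n \<and> \<kappa> n A * v = 1 \<and> v * \<kappa> n A = 1"
  shows "A [^]\<^bsub>YH d m n\<^esub> (a :: int) \<in> carrier (YH d m n)" and "\<kappa> n (A [^]\<^bsub>YH d m n\<^esub> a) = zpow (\<kappa> n A) v a"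
proof -
  interpret R: ring "YH d m n" by (rule ring_YH)
  have "A [^]\<^bsub>YH d m n\<^esub> a \<in> carrier (YH d m n) \<and> \<kappa> n (A [^]\<^bsub>YH d m n\<^esub> a) = zpow (\<kappa> n A) v a"
  proof (cases "a < 0")
    case True
    let ?k = "nat (- a)"
    have v: "v \<in> S n" "\<kappa> n A * v = 1" "v * \<kappa> n A = 1" using v[OF True] by simp_all
    let ?B = "A [^]\<^bsub>YH d m n\<^esub> ?k"
    have B: "?B \<in> carrier (YH d m n)" "\<kappa> n ?B = \<kappa> n A ^ ?k" using \<kappa>_pow[OF A, of ?k] by simp_all
    have "\<kappa> n ?B * v ^ ?k = 1" "v ^ ?k * \<kappa> n ?B = 1"
      unfolding B(2) by (rule left_right_inverse_power[OF v(2)], rule left_right_inverse_power[OF v(3)])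
    note inv = \<kappa>_inv[OF B(1) S_power[OF v(1)] this]
    have "A [^]\<^bsub>YH d m n\<^esub> a = inv\<^bsub>YH d m n\<^esub> ?B" using True by (simp only: int_pow_def2 if_True)
    moreover have "zpow (\<kappa> n A) v a = v ^ ?k" using True by (simp add: zpow_def)
    ultimately show ?thesis using inv by simp
  next
    case False
    have "A [^]\<^bsub>YH d m n\<^esub> a = A [^]\<^bsub>YH d m n\<^esub> nat a" using False by (simp only: int_pow_def2 if_False)
    moreover have "zpow (\<kappa> n A) v a = \<kappa> n A ^ nat a" using False by (simp add: zpow_def)
    ultimately show ?thesis using \<kappa>_pow[OF A, of "nat a"] by (simp only:)
  qed
  then show "A [^]\<^bsub>YH d m n\<^esub> (a :: int) \<in> carrier (YH d m n)" "\<kappa> n (A [^]\<^bsub>YH d m n\<^esub> a) = zpow (\<kappa> n A) v a"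
    by simp_all
qed

lemma \<kappa>_X_pow:
  assumes "1 \<le> n"
  shows "yh_X d m n [^]\<^bsub>YH d m n\<^esub> (a :: int) \<in> carrier (YH d m n)" and "\<kappa> n (yh_X d m n [^]\<^bsub>YH d m n\<^esub> a) = Xp a"
proof -
  interpret A: yokonuma_algebra d n dl t g X Xi m ev by (rule alg)
  show "yh_X d m n [^]\<^bsub>YH d m n\<^esub> (a :: int) \<in> carrier (YH d m n)" "\<kappa> n (yh_X d m n [^]\<^bsub>YH d m n\<^esub> a) = Xp a"
    using \<kappa>_int_pow[OF \<kappa>_X(1)[OF assms], of a Xi] \<kappa>_X(2)[OF assms] S_Xi[OF assms] A.X_Xi A.Xi_X assms by simp_all
qed

lemma \<kappa>_t_pow:
  assumes "1 \<le> j" "j \<le> n" "0 \<le> b"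
  shows "yh_t d m n j [^]\<^bsub>YH d m n\<^esub> (b :: int) \<in> carrier (YH d m n)" and "\<kappa> n (yh_t d m n j [^]\<^bsub>YH d m n\<^esub> b) = tp j b"
proof -
  interpret A: yokonuma_algebra d n dl t g X Xi m ev by (rule alg)
  \<comment> \<open>The 0 stands in the place of the inverse of t_j, which is not consulted since b
    \<ge> 0.\<close>
  show "yh_t d m n j [^]\<^bsub>YH d m n\<^esub> (b :: int) \<in> carrier (YH d m n)" "\<kappa> n (yh_t d m n j [^]\<^bsub>YH d m n\<^esub> b) = tp j b"
    using \<kappa>_int_pow[OF \<kappa>_t(1)[OF assms(1,2)], of b 0] \<kappa>_t(2)[OF assms(1,2)] A.tp_int[OF assms(1,2), of "nat b"] assms(3)
    by (simp_all add: zpow_def)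
qed

lemma \<kappa>_gi:
  assumes "1 \<le> i" "i < n"
  shows "inv\<^bsub>YH d m n\<^esub> yh_g d m n i \<in> carrier (YH d m n)" and "\<kappa> n (inv\<^bsub>YH d m n\<^esub> yh_g d m n i) = gi i"
proof -
  interpret A: yokonuma_algebra d n dl t g X Xi m ev by (rule alg)
  show "inv\<^bsub>YH d m n\<^esub> yh_g d m n i \<in> carrier (YH d m n)" "\<kappa> n (inv\<^bsub>YH d m n\<^esub> yh_g d m n i) = gi i"
    using \<kappa>_inv[OF \<kappa>_g(1)[OF assms] S_gi[OF assms]] \<kappa>_g(2)[OF assms] A.g_gi[OF assms] A.gi_g[OF assms] by simp_all
qed

lemma \<kappa>_g_pow:
  assumes "1 \<le> i" "i < n"
  shows "yh_g d m n i [^]\<^bsub>YH d m n\<^esub> (a :: int) \<in> carrier (YH d m n)" and "\<kappa> n (yh_g d m n i [^]\<^bsub>YH d m n\<^esub> a) = zpow (g i) (gi i) a"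
proof -
  interpret A: yokonuma_algebra d n dl t g X Xi m ev by (rule alg)
  show "yh_g d m n i [^]\<^bsub>YH d m n\<^esub> (a :: int) \<in> carrier (YH d m n)" "\<kappa> n (yh_g d m n i [^]\<^bsub>YH d m n\<^esub> a) = zpow (g i) (gi i) a"
    using \<kappa>_int_pow[OF \<kappa>_g(1)[OF assms], of a "gi i"] \<kappa>_g(2)[OF assms] S_gi[OF assms] A.g_gi[OF assms] A.gi_g[OF assms] by simp_all
qed

lemma \<kappa>_foldr:
  assumes "\<And>i. i \<in> set is \<Longrightarrow> A i \<in> carrier (YH d m n) \<and> \<kappa> n (A i) = u i"
  shows "foldr (\<otimes>\<^bsub>YH d m n\<^esub>) (map A is) \<one>\<^bsub>YH d m n\<^esub> \<in> carrier (YH d m n) \<and>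
    \<kappa> n (foldr (\<otimes>\<^bsub>YH d m n\<^esub>) (map A is) \<one>\<^bsub>YH d m n\<^esub>) = prod_list (map u is)"
  using assms
proof (induction "is")
  case Nil
  then show ?case by (simp add: YH_one_in \<kappa>_one)
next
  case (Cons i "is")
  then have "A i \<in> carrier (YH d m n) \<and> \<kappa> n (A i) = u i" by simp
  with Cons show ?case by (simp add: YH_mult_in \<kappa>_mult)
qed

lemma prod_list_gi: "prod_list (map gi (rev [1..<Suc J])) = Gi J"
  by (induction J) simp_all

lemma prod_list_g: "prod_list (map g [1..<Suc j]) = Gp j"
  by (induction j) simp_all

lemma \<kappa>_W:
  assumes J: "J \<le> n" and b: "0 \<le> b"
  shows "yh_W d m (Suc n) J a b \<in> carrier (YH d m (Suc n))" and "\<kappa> (Suc n) (yh_W d m (Suc n) J a b) = W n J a b"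
proof -
  interpret A: yokonuma_algebra d "Suc n" dl t g X Xi m ev by (rule alg)
  let ?R = "YH d m (Suc n)"
  let ?G = "foldr (\<otimes>\<^bsub>?R\<^esub>) (map (\<lambda>i. inv\<^bsub>?R\<^esub> yh_g d m (Suc n) i) (rev [1..<Suc J])) \<one>\<^bsub>?R\<^esub>"
  let ?P = "foldr (\<otimes>\<^bsub>?R\<^esub>) (map (yh_g d m (Suc n)) [1..<Suc n]) \<one>\<^bsub>?R\<^esub>"
  let ?X = "yh_X d m (Suc n) [^]\<^bsub>?R\<^esub> a" and ?t = "yh_t d m (Suc n) 1 [^]\<^bsub>?R\<^esub> b"
  have G: "?G \<in> carrier ?R \<and> \<kappa> (Suc n) ?G = Gi J"
    unfolding prod_list_gi[symmetric] by (rule \<kappa>_foldr) (use J \<kappa>_gi in auto)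
  have P: "?P \<in> carrier ?R \<and> \<kappa> (Suc n) ?P = Gp n"
    unfolding prod_list_g[symmetric] by (rule \<kappa>_foldr) (use \<kappa>_g in auto)
  have Xt: "?X \<in> carrier ?R" "\<kappa> (Suc n) ?X = Xp a" "?t \<in> carrier ?R" "\<kappa> (Suc n) ?t = tp 1 b"
    using \<kappa>_X_pow[of "Suc n" a] \<kappa>_t_pow[of 1 "Suc n" b] b by simp_all
  show "yh_W d m (Suc n) J a b \<in> carrier ?R"
    unfolding yh_W_def by (intro YH_mult_in conjunct1[OF G] conjunct1[OF P] Xt)
  have "\<kappa> (Suc n) (?G \<otimes>\<^bsub>?R\<^esub> ?X \<otimes>\<^bsub>?R\<^esub> ?t \<otimes>\<^bsub>?R\<^esub> ?P) = Gi J * Xp a * tp 1 b * Gp n"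
    unfolding \<kappa>_mult[OF YH_mult_in[OF YH_mult_in[OF conjunct1[OF G] Xt(1)] Xt(3)] conjunct1[OF P]]
      \<kappa>_mult[OF YH_mult_in[OF conjunct1[OF G] Xt(1)] Xt(3)] \<kappa>_mult[OF conjunct1[OF G] Xt(1)]
      Xt conjunct2[OF G] conjunct2[OF P] ..
  then show "\<kappa> (Suc n) (yh_W d m (Suc n) J a b) = W n J a b"
    unfolding yh_W_def A.W_def by (simp only: mult.assoc)
qed

text \<open>The axioms read inside the common ring: inclusions disappear, \<open>T n\<close> is
  tr_{n+1}, and the two signs \<epsilon> are separate clauses. Values outside the subrings are left
  free, so uniqueness is meant on \<open>S (Suc n)\<close> only.\<close>

definition trace_chain :: "laurent \<Rightarrow> (int \<Rightarrow> int \<Rightarrow> laurent) \<Rightarrow> (nat \<Rightarrow> 'a \<Rightarrow> 'a) \<Rightarrow> bool"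
  where "trace_chain z x T \<longleftrightarrow>
    (\<forall>n. \<forall>u\<in>S (Suc n). T n u \<in> S n \<and> (\<forall>v\<in>S (Suc n). T n (u + v) = T n u + T n v) \<and>
      (\<forall>c\<in>carrier (\<R> m). T n (sc c * u) = sc c * T n u)) \<and>
    (\<forall>a\<in>E_set m. \<forall>b\<in>{0..<int d}. T 0 (Xp a * tp 1 b) = sc (x a b)) \<and>
    (\<forall>p. (\<forall>u\<in>S (Suc p). \<forall>v\<in>S (Suc p). \<forall>Z\<in>S (Suc (Suc p)). T (Suc p) (u * Z * v) = u * T (Suc p) Z * v) \<and>
      (\<forall>u\<in>S (Suc p). T (Suc p) (g (Suc p) * u * gi (Suc p)) = T p u \<and>
        T (Suc p) (gi (Suc p) * u * g (Suc p)) = T p u) \<and>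
      (\<forall>Z\<in>S (Suc (Suc p)). T p (T (Suc p) (g (Suc p) * Z)) = T p (T (Suc p) (Z * g (Suc p)))) \<and>
      T (Suc p) (g (Suc p)) = sc z)"

lemma trace_chainI:
  assumes "\<And>n u. u \<in> S (Suc n) \<Longrightarrow> T n u \<in> S n"
    and "\<And>n u v. u \<in> S (Suc n) \<Longrightarrow> v \<in> S (Suc n) \<Longrightarrow> T n (u + v) = T n u + T n v"
    and "\<And>n c u. c \<in> carrier (\<R> m) \<Longrightarrow> u \<in> S (Suc n) \<Longrightarrow> T n (sc c * u) = sc c * T n u"
    and "\<And>a b. a \<in> E_set m \<Longrightarrow> b \<in> {0..<int d} \<Longrightarrow> T 0 (Xp a * tp 1 b) = sc (x a b)"
    and "\<And>p u v Z. u \<in> S (Suc p) \<Longrightarrow> v \<in> S (Suc p) \<Longrightarrow> Z \<in> S (Suc (Suc p)) \<Longrightarrow>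
      T (Suc p) (u * Z * v) = u * T (Suc p) Z * v"
    and "\<And>p u. u \<in> S (Suc p) \<Longrightarrow> T (Suc p) (g (Suc p) * u * gi (Suc p)) = T p u"
    and "\<And>p u. u \<in> S (Suc p) \<Longrightarrow> T (Suc p) (gi (Suc p) * u * g (Suc p)) = T p u"
    and "\<And>p Z. Z \<in> S (Suc (Suc p)) \<Longrightarrow> T p (T (Suc p) (g (Suc p) * Z)) = T p (T (Suc p) (Z * g (Suc p)))"
    and "\<And>p. T (Suc p) (g (Suc p)) = sc z"
  shows "trace_chain z x T"
  unfolding trace_chain_def by (intro conjI allI ballI) (fact assms | rule assms; assumption)+

lemma trace_chainD:
  assumes "trace_chain z x T"
  shows "u \<in> S (Suc n) \<Longrightarrow> T n u \<in> S n"
    and "u \<in> S (Suc n) \<Longrightarrow> v \<in> S (Suc n) \<Longrightarrow> T n (u + v) = T n u + T n v"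
    and "c \<in> carrier (\<R> m) \<Longrightarrow> u \<in> S (Suc n) \<Longrightarrow> T n (sc c * u) = sc c * T n u"
    and "a \<in> E_set m \<Longrightarrow> b \<in> {0..<int d} \<Longrightarrow> T 0 (Xp a * tp 1 b) = sc (x a b)"
    and "u \<in> S (Suc p) \<Longrightarrow> v \<in> S (Suc p) \<Longrightarrow> Z \<in> S (Suc (Suc p)) \<Longrightarrow>
      T (Suc p) (u * Z * v) = u * T (Suc p) Z * v"
    and "u \<in> S (Suc p) \<Longrightarrow> T (Suc p) (g (Suc p) * u * gi (Suc p)) = T p u"
    and "u \<in> S (Suc p) \<Longrightarrow> T (Suc p) (gi (Suc p) * u * g (Suc p)) = T p u"
    and "Z \<in> S (Suc (Suc p)) \<Longrightarrow> T p (T (Suc p) (g (Suc p) * Z)) = T p (T (Suc p) (Z * g (Suc p)))"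
    and "T (Suc p) (g (Suc p)) = sc z"
  using assms unfolding trace_chain_def by simp_all

lemma S_level_0:
  assumes "w \<in> S 0"
  obtains c where "c \<in> carrier (\<R> m)" "w = sc c"
proof -
  interpret A: yokonuma_algebra d 0 dl t g X Xi m ev by (rule alg)
  from assms have "\<exists>c\<in>carrier (\<R> m). w = sc c"
  proof (induction w rule: S_induct)
    case zero
    then show ?case by (auto intro!: bexI[of _ 0] simp: sc_0)
  next
    case (add u v)
    then obtain c c' where "c \<in> carrier (\<R> m)" "u = sc c" "c' \<in> carrier (\<R> m)" "v = sc c'" by blast
    then show ?case using sc_add[of c c'] laurent_ring_add[of c m c'] by (auto intro!: bexI[of _ "c + c'"])
  next
    case (letter y u)
    then show ?case by (cases y) (simp_all add: yh_gens_def)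
  qed auto
  then show ?thesis using that by blast
qed

text \<open>Axiom (i) starts at tr_2. For tr_1 the factor on the right lies in Y(d,m,0), hence is a
  central scalar, and linearity suffices.\<close>

lemma trace_chain_right:
  assumes T: "trace_chain z x T" and Z: "Z \<in> S (Suc n)" and w: "w \<in> S n"
  shows "T n (Z * w) = T n Z * w"
proof (cases n)
  case 0
  then obtain c where c: "c \<in> carrier (\<R> m)" "w = sc c" using w S_level_0 by blast
  then show ?thesis using trace_chainD(3)[OF T c(1) Z] sc_central[OF c(1), of Z] sc_central[OF c(1), of "T n Z"] by simp
next
  case (Suc p)
  then show ?thesis using trace_chainD(5)[OF T S_1, of w p Z] w Z by simp
qed

text \<open>By \<open>W_top\<close> the top element is a conjugate of the one a level below, so
  axiom (ii) with \<epsilon> = -1 carries the parameter upwards.\<close>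

lemma trace_chain_W_top:
  assumes T: "trace_chain z x T" and a: "a \<in> E_set m" and b: "b \<in> {0..<int d}"
  shows "T n (W n n a b) = sc (x a b)"
proof (induction n)
  case 0
  show ?case using trace_chainD(4)[OF T a b] by (simp add: W_def)
next
  case (Suc p)
  interpret A: yokonuma_algebra d p dl t g X Xi m ev by (rule alg)
  show ?case
    unfolding A.W_top using trace_chainD(7)[OF T S_W[of p "Suc p" p a b]] Suc by simp
qed

text \<open>For J < n the last factor g_n splits off, and axioms (i) and (iv) give the value; for J
  = n it is \<open>trace_chain_W_top\<close>.\<close>

lemma trace_chain_W:
  assumes T: "trace_chain z x T" and z: "z \<in> carrier (\<R> m)" and w: "w \<in> S n" and J: "J \<le> n"
  shows "J < n \<Longrightarrow> T n (W n J a b * w) = sc z * W (n - 1) J a b * w"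
    and "J = n \<Longrightarrow> a \<in> E_set m \<Longrightarrow> b \<in> {0..<int d} \<Longrightarrow> T n (W n J a b * w) = sc (x a b) * w"
proof -
  have W: "W n J a b \<in> S (Suc n)" using J by (intro S_W) auto
  show "T n (W n J a b * w) = sc (x a b) * w" if "J = n" "a \<in> E_set m" "b \<in> {0..<int d}"
    using trace_chain_right[OF T W w] trace_chain_W_top[OF T that(2,3), of n] that(1) by simp
  assume "J < n"
  then obtain p where p: "n = Suc p" "J \<le> p" by (cases n) auto
  interpret A: yokonuma_algebra d "Suc (Suc p)" dl t g X Xi m ev by (rule alg)
  have WS: "W p J a b \<in> S (Suc p)" using p by (intro S_W) auto
  have gS: "g (Suc p) \<in> S (Suc (Suc p))" by (rule S_g) auto
  have "T n (W n J a b) = T (Suc p) (W p J a b * g (Suc p) * 1)" by (simp add: p A.W_Suc)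
  also have "\<dots> = W p J a b * sc z * 1"
    unfolding trace_chainD(5)[OF T WS S_1 gS] trace_chainD(9)[OF T] ..
  also have "\<dots> = sc z * W p J a b"
    using sc_central[OF z, of "W p J a b"] by simp
  finally show "T n (W n J a b * w) = sc z * W (n - 1) J a b * w"
    using trace_chain_right[OF T W w] p by simp
qed

lemma trace_chain_diff:
  assumes T: "trace_chain z x T" and "u \<in> S (Suc n)" "v \<in> S (Suc n)"
  shows "T n (u - v) = T n u - T n v"
  using trace_chainD(2)[OF T S_diff[OF assms(2,3)] assms(3)] by simp

lemma S_shifts:
  assumes "\<And>a. h a \<in> S n" "set is \<subseteq> {1..<Suc k}" "m = enat k"
  shows "shifts (vs is) h a \<in> S n"
  using assms(2)
proof (induction "is" arbitrary: a)
  case (Cons i "is")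
  then have "i \<in> set [1..<Suc k]" by (simp del: upt_Suc)
  then have i: "lvar (IndV i) 1 \<in> carrier (\<R> m)" by (rule lvar_V[OF assms(3)])
  have "shifts (vs is) h a \<in> S n" for a using Cons by simp
  then show ?case by (auto simp: vs_def intro!: S_diff S_mult S_sc i)
qed (simp add: assms(1) vs_def)

lemma trace_chain_shifts:
  assumes T: "trace_chain z x T" and h: "\<And>a. h a \<in> S (Suc n)" and "set is \<subseteq> {1..<Suc k}" and m: "m = enat k"
  shows "T n (shifts (vs is) h a) = shifts (vs is) (\<lambda>a. T n (h a)) a"
  using assms(3)
proof (induction "is" arbitrary: a)
  case (Cons i "is")
  then have "i \<in> set [1..<Suc k]" by (simp del: upt_Suc)
  then have i: "lvar (IndV i) 1 \<in> carrier (\<R> m)" by (rule lvar_V[OF m])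
  have s: "shifts (vs is) h a \<in> S (Suc n)" for a using Cons(2) by (intro S_shifts[OF h _ m]) auto
  have "T n (shifts (vs (i # is)) h a) = T n (shifts (vs is) h (a + 1) - sc (lvar (IndV i) 1) * shifts (vs is) h a)"
    by (simp add: vs_def)
  also have "\<dots> = T n (shifts (vs is) h (a + 1)) - sc (lvar (IndV i) 1) * T n (shifts (vs is) h a)"
    by (simp only: trace_chain_diff[OF T s S_mult[OF S_sc[OF i] s]] trace_chainD(3)[OF T i s])
  finally show ?case using Cons by (simp add: vs_def)
qed (simp add: vs_def)

text \<open>Both chains agree on W w when a \<in> E_m. For fixed J, b and w the difference of the
  two values satisfies the recurrence in a, and as many consecutive zeros as there are factors force
  it to vanish.\<close>

lemma trace_chain_unique:
  assumes T: "trace_chain z x T" and T': "trace_chain z x T'" and z: "z \<in> carrier (\<R> m)"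
    and Z: "Z \<in> S (Suc n)"
  shows "T n Z = T' n Z"
  using Z
proof (induction Z rule: S_span)
  case (add u v)
  then show ?case by (simp add: trace_chainD(2)[OF T] trace_chainD(2)[OF T'])
next
  case (W J a b w)
  interpret A: yokonuma_algebra d "Suc n" dl t g X Xi m ev by (rule alg)
  \<comment> \<open>W sees b only modulo d, so b may be taken in the range of the
    parameters.\<close>
  define b' where "b' = b mod int d"
  have b': "b' \<in> {0..<int d}" using d_pos by (simp add: b'_def)
  have Wb: "W n J a b = W n J a b'" for a by (simp add: A.W_def A.tp_def b'_def)
  define h where "h = (\<lambda>a. W n J a b' * w)"
  have h: "h a \<in> S (Suc n)" for a
    unfolding h_def using W by (intro S_mult S_W S_Suc) auto
  have E: "T n (h a) = T' n (h a)" if "a \<in> E_set m" for a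
    unfolding h_def using trace_chain_W[OF T z W(2,1), of a b'] trace_chain_W[OF T' z W(2,1), of a b'] that b' W(1)
    by (cases "J < n") auto
  have "T n (h a) = T' n (h a)"
  proof (cases m)
    case infinity
    then show ?thesis using E by (simp add: E_set_def)
  next
    case (enat k)
    have "rcr h"
      unfolding h_def A.W_def by (intro A.rcr_rmult A.rcr_lmult A.rcr_Xp) simp
    then have rec: "shifts (vs [1..<Suc k]) h a = 0" for a using enat unfolding A.rcr_def by blast
    have D: "shifts (vs [1..<Suc k]) (\<lambda>a. T n (h a) - T' n (h a)) a = 0" for a
    proof -
      have "T n 0 = 0" "T' n 0 = 0"
        using trace_chainD(2)[OF T S_0 S_0, of n] trace_chainD(2)[OF T' S_0 S_0, of n] by simp_all
      moreover have "T n (shifts (vs [1..<Suc k]) h a) = shifts (vs [1..<Suc k]) (\<lambda>a. T n (h a)) a"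
        by (rule trace_chain_shifts[OF T h _ enat]) (simp del: upt_Suc)
      moreover have "T' n (shifts (vs [1..<Suc k]) h a) = shifts (vs [1..<Suc k]) (\<lambda>a. T' n (h a)) a"
        by (rule trace_chain_shifts[OF T' h _ enat]) (simp del: upt_Suc)
      ultimately show ?thesis unfolding rec shifts_diff by simp
    qed
    have "T n (h a) - T' n (h a) = 0"
    proof (rule shifts_unique[where vs = "vs [1..<Suc k]" and h = "\<lambda>a. T n (h a) - T' n (h a)"])
      fix v assume v: "v \<in> set (vs [1..<Suc k])"
      then show "v * c = c * v" for c by (rule vs_central[OF enat])
      from v obtain i where i: "i \<in> set [1..<Suc k]" "v = sc (lvar (IndV i) 1)" by (auto simp: vs_def simp del: upt_Suc)
      have "sc (lvar (IndV i) (- 1)) * v = 1"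
        unfolding i(2) using A.sc_mult[OF lvar_V[OF enat i(1)] lvar_V[OF enat i(1)], of "- 1" 1] lvar_unit[of "IndV i" "- 1"]
        by (simp add: sc_1)
      then show "\<exists>v'. v' * v = 1" ..
    next
      fix a assume "0 \<le> a" "a < int (length (vs [1..<Suc k]))"
      then have "a \<in> E_set m" using enat by (simp add: E_set_def vs_def del: upt_Suc)
      then show "T n (h a) - T' n (h a) = 0" using E by simp
    qed (rule D)
    then show ?thesis by simp
  qed
  then show ?case unfolding Wb h_def .
qed

end

context yh_trace
begin

lemma trace_chain_TR: "trace_chain z x TR"
proof (rule trace_chainI)
  show "TR 0 (Xp a * tp 1 b) = sc (x a b)" for a b
    using TR_W[of 0 0 a b] by (simp add: F0_def W_def)
  fix p u v Z
  assume "u \<in> S (Suc p)" "v \<in> S (Suc p)" "Z \<in> S (Suc (Suc p))"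
  then show "TR (Suc p) (u * Z * v) = u * TR (Suc p) Z * v"
    using TR_right[OF S_mult[OF S_Suc]] by (simp add: TR_left)
next
  show "TR (Suc p) (g (Suc p)) = sc z" for p using TR_g[OF S_1 S_1, of p] by simp
qed (rule TR_S TR_add TR_sc TR_conj TR_conj_inv T2_commute; assumption)+

end

section \<open>Passage between chains on the quotient rings and chains in the common ring\<close>

lemma all_Suc_iff: "(\<forall>k\<ge>1. P k) \<longleftrightarrow> (\<forall>n. P (Suc n))" "(\<forall>k\<ge>2. P k) \<longleftrightarrow> (\<forall>n. P (Suc (Suc n)))"
proof -
  show "(\<forall>k\<ge>1. P k) \<longleftrightarrow> (\<forall>n. P (Suc n))"
  proof (intro iffI allI impI)
    fix k :: nat assume "\<forall>n. P (Suc n)" "1 \<le> k"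
    then show "P k" by (cases k) auto
  qed simp
  show "(\<forall>k\<ge>2. P k) \<longleftrightarrow> (\<forall>n. P (Suc (Suc n)))"
  proof (intro iffI allI impI)
    fix k :: nat assume P: "\<forall>n. P (Suc (Suc n))" and k: "2 \<le> k"
    then have "P (Suc (Suc (k - 2)))" by blast
    moreover have "Suc (Suc (k - 2)) = k" using k by arith
    ultimately show "P k" by simp
  qed simp
qed

lemma relative_trace_chain_Suc:
  "relative_trace_chain d m z x tr \<longleftrightarrow>
    tr \<in> (\<Pi>\<^sub>E k\<in>{1..}. carrier (YH d m k) \<rightarrow>\<^sub>E carrier (YH d m (k - 1))) \<and>
    (\<forall>n. yh_linear d m (Suc n) n (tr (Suc n))) \<and>
    (\<forall>a \<in> E_set m. \<forall>b \<in> {0..<int d}.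
      tr 1 ((yh_X d m 1 [^]\<^bsub>YH d m 1\<^esub> a) \<otimes>\<^bsub>YH d m 1\<^esub> (yh_t d m 1 1 [^]\<^bsub>YH d m 1\<^esub> b))
        = yh_scal d m 0 (x a b)) \<and>
    (\<forall>n. let k = Suc (Suc n) in
      (\<forall>u \<in> carrier (YH d m (Suc n)). \<forall>v \<in> carrier (YH d m (Suc n)). \<forall>Z \<in> carrier (YH d m k).
        tr k (yh_incl d m k u \<otimes>\<^bsub>YH d m k\<^esub> Z \<otimes>\<^bsub>YH d m k\<^esub> yh_incl d m k v)
          = u \<otimes>\<^bsub>YH d m (Suc n)\<^esub> tr k Z \<otimes>\<^bsub>YH d m (Suc n)\<^esub> v) \<and>
      (\<forall>u \<in> carrier (YH d m (Suc n)). \<forall>\<epsilon> \<in> {1, -1 :: int}.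
        tr k ((yh_g d m k (Suc n) [^]\<^bsub>YH d m k\<^esub> \<epsilon>) \<otimes>\<^bsub>YH d m k\<^esub> yh_incl d m k u
                \<otimes>\<^bsub>YH d m k\<^esub> (yh_g d m k (Suc n) [^]\<^bsub>YH d m k\<^esub> (- \<epsilon>)))
          = yh_incl d m (Suc n) (tr (Suc n) u)) \<and>
      (\<forall>Z \<in> carrier (YH d m k).
        tr (Suc n) (tr k (yh_g d m k (Suc n) \<otimes>\<^bsub>YH d m k\<^esub> Z))
          = tr (Suc n) (tr k (Z \<otimes>\<^bsub>YH d m k\<^esub> yh_g d m k (Suc n)))) \<and>
      tr k (yh_g d m k (Suc n)) = yh_scal d m (Suc n) z)"
  unfolding relative_trace_chain_def all_Suc_iff diff_Suc_1 Let_def ..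

lemma relative_trace_chainD:
  assumes "relative_trace_chain d m z x tr"
  shows "tr \<in> (\<Pi>\<^sub>E k\<in>{1..}. carrier (YH d m k) \<rightarrow>\<^sub>E carrier (YH d m (k - 1)))"
    and "A \<in> carrier (YH d m (Suc n)) \<Longrightarrow> tr (Suc n) A \<in> carrier (YH d m n)"
    and "A \<in> carrier (YH d m (Suc n)) \<Longrightarrow> B \<in> carrier (YH d m (Suc n)) \<Longrightarrow>
      tr (Suc n) (A \<oplus>\<^bsub>YH d m (Suc n)\<^esub> B) = tr (Suc n) A \<oplus>\<^bsub>YH d m n\<^esub> tr (Suc n) B"
    and "c \<in> carrier (\<R> m) \<Longrightarrow> A \<in> carrier (YH d m (Suc n)) \<Longrightarrow>
      tr (Suc n) (yh_scal d m (Suc n) c \<otimes>\<^bsub>YH d m (Suc n)\<^esub> A) = yh_scal d m n c \<otimes>\<^bsub>YH d m n\<^esub> tr (Suc n) A"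
    and "a \<in> E_set m \<Longrightarrow> b \<in> {0..<int d} \<Longrightarrow>
      tr 1 ((yh_X d m 1 [^]\<^bsub>YH d m 1\<^esub> a) \<otimes>\<^bsub>YH d m 1\<^esub> (yh_t d m 1 1 [^]\<^bsub>YH d m 1\<^esub> b)) = yh_scal d m 0 (x a b)"
    and "A \<in> carrier (YH d m (Suc p)) \<Longrightarrow> B \<in> carrier (YH d m (Suc p)) \<Longrightarrow> C \<in> carrier (YH d m (Suc (Suc p))) \<Longrightarrow>
      tr (Suc (Suc p)) (yh_incl d m (Suc (Suc p)) A \<otimes>\<^bsub>YH d m (Suc (Suc p))\<^esub> C \<otimes>\<^bsub>YH d m (Suc (Suc p))\<^esub> yh_incl d m (Suc (Suc p)) B)
        = A \<otimes>\<^bsub>YH d m (Suc p)\<^esub> tr (Suc (Suc p)) C \<otimes>\<^bsub>YH d m (Suc p)\<^esub> B"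
    and "A \<in> carrier (YH d m (Suc p)) \<Longrightarrow> \<epsilon> \<in> {1, -1 :: int} \<Longrightarrow>
      tr (Suc (Suc p)) ((yh_g d m (Suc (Suc p)) (Suc p) [^]\<^bsub>YH d m (Suc (Suc p))\<^esub> \<epsilon>)
          \<otimes>\<^bsub>YH d m (Suc (Suc p))\<^esub> yh_incl d m (Suc (Suc p)) A
          \<otimes>\<^bsub>YH d m (Suc (Suc p))\<^esub> (yh_g d m (Suc (Suc p)) (Suc p) [^]\<^bsub>YH d m (Suc (Suc p))\<^esub> (- \<epsilon>)))
        = yh_incl d m (Suc p) (tr (Suc p) A)"
    and "C \<in> carrier (YH d m (Suc (Suc p))) \<Longrightarrow>
      tr (Suc p) (tr (Suc (Suc p)) (yh_g d m (Suc (Suc p)) (Suc p) \<otimes>\<^bsub>YH d m (Suc (Suc p))\<^esub> C))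
        = tr (Suc p) (tr (Suc (Suc p)) (C \<otimes>\<^bsub>YH d m (Suc (Suc p))\<^esub> yh_g d m (Suc (Suc p)) (Suc p)))"
    and "tr (Suc (Suc p)) (yh_g d m (Suc (Suc p)) (Suc p)) = yh_scal d m (Suc p) z"
proof -
  note r = assms[unfolded relative_trace_chain_Suc Let_def]
  note 1 = conjunct1[OF r] and 2 = conjunct1[OF conjunct2[OF r]]
    and 3 = conjunct1[OF conjunct2[OF conjunct2[OF r]]] and 4 = spec[OF conjunct2[OF conjunct2[OF conjunct2[OF r]]], of p]
  note lin = spec[OF 2, of n, unfolded yh_linear_def]
  note 5 = bspec[OF bspec[OF 3]] bspec[OF bspec[OF bspec[OF conjunct1[OF 4]]]]
    bspec[OF bspec[OF conjunct1[OF conjunct2[OF 4]]]] bspec[OF conjunct1[OF conjunct2[OF conjunct2[OF 4]]]]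
    conjunct2[OF conjunct2[OF conjunct2[OF 4]]]
  show "tr \<in> (\<Pi>\<^sub>E k\<in>{1..}. carrier (YH d m k) \<rightarrow>\<^sub>E carrier (YH d m (k - 1)))" by (rule 1)
  show "A \<in> carrier (YH d m (Suc n)) \<Longrightarrow> tr (Suc n) A \<in> carrier (YH d m n)"
    by (rule funcset_mem[OF conjunct1[OF lin]])
  show "A \<in> carrier (YH d m (Suc n)) \<Longrightarrow> B \<in> carrier (YH d m (Suc n)) \<Longrightarrow>
      tr (Suc n) (A \<oplus>\<^bsub>YH d m (Suc n)\<^esub> B) = tr (Suc n) A \<oplus>\<^bsub>YH d m n\<^esub> tr (Suc n) B"
    by (rule bspec[OF bspec[OF conjunct1[OF conjunct2[OF lin]]]])
  show "c \<in> carrier (\<R> m) \<Longrightarrow> A \<in> carrier (YH d m (Suc n)) \<Longrightarrow>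
      tr (Suc n) (yh_scal d m (Suc n) c \<otimes>\<^bsub>YH d m (Suc n)\<^esub> A) = yh_scal d m n c \<otimes>\<^bsub>YH d m n\<^esub> tr (Suc n) A"
    by (rule bspec[OF bspec[OF conjunct2[OF conjunct2[OF lin]]]])
  show "a \<in> E_set m \<Longrightarrow> b \<in> {0..<int d} \<Longrightarrow>
      tr 1 ((yh_X d m 1 [^]\<^bsub>YH d m 1\<^esub> a) \<otimes>\<^bsub>YH d m 1\<^esub> (yh_t d m 1 1 [^]\<^bsub>YH d m 1\<^esub> b)) = yh_scal d m 0 (x a b)"
    by (rule 5(1))
  show "A \<in> carrier (YH d m (Suc p)) \<Longrightarrow> B \<in> carrier (YH d m (Suc p)) \<Longrightarrow> C \<in> carrier (YH d m (Suc (Suc p))) \<Longrightarrow>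
      tr (Suc (Suc p)) (yh_incl d m (Suc (Suc p)) A \<otimes>\<^bsub>YH d m (Suc (Suc p))\<^esub> C \<otimes>\<^bsub>YH d m (Suc (Suc p))\<^esub> yh_incl d m (Suc (Suc p)) B)
        = A \<otimes>\<^bsub>YH d m (Suc p)\<^esub> tr (Suc (Suc p)) C \<otimes>\<^bsub>YH d m (Suc p)\<^esub> B"
    by (rule 5(2))
  show "A \<in> carrier (YH d m (Suc p)) \<Longrightarrow> \<epsilon> \<in> {1, -1 :: int} \<Longrightarrow>
      tr (Suc (Suc p)) ((yh_g d m (Suc (Suc p)) (Suc p) [^]\<^bsub>YH d m (Suc (Suc p))\<^esub> \<epsilon>)
          \<otimes>\<^bsub>YH d m (Suc (Suc p))\<^esub> yh_incl d m (Suc (Suc p)) A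
          \<otimes>\<^bsub>YH d m (Suc (Suc p))\<^esub> (yh_g d m (Suc (Suc p)) (Suc p) [^]\<^bsub>YH d m (Suc (Suc p))\<^esub> (- \<epsilon>)))
        = yh_incl d m (Suc p) (tr (Suc p) A)"
    by (rule 5(3))
  show "C \<in> carrier (YH d m (Suc (Suc p))) \<Longrightarrow>
      tr (Suc p) (tr (Suc (Suc p)) (yh_g d m (Suc (Suc p)) (Suc p) \<otimes>\<^bsub>YH d m (Suc (Suc p))\<^esub> C))
        = tr (Suc p) (tr (Suc (Suc p)) (C \<otimes>\<^bsub>YH d m (Suc (Suc p))\<^esub> yh_g d m (Suc (Suc p)) (Suc p)))"
    by (rule 5(4))
  show "tr (Suc (Suc p)) (yh_g d m (Suc (Suc p)) (Suc p)) = yh_scal d m (Suc p) z"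
    by (rule 5(5))
qed

context yh_limit
begin

lemma \<kappa>_conj:
  assumes "A \<in> carrier (YH d m (Suc p))"
  defines "k \<equiv> Suc (Suc p)"
  defines "C \<equiv> \<lambda>\<epsilon>. (yh_g d m k (Suc p) [^]\<^bsub>YH d m k\<^esub> (\<epsilon> :: int)) \<otimes>\<^bsub>YH d m k\<^esub> yh_incl d m k A
    \<otimes>\<^bsub>YH d m k\<^esub> (yh_g d m k (Suc p) [^]\<^bsub>YH d m k\<^esub> (- \<epsilon>))"
  shows "C \<epsilon> \<in> carrier (YH d m k)"
    and "\<kappa> k (C \<epsilon>) = zpow (g (Suc p)) (gi (Suc p)) \<epsilon> * \<kappa> (Suc p) A * zpow (g (Suc p)) (gi (Suc p)) (- \<epsilon>)"
proof -
  have "1 \<le> Suc p" "Suc p < k" by (simp_all add: k_def)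
  note g = \<kappa>_g_pow[OF this]
  have "Suc p \<le> k" by (simp add: k_def)
  note A = \<kappa>_incl[OF this assms(1)]
  show "C \<epsilon> \<in> carrier (YH d m k)"
    unfolding C_def by (intro YH_mult_in g A)
  show "\<kappa> k (C \<epsilon>) = zpow (g (Suc p)) (gi (Suc p)) \<epsilon> * \<kappa> (Suc p) A * zpow (g (Suc p)) (gi (Suc p)) (- \<epsilon>)"
    unfolding C_def \<kappa>_mult[OF YH_mult_in[OF g(1) A(1)] g(1)] \<kappa>_mult[OF g(1) A(1)] g(2) A(2) ..
qed

lemma \<kappa>_bimodule:
  assumes "A \<in> carrier (YH d m n)" "B \<in> carrier (YH d m n)" "C \<in> carrier (YH d m (Suc n))"
  defines "D \<equiv> yh_incl d m (Suc n) A \<otimes>\<^bsub>YH d m (Suc n)\<^esub> C \<otimes>\<^bsub>YH d m (Suc n)\<^esub> yh_incl d m (Suc n) B"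
  shows "D \<in> carrier (YH d m (Suc n))" and "\<kappa> (Suc n) D = \<kappa> n A * \<kappa> (Suc n) C * \<kappa> n B"
proof -
  have "n \<le> Suc n" by simp
  note A = \<kappa>_incl[OF this assms(1)] and B = \<kappa>_incl[OF this assms(2)]
  show "D \<in> carrier (YH d m (Suc n))"
    unfolding D_def by (intro YH_mult_in A B assms)
  show "\<kappa> (Suc n) D = \<kappa> n A * \<kappa> (Suc n) C * \<kappa> n B"
    unfolding D_def \<kappa>_mult[OF YH_mult_in[OF A(1) assms(3)] B(1)] \<kappa>_mult[OF A(1) assms(3)] A(2) B(2) ..
qed

lemma \<kappa>_X_t:
  fixes a b :: int
  assumes "0 \<le> b"
  defines "A \<equiv> (yh_X d m 1 [^]\<^bsub>YH d m 1\<^esub> a) \<otimes>\<^bsub>YH d m 1\<^esub> (yh_t d m 1 1 [^]\<^bsub>YH d m 1\<^esub> b)"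
  shows "A \<in> carrier (YH d m (Suc 0))" and "\<kappa> (Suc 0) A = Xp a * tp 1 b"
proof -
  note X = \<kappa>_X_pow[of 1 a, OF order_refl] and t = \<kappa>_t_pow[of 1 1 b, OF order_refl order_refl assms(1)]
  show "A \<in> carrier (YH d m (Suc 0))" "\<kappa> (Suc 0) A = Xp a * tp 1 b"
    using YH_mult_in[OF X(1) t(1)] \<kappa>_mult[OF X(1) t(1)] X(2) t(2) by (simp_all add: A_def)
qed

definition lower :: "(nat \<Rightarrow> yh_elem \<Rightarrow> yh_elem) \<Rightarrow> nat \<Rightarrow> 'a \<Rightarrow> 'a"
  where "lower tr n u = \<kappa> n (tr (Suc n) (\<iota> (Suc n) u))"

lemma lower_\<kappa>: "A \<in> carrier (YH d m (Suc n)) \<Longrightarrow> lower tr n (\<kappa> (Suc n) A) = \<kappa> n (tr (Suc n) A)"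
  by (simp add: lower_def \<iota>_\<kappa>)

lemma S_cases:
  assumes "u \<in> S n"
  obtains A where "A \<in> carrier (YH d m n)" "u = \<kappa> n A"
  using \<kappa>_surj[OF assms] by (rule imageE) (rule that)

lemma trace_chain_lower:
  assumes R: "relative_trace_chain d m z x tr" and z: "z \<in> carrier (\<R> m)"
    and x: "\<And>a b. a \<in> E_set m \<Longrightarrow> b \<in> {0..<int d} \<Longrightarrow> x a b \<in> carrier (\<R> m)"
  shows "trace_chain z x (lower tr)"
proof (rule trace_chainI)
  note r = relative_trace_chainD[OF R]
  note tr_in = r(2)
  fix n
  show "lower tr n u \<in> S n" if "u \<in> S (Suc n)" for u
    using that by (rule S_cases) (simp add: lower_\<kappa> \<kappa>_S tr_in)
  show "lower tr n (u + v) = lower tr n u + lower tr n v" if u: "u \<in> S (Suc n)" and v: "v \<in> S (Suc n)" for u v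
  proof -
    obtain A B where A: "A \<in> carrier (YH d m (Suc n))" "u = \<kappa> (Suc n) A"
      and B: "B \<in> carrier (YH d m (Suc n))" "v = \<kappa> (Suc n) B"
      using S_cases[OF u] S_cases[OF v] by metis
    have "tr (Suc n) (A \<oplus>\<^bsub>YH d m (Suc n)\<^esub> B) = tr (Suc n) A \<oplus>\<^bsub>YH d m n\<^esub> tr (Suc n) B"
      by (rule r(3)[OF A(1) B(1)])
    then show ?thesis
      unfolding A(2) B(2) \<kappa>_add[OF A(1) B(1), symmetric] lower_\<kappa>[OF YH_add_in[OF A(1) B(1)]] lower_\<kappa>[OF A(1)] lower_\<kappa>[OF B(1)]
      by (simp only: \<kappa>_add[OF tr_in[OF A(1)] tr_in[OF B(1)]])
  qed
  show "lower tr n (sc c * u) = sc c * lower tr n u" if c: "c \<in> carrier (\<R> m)" and u: "u \<in> S (Suc n)" for c u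
  proof -
    obtain A where A: "A \<in> carrier (YH d m (Suc n))" "u = \<kappa> (Suc n) A" using u by (rule S_cases)
    note c1 = \<kappa>_scal[OF c, of "Suc n"] and c0 = \<kappa>_scal[OF c, of n]
    have "tr (Suc n) (yh_scal d m (Suc n) c \<otimes>\<^bsub>YH d m (Suc n)\<^esub> A) = yh_scal d m n c \<otimes>\<^bsub>YH d m n\<^esub> tr (Suc n) A"
      by (rule r(4)[OF c A(1)])
    then show ?thesis
      unfolding A(2) c1(2)[symmetric] \<kappa>_mult[OF c1(1) A(1), symmetric] lower_\<kappa>[OF YH_mult_in[OF c1(1) A(1)]] lower_\<kappa>[OF A(1)]
      by (simp only: \<kappa>_mult[OF c0(1) tr_in[OF A(1)]] c0(2) c1(2))
  qed
  show "lower tr 0 (Xp a * tp 1 b) = sc (x a b)" if a: "a \<in> E_set m" and b: "b \<in> {0..<int d}" for a b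
  proof -
    have b0: "0 \<le> b" using b by simp
    note A = \<kappa>_X_t[OF b0, of a]
    have "tr 1 ((yh_X d m 1 [^]\<^bsub>YH d m 1\<^esub> a) \<otimes>\<^bsub>YH d m 1\<^esub> (yh_t d m 1 1 [^]\<^bsub>YH d m 1\<^esub> b)) = yh_scal d m 0 (x a b)"
      by (rule r(5)[OF a b])
    then show ?thesis
      unfolding A(2)[symmetric] lower_\<kappa>[OF A(1)] using \<kappa>_scal(2)[OF x[OF a b], of 0] by simp
  qed
  show "lower tr (Suc p) (u * Z * v) = u * lower tr (Suc p) Z * v"
    if u: "u \<in> S (Suc p)" and v: "v \<in> S (Suc p)" and Z: "Z \<in> S (Suc (Suc p))" for p u v Z
  proof -
    obtain A B where A: "A \<in> carrier (YH d m (Suc p))" "u = \<kappa> (Suc p) A"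
      and B: "B \<in> carrier (YH d m (Suc p))" "v = \<kappa> (Suc p) B"
      using S_cases[OF u] S_cases[OF v] by metis
    obtain C where C: "C \<in> carrier (YH d m (Suc (Suc p)))" "Z = \<kappa> (Suc (Suc p)) C" using Z by (rule S_cases)
    note D = \<kappa>_bimodule[OF A(1) B(1) C(1)]
    have "tr (Suc (Suc p)) (yh_incl d m (Suc (Suc p)) A \<otimes>\<^bsub>YH d m (Suc (Suc p))\<^esub> C \<otimes>\<^bsub>YH d m (Suc (Suc p))\<^esub> yh_incl d m (Suc (Suc p)) B)
        = A \<otimes>\<^bsub>YH d m (Suc p)\<^esub> tr (Suc (Suc p)) C \<otimes>\<^bsub>YH d m (Suc p)\<^esub> B"
      by (rule r(6)[OF A(1) B(1) C(1)])
    then show ?thesis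
      unfolding A(2) B(2) C(2) D(2)[symmetric] lower_\<kappa>[OF D(1)] lower_\<kappa>[OF C(1)]
      by (simp only: \<kappa>_mult[OF YH_mult_in[OF A(1) tr_in[OF C(1)]] B(1)] \<kappa>_mult[OF A(1) tr_in[OF C(1)]])
  qed
  have conj: "lower tr (Suc p) (zpow (g (Suc p)) (gi (Suc p)) \<epsilon> * u * zpow (g (Suc p)) (gi (Suc p)) (- \<epsilon>)) = lower tr p u"
    if u: "u \<in> S (Suc p)" and e: "\<epsilon> \<in> {1, - 1}" for p u \<epsilon>
  proof -
    obtain A where A: "A \<in> carrier (YH d m (Suc p))" "u = \<kappa> (Suc p) A" using u by (rule S_cases)
    note C = \<kappa>_conj[OF A(1), of \<epsilon>]
    have "p \<le> Suc p" by simp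
    note i = \<kappa>_incl(2)[OF this tr_in[OF A(1)]]
    show ?thesis
      unfolding A(2) C(2)[symmetric] lower_\<kappa>[OF C(1)] lower_\<kappa>[OF A(1)] i[symmetric] r(7)[OF A(1) e] ..
  qed
  show "lower tr (Suc p) (g (Suc p) * u * gi (Suc p)) = lower tr p u"
    "lower tr (Suc p) (gi (Suc p) * u * g (Suc p)) = lower tr p u" if "u \<in> S (Suc p)" for p u
    using conj[OF that, of 1] conj[OF that, of "- 1"] by simp_all
  fix p
  have "1 \<le> Suc p" "Suc p < Suc (Suc p)" by simp_all
  note g = \<kappa>_g[OF this]
  show "lower tr (Suc p) (g (Suc p)) = sc z"
    unfolding g(2)[symmetric] lower_\<kappa>[OF g(1)] \<kappa>_scal(2)[OF z, of "Suc p", symmetric] r(9) ..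
  show "lower tr p (lower tr (Suc p) (g (Suc p) * Z)) = lower tr p (lower tr (Suc p) (Z * g (Suc p)))"
    if Z: "Z \<in> S (Suc (Suc p))" for Z
  proof -
    obtain C where C: "C \<in> carrier (YH d m (Suc (Suc p)))" "Z = \<kappa> (Suc (Suc p)) C" using Z by (rule S_cases)
    note gC = YH_mult_in[OF g(1) C(1)] YH_mult_in[OF C(1) g(1)]
    have "tr (Suc p) (tr (Suc (Suc p)) (yh_g d m (Suc (Suc p)) (Suc p) \<otimes>\<^bsub>YH d m (Suc (Suc p))\<^esub> C))
        = tr (Suc p) (tr (Suc (Suc p)) (C \<otimes>\<^bsub>YH d m (Suc (Suc p))\<^esub> yh_g d m (Suc (Suc p)) (Suc p)))"
      by (rule r(8)[OF C(1)])
    then show ?thesis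
      unfolding C(2) g(2)[symmetric] \<kappa>_mult[OF g(1) C(1), symmetric] \<kappa>_mult[OF C(1) g(1), symmetric]
        lower_\<kappa>[OF gC(1)] lower_\<kappa>[OF gC(2)] lower_\<kappa>[OF tr_in[OF gC(1)]] lower_\<kappa>[OF tr_in[OF gC(2)]]
      by (simp only:)
  qed
qed

text \<open>Restriction in both arguments makes the family extensional, which the definition of a
  chain of relative traces demands.\<close>

definition upper :: "(nat \<Rightarrow> 'a \<Rightarrow> 'a) \<Rightarrow> nat \<Rightarrow> yh_elem \<Rightarrow> yh_elem"
  where "upper T = (\<lambda>k\<in>{1..}. \<lambda>A\<in>carrier (YH d m k). \<iota> (k - 1) (T (k - 1) (\<kappa> k A)))"

lemma upper_Suc:
  assumes "trace_chain z x T" "A \<in> carrier (YH d m (Suc n))"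
  shows "upper T (Suc n) A \<in> carrier (YH d m n)" and "\<kappa> n (upper T (Suc n) A) = T n (\<kappa> (Suc n) A)"
proof -
  have "upper T (Suc n) A = \<iota> n (T n (\<kappa> (Suc n) A))" using assms(2) by (simp add: upper_def)
  moreover have "T n (\<kappa> (Suc n) A) \<in> S n" by (rule trace_chainD(1)[OF assms(1) \<kappa>_S[OF assms(2)]])
  ultimately show "upper T (Suc n) A \<in> carrier (YH d m n)" "\<kappa> n (upper T (Suc n) A) = T n (\<kappa> (Suc n) A)"
    using \<iota>_in \<kappa>_\<iota> by (simp_all only:)
qed

text \<open>A chain sees the parameters on their original range only, so the chain built from the
  extended parameters is one for the given parameters.\<close>

lemma trace_chain_cong:
  assumes T: "trace_chain z x T" and "\<And>a b. a \<in> E_set m \<Longrightarrow> b \<in> {0..<int d} \<Longrightarrow> x a b = x' a b"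
  shows "trace_chain z x' T"
proof (rule trace_chainI)
  fix a b assume a: "a \<in> E_set m" and b: "b \<in> {0..<int d}"
  show "T 0 (Xp a * tp 1 b) = sc (x' a b)"
    using trace_chainD(4)[OF T a b] assms(2)[OF a b] by (simp only:)
qed (rule trace_chainD[OF T]; assumption)+

lemma relative_trace_chain_upper:
  assumes T: "trace_chain z x T" and z: "z \<in> carrier (\<R> m)"
    and x: "\<And>a b. a \<in> E_set m \<Longrightarrow> b \<in> {0..<int d} \<Longrightarrow> x a b \<in> carrier (\<R> m)"
  shows "relative_trace_chain d m z x (upper T)"
  unfolding relative_trace_chain_Suc Let_def yh_linear_def
proof (intro conjI allI ballI)
  note U = upper_Suc[OF T]
  show "upper T \<in> (\<Pi>\<^sub>E k\<in>{1..}. carrier (YH d m k) \<rightarrow>\<^sub>E carrier (YH d m (k - 1)))"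
  proof (rule PiE_I)
    fix k :: nat assume "k \<in> {1..}"
    then obtain n where k: "k = Suc n" by (cases k) auto
    show "upper T k \<in> carrier (YH d m k) \<rightarrow>\<^sub>E carrier (YH d m (k - 1))"
      unfolding k by (rule PiE_I) (use U(1) in simp, simp add: upper_def)
  qed (simp add: upper_def)
  fix n
  show "upper T (Suc n) \<in> carrier (YH d m (Suc n)) \<rightarrow> carrier (YH d m n)"
    by (rule funcsetI[OF U(1)])
  fix A assume A: "A \<in> carrier (YH d m (Suc n))"
  show "upper T (Suc n) (A \<oplus>\<^bsub>YH d m (Suc n)\<^esub> B) = upper T (Suc n) A \<oplus>\<^bsub>YH d m n\<^esub> upper T (Suc n) B"
    if B: "B \<in> carrier (YH d m (Suc n))" for B
  proof (rule \<kappa>_inj[OF U(1)[OF YH_add_in[OF A B]] YH_add_in[OF U(1)[OF A] U(1)[OF B]]])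
    show "\<kappa> n (upper T (Suc n) (A \<oplus>\<^bsub>YH d m (Suc n)\<^esub> B)) = \<kappa> n (upper T (Suc n) A \<oplus>\<^bsub>YH d m n\<^esub> upper T (Suc n) B)"
      unfolding U(2)[OF YH_add_in[OF A B]] \<kappa>_add[OF A B] \<kappa>_add[OF U(1)[OF A] U(1)[OF B]] U(2)[OF A] U(2)[OF B]
      by (rule trace_chainD(2)[OF T \<kappa>_S[OF A] \<kappa>_S[OF B]])
  qed
  fix c assume c: "c \<in> carrier (\<R> m)"
  note c1 = \<kappa>_scal[OF c, of "Suc n"] and c0 = \<kappa>_scal[OF c, of n]
  show "upper T (Suc n) (yh_scal d m (Suc n) c \<otimes>\<^bsub>YH d m (Suc n)\<^esub> A) = yh_scal d m n c \<otimes>\<^bsub>YH d m n\<^esub> upper T (Suc n) A"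
  proof (rule \<kappa>_inj[OF U(1)[OF YH_mult_in[OF c1(1) A]] YH_mult_in[OF c0(1) U(1)[OF A]]])
    show "\<kappa> n (upper T (Suc n) (yh_scal d m (Suc n) c \<otimes>\<^bsub>YH d m (Suc n)\<^esub> A)) = \<kappa> n (yh_scal d m n c \<otimes>\<^bsub>YH d m n\<^esub> upper T (Suc n) A)"
      unfolding U(2)[OF YH_mult_in[OF c1(1) A]] \<kappa>_mult[OF c1(1) A] c1(2) \<kappa>_mult[OF c0(1) U(1)[OF A]] c0(2) U(2)[OF A]
      by (rule trace_chainD(3)[OF T c \<kappa>_S[OF A]])
  qed
next
  note U = upper_Suc[OF T]
  fix a b assume a: "a \<in> E_set m" and b: "b \<in> {0..<int d}"
  then have b0: "0 \<le> b" by simp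
  note A = \<kappa>_X_t[OF b0, of a] and c = \<kappa>_scal[OF x[OF a b], of 0]
  let ?A = "yh_X d m 1 [^]\<^bsub>YH d m 1\<^esub> a \<otimes>\<^bsub>YH d m 1\<^esub> yh_t d m 1 1 [^]\<^bsub>YH d m 1\<^esub> b"
  have "upper T (Suc 0) ?A = yh_scal d m 0 (x a b)"
    by (rule \<kappa>_inj[OF U(1)[OF A(1)] c(1)]) (unfold U(2)[OF A(1)] A(2) c(2), rule trace_chainD(4)[OF T a b])
  then show "upper T 1 ?A = yh_scal d m 0 (x a b)" by (simp only: One_nat_def)
next
  note U = upper_Suc[OF T]
  fix p A B C
  assume A: "A \<in> carrier (YH d m (Suc p))" and B: "B \<in> carrier (YH d m (Suc p))" and C: "C \<in> carrier (YH d m (Suc (Suc p)))"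
  note D = \<kappa>_bimodule[OF A B C]
  note AC = YH_mult_in[OF A U(1)[OF C]]
  let ?k = "Suc (Suc p)"
  show "upper T ?k (yh_incl d m ?k A \<otimes>\<^bsub>YH d m ?k\<^esub> C \<otimes>\<^bsub>YH d m ?k\<^esub> yh_incl d m ?k B)
      = A \<otimes>\<^bsub>YH d m (Suc p)\<^esub> upper T ?k C \<otimes>\<^bsub>YH d m (Suc p)\<^esub> B"
    by (rule \<kappa>_inj[OF U(1)[OF D(1)] YH_mult_in[OF AC B]])
      (unfold U(2)[OF D(1)] D(2) \<kappa>_mult[OF AC B] \<kappa>_mult[OF A U(1)[OF C]] U(2)[OF C],
        rule trace_chainD(5)[OF T \<kappa>_S[OF A] \<kappa>_S[OF B] \<kappa>_S[OF C]])
next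
  note U = upper_Suc[OF T]
  fix p A and \<epsilon> :: int
  assume A: "A \<in> carrier (YH d m (Suc p))" and e: "\<epsilon> \<in> {1, - 1}"
  note D = \<kappa>_conj[OF A, of \<epsilon>]
  have "p \<le> Suc p" by simp
  note i = \<kappa>_incl[OF this U(1)[OF A]]
  let ?k = "Suc (Suc p)"
  show "upper T ?k (yh_g d m ?k (Suc p) [^]\<^bsub>YH d m ?k\<^esub> \<epsilon> \<otimes>\<^bsub>YH d m ?k\<^esub> yh_incl d m ?k A
      \<otimes>\<^bsub>YH d m ?k\<^esub> yh_g d m ?k (Suc p) [^]\<^bsub>YH d m ?k\<^esub> (- \<epsilon>)) = yh_incl d m (Suc p) (upper T (Suc p) A)"
  proof (rule \<kappa>_inj[OF U(1)[OF D(1)] i(1)])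
    have "T (Suc p) (zpow (g (Suc p)) (gi (Suc p)) \<epsilon> * \<kappa> (Suc p) A * zpow (g (Suc p)) (gi (Suc p)) (- \<epsilon>)) = T p (\<kappa> (Suc p) A)"
    proof (cases "\<epsilon> = 1")
      case True
      then show ?thesis using trace_chainD(6)[OF T \<kappa>_S[OF A]] by simp
    next
      case False
      then have "\<epsilon> = - 1" using e by simp
      then show ?thesis using trace_chainD(7)[OF T \<kappa>_S[OF A]] by simp
    qed
    then show "\<kappa> (Suc p) (upper T ?k (yh_g d m ?k (Suc p) [^]\<^bsub>YH d m ?k\<^esub> \<epsilon> \<otimes>\<^bsub>YH d m ?k\<^esub> yh_incl d m ?k A
        \<otimes>\<^bsub>YH d m ?k\<^esub> yh_g d m ?k (Suc p) [^]\<^bsub>YH d m ?k\<^esub> (- \<epsilon>))) = \<kappa> (Suc p) (yh_incl d m (Suc p) (upper T (Suc p) A))"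
      unfolding U(2)[OF D(1)] D(2) i(2) U(2)[OF A] .
  qed
next
  note U = upper_Suc[OF T]
  fix p
  let ?k = "Suc (Suc p)"
  have "1 \<le> Suc p" "Suc p < ?k" by simp_all
  note g = \<kappa>_g[OF this]
  note z' = \<kappa>_scal[OF z, of "Suc p"]
  show "upper T ?k (yh_g d m ?k (Suc p)) = yh_scal d m (Suc p) z"
    by (rule \<kappa>_inj[OF U(1)[OF g(1)] z'(1)]) (unfold U(2)[OF g(1)] g(2) z'(2), rule trace_chainD(9)[OF T])
  fix C assume C: "C \<in> carrier (YH d m ?k)"
  note gC = YH_mult_in[OF g(1) C] and Cg = YH_mult_in[OF C g(1)]
  show "upper T (Suc p) (upper T ?k (yh_g d m ?k (Suc p) \<otimes>\<^bsub>YH d m ?k\<^esub> C)) =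
      upper T (Suc p) (upper T ?k (C \<otimes>\<^bsub>YH d m ?k\<^esub> yh_g d m ?k (Suc p)))"
    by (rule \<kappa>_inj[OF U(1)[OF U(1)[OF gC]] U(1)[OF U(1)[OF Cg]]])
      (unfold U(2)[OF U(1)[OF gC]] U(2)[OF U(1)[OF Cg]] U(2)[OF gC] U(2)[OF Cg] \<kappa>_mult[OF g(1) C] \<kappa>_mult[OF C g(1)] g(2),
        rule trace_chainD(8)[OF T \<kappa>_S[OF C]])
qed

lemma relative_trace_chain_unique:
  assumes R: "relative_trace_chain d m z x tr" "relative_trace_chain d m z x tr'" and z: "z \<in> carrier (\<R> m)"
    and x: "\<And>a b. a \<in> E_set m \<Longrightarrow> b \<in> {0..<int d} \<Longrightarrow> x a b \<in> carrier (\<R> m)"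
  shows "tr = tr'"
proof -
  have T: "trace_chain z x (lower tr)" by (rule trace_chain_lower[OF R(1) z x])
  have T': "trace_chain z x (lower tr')" by (rule trace_chain_lower[OF R(2) z x])
  show ?thesis
  proof (rule PiE_ext[OF relative_trace_chainD(1)[OF R(1)] relative_trace_chainD(1)[OF R(2)]])
    fix k :: nat assume "k \<in> {1..}"
    then obtain n where k: "k = Suc n" by (cases k) auto
    have "tr (Suc n) \<in> carrier (YH d m (Suc n)) \<rightarrow>\<^sub>E carrier (YH d m (Suc n - 1))"
      "tr' (Suc n) \<in> carrier (YH d m (Suc n)) \<rightarrow>\<^sub>E carrier (YH d m (Suc n - 1))"
      by (rule PiE_mem[OF relative_trace_chainD(1)[OF R(1)]] PiE_mem[OF relative_trace_chainD(1)[OF R(2)]], simp)+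
    then have "tr (Suc n) = tr' (Suc n)"
    proof (rule PiE_ext)
      fix A assume A: "A \<in> carrier (YH d m (Suc n))"
      have "lower tr n (\<kappa> (Suc n) A) = lower tr' n (\<kappa> (Suc n) A)"
        by (rule trace_chain_unique[OF T T' z \<kappa>_S[OF A]])
      then show "tr (Suc n) A = tr' (Suc n) A"
        unfolding lower_\<kappa>[OF A]
        by (rule \<kappa>_inj[OF relative_trace_chainD(2)[OF R(1) A] relative_trace_chainD(2)[OF R(2) A]])
    qed
    then show "tr k = tr' k" by (simp only: k)
  qed
qed

lemma relative_trace_chain_W:
  assumes R: "relative_trace_chain d m z x tr" and z: "z \<in> carrier (\<R> m)"
    and x: "\<And>a b. a \<in> E_set m \<Longrightarrow> b \<in> {0..<int d} \<Longrightarrow> x a b \<in> carrier (\<R> m)"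
    and J: "J \<le> n" and a: "a \<in> E_set m" and b: "b \<in> {0..<int d}" and w: "w \<in> carrier (YH d m n)"
  shows "J < n \<Longrightarrow> tr (Suc n) (yh_W d m (Suc n) J a b \<otimes>\<^bsub>YH d m (Suc n)\<^esub> yh_incl d m (Suc n) w) =
      yh_scal d m n z \<otimes>\<^bsub>YH d m n\<^esub> yh_W d m n J a b \<otimes>\<^bsub>YH d m n\<^esub> w" (is "_ \<Longrightarrow> ?lhs = ?rhs1")
    and "J = n \<Longrightarrow> tr (Suc n) (yh_W d m (Suc n) J a b \<otimes>\<^bsub>YH d m (Suc n)\<^esub> yh_incl d m (Suc n) w) =
      yh_scal d m n (x a b) \<otimes>\<^bsub>YH d m n\<^esub> w" (is "_ \<Longrightarrow> _ = ?rhs2")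
proof -
  have T: "trace_chain z x (lower tr)" by (rule trace_chain_lower[OF R z x])
  have b0: "0 \<le> b" using b by simp
  have n: "n \<le> Suc n" by simp
  note W = \<kappa>_W[OF J b0, of a] and i = \<kappa>_incl[OF n w]
  note Ww = YH_mult_in[OF W(1) i(1)]
  note tr_in = relative_trace_chainD(2)[OF R Ww]
  have lhs: "\<kappa> n ?lhs = lower tr n (W n J a b * \<kappa> n w)"
    unfolding lower_\<kappa>[OF Ww, symmetric] \<kappa>_mult[OF W(1) i(1)] W(2) i(2) ..
  show "?lhs = ?rhs1" if Jn: "J < n"
  proof -
    obtain p where p: "n = Suc p" "J \<le> p" using Jn by (cases n) auto
    note W' = \<kappa>_W[OF p(2) b0, of a, folded p(1)] and c = \<kappa>_scal[OF z, of n]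
    note cW = YH_mult_in[OF c(1) W'(1)]
    show ?thesis
      by (rule \<kappa>_inj[OF tr_in YH_mult_in[OF cW w]])
        (unfold lhs \<kappa>_mult[OF cW w] \<kappa>_mult[OF c(1) W'(1)] c(2) W'(2) trace_chain_W(1)[OF T z \<kappa>_S[OF w] J Jn],
          simp add: p)
  qed
  show "?lhs = ?rhs2" if Jn: "J = n"
  proof -
    note c = \<kappa>_scal[OF x[OF a b], of n]
    show ?thesis
      by (rule \<kappa>_inj[OF tr_in YH_mult_in[OF c(1) w]])
        (unfold lhs \<kappa>_mult[OF c(1) w] c(2), rule trace_chain_W(2)[OF T z \<kappa>_S[OF w] J Jn a b])
  qed
qed

lemma relative_trace_chain_exists:
  assumes z: "z \<in> carrier (\<R> m)" and x: "\<And>a b. a \<in> E_set m \<Longrightarrow> b \<in> {0..<int d} \<Longrightarrow> x a b \<in> carrier (\<R> m)"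
  shows "\<exists>tr. relative_trace_chain d m z x tr"
proof (rule parameter_extension[of m d x])
  show "x a b \<in> carrier (\<R> m)" if "a \<in> E_set m" "b \<in> {0..<int d}" for a b using that by (rule x)
  fix x'
  assume x': "\<And>a b. x' a b \<in> carrier (\<R> m)" "\<And>a b. x' a (b + int d) = x' a b"
    "\<And>k a b. m = enat k \<Longrightarrow> shifts (lvars [1..<Suc k]) (\<lambda>a. x' a b) a = 0"
    "\<And>a b. a \<in> E_set m \<Longrightarrow> b \<in> {0..<int d} \<Longrightarrow> x' a b = x a b"
  interpret Tr: yh_trace d dl t g X Xi m ev z x'
    by unfold_locales (fact z x'(1-3))+
  have "trace_chain z x Tr.TR"
    by (rule trace_chain_cong[OF Tr.trace_chain_TR x'(4)])
  then have "relative_trace_chain d m z x (upper Tr.TR)"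
    by (rule relative_trace_chain_upper[OF _ z x])
  then show ?thesis by (rule exI[of "relative_trace_chain d m z x"])
qed (rule d_pos)

end

section \<open>Kernels of the evaluation maps and injectivity of the inclusions of levels\<close>

lemma world_ideal:
  assumes d: "0 < d" and m: "0 < m" and f: "f \<in> carrier (yh_free m n)" and n: "enat n \<le> N"
  shows "uemb (d, m, N) f = 0 \<longleftrightarrow> f \<in> uid (d, m, N)"
proof -
  interpret A: yokonuma_algebra d n "uemb (d, m, N) (scal (lvar IndQ 1 - lvar IndQ (-1))) * uemb (d, m, N) (scal (lconst (1 / of_nat d)))"
    "\<lambda>j. uemb (d, m, N) (letter (GenT j))" "\<lambda>i. uemb (d, m, N) (letter (GenG i))"
    "uemb (d, m, N) (letter GenX)" "uemb (d, m, N) (letter GenXinv)" m "uemb (d, m, N)"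
    by (rule world[OF d m n])
  show ?thesis
    using uemb_eq_iff[OF d m ucarI[OF f n] ucar_0] unfolding A.ev_0 diff_zero .
qed

text \<open>The component N = n is used because its kernel on level n is the union of the ideals of
  levels up to n, that is, the ideal of level n. In the limit component the argument would be
  circular, the kernel there being the union of all the ideals.\<close>

lemma yh_ideal_Suc:
  assumes d: "0 < d" and m: "0 < m" and f: "f \<in> carrier (yh_free m n)" "f \<in> yh_ideal d m (Suc n)"
  shows "f \<in> yh_ideal d m n"
proof -
  let ?ev = "uemb (d, m, enat n)"
  interpret A: yokonuma_algebra d n "?ev (scal (lvar IndQ 1 - lvar IndQ (-1))) * ?ev (scal (lconst (1 / of_nat d)))"
    "\<lambda>j. ?ev (letter (GenT j))" "\<lambda>i. ?ev (letter (GenG i))" "?ev (letter GenX)" "?ev (letter GenXinv)" m ?ev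
    by (rule world[OF d m order_refl])
  show ?thesis
  proof (rule A.ideal_descent[OF _ f m])
    fix f assume f: "f \<in> carrier (yh_free m n)" "?ev f = 0"
    then have "f \<in> uid (d, m, enat n)" using world_ideal[OF d m f(1) order_refl] by blast
    then obtain k where "k \<le> n" "f \<in> yh_ideal d m k" by (auto simp: uid_def)
    then show "f \<in> yh_ideal d m n" using yh_ideal_mono[of k n d m] by blast
  qed
qed

text \<open>Iterated descent from level k to level n. It makes the kernel of the limit, a union of
  ideals, cut out on each level exactly the ideal of that level.\<close>

lemma yh_ideal_restrict:
  assumes d: "0 < d" and m: "0 < m" and f: "f \<in> carrier (yh_free m n)" "f \<in> yh_ideal d m k"
  shows "f \<in> yh_ideal d m n"
  using f(2)
proof (induction k)
  case 0
  then show ?case using yh_ideal_mono[of 0 n d m] by blast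
next
  case (Suc k)
  show ?case
  proof (cases "Suc k \<le> n")
    case True
    then show ?thesis using yh_ideal_mono[of "Suc k" n d m] Suc.prems by blast
  next
    case False
    then have "f \<in> carrier (yh_free m k)" using f(1) yh_free_mono[of n k m] by auto
    then show ?thesis using yh_ideal_Suc[OF d m _ Suc.prems] Suc.IH by blast
  qed
qed

lemma world_limit:
  assumes d: "0 < d" and m: "0 < m"
  defines "ev \<equiv> uemb (d, m, \<infinity>)"
  shows "yh_limit d (ev (scal (lvar IndQ 1 - lvar IndQ (-1))) * ev (scal (lconst (1 / of_nat d))))
    (\<lambda>j. ev (letter (GenT j))) (\<lambda>i. ev (letter (GenG i))) (ev (letter GenX)) (ev (letter GenXinv)) m ev"
proof -
  have inf: "enat n \<le> \<infinity>" for n by simp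
  note w = world[OF d m inf, folded ev_def]
  show ?thesis
  proof (rule yh_limit.intro[OF w], rule yh_limit_axioms.intro)
    show "ev f = 0" if "f \<in> yh_ideal d m n" for f n
      using world_ideal[OF d m subsetD[OF yh_ideal_sub that] inf] uidI[OF that inf] by (simp add: ev_def)
    show "f \<in> yh_ideal d m n" if f: "f \<in> carrier (yh_free m n)" "ev f = 0" for f n
    proof -
      have "f \<in> uid (d, m, \<infinity>)" using world_ideal[OF d m f(1) inf] f(2) by (simp add: ev_def)
      then obtain k where "f \<in> yh_ideal d m k" by (auto simp: uid_def)
      then show ?thesis by (rule yh_ideal_restrict[OF d m f(1)])
    qed
  qed (rule m, rule w)
qed

theorem proposition5p3:
  fixes d :: nat and m :: enat and z :: laurent and x :: "int \<Rightarrow> int \<Rightarrow> laurent"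
  assumes "d > 0" and "m > 0"
    and "z \<in> carrier (\<R> m)"
    and "\<And>a b. a \<in> E_set m \<Longrightarrow> b \<in> {0..<int d} \<Longrightarrow> x a b \<in> carrier (\<R> m)"
  shows "(\<exists>!tr. relative_trace_chain d m z x tr) \<and>
    (\<forall>tr. relative_trace_chain d m z x tr \<longrightarrow>
      (\<forall>k\<ge>1. \<forall>J<k. \<forall>a \<in> E_set m. \<forall>b \<in> {0..<int d}. \<forall>w \<in> carrier (YH d m (k - 1)).
        (J < k - 1 \<longrightarrow>
          tr k (yh_W d m k J a b \<otimes>\<^bsub>YH d m k\<^esub> yh_incl d m k w)
            = yh_scal d m (k - 1) z \<otimes>\<^bsub>YH d m (k - 1)\<^esub> yh_W d m (k - 1) J a b
                \<otimes>\<^bsub>YH d m (k - 1)\<^esub> w) \<and>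
        (J = k - 1 \<longrightarrow>
          tr k (yh_W d m k J a b \<otimes>\<^bsub>YH d m k\<^esub> yh_incl d m k w)
            = yh_scal d m (k - 1) (x a b) \<otimes>\<^bsub>YH d m (k - 1)\<^esub> w)))"
proof -
  let ?ev = "uemb (d, m, \<infinity>)"
  interpret yh_limit d "?ev (scal (lvar IndQ 1 - lvar IndQ (-1))) * ?ev (scal (lconst (1 / of_nat d)))"
    "\<lambda>j. ?ev (letter (GenT j))" "\<lambda>i. ?ev (letter (GenG i))" "?ev (letter GenX)" "?ev (letter GenXinv)" m ?ev
    by (rule world_limit[OF assms(1,2)])
  show ?thesis
    unfolding all_Suc_iff diff_Suc_1
  proof (intro conjI allI impI ballI)
    obtain tr where tr: "relative_trace_chain d m z x tr"
      using relative_trace_chain_exists[OF assms(3,4)] ..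
    show "\<exists>!tr. relative_trace_chain d m z x tr"
    proof (rule ex1I[of _ tr], rule tr)
      fix tr' assume "relative_trace_chain d m z x tr'"
      from this tr assms(3,4) show "tr' = tr" by (rule relative_trace_chain_unique)
    qed
    fix tr n J a b w
    assume R: "relative_trace_chain d m z x tr" and J: "J < Suc n"
      and a: "a \<in> E_set m" and b: "b \<in> {0..<int d}" and w: "w \<in> carrier (YH d m n)"
    have J': "J \<le> n" using J by simp
    show "tr (Suc n) (yh_W d m (Suc n) J a b \<otimes>\<^bsub>YH d m (Suc n)\<^esub> yh_incl d m (Suc n) w) =
        yh_scal d m n z \<otimes>\<^bsub>YH d m n\<^esub> yh_W d m n J a b \<otimes>\<^bsub>YH d m n\<^esub> w" if "J < n"
      by (rule relative_trace_chain_W(1)[OF R assms(3,4) J' a b w that])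
    show "tr (Suc n) (yh_W d m (Suc n) J a b \<otimes>\<^bsub>YH d m (Suc n)\<^esub> yh_incl d m (Suc n) w) =
        yh_scal d m n (x a b) \<otimes>\<^bsub>YH d m n\<^esub> w" if "J = n"
      by (rule relative_trace_chain_W(2)[OF R assms(3,4) J' a b w that])
  qed
qed

end
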